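(* Suppose that $s\neq 0$ and $a\ne 0$, and let $m=m(s)$, $m'=m(s,a)$, $\mathcal{E}'=(\tilde{E},\tau,s^{1/m})$, $\tilde{E}'$, $\tau'$, $\tilde e_j$, $\tilde\phi_0$, $\tilde E''$ be as defined in the context. 1. The algebra $$\tilde{\mathcal{E}}''=(\tilde{E}',\tau',s^{\frac1{m}}):=\tilde{E}'[H;\tau']/\big(H^{\frac{n}{mm'}}-s^{\frac1m}\big)=\bigoplus_{k=0}^{\frac{n}{mm'}-1}\tilde{E}'H^k$$ is a reduced cyclic $F$-algebra with $\mathrm{Deg}(\tilde{\mathcal{E}}'')=\frac{n}{mm'}$ and $s^{\frac1m}\in F^\times$. In particular, the centre of $\tilde{\mathcal{E}}''$ is $F$ and the field $\tilde E'$ is a strictly maximal subfield of $\tilde{\mathcal{E}}''$ (i.e. $[\tilde{E}':F]=\frac{n}{mm'}$). 2. The algebra $\tilde{\mathcal{E}}''$ is isomorphic to the matrix algebra $M_{\frac{n}{mm'}}(F)$ if and only if $s^{\frac1m}=N_{\tilde{E}'/F}(b)$ for some $b\in(\tilde{E}')^\times$. 3. The monomorphism $\tilde\phi_0:\tilde{E}'\to\tilde{E}\subseteq\mathcal{E}'$ can be extended to a monomorphism $\tilde\phi_0:\tilde{\mathcal{E}}''\to\mathcal{E}'$ by the rule $H\mapsto h^{m'}$, and $$\tilde\phi_0(\tilde{\mathcal{E}}'')=\tilde{E}''[h^{m'};\tau']/\big(h^{\frac nm}-s^{\frac1m}\big)=\bigoplus_{k=0}^{\frac{n}{mm'}-1}\tilde{E}''h^{km'}.$$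 Identifying $\tilde{\mathcal{E}}''$ with its image in $\mathcal{E}'$, we have $\mathcal{E}'\simeq M_{m'}(\tilde{\mathcal{E}}'')$ and $C_{\mathcal{E}'}(\tilde{\mathcal{E}}'')\simeq M_{m'}(F)$. 4. $\mathcal{E}'=\bigoplus_{i=0}^{m'-1}\Big(\prod_{j=0}^{m'-1}\tilde{\mathcal{E}}''\tilde e_j\Big)h^i$. 5. $\mathcal{E}\simeq M_{mm'}(\tilde{\mathcal{E}}'')$. In particular, the algebra $\mathcal{E}$ is equivalent to the reduced cyclic algebra $\tilde{\mathcal{E}}''$.
   Context: $F$ is a field containing a primitive $n$'th root of unity $q$ ($n\ge2$), $s,a\in F$, and $\mathcal{E}$ is the $F$-algebra generated by $h,x$ with relations $xh=qhx$, $h^n=s$, $x^n=a$. For $k\ge1$, $F^{[k]}=\{u^k\mid u\in F\}$. $m=m(s)=\max\{k\ge1\mid k\mid n,\ s\in F^{[k]}\}$ and $m'=m(s,a)=\max\{k\geq 1\mid k\mid \frac{n}{m(s)},\ a\in F^{[k]}\}$. Fix roots $s^{1/m}\in F$ and $a^{1/m'}\in F$. $\mathcal{E}'$ is the $F$-algebra generated by $h,X$ with relations $Xh=q^{m}hX$, $h^{n/m}=s^{1/m}$, $X^{n/m}=a$ (a cyclic $F$-algebra of degree $n/m$). Equivalently $\mathcal{E}'=(\tilde{E},\tau,s^{1/m})=\tilde{E}[h;\tau]/(h^{n/m}-s^{1/m})$ where $\tilde{E}=F[X]/(X^{n/m}-a)$, $\tau(X)=q^{-m}X$, and $he=\tau(e)h$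 for $e\in\tilde E$. $\tilde{E}'=F[X]/(X^{\frac{n}{mm'}}-a^{1/m'})$, a cyclic field extension of $F$ whose Galois group is generated by $\tau'=\tau^{m'}$, $\tau'(X)=q^{-mm'}X$. Put $\omega=q^{n/m'}$, a primitive $m'$'th root of unity. For $i=0,\ldots,m'-1$, $$\tilde e_i=\prod_{j\ne i}\frac{X^{\frac{n}{mm'}}-\omega^ja^{1/m'}}{\omega^ia^{1/m'}-\omega^ja^{1/m'}}\in\tilde{E}$$ are orthogonal nonzero idempotents with sum $1$, $\tau(\tilde e_i)=\tilde e_{i+1}$ (indices modulo $m'$), and $\tilde{E}\tilde e_0$ is identified with $\tilde{E}'$ (via $X\tilde e_0\leftrightarrow X$). The map $\tilde\phi_0:\tilde{E}'=\tilde{E}\tilde e_0\to\tilde{E}$ is $\lambda\mapsto\sum_{i=0}^{m'-1}\tau^i(\lambda)$, and $\tilde{E}''=\tilde\phi_0(\tilde E')$; $\tau'$ also denotes the restriction of $\tau^{m'}$ to $\tilde E''$. $\tilde{\mathcal{E}}''\tilde e_j$ means $\tilde\phi_0(\tilde{\mathcal{E}}'')\tilde e_j$. Degree of a central simple algebra of dimension $d^2$ is $d$; a subfield containing $F$ is strictly maximal if its degree over $F$ is the degree of the algebra; an algebra is cyclic if it is central simple finite dimensional with a strictly maximal subfield that is a cyclic Galois extension of the centre. A cyclic algebra generated by two elements $u,v$ with $vu=\zeta uv$, $u^N=\alpha$, $v^N=\beta$ ($\zeta\in F$ a primitive $N$'th root of unity, $\alpha,\beta\in F^\times$) is called reduced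 if both subalgebras $F[u]=F[u]/(u^N-\alpha)$ and $F[v]=F[v]/(v^N-\beta)$ are fields. Two central simple finite dimensional $F$-algebras $A,B$ are equivalent if $M_k(A)\simeq M_l(B)$ for some $k,l\ge1$. $C_{\mathcal{E}'}(\cdot)$ denotes the centralizer in $\mathcal{E}'$. *)

theory Defs
  imports "HOL-Algebra.Algebra"
begin

section \<open>Associative algebras over a field\<close>

text \<open>
  An algebra over \<open>F\<close> is represented by the library record \<open>module\<close>, which carries both a ring
  structure and a scalar multiplication. The library locale \<open>algebra\<close> is restricted to
  commutative rings, hence the following one.
\<close>

locale assoc_algebra = module F A + ring A for F (structure) and A (structure) +
  assumes smult_mult_left:
      "\<lbrakk>c \<in> carrier F; x \<in> carrier A; y \<in> carrier A\<rbrakk> \<Longrightarrow>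
         (c \<odot>\<^bsub>A\<^esub> x) \<otimes>\<^bsub>A\<^esub> y = c \<odot>\<^bsub>A\<^esub> (x \<otimes>\<^bsub>A\<^esub> y)"
    and smult_mult_right:
      "\<lbrakk>c \<in> carrier F; x \<in> carrier A; y \<in> carrier A\<rbrakk> \<Longrightarrow>
         x \<otimes>\<^bsub>A\<^esub> (c \<odot>\<^bsub>A\<^esub> y) = c \<odot>\<^bsub>A\<^esub> (x \<otimes>\<^bsub>A\<^esub> y)"

definition alg_hom ::
  "('f, 'r) ring_scheme \<Rightarrow> ('f, 'a, 'x) module_scheme \<Rightarrow> ('f, 'b, 'y) module_scheme \<Rightarrow> ('a \<Rightarrow> 'b) set"
  where "alg_hom F A B =
    {f \<in> ring_hom A B. \<forall>c\<in>carrier F. \<forall>x\<in>carrier A. f (c \<odot>\<^bsub>A\<^esub> x) = c \<odot>\<^bsub>B\<^esub> f x}"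

definition alg_mono ::
  "('f, 'r) ring_scheme \<Rightarrow> ('f, 'a, 'x) module_scheme \<Rightarrow> ('f, 'b, 'y) module_scheme \<Rightarrow> ('a \<Rightarrow> 'b) set"
  where "alg_mono F A B = {f \<in> alg_hom F A B. inj_on f (carrier A)}"

definition alg_isomorphic ::
  "('f, 'r) ring_scheme \<Rightarrow> ('f, 'a, 'x) module_scheme \<Rightarrow> ('f, 'b, 'y) module_scheme \<Rightarrow> bool"
  where "alg_isomorphic F A B \<longleftrightarrow> (\<exists>f \<in> alg_hom F A B. bij_betw f (carrier A) (carrier B))"

definition scalars :: "('f, 'r) ring_scheme \<Rightarrow> ('f, 'a, 'x) module_scheme \<Rightarrow> 'a set"
  where "scalars F A = (\<lambda>c. c \<odot>\<^bsub>A\<^esub> \<one>\<^bsub>A\<^esub>) ` carrier F"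

definition subalg_gen :: "('f, 'r) ring_scheme \<Rightarrow> ('f, 'a, 'x) module_scheme \<Rightarrow> 'a set \<Rightarrow> 'a set"
  where "subalg_gen F A S = generate_ring A (scalars F A \<union> S)"

definition centralizer :: "('a, 'x) ring_scheme \<Rightarrow> 'a set \<Rightarrow> 'a set"
  where "centralizer A S = {z \<in> carrier A. \<forall>x\<in>S. z \<otimes>\<^bsub>A\<^esub> x = x \<otimes>\<^bsub>A\<^esub> z}"

definition self_alg :: "('f, 'r) ring_scheme \<Rightarrow> ('f, 'f) module"
  where "self_alg F = \<lparr>carrier = carrier F, monoid.mult = monoid.mult F, one = \<one>\<^bsub>F\<^esub>, ring.zero = \<zero>\<^bsub>F\<^esub>,
    add = add F, smult = monoid.mult F\<rparr>"

text \<open>The matrix algebra $M_k(A)$; matrices are extensional functions on the index square.\<close>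

definition mat_alg :: "nat \<Rightarrow> ('f, 'a, 'x) module_scheme \<Rightarrow> ('f, nat \<times> nat \<Rightarrow> 'a) module"
  where "mat_alg k A = \<lparr>
    carrier = ({..<k} \<times> {..<k}) \<rightarrow>\<^sub>E carrier A,
    monoid.mult = (\<lambda>P Q. \<lambda>(i, j)\<in>{..<k} \<times> {..<k}. \<Oplus>\<^bsub>A\<^esub>l\<in>{..<k}. P (i, l) \<otimes>\<^bsub>A\<^esub> Q (l, j)),
    one = (\<lambda>(i, j)\<in>{..<k} \<times> {..<k}. if i = j then \<one>\<^bsub>A\<^esub> else \<zero>\<^bsub>A\<^esub>),
    ring.zero = (\<lambda>_\<in>{..<k} \<times> {..<k}. \<zero>\<^bsub>A\<^esub>),
    add = (\<lambda>P Q. \<lambda>p\<in>{..<k} \<times> {..<k}. P p \<oplus>\<^bsub>A\<^esub> Q p),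
    smult = (\<lambda>c P. \<lambda>p\<in>{..<k} \<times> {..<k}. c \<odot>\<^bsub>A\<^esub> P p)\<rparr>"

text \<open>The direct product $B_0 \times \dots \times B_{k-1}$ of algebras.\<close>

definition prod_alg :: "nat \<Rightarrow> (nat \<Rightarrow> ('f, 'a, 'x) module_scheme) \<Rightarrow> ('f, nat \<Rightarrow> 'a) module"
  where "prod_alg k B = \<lparr>
    carrier = (\<Pi>\<^sub>E j\<in>{..<k}. carrier (B j)),
    monoid.mult = (\<lambda>v w. \<lambda>j\<in>{..<k}. v j \<otimes>\<^bsub>B j\<^esub> w j),
    one = (\<lambda>j\<in>{..<k}. \<one>\<^bsub>B j\<^esub>),
    ring.zero = (\<lambda>j\<in>{..<k}. \<zero>\<^bsub>B j\<^esub>),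
    add = (\<lambda>v w. \<lambda>j\<in>{..<k}. v j \<oplus>\<^bsub>B j\<^esub> w j),
    smult = (\<lambda>c v. \<lambda>j\<in>{..<k}. c \<odot>\<^bsub>B j\<^esub> v j)\<rparr>"

text \<open>
  The set \<open>W\<close> is the internal direct sum of the \<open>F\<close>-subspaces $V_0, \dots, V_{k-1}$ of \<open>A\<close>.
\<close>

definition internal_direct_sum ::
  "('f, 'r) ring_scheme \<Rightarrow> ('f, 'a, 'x) module_scheme \<Rightarrow> nat \<Rightarrow> (nat \<Rightarrow> 'a set) \<Rightarrow> 'a set \<Rightarrow> bool"
  where "internal_direct_sum F A k V W \<longleftrightarrow>
    (\<forall>i<k. submodule (V i) F A) \<and>
    bij_betw (\<lambda>v. \<Oplus>\<^bsub>A\<^esub>i\<in>{..<k}. v i) (\<Pi>\<^sub>E i\<in>{..<k}. V i) W"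

text \<open>
  The library quotient ring equipped with the induced scalar multiplication, written as a union
  over representatives in the same way as the library's \<open>rcoset_mult\<close>.
\<close>

definition alg_quot :: "('f, 'a, 'x) module_scheme \<Rightarrow> 'a set \<Rightarrow> ('f, 'a set) module"
  where "alg_quot A I = ring.extend (A Quot I)
    \<lparr>smult = (\<lambda>c S. \<Union>x\<in>S. I +>\<^bsub>A\<^esub> (c \<odot>\<^bsub>A\<^esub> x))\<rparr>"


section \<open>Central simple and cyclic algebras\<close>

definition simple_ring :: "('a, 'x) ring_scheme \<Rightarrow> bool"
  where "simple_ring A \<longleftrightarrow> carrier A \<noteq> {\<zero>\<^bsub>A\<^esub>} \<and>
    (\<forall>I. ideal I A \<longrightarrow> I = {\<zero>\<^bsub>A\<^esub>} \<or> I = carrier A)"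

definition central_simple :: "('f, 'r) ring_scheme \<Rightarrow> ('f, 'a, 'x) module_scheme \<Rightarrow> bool"
  where "central_simple F A \<longleftrightarrow>
    assoc_algebra F A \<and> simple_ring A \<and>
    centralizer A (carrier A) = scalars F A \<and>
    ring.finite_dimension A (scalars F A) (carrier A)"

definition has_degree :: "('f, 'r) ring_scheme \<Rightarrow> ('f, 'a, 'x) module_scheme \<Rightarrow> nat \<Rightarrow> bool"
  where "has_degree F A d \<longleftrightarrow> ring.dimension A (d ^ 2) (scalars F A) (carrier A)"

definition strictly_maximal_subfield ::
  "('f, 'r) ring_scheme \<Rightarrow> ('f, 'a, 'x) module_scheme \<Rightarrow> 'a set \<Rightarrow> bool"
  where "strictly_maximal_subfield F A K \<longleftrightarrow>
    subfield K A \<and> scalars F A \<subseteq> K \<and>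
    (\<exists>d. has_degree F A d \<and> ring.dimension A d (scalars F A) K)"

definition galois_group :: "('a, 'x) ring_scheme \<Rightarrow> 'a set \<Rightarrow> ('a \<Rightarrow> 'a) monoid"
  where "galois_group L k = (BijGroup (carrier L))
    \<lparr>carrier := {\<sigma> \<in> Bij (carrier L). \<sigma> \<in> ring_hom L L \<and> (\<forall>c\<in>k. \<sigma> c = c)}\<rparr>"

definition cyclic_extension :: "('a, 'x) ring_scheme \<Rightarrow> 'a set \<Rightarrow> bool"
  where "cyclic_extension L k \<longleftrightarrow>
    field L \<and> subfield k L \<and> ring.finite_dimension L k (carrier L) \<and>
    {x \<in> carrier L. \<forall>\<sigma>\<in>carrier (galois_group L k). \<sigma> x = x} = k \<and>
    cyclic_group (galois_group L k)"

text \<open>The norm of a finite Galois extension \<open>L\<close> of its subfield \<open>k\<close>.\<close>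

definition galois_norm :: "('a, 'x) ring_scheme \<Rightarrow> 'a set \<Rightarrow> 'a \<Rightarrow> 'a"
  where "galois_norm L k b = (\<Otimes>\<^bsub>L\<^esub>\<sigma>\<in>carrier (galois_group L k). \<sigma> b)"

definition cyclic_algebra :: "('f, 'r) ring_scheme \<Rightarrow> ('f, 'a, 'x) module_scheme \<Rightarrow> bool"
  where "cyclic_algebra F A \<longleftrightarrow> central_simple F A \<and>
    (\<exists>K. strictly_maximal_subfield F A K \<and> cyclic_extension (A\<lparr>carrier := K\<rparr>) (scalars F A))"

definition alg_equivalent ::
  "('f, 'r) ring_scheme \<Rightarrow> ('f, 'a, 'x) module_scheme \<Rightarrow> ('f, 'b, 'y) module_scheme \<Rightarrow> bool"
  where "alg_equivalent F A B \<longleftrightarrow> central_simple F A \<and> central_simple F B \<and>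
    (\<exists>k\<ge>1. \<exists>l\<ge>1. alg_isomorphic F (mat_alg k A) (mat_alg l B))"


section \<open>Powers and roots of unity\<close>

definition primitive_root_of_unity :: "('f, 'r) ring_scheme \<Rightarrow> nat \<Rightarrow> 'f \<Rightarrow> bool"
  where "primitive_root_of_unity F n q \<longleftrightarrow> q \<in> carrier F \<and> n > 0 \<and>
    q [^]\<^bsub>F\<^esub> n = \<one>\<^bsub>F\<^esub> \<and> (\<forall>k. 0 < k \<and> k < n \<longrightarrow> q [^]\<^bsub>F\<^esub> k \<noteq> \<one>\<^bsub>F\<^esub>)"

definition powers :: "('f, 'r) ring_scheme \<Rightarrow> nat \<Rightarrow> 'f set"
  where "powers F k = {u [^]\<^bsub>F\<^esub> k | u. u \<in> carrier F}"

definition max_power :: "('f, 'r) ring_scheme \<Rightarrow> nat \<Rightarrow> 'f \<Rightarrow> nat"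
  where "max_power F n s = Max {k. k \<ge> 1 \<and> k dvd n \<and> s \<in> powers F k}"


section \<open>The algebra $F[X]/(X^N - \alpha)$\<close>

definition kummer_ideal :: "('f, 'r) ring_scheme \<Rightarrow> nat \<Rightarrow> 'f \<Rightarrow> (nat \<Rightarrow> 'f) set"
  where "kummer_ideal F N \<alpha> =
    Idl\<^bsub>UP F\<^esub> {monom (UP F) \<one>\<^bsub>F\<^esub> N \<ominus>\<^bsub>UP F\<^esub> monom (UP F) \<alpha> 0}"

definition kummer :: "('f, 'r) ring_scheme \<Rightarrow> nat \<Rightarrow> 'f \<Rightarrow> ('f, (nat \<Rightarrow> 'f) set) module"
  where "kummer F N \<alpha> = alg_quot (UP F) (kummer_ideal F N \<alpha>)"

definition kummer_class :: "('f, 'r) ring_scheme \<Rightarrow> nat \<Rightarrow> 'f \<Rightarrow> (nat \<Rightarrow> 'f) \<Rightarrow> (nat \<Rightarrow> 'f) set"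
  where "kummer_class F N \<alpha> p = kummer_ideal F N \<alpha> +>\<^bsub>UP F\<^esub> p"

definition kummer_gen :: "('f, 'r) ring_scheme \<Rightarrow> nat \<Rightarrow> 'f \<Rightarrow> (nat \<Rightarrow> 'f) set"
  where "kummer_gen F N \<alpha> = kummer_class F N \<alpha> (monom (UP F) \<one>\<^bsub>F\<^esub> 1)"

text \<open>
  The substitution $X \mapsto cX$ on residue classes. For $c^N = 1$ it is the \<open>F\<close>-algebra
  automorphism of $F[X]/(X^N - \alpha)$ sending $X$ to $cX$: the automorphism
  $p(X) \mapsto p(cX)$ of $F[X]$ then preserves the ideal, so the image of a residue class is
  again a residue class.
\<close>

definition scale_aut :: "('f, 'r) ring_scheme \<Rightarrow> 'f \<Rightarrow> (nat \<Rightarrow> 'f) set \<Rightarrow> (nat \<Rightarrow> 'f) set"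
  where "scale_aut F c S = (\<lambda>p i. c [^]\<^bsub>F\<^esub> i \<otimes>\<^bsub>F\<^esub> p i) ` S"


section \<open>Skew polynomials and the algebras $(K, \tau, c) = K[h; \tau]/(h^N - c)$\<close>

text \<open>
  Elements of $K[h;\tau]$ are written $\sum_i p_i h^i$ with coefficients on the left, and
  $h e = \tau(e) h$, so $(e h^i)(e' h^j) = e \tau^i(e') h^{i+j}$.
\<close>

definition skew_poly :: "('f, 'k, 'x) module_scheme \<Rightarrow> ('k \<Rightarrow> 'k) \<Rightarrow> ('f, nat \<Rightarrow> 'k) module"
  where "skew_poly K \<tau> = \<lparr>
    carrier = up K,
    monoid.mult = (\<lambda>p q n. \<Oplus>\<^bsub>K\<^esub>i\<in>{..n}. p i \<otimes>\<^bsub>K\<^esub> (\<tau> ^^ i) (q (n - i))),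
    one = (\<lambda>i. if i = 0 then \<one>\<^bsub>K\<^esub> else \<zero>\<^bsub>K\<^esub>),
    ring.zero = (\<lambda>i. \<zero>\<^bsub>K\<^esub>),
    add = (\<lambda>p q i. p i \<oplus>\<^bsub>K\<^esub> q i),
    smult = (\<lambda>c p i. c \<odot>\<^bsub>K\<^esub> p i)\<rparr>"

definition skew_monom :: "('f, 'k, 'x) module_scheme \<Rightarrow> 'k \<Rightarrow> nat \<Rightarrow> nat \<Rightarrow> 'k"
  where "skew_monom K e i = (\<lambda>j. if j = i then e else \<zero>\<^bsub>K\<^esub>)"

definition skew_cyclic_ideal ::
  "('f, 'k, 'x) module_scheme \<Rightarrow> ('k \<Rightarrow> 'k) \<Rightarrow> nat \<Rightarrow> 'f \<Rightarrow> (nat \<Rightarrow> 'k) set"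
  where "skew_cyclic_ideal K \<tau> N c =
    Idl\<^bsub>skew_poly K \<tau>\<^esub>
      {skew_monom K \<one>\<^bsub>K\<^esub> N \<ominus>\<^bsub>skew_poly K \<tau>\<^esub> skew_monom K (c \<odot>\<^bsub>K\<^esub> \<one>\<^bsub>K\<^esub>) 0}"

definition skew_cyclic ::
  "('f, 'k, 'x) module_scheme \<Rightarrow> ('k \<Rightarrow> 'k) \<Rightarrow> nat \<Rightarrow> 'f \<Rightarrow> ('f, (nat \<Rightarrow> 'k) set) module"
  where "skew_cyclic K \<tau> N c = alg_quot (skew_poly K \<tau>) (skew_cyclic_ideal K \<tau> N c)"

definition skew_const ::
  "('f, 'k, 'x) module_scheme \<Rightarrow> ('k \<Rightarrow> 'k) \<Rightarrow> nat \<Rightarrow> 'f \<Rightarrow> 'k \<Rightarrow> (nat \<Rightarrow> 'k) set"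
  where "skew_const K \<tau> N c e =
    skew_cyclic_ideal K \<tau> N c +>\<^bsub>skew_poly K \<tau>\<^esub> skew_monom K e 0"

definition skew_gen ::
  "('f, 'k, 'x) module_scheme \<Rightarrow> ('k \<Rightarrow> 'k) \<Rightarrow> nat \<Rightarrow> 'f \<Rightarrow> (nat \<Rightarrow> 'k) set"
  where "skew_gen K \<tau> N c =
    skew_cyclic_ideal K \<tau> N c +>\<^bsub>skew_poly K \<tau>\<^esub> skew_monom K \<one>\<^bsub>K\<^esub> 1"


section \<open>Reduced cyclic algebras\<close>

text \<open>
  The subalgebra $F[u]$ is a field, and it is $F[X]/(X^N - \alpha)$ via $X \mapsto u$.
\<close>

definition kummer_subfield ::
  "('f, 'r) ring_scheme \<Rightarrow> ('f, 'a, 'x) module_scheme \<Rightarrow> nat \<Rightarrow> 'f \<Rightarrow> 'a \<Rightarrow> bool"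
  where "kummer_subfield F A N \<alpha> u \<longleftrightarrow>
    subfield (subalg_gen F A {u}) A \<and>
    (\<exists>f \<in> alg_mono F (kummer F N \<alpha>) A.
       f (kummer_gen F N \<alpha>) = u \<and> f ` carrier (kummer F N \<alpha>) = subalg_gen F A {u})"

definition reduced_cyclic ::
  "('f, 'r) ring_scheme \<Rightarrow> ('f, 'a, 'x) module_scheme \<Rightarrow>
   nat \<Rightarrow> 'f \<Rightarrow> 'f \<Rightarrow> 'f \<Rightarrow> 'a \<Rightarrow> 'a \<Rightarrow> bool"
  where "reduced_cyclic F A N \<zeta> \<alpha> \<beta> u v \<longleftrightarrow>
    cyclic_algebra F A \<and>
    primitive_root_of_unity F N \<zeta> \<and>
    \<alpha> \<in> carrier F - {\<zero>\<^bsub>F\<^esub>} \<and> \<beta> \<in> carrier F - {\<zero>\<^bsub>F\<^esub>} \<and>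
    u \<in> carrier A \<and> v \<in> carrier A \<and> subalg_gen F A {u, v} = carrier A \<and>
    v \<otimes>\<^bsub>A\<^esub> u = \<zeta> \<odot>\<^bsub>A\<^esub> (u \<otimes>\<^bsub>A\<^esub> v) \<and>
    u [^]\<^bsub>A\<^esub> N = \<alpha> \<odot>\<^bsub>A\<^esub> \<one>\<^bsub>A\<^esub> \<and> v [^]\<^bsub>A\<^esub> N = \<beta> \<odot>\<^bsub>A\<^esub> \<one>\<^bsub>A\<^esub> \<and>
    kummer_subfield F A N \<alpha> u \<and> kummer_subfield F A N \<beta> v"


section \<open>The algebra with generators $h, x$ and relations $xh = qhx$, $h^n = s$, $x^n = a$\<close>

text \<open>
  The free algebra on a type of letters: finitely supported functions on words, multiplied by
  concatenation of words.
\<close>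

definition free_alg :: "('f, 'r) ring_scheme \<Rightarrow> ('f, 'g list \<Rightarrow> 'f) module"
  where "free_alg F = \<lparr>
    carrier = {f. (\<forall>w. f w \<in> carrier F) \<and> finite {w. f w \<noteq> \<zero>\<^bsub>F\<^esub>}},
    monoid.mult = (\<lambda>f g w. \<Oplus>\<^bsub>F\<^esub>i\<in>{..length w}. f (take i w) \<otimes>\<^bsub>F\<^esub> g (drop i w)),
    one = (\<lambda>w. if w = [] then \<one>\<^bsub>F\<^esub> else \<zero>\<^bsub>F\<^esub>),
    ring.zero = (\<lambda>w. \<zero>\<^bsub>F\<^esub>),
    add = (\<lambda>f g w. f w \<oplus>\<^bsub>F\<^esub> g w),
    smult = (\<lambda>c f w. c \<otimes>\<^bsub>F\<^esub> f w)\<rparr>"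

definition letter :: "('f, 'r) ring_scheme \<Rightarrow> 'g \<Rightarrow> 'g list \<Rightarrow> 'f"
  where "letter F g = (\<lambda>w. if w = [g] then \<one>\<^bsub>F\<^esub> else \<zero>\<^bsub>F\<^esub>)"

datatype gen = Gen_h | Gen_x

definition symbol_alg ::
  "('f, 'r) ring_scheme \<Rightarrow> nat \<Rightarrow> 'f \<Rightarrow> 'f \<Rightarrow> 'f \<Rightarrow> ('f, (gen list \<Rightarrow> 'f) set) module"
  where "symbol_alg F n q s a =
    (let A = free_alg F; h = letter F Gen_h; x = letter F Gen_x
     in alg_quot A (Idl\<^bsub>A\<^esub>
          {x \<otimes>\<^bsub>A\<^esub> h \<ominus>\<^bsub>A\<^esub> q \<odot>\<^bsub>A\<^esub> (h \<otimes>\<^bsub>A\<^esub> x),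
           h [^]\<^bsub>A\<^esub> n \<ominus>\<^bsub>A\<^esub> s \<odot>\<^bsub>A\<^esub> \<one>\<^bsub>A\<^esub>,
           x [^]\<^bsub>A\<^esub> n \<ominus>\<^bsub>A\<^esub> a \<odot>\<^bsub>A\<^esub> \<one>\<^bsub>A\<^esub>}))"


section \<open>The idempotents $\tilde e_i$ and the map $\tilde\phi_0$\<close>

text \<open>
  Here \<open>E\<close> stands for $F[X]/(X^{NM'} - \alpha^{M'})$, \<open>x\<close> for the class of $X$, and \<open>\<omega>\<close> for a primitive
  \<open>M'\<close>-th root of unity.
\<close>

definition split_idem ::
  "('f, 'r) ring_scheme \<Rightarrow> ('f, 'e, 'x) module_scheme \<Rightarrow> 'e \<Rightarrow> nat \<Rightarrow> nat \<Rightarrow> 'f \<Rightarrow> 'f \<Rightarrow> nat \<Rightarrow> 'e"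
  where "split_idem F E x N M' \<omega> \<alpha> i =
    (\<Otimes>\<^bsub>E\<^esub>j\<in>{..<M'} - {i}.
       inv\<^bsub>F\<^esub> (\<omega> [^]\<^bsub>F\<^esub> i \<otimes>\<^bsub>F\<^esub> \<alpha> \<ominus>\<^bsub>F\<^esub> \<omega> [^]\<^bsub>F\<^esub> j \<otimes>\<^bsub>F\<^esub> \<alpha>) \<odot>\<^bsub>E\<^esub>
         (x [^]\<^bsub>E\<^esub> N \<ominus>\<^bsub>E\<^esub> (\<omega> [^]\<^bsub>F\<^esub> j \<otimes>\<^bsub>F\<^esub> \<alpha>) \<odot>\<^bsub>E\<^esub> \<one>\<^bsub>E\<^esub>))"

text \<open>
  The identification of $F[X]/(X^N - \alpha)$ with the component $\tilde E \tilde e_0$ of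
  $\tilde E = F[X]/(X^M - a)$, $X \mapsto X \tilde e_0$: the class of a polynomial \<open>p\<close> goes to
  the class of \<open>p\<close> in $\tilde E$ times $\tilde e_0$. All representatives \<open>p \<in> S\<close> give the same
  element.
\<close>

definition component_embed ::
  "('f, 'r) ring_scheme \<Rightarrow> nat \<Rightarrow> 'f \<Rightarrow> (nat \<Rightarrow> 'f) set \<Rightarrow> (nat \<Rightarrow> 'f) set \<Rightarrow> (nat \<Rightarrow> 'f) set"
  where "component_embed F M a e0 S =
    the_elem ((\<lambda>p. kummer_class F M a p \<otimes>\<^bsub>kummer F M a\<^esub> e0) ` S)"

end

theory Submission
  imports Defs
begin

text \<open>
  In an algebra generated by \<open>u\<close> and \<open>v\<close> with \<open>v u = z u v\<close>, \<open>u\<^sup>D = b\<close>, \<open>v\<^sup>D = g\<close> the monomials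
  \<open>u\<^sup>i v\<^sup>j\<close> are joint eigenvectors of the conjugations by \<open>u\<close> and \<open>v\<close> with distinct eigenvalues. Hence they
  form a basis, the algebra is central simple, and every pair satisfying the same relations in another
  algebra generates an isomorphic copy.

  If \<open>D = M k\<close> and \<open>g = d\<^sup>k\<close>, then \<open>F[v\<^sup>M]\<close> contains idempotents \<open>e\<^sub>0, \<dots>, e\<^bsub>k-1\<^esub>\<close> which conjugation by
  \<open>u\<close> permutes cyclically, so the elements \<open>u\<^sup>i e\<^sub>0 u\<^bsup>-j\<^esup>\<close> are matrix units. They commute with \<open>u\<^sup>k\<close> and with
  \<open>y = \<Sum> z\<^bsup>-i\<^esup> v e\<^sub>i\<close>, which generate the corresponding algebra with \<open>u\<^bsup>k M\<^esup> = b\<close> and \<open>y\<^sup>M = d\<close>. This step with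
  \<open>v = h\<close>, \<open>d = s\<^bsup>1/m\<^esup>\<close> passes from \<open>\<E>\<close> to \<open>\<E>'\<close>, and with \<open>v = X\<close>, \<open>d = a\<^bsup>1/m'\<^esup>\<close> from \<open>\<E>'\<close> to \<open>\<E>''\<close>,
  where it yields the maps and decompositions of claims 3 and 4.

  For claim 2, if \<open>s\<^bsup>1/m\<^esup>\<close> is the norm of \<open>b\<close>, then \<open>b\<^bsup>-1\<^esup> H\<close> has \<open>N\<close>-th power \<open>1\<close> and the same step splits the
  algebra completely. Conversely, in a matrix algebra a minimal left ideal generated by an idempotent \<open>\<epsilon>\<close>
  is one-dimensional over the maximal subfield, and \<open>H \<epsilon> = b \<epsilon>\<close> gives the required norm.
\<close>

section \<open>Linear algebra in algebras over a field\<close>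

text \<open>Two obstacles shape the development. The algebras are quotients, in which equality and
  even \<open>\<one> \<noteq> \<zero>\<close> are hard to see. Quotients therefore supply only two
  facts, spanning and nontriviality, and all else is done for abstract generators. The relations
  alone, in \<open>symbol_pair\<close>, make the monomials independent once
  \<open>\<one> \<noteq> \<zero>\<close>; spanning is added in \<open>symbol_algebra\<close>, so
  maps from the latter to the former are automatically injective. The algebra given by generators
  and relations is nontrivial because it has a model: a skew polynomial quotient by a central
  element. The other obstacle is that \<open>Et'\<close> has to be a field. Maximality of
  \<open>m\<close> and \<open>m'\<close> only says that \<open>\<sigma>\<close> and
  \<open>\<alpha>\<close> are not t-th powers for divisors t > 1 of \<open>N\<close>. This is enough
  because of the roots of unity in F: the exceptional elements -4c^4 of the general irreducibility
  criterion for binomials are genuine fourth powers here, as 4 | N puts a square root of -1 into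
  F.\<close>

locale field_algebra = assoc_algebra F A + K: field F
  for F :: "('f, 'r) ring_scheme" and A :: "('f, 'a, 'x) module_scheme" (structure)
begin

lemma smult_smult [simp]:
  "\<lbrakk>c \<in> carrier F; d \<in> carrier F; x \<in> carrier A\<rbrakk> \<Longrightarrow> c \<odot> (d \<odot> x) = (c \<otimes>\<^bsub>F\<^esub> d) \<odot> x"
  by (simp add: smult_assoc1)

lemmas smult_mult [simp] = smult_mult_left smult_mult_right

lemma smult_cancel_zero:
  assumes "c \<in> carrier F" "c \<noteq> \<zero>\<^bsub>F\<^esub>" "x \<in> carrier A" "c \<odot> x = \<zero>"
  shows "x = \<zero>"
proof -
  have "inv\<^bsub>F\<^esub> c \<in> carrier F" "inv\<^bsub>F\<^esub> c \<otimes>\<^bsub>F\<^esub> c = \<one>\<^bsub>F\<^esub>"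
    using assms by (simp_all add: K.field_Units)
  then show ?thesis
    using assms smult_assoc1[of "inv\<^bsub>F\<^esub> c" c x] by simp
qed

lemma smult_minus_one: "x \<in> carrier A \<Longrightarrow> (\<ominus>\<^bsub>F\<^esub> \<one>\<^bsub>F\<^esub>) \<odot> x = \<ominus> x"
  by (simp add: smult_l_minus)

lemma smult_diff_distrib:
  "\<lbrakk>c \<in> carrier F; d \<in> carrier F; x \<in> carrier A\<rbrakk> \<Longrightarrow> (c \<ominus>\<^bsub>F\<^esub> d) \<odot> x = c \<odot> x \<ominus> d \<odot> x"
  by (simp add: R.minus_eq minus_eq smult_l_distr smult_l_minus)

lemma smult_pow:
  assumes "c \<in> carrier F" "x \<in> carrier A"
  shows "(c \<odot> x) [^] (k::nat) = (c [^]\<^bsub>F\<^esub> k) \<odot> (x [^] k)"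
  using assms by (induction k) (simp_all add: R.m_comm)

lemma finsum_smult_left:
  assumes "x \<in> carrier A" "c \<in> I \<rightarrow> carrier F"
  shows "(\<Oplus>\<^bsub>F\<^esub>i\<in>I. c i) \<odot> x = (\<Oplus>i\<in>I. c i \<odot> x)"
  using assms
  by (induction I rule: infinite_finite_induct) (auto simp: smult_l_distr Pi_def)

lemma subspaceI:
  assumes "V \<subseteq> carrier A" "\<zero> \<in> V"
    and "\<And>x y. x \<in> V \<Longrightarrow> y \<in> V \<Longrightarrow> x \<oplus> y \<in> V"
    and "\<And>c x. c \<in> carrier F \<Longrightarrow> x \<in> V \<Longrightarrow> c \<odot> x \<in> V"
  shows "submodule V F A"
proof (rule submoduleI)
  fix x assume "x \<in> V"
  then have "(\<ominus>\<^bsub>F\<^esub> \<one>\<^bsub>F\<^esub>) \<odot> x \<in> V" by (intro assms(4)) simp_all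
  then show "\<ominus> x \<in> V" using \<open>x \<in> V\<close> assms(1) smult_minus_one by (metis subsetD)
qed (use assms in auto)

lemma subspaceD:
  assumes "submodule V F A"
  shows "V \<subseteq> carrier A" "\<zero> \<in> V"
    and "\<And>x y. x \<in> V \<Longrightarrow> y \<in> V \<Longrightarrow> x \<oplus> y \<in> V"
    and "\<And>c x. c \<in> carrier F \<Longrightarrow> x \<in> V \<Longrightarrow> c \<odot> x \<in> V"
    and "\<And>x y. x \<in> V \<Longrightarrow> y \<in> V \<Longrightarrow> x \<ominus> y \<in> V"
proof -
  show "\<zero> \<in> V"
    using submoduleE(1,2,4)[OF assms] smult_l_null R.zero_closed by (metis ex_in_conv subsetD)
qed (use submoduleE[OF assms] in \<open>auto simp: minus_eq\<close>)

lemma zero_subspace: "submodule {\<zero>} F A"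
  by (rule subspaceI) auto

lemma carrier_subspace: "submodule (carrier A) F A"
  by (rule carrier_is_submodule)

lemma subspace_finsum:
  assumes "submodule V F A" "f \<in> I \<rightarrow> V"
  shows "(\<Oplus>i\<in>I. f i) \<in> V"
  using assms(2)
proof (induction I rule: infinite_finite_induct)
  case (insert i I)
  then show ?case
    using subspaceD[OF assms(1)] by (subst finsum_insert) (auto simp: Pi_def)
qed (use subspaceD[OF assms(1)] in auto)

lemma finsum_delta:
  assumes "finite I" "i \<in> I" "x \<in> carrier A"
  shows "(\<Oplus>j\<in>I. if j = i then x else \<zero>) = x"
  using add.finprod_singleton_swap[of i I "\<lambda>_. x"] assms by simp

text \<open>An ideal absorbs \<open>c \<odot> \<one>\<close>, and multiplying by this element is
  scalar multiplication. Ideals can thus enter the eigenvector argument as subspaces.\<close>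

lemma ideal_subspace:
  assumes "ideal J A"
  shows "submodule J F A"
proof -
  interpret J: ideal J A by fact
  show ?thesis
  proof (rule subspaceI)
    fix c x assume "c \<in> carrier F" "x \<in> J"
    then have "(c \<odot> \<one>) \<otimes> x \<in> J" by (intro J.I_l_closed) auto
    then show "c \<odot> x \<in> J" using \<open>x \<in> J\<close> \<open>c \<in> carrier F\<close> by (simp add: J.Icarr)
  qed (auto simp: J.Icarr)
qed

end

section \<open>Linear maps and homomorphisms of algebras\<close>

definition lin_map ::
  "('f, 'r) ring_scheme \<Rightarrow> ('f, 'a, 'x) module_scheme \<Rightarrow> ('f, 'b, 'y) module_scheme \<Rightarrow> ('a \<Rightarrow> 'b) set"
  where "lin_map F A B = {f \<in> carrier A \<rightarrow> carrier B.
    (\<forall>x\<in>carrier A. \<forall>y\<in>carrier A. f (x \<oplus>\<^bsub>A\<^esub> y) = f x \<oplus>\<^bsub>B\<^esub> f y) \<and>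
    (\<forall>c\<in>carrier F. \<forall>x\<in>carrier A. f (c \<odot>\<^bsub>A\<^esub> x) = c \<odot>\<^bsub>B\<^esub> f x)}"

lemma lin_mapI:
  assumes "\<And>x. x \<in> carrier A \<Longrightarrow> f x \<in> carrier B"
    and "\<And>x y. x \<in> carrier A \<Longrightarrow> y \<in> carrier A \<Longrightarrow> f (x \<oplus>\<^bsub>A\<^esub> y) = f x \<oplus>\<^bsub>B\<^esub> f y"
    and "\<And>c x. c \<in> carrier F \<Longrightarrow> x \<in> carrier A \<Longrightarrow> f (c \<odot>\<^bsub>A\<^esub> x) = c \<odot>\<^bsub>B\<^esub> f x"
  shows "f \<in> lin_map F A B"
  using assms by (auto simp: lin_map_def)

lemma lin_mapD:
  assumes "f \<in> lin_map F A B"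
  shows "\<And>x. x \<in> carrier A \<Longrightarrow> f x \<in> carrier B"
    and "\<And>x y. x \<in> carrier A \<Longrightarrow> y \<in> carrier A \<Longrightarrow> f (x \<oplus>\<^bsub>A\<^esub> y) = f x \<oplus>\<^bsub>B\<^esub> f y"
    and "\<And>c x. c \<in> carrier F \<Longrightarrow> x \<in> carrier A \<Longrightarrow> f (c \<odot>\<^bsub>A\<^esub> x) = c \<odot>\<^bsub>B\<^esub> f x"
  using assms by (auto simp: lin_map_def)

lemma alg_hom_lin: "f \<in> alg_hom F A B \<Longrightarrow> f \<in> lin_map F A B"
  by (auto simp: alg_hom_def lin_map_def ring_hom_def)

lemma alg_homI:
  assumes "f \<in> lin_map F A B"
    and "\<And>x y. x \<in> carrier A \<Longrightarrow> y \<in> carrier A \<Longrightarrow> f (x \<otimes>\<^bsub>A\<^esub> y) = f x \<otimes>\<^bsub>B\<^esub> f y"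
    and "f \<one>\<^bsub>A\<^esub> = \<one>\<^bsub>B\<^esub>"
  shows "f \<in> alg_hom F A B"
  using assms by (auto simp: alg_hom_def lin_map_def ring_hom_def)

lemma alg_homD:
  assumes "f \<in> alg_hom F A B"
  shows "\<And>x. x \<in> carrier A \<Longrightarrow> f x \<in> carrier B"
    and "\<And>x y. x \<in> carrier A \<Longrightarrow> y \<in> carrier A \<Longrightarrow> f (x \<oplus>\<^bsub>A\<^esub> y) = f x \<oplus>\<^bsub>B\<^esub> f y"
    and "\<And>c x. c \<in> carrier F \<Longrightarrow> x \<in> carrier A \<Longrightarrow> f (c \<odot>\<^bsub>A\<^esub> x) = c \<odot>\<^bsub>B\<^esub> f x"
    and "\<And>x y. x \<in> carrier A \<Longrightarrow> y \<in> carrier A \<Longrightarrow> f (x \<otimes>\<^bsub>A\<^esub> y) = f x \<otimes>\<^bsub>B\<^esub> f y"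
    and "f \<one>\<^bsub>A\<^esub> = \<one>\<^bsub>B\<^esub>"
  using assms by (auto simp: alg_hom_def ring_hom_def)

lemma alg_hom_pow:
  assumes "f \<in> alg_hom F A B" "ring A" "ring B" "x \<in> carrier A"
  shows "f (x [^]\<^bsub>A\<^esub> (k::nat)) = f x [^]\<^bsub>B\<^esub> k"
proof -
  interpret A: ring A by fact
  interpret B: ring B by fact
  show ?thesis using assms(4) alg_homD[OF assms(1)] by (induction k) simp_all
qed

lemma alg_hom_comp:
  assumes "f \<in> alg_hom F A B" "g \<in> alg_hom F B C"
  shows "g \<circ> f \<in> alg_hom F A C"
  using alg_homD[OF assms(1)] alg_homD[OF assms(2)] by (auto intro!: alg_homI lin_mapI)

lemma alg_monoD:
  assumes "f \<in> alg_mono F A B"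
  shows "f \<in> alg_hom F A B" "inj_on f (carrier A)"
  using assms by (auto simp: alg_mono_def)

lemma alg_mono_comp:
  assumes "f \<in> alg_mono F A B" "g \<in> alg_mono F B C"
  shows "g \<circ> f \<in> alg_mono F A C"
proof -
  have "inj_on (g \<circ> f) (carrier A)"
    using alg_monoD[OF assms(1)] alg_monoD[OF assms(2)] alg_homD(1)[OF alg_monoD(1)[OF assms(1)]]
    by (intro comp_inj_on) (auto intro!: inj_on_subset[of g "carrier B"])
  then show ?thesis
    using alg_hom_comp alg_monoD(1)[OF assms(1)] alg_monoD(1)[OF assms(2)] by (auto simp: alg_mono_def)
qed

lemma lin_map_zero:
  assumes "field_algebra F A" "field_algebra F B" "f \<in> lin_map F A B"
  shows "f \<zero>\<^bsub>A\<^esub> = \<zero>\<^bsub>B\<^esub>"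
proof -
  interpret A: field_algebra F A by fact
  interpret B: field_algebra F B by fact
  show ?thesis
    using lin_mapD(3)[OF assms(3), of "\<zero>\<^bsub>F\<^esub>" "\<zero>\<^bsub>A\<^esub>"] lin_mapD(1)[OF assms(3), of "\<zero>\<^bsub>A\<^esub>"] by simp
qed

lemma lin_map_finsum:
  assumes "field_algebra F A" "field_algebra F B" "f \<in> lin_map F A B" "w \<in> I \<rightarrow> carrier A"
  shows "f (\<Oplus>\<^bsub>A\<^esub>i\<in>I. w i) = (\<Oplus>\<^bsub>B\<^esub>i\<in>I. f (w i))"
proof -
  interpret A: field_algebra F A by fact
  interpret B: field_algebra F B by fact
  show ?thesis
    using assms(4) lin_mapD[OF assms(3)] lin_map_zero[OF assms(1-3)]
    by (induction I rule: infinite_finite_induct) (auto simp: Pi_def)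
qed

lemma lin_map_minus:
  assumes "field_algebra F A" "field_algebra F B" "f \<in> lin_map F A B"
    "x \<in> carrier A" "y \<in> carrier A"
  shows "f (x \<ominus>\<^bsub>A\<^esub> y) = f x \<ominus>\<^bsub>B\<^esub> f y"
proof -
  interpret A: field_algebra F A by fact
  interpret B: field_algebra F B by fact
  have "f (\<ominus>\<^bsub>A\<^esub> y) = \<ominus>\<^bsub>B\<^esub> f y"
    using lin_mapD[OF assms(3)] assms(5)
    by (simp flip: A.smult_minus_one B.smult_minus_one)
  then show ?thesis using lin_mapD[OF assms(3)] assms(4,5) by (simp add: A.minus_eq B.minus_eq)
qed

lemma lin_map_inj:
  assumes "field_algebra F A" "field_algebra F B" "f \<in> lin_map F A B"
    and "\<And>x. x \<in> carrier A \<Longrightarrow> f x = \<zero>\<^bsub>B\<^esub> \<Longrightarrow> x = \<zero>\<^bsub>A\<^esub>"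
  shows "inj_on f (carrier A)"
proof (rule inj_onI)
  interpret A: field_algebra F A by fact
  interpret B: field_algebra F B by fact
  fix x y assume xy: "x \<in> carrier A" "y \<in> carrier A" "f x = f y"
  then have "f (x \<ominus>\<^bsub>A\<^esub> y) = \<zero>\<^bsub>B\<^esub>"
    using lin_map_minus[OF assms(1-3) xy(1,2)] lin_mapD(1)[OF assms(3) xy(2)]
    by (simp add: B.minus_eq B.r_neg)
  then have "x \<ominus>\<^bsub>A\<^esub> y = \<zero>\<^bsub>A\<^esub>" using xy by (intro assms(4)) auto
  then show "x = y" using xy by simp
qed

lemma lin_map_image_subspace:
  assumes "field_algebra F A" "field_algebra F B" "f \<in> lin_map F A B" "submodule V F A"
  shows "submodule (f ` V) F B"
proof -
  interpret A: field_algebra F A by fact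
  interpret B: field_algebra F B by fact
  note V = A.subspaceD[OF assms(4)] and f = lin_mapD[OF assms(3)]
  show ?thesis
  proof (rule B.subspaceI)
    show "\<zero>\<^bsub>B\<^esub> \<in> f ` V" using V(2) lin_map_zero[OF assms(1-3)] by (metis imageI)
  next
    fix x y assume "x \<in> f ` V" "y \<in> f ` V"
    then obtain x' y' where "x' \<in> V" "y' \<in> V" "x = f x'" "y = f y'" by auto
    then show "x \<oplus>\<^bsub>B\<^esub> y \<in> f ` V"
      using V f(2)[of x' y'] by (metis imageI subsetD)
  next
    fix c x assume c: "c \<in> carrier F" and "x \<in> f ` V"
    then obtain x' where "x' \<in> V" "x = f x'" by auto
    then show "c \<odot>\<^bsub>B\<^esub> x \<in> f ` V"
      using V f(3)[OF c, of x'] c by (metis imageI subsetD)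
  qed (use V f in auto)
qed

lemma lin_map_eq_subspace:
  assumes "field_algebra F A" "field_algebra F B" "f \<in> lin_map F A B" "g \<in> lin_map F A B"
  shows "submodule {x \<in> carrier A. f x = g x} F A"
proof -
  interpret A: field_algebra F A by fact
  show ?thesis
    using lin_map_zero[OF assms(1-2) assms(3)] lin_map_zero[OF assms(1-2) assms(4)]
    by (intro A.subspaceI)
      (simp_all add: subset_eq lin_mapD[OF assms(3)] lin_mapD[OF assms(4)])
qed

text \<open>Spanning is encoded by subspaces instead of finite sums. A claim about all elements then
  reduces to two checks: the elements that satisfy it form a subspace, and this subspace contains
  \<open>S\<close>.\<close>

definition spanned ::
  "('f, 'r) ring_scheme \<Rightarrow> ('f, 'a, 'x) module_scheme \<Rightarrow> 'a set \<Rightarrow> bool"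
  where "spanned F A S \<longleftrightarrow> S \<subseteq> carrier A \<and> (\<forall>V. submodule V F A \<longrightarrow> S \<subseteq> V \<longrightarrow> carrier A \<subseteq> V)"

lemma spannedD:
  assumes "spanned F A S"
  shows "S \<subseteq> carrier A" "\<And>V. submodule V F A \<Longrightarrow> S \<subseteq> V \<Longrightarrow> carrier A \<subseteq> V"
  using assms by (auto simp: spanned_def)

lemma spanned_lin_map_eq:
  assumes "field_algebra F A" "field_algebra F B" "f \<in> lin_map F A B" "g \<in> lin_map F A B"
    and "spanned F A S" "\<And>s. s \<in> S \<Longrightarrow> f s = g s" "x \<in> carrier A"
  shows "f x = g x"
  using spannedD(2)[OF assms(5) lin_map_eq_subspace[OF assms(1-4)]] spannedD(1)[OF assms(5)]
    assms(6,7) by blast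

text \<open>Multiplicativity is an equation of bilinear expressions, so it extends from
  \<open>S\<close> in two passes: the left factor runs over the algebra while the right one stays in
  \<open>S\<close>, then the right factor is released as well.\<close>

lemma spanned_lin_map_mult:
  assumes "field_algebra F A" "field_algebra F B" "f \<in> lin_map F A B"
    and S: "spanned F A S"
    and mult: "\<And>s t. s \<in> S \<Longrightarrow> t \<in> S \<Longrightarrow> f (s \<otimes>\<^bsub>A\<^esub> t) = f s \<otimes>\<^bsub>B\<^esub> f t"
    and one: "f \<one>\<^bsub>A\<^esub> = \<one>\<^bsub>B\<^esub>"
  shows "f \<in> alg_hom F A B"
proof (rule alg_homI[OF assms(3) _ one])
  interpret A: field_algebra F A by fact
  interpret B: field_algebra F B by fact
  note f = lin_mapD[OF assms(3)]
  have 1: "f (x \<otimes>\<^bsub>A\<^esub> t) = f x \<otimes>\<^bsub>B\<^esub> f t" if x: "x \<in> carrier A" and t: "t \<in> S" for x t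
  proof (rule spanned_lin_map_eq[OF assms(1,2) _ _ S _ x])
    have tc: "t \<in> carrier A" using spannedD(1)[OF S] t by auto
    show "(\<lambda>x. f (x \<otimes>\<^bsub>A\<^esub> t)) \<in> lin_map F A B" "(\<lambda>x. f x \<otimes>\<^bsub>B\<^esub> f t) \<in> lin_map F A B"
      using f tc by (auto intro!: lin_mapI simp: A.l_distr B.l_distr)
  qed (use mult t in auto)
  fix x y assume x: "x \<in> carrier A" and y: "y \<in> carrier A"
  show "f (x \<otimes>\<^bsub>A\<^esub> y) = f x \<otimes>\<^bsub>B\<^esub> f y"
  proof (rule spanned_lin_map_eq[OF assms(1,2) _ _ S _ y])
    show "(\<lambda>y. f (x \<otimes>\<^bsub>A\<^esub> y)) \<in> lin_map F A B" "(\<lambda>y. f x \<otimes>\<^bsub>B\<^esub> f y) \<in> lin_map F A B"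
      using f x by (auto intro!: lin_mapI simp: A.r_distr B.r_distr)
  qed (use 1 x in auto)
qed

section \<open>Bases and linear extension\<close>

definition is_basis ::
  "('f, 'r) ring_scheme \<Rightarrow> ('f, 'a, 'x) module_scheme \<Rightarrow> 'i set \<Rightarrow> ('i \<Rightarrow> 'a) \<Rightarrow> bool"
  where "is_basis F A I b \<longleftrightarrow> finite I \<and> spanned F A (b ` I) \<and>
    (\<forall>c \<in> I \<rightarrow> carrier F. (\<Oplus>\<^bsub>A\<^esub>i\<in>I. c i \<odot>\<^bsub>A\<^esub> b i) = \<zero>\<^bsub>A\<^esub> \<longrightarrow> (\<forall>i\<in>I. c i = \<zero>\<^bsub>F\<^esub>))"

context field_algebra
begin

lemma lincomb_closed:
  "\<lbrakk>b \<in> I \<rightarrow> carrier A; c \<in> I \<rightarrow> carrier F\<rbrakk> \<Longrightarrow> (\<Oplus>i\<in>I. c i \<odot> b i) \<in> carrier A"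
  by (intro finsum_closed) auto

lemma lincomb_add:
  assumes "b \<in> I \<rightarrow> carrier A" "c \<in> I \<rightarrow> carrier F" "d \<in> I \<rightarrow> carrier F"
  shows "(\<Oplus>i\<in>I. c i \<odot> b i) \<oplus> (\<Oplus>i\<in>I. d i \<odot> b i) = (\<Oplus>i\<in>I. (c i \<oplus>\<^bsub>F\<^esub> d i) \<odot> b i)"
proof -
  have "(\<Oplus>i\<in>I. (c i \<oplus>\<^bsub>F\<^esub> d i) \<odot> b i) = (\<Oplus>i\<in>I. c i \<odot> b i \<oplus> d i \<odot> b i)"
    using assms by (intro finsum_cong') (auto simp: smult_l_distr Pi_def)
  also have "\<dots> = (\<Oplus>i\<in>I. c i \<odot> b i) \<oplus> (\<Oplus>i\<in>I. d i \<odot> b i)"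
    using assms by (intro finsum_addf) auto
  finally show ?thesis by simp
qed

lemma lincomb_smult:
  assumes "finite I" "b \<in> I \<rightarrow> carrier A" "c \<in> I \<rightarrow> carrier F" "d \<in> carrier F"
  shows "d \<odot> (\<Oplus>i\<in>I. c i \<odot> b i) = (\<Oplus>i\<in>I. (d \<otimes>\<^bsub>F\<^esub> c i) \<odot> b i)"
proof -
  have "d \<odot> (\<Oplus>i\<in>I. c i \<odot> b i) = (\<Oplus>i\<in>I. d \<odot> (c i \<odot> b i))"
    using assms by (intro finsum_smult_ldistr) auto
  also have "\<dots> = (\<Oplus>i\<in>I. (d \<otimes>\<^bsub>F\<^esub> c i) \<odot> b i)"
    using assms by (intro finsum_cong') (auto simp: Pi_def)
  finally show ?thesis .
qed

lemma lincomb_unit: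
  assumes "finite I" "b \<in> I \<rightarrow> carrier A" "i \<in> I"
  shows "(\<Oplus>j\<in>I. (if j = i then \<one>\<^bsub>F\<^esub> else \<zero>\<^bsub>F\<^esub>) \<odot> b j) = b i"
proof -
  have "(\<Oplus>j\<in>I. (if j = i then \<one>\<^bsub>F\<^esub> else \<zero>\<^bsub>F\<^esub>) \<odot> b j) = (\<Oplus>j\<in>I. if j = i then b i else \<zero>)"
    using assms by (intro finsum_cong') (auto simp: Pi_def)
  then show ?thesis using assms finsum_delta[of I i "b i"] by auto
qed

lemma lincombs_subspace:
  assumes "finite I" "b \<in> I \<rightarrow> carrier A"
  shows "submodule {\<Oplus>i\<in>I. c i \<odot> b i | c. c \<in> I \<rightarrow> carrier F} F A" (is "submodule ?V F A")
proof (rule subspaceI)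
  have "(\<Oplus>i\<in>I. \<zero>\<^bsub>F\<^esub> \<odot> b i) = \<zero>"
    using assms by (intro add.finprod_one_eqI) (auto simp: Pi_def)
  then show "\<zero> \<in> ?V" by (auto intro!: exI[of _ "\<lambda>_. \<zero>\<^bsub>F\<^esub>"])
next
  fix x y assume "x \<in> ?V" "y \<in> ?V"
  then obtain c d where "c \<in> I \<rightarrow> carrier F" "d \<in> I \<rightarrow> carrier F"
    "x = (\<Oplus>i\<in>I. c i \<odot> b i)" "y = (\<Oplus>i\<in>I. d i \<odot> b i)" by auto
  then show "x \<oplus> y \<in> ?V"
    using lincomb_add[OF assms(2), of c d] by (auto intro!: exI[of _ "\<lambda>i. c i \<oplus>\<^bsub>F\<^esub> d i"])
next
  fix d x assume d: "d \<in> carrier F" and "x \<in> ?V"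
  then obtain c where "c \<in> I \<rightarrow> carrier F" "x = (\<Oplus>i\<in>I. c i \<odot> b i)" by auto
  then show "d \<odot> x \<in> ?V"
    using lincomb_smult[OF assms, of c d] d by (auto intro!: exI[of _ "\<lambda>i. d \<otimes>\<^bsub>F\<^esub> c i"])
qed (use lincomb_closed[OF assms(2)] in auto)

lemma spanned_lincomb:
  assumes "finite I" "spanned F A (b ` I)" "x \<in> carrier A"
  obtains c where "c \<in> I \<rightarrow> carrier F" "x = (\<Oplus>i\<in>I. c i \<odot> b i)"
proof -
  have b: "b \<in> I \<rightarrow> carrier A" using spannedD(1)[OF assms(2)] by auto
  have "b ` I \<subseteq> {\<Oplus>i\<in>I. c i \<odot> b i | c. c \<in> I \<rightarrow> carrier F}"
  proof
    fix y assume "y \<in> b ` I"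
    then obtain i where i: "i \<in> I" "y = b i" by auto
    show "y \<in> {\<Oplus>i\<in>I. c i \<odot> b i | c. c \<in> I \<rightarrow> carrier F}"
      using lincomb_unit[OF assms(1) b i(1)] i(2)
      by (auto intro!: exI[of _ "\<lambda>j. if j = i then \<one>\<^bsub>F\<^esub> else \<zero>\<^bsub>F\<^esub>"])
  qed
  from spannedD(2)[OF assms(2) lincombs_subspace[OF assms(1) b] this]
  show ?thesis using assms(3) that by blast
qed

lemma basisD:
  assumes "is_basis F A I b"
  shows "finite I" "spanned F A (b ` I)" "b \<in> I \<rightarrow> carrier A"
    and "\<And>c i. c \<in> I \<rightarrow> carrier F \<Longrightarrow> (\<Oplus>i\<in>I. c i \<odot> b i) = \<zero> \<Longrightarrow> i \<in> I \<Longrightarrow> c i = \<zero>\<^bsub>F\<^esub>"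
  using assms by (auto simp: is_basis_def spanned_def)

lemma basis_unique:
  assumes "is_basis F A I b" "c \<in> I \<rightarrow> carrier F" "d \<in> I \<rightarrow> carrier F"
    and eq: "(\<Oplus>i\<in>I. c i \<odot> b i) = (\<Oplus>i\<in>I. d i \<odot> b i)" and i: "i \<in> I"
  shows "c i = d i"
proof -
  note b = basisD[OF assms(1)]
  have m: "(\<lambda>i. (\<ominus>\<^bsub>F\<^esub> \<one>\<^bsub>F\<^esub>) \<otimes>\<^bsub>F\<^esub> d i) \<in> I \<rightarrow> carrier F" using assms(3) by auto
  have "(\<Oplus>i\<in>I. (c i \<oplus>\<^bsub>F\<^esub> (\<ominus>\<^bsub>F\<^esub> \<one>\<^bsub>F\<^esub>) \<otimes>\<^bsub>F\<^esub> d i) \<odot> b i) =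
      (\<Oplus>i\<in>I. c i \<odot> b i) \<oplus> (\<ominus>\<^bsub>F\<^esub> \<one>\<^bsub>F\<^esub>) \<odot> (\<Oplus>i\<in>I. d i \<odot> b i)"
    using lincomb_add[OF b(3) assms(2) m] lincomb_smult[OF b(1,3) assms(3), of "\<ominus>\<^bsub>F\<^esub> \<one>\<^bsub>F\<^esub>"] by simp
  also have "\<dots> = \<zero>"
    using lincomb_closed[OF b(3) assms(3)] eq by (simp add: smult_minus_one r_neg)
  finally have "c i \<oplus>\<^bsub>F\<^esub> (\<ominus>\<^bsub>F\<^esub> \<one>\<^bsub>F\<^esub>) \<otimes>\<^bsub>F\<^esub> d i = \<zero>\<^bsub>F\<^esub>"
    using assms(2,3) by (intro b(4)[OF _ _ i]) auto
  then show ?thesis using assms(2,3) i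
    by (simp add: Pi_def R.l_minus R.minus_eq[symmetric])
qed

end

text \<open>The third conclusion evaluates \<open>f\<close> on an arbitrary combination, without
  reference to chosen coefficients; injectivity proofs read off the image from it.\<close>

lemma basis_extend:
  assumes "field_algebra F A" "field_algebra F B" "is_basis F A I b" "t \<in> I \<rightarrow> carrier B"
  obtains f where "f \<in> lin_map F A B" "\<And>i. i \<in> I \<Longrightarrow> f (b i) = t i"
    "\<And>c. c \<in> I \<rightarrow> carrier F \<Longrightarrow> f (\<Oplus>\<^bsub>A\<^esub>i\<in>I. c i \<odot>\<^bsub>A\<^esub> b i) = (\<Oplus>\<^bsub>B\<^esub>i\<in>I. c i \<odot>\<^bsub>B\<^esub> t i)"
proof -
  interpret A: field_algebra F A by fact
  interpret B: field_algebra F B by fact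
  note b = A.basisD[OF assms(3)]
  \<comment> \<open>Some coefficient vector is chosen for each element. By uniqueness of
    coefficients any other representation has the same values on \<open>I\<close>, so the choice
    leaves no trace in \<open>f\<close>.\<close>
  define co where "co x = (SOME c. c \<in> I \<rightarrow> carrier F \<and> x = (\<Oplus>\<^bsub>A\<^esub>i\<in>I. c i \<odot>\<^bsub>A\<^esub> b i))" for x
  define f where "f x = (\<Oplus>\<^bsub>B\<^esub>i\<in>I. co x i \<odot>\<^bsub>B\<^esub> t i)" for x
  have key: "f (\<Oplus>\<^bsub>A\<^esub>i\<in>I. c i \<odot>\<^bsub>A\<^esub> b i) = (\<Oplus>\<^bsub>B\<^esub>i\<in>I. c i \<odot>\<^bsub>B\<^esub> t i)" if c: "c \<in> I \<rightarrow> carrier F" for c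
  proof -
    let ?x = "\<Oplus>\<^bsub>A\<^esub>i\<in>I. c i \<odot>\<^bsub>A\<^esub> b i"
    have "\<exists>d. d \<in> I \<rightarrow> carrier F \<and> ?x = (\<Oplus>\<^bsub>A\<^esub>i\<in>I. d i \<odot>\<^bsub>A\<^esub> b i)"
      using c by blast
    then have "co ?x \<in> I \<rightarrow> carrier F \<and> ?x = (\<Oplus>\<^bsub>A\<^esub>i\<in>I. co ?x i \<odot>\<^bsub>A\<^esub> b i)"
      unfolding co_def[of ?x] by (rule someI_ex)
    then have "co ?x i = c i" if "i \<in> I" for i
      using A.basis_unique[OF assms(3), of "co ?x" c i] c that by auto
    then show ?thesis
      unfolding f_def using assms(4) c by (intro B.finsum_cong') (auto simp: Pi_def)
  qed
  show ?thesis
  proof (rule that[OF _ _ key])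
    show "f \<in> lin_map F A B"
    proof (rule lin_mapI)
      fix x y assume x: "x \<in> carrier A" and y: "y \<in> carrier A"
      obtain c where c: "c \<in> I \<rightarrow> carrier F" "x = (\<Oplus>\<^bsub>A\<^esub>i\<in>I. c i \<odot>\<^bsub>A\<^esub> b i)"
        using A.spanned_lincomb[OF b(1,2) x] .
      obtain d where d: "d \<in> I \<rightarrow> carrier F" "y = (\<Oplus>\<^bsub>A\<^esub>i\<in>I. d i \<odot>\<^bsub>A\<^esub> b i)"
        using A.spanned_lincomb[OF b(1,2) y] .
      have cd: "(\<lambda>i. c i \<oplus>\<^bsub>F\<^esub> d i) \<in> I \<rightarrow> carrier F" using c d by auto
      show "f x \<in> carrier B" unfolding c(2) key[OF c(1)] by (rule B.lincomb_closed[OF assms(4) c(1)])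
      show "f (x \<oplus>\<^bsub>A\<^esub> y) = f x \<oplus>\<^bsub>B\<^esub> f y"
        unfolding c(2) d(2) A.lincomb_add[OF b(3) c(1) d(1)] key[OF cd] key[OF c(1)] key[OF d(1)]
        by (simp add: B.lincomb_add[OF assms(4) c(1) d(1)])
      fix k assume k: "k \<in> carrier F"
      have kc: "(\<lambda>i. k \<otimes>\<^bsub>F\<^esub> c i) \<in> I \<rightarrow> carrier F" using c k by auto
      show "f (k \<odot>\<^bsub>A\<^esub> x) = k \<odot>\<^bsub>B\<^esub> f x"
        unfolding c(2) A.lincomb_smult[OF b(1,3) c(1) k] key[OF kc] key[OF c(1)]
        by (simp add: B.lincomb_smult[OF b(1) assms(4) c(1) k])
    qed
    fix i assume i: "i \<in> I"
    show "f (b i) = t i"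
      using key[of "\<lambda>j. if j = i then \<one>\<^bsub>F\<^esub> else \<zero>\<^bsub>F\<^esub>"]
      by (simp add: A.lincomb_unit[OF b(1,3) i] B.lincomb_unit[OF b(1) assms(4) i] Pi_def)
  qed
qed

text \<open>The operator \<open>T k\<close> minus the scalar \<open>l k i1\<close> maps
  \<open>J\<close> into itself, kills \<open>w i1\<close> and rescales every other summand.
  Repeating this removes all summands except \<open>w i0\<close>, which survives with a nonzero
  factor. Only \<open>i0\<close> has to be separated from the others, each time by a suitable
  \<open>k\<close>. With \<open>J\<close> zero this gives independence, with an ideal simplicity,
  with the centralizer of everything the centre.\<close>

lemma (in field_algebra) eigenvector_component:
  assumes J: "submodule J F A" and "finite I" "i0 \<notin> I"
    and T: "\<And>k. T k \<in> lin_map F A A" "\<And>k z. z \<in> J \<Longrightarrow> T k z \<in> J"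
    and w: "\<And>i. i \<in> insert i0 I \<Longrightarrow> w i \<in> carrier A"
    and l: "\<And>k i. i \<in> insert i0 I \<Longrightarrow> l k i \<in> carrier F"
    and eig: "\<And>k i. i \<in> insert i0 I \<Longrightarrow> T k (w i) = l k i \<odot> w i"
    and sep: "\<And>i. i \<in> I \<Longrightarrow> \<exists>k. l k i \<noteq> l k i0"
    and sum: "(\<Oplus>i\<in>insert i0 I. w i) \<in> J"
  shows "w i0 \<in> J"
  using assms(2,3) w l eig sep sum
proof (induction I arbitrary: w)
  case empty
  then show ?case by simp
next
  case (insert i1 I)
  note J' = subspaceD[OF J]
  have fa: "field_algebra F A" ..
  obtain k where k: "l k i1 \<noteq> l k i0" using insert.prems(5) by auto
  define S where "S = insert i0 (insert i1 I)"
  have wS: "w \<in> S \<rightarrow> carrier A" and lS: "\<And>i. i \<in> S \<Longrightarrow> l k i \<in> carrier F"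
    using insert.prems by (auto simp: S_def)
  \<comment> \<open>The image of \<open>w i\<close> under \<open>T k\<close> minus
    \<open>l k i1\<close>. It is an eigenvector with the same eigenvalues, and it vanishes at
    \<open>i1\<close>.\<close>
  define w' where "w' i = (l k i \<ominus>\<^bsub>F\<^esub> l k i1) \<odot> w i" for i
  have w'S: "w' \<in> S \<rightarrow> carrier A" using wS lS by (auto simp: w'_def S_def Pi_def)
  have "T k (\<Oplus>i\<in>S. w i) \<ominus> l k i1 \<odot> (\<Oplus>i\<in>S. w i) \<in> J"
    using insert.prems(6) T J' lS by (auto simp: S_def)
  also have "T k (\<Oplus>i\<in>S. w i) = (\<Oplus>i\<in>S. T k (w i))"
    by (rule lin_map_finsum[OF fa fa T(1) wS])
  also have "(\<Oplus>i\<in>S. T k (w i)) \<ominus> l k i1 \<odot> (\<Oplus>i\<in>S. w i) =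
      (\<Oplus>i\<in>S. T k (w i)) \<oplus> (\<Oplus>i\<in>S. (\<ominus>\<^bsub>F\<^esub> l k i1) \<odot> w i)"
    using wS lS insert.hyps(1)
    by (subst finsum_smult_ldistr[symmetric]) (auto simp: S_def minus_eq smult_l_minus)
  also have "\<dots> = (\<Oplus>i\<in>S. T k (w i) \<oplus> (\<ominus>\<^bsub>F\<^esub> l k i1) \<odot> w i)"
    using wS lS lin_mapD(1)[OF T(1)] by (intro finsum_addf[symmetric]) (auto simp: Pi_def S_def)
  also have "\<dots> = (\<Oplus>i\<in>S. w' i)"
    using wS lS insert.prems(4)
    by (intro finsum_cong') (auto simp: w'_def S_def Pi_def R.minus_eq smult_l_distr)
  also have "\<dots> = (\<Oplus>i\<in>insert i0 I. w' i)"
  proof -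
    have 0: "w' i1 = \<zero>" using insert.prems by (simp add: w'_def R.minus_eq R.r_neg)
    have S: "S = insert i1 (insert i0 I)" by (auto simp: S_def)
    show ?thesis
      unfolding S using insert.hyps insert.prems(1) w'S
      by (subst finsum_insert) (auto simp: 0 S_def Pi_def)
  qed
  finally have "(\<Oplus>i\<in>insert i0 I. w' i) \<in> J" .
  note sum' = this
  have "w' i0 \<in> J"
  proof (rule insert.IH)
    fix k' i assume i: "i \<in> insert i0 I"
    then have "i \<in> S" by (auto simp: S_def)
    then show "T k' (w' i) = l k' i \<odot> w' i"
      using insert.prems(2-4) wS lS lin_mapD(3)[OF T(1)] i
      by (auto simp: w'_def S_def Pi_def R.m_comm)
  qed (use insert.prems w'S sum' in \<open>auto simp: S_def\<close>)
  then have "inv\<^bsub>F\<^esub> (l k i0 \<ominus>\<^bsub>F\<^esub> l k i1) \<odot> w' i0 \<in> J"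
    and "l k i0 \<ominus>\<^bsub>F\<^esub> l k i1 \<in> Units F"
    using k lS J' by (auto simp: S_def K.field_Units)
  then show ?case using wS lS by (simp add: w'_def S_def Pi_def)
qed

section \<open>Primitive roots of unity\<close>

context field
begin

lemma primitive_rootD:
  assumes "primitive_root_of_unity R n z"
  shows "z \<in> carrier R" "n > 0" "z [^] n = \<one>" "z \<noteq> \<zero>" "z \<in> Units R"
    and "\<And>k. 0 < k \<Longrightarrow> k < n \<Longrightarrow> z [^] k \<noteq> \<one>"
proof -
  show z: "z \<in> carrier R" "n > 0" "z [^] n = \<one>" "\<And>k. 0 < k \<Longrightarrow> k < n \<Longrightarrow> z [^] k \<noteq> \<one>"
    using assms by (auto simp: primitive_root_of_unity_def)
  show "z \<noteq> \<zero>" using z(2,3) by (auto simp: nat_pow_zero)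
  then show "z \<in> Units R" using z(1) by (simp add: field_Units)
qed

lemma pow_nonzero: "c \<in> carrier R \<Longrightarrow> c \<noteq> \<zero> \<Longrightarrow> c [^] (k::nat) \<noteq> \<zero>"
  by (metis field_Units Units_pow_closed Diff_iff singleton_iff insert_iff)

lemma mult_cancel_left: 
  "\<lbrakk>c \<in> carrier R; d \<in> carrier R; e \<in> carrier R; e \<noteq> \<zero>\<rbrakk> \<Longrightarrow> e \<otimes> c = e \<otimes> d \<longleftrightarrow> c = d"
  using m_lcancel by metis

lemma primitive_root_pow_mod:
  assumes "primitive_root_of_unity R n z"
  shows "z [^] (i mod n) = z [^] i"
proof -
  note z = primitive_rootD[OF assms]
  have "z [^] i = z [^] (n * (i div n) + i mod n)" by simp
  also have "\<dots> = (z [^] n) [^] (i div n) \<otimes> z [^] (i mod n)"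
    using z(1) by (metis nat_pow_mult nat_pow_pow)
  finally show ?thesis using z(1,3) by simp
qed

lemma primitive_root_pow_eq_one:
  assumes "primitive_root_of_unity R n z"
  shows "z [^] i = \<one> \<longleftrightarrow> n dvd i"
  using primitive_root_pow_mod[OF assms, of i] primitive_rootD[OF assms]
  by (metis dvd_eq_mod_eq_0 gr0I mod_less_divisor nat_pow_0)

lemma primitive_root_inj:
  assumes "primitive_root_of_unity R n z" "z [^] i = z [^] j"
  shows "i mod n = j mod n"
proof -
  note z = primitive_rootD[OF assms(1)]
  have *: "n dvd j - i" if "i \<le> j" "z [^] i = z [^] j" for i j
  proof -
    have "z [^] i \<otimes> z [^] (j - i) = z [^] i \<otimes> \<one>"
      using nat_pow_mult[OF z(1), of i "j - i"] that z(1) by simp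
    then have "z [^] (j - i) = \<one>"
      using mult_cancel_left[of "z [^] (j - i)" \<one> "z [^] i"] z(1,4) pow_nonzero by simp
    then show ?thesis using primitive_root_pow_eq_one[OF assms(1)] by simp
  qed
  show ?thesis
  proof (cases "i \<le> j")
    case True
    then show ?thesis using *[of i j] assms(2) by (metis mod_eq_dvd_iff_nat)
  next
    case False
    then show ?thesis using *[of j i] assms(2) by (metis mod_eq_dvd_iff_nat nat_le_linear)
  qed
qed

lemma primitive_root_power:
  assumes "primitive_root_of_unity R (k * l) z"
  shows "primitive_root_of_unity R l (z [^] k)"
  using primitive_rootD[OF assms]
  by (auto simp: primitive_root_of_unity_def nat_pow_pow)

lemma primitive_root_inverse:
  assumes "primitive_root_of_unity R n z"
  shows "primitive_root_of_unity R n (inv z)"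
proof -
  note z = primitive_rootD[OF assms]
  have "inv z [^] k = \<one> \<longleftrightarrow> z [^] k = \<one>" for k :: nat
  proof -
    have "z [^] k \<otimes> inv z [^] k = \<one>"
      using z(1,5) by (simp add: nat_pow_distrib[symmetric])
    then show ?thesis using z(1,5) by auto
  qed
  then show ?thesis using z by (auto simp: primitive_root_of_unity_def)
qed

lemma primitive_root_one: "primitive_root_of_unity R 1 \<one>"
  by (auto simp: primitive_root_of_unity_def)

end

subsection \<open>Dimension\<close>

context field_algebra
begin

lemma smult_eq_self:
  assumes "c \<in> carrier F" "x \<in> carrier A" "x \<noteq> \<zero>" "c \<odot> x = x"
  shows "c = \<one>\<^bsub>F\<^esub>"
proof -
  have "(c \<ominus>\<^bsub>F\<^esub> \<one>\<^bsub>F\<^esub>) \<odot> x = \<zero>"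
    using assms by (subst smult_diff_distrib) (auto simp: minus_eq r_neg)
  then show ?thesis using smult_cancel_zero[of "c \<ominus>\<^bsub>F\<^esub> \<one>\<^bsub>F\<^esub>" x] assms by auto
qed

lemma subspace_cancel:
  assumes "submodule V F A" "c \<in> carrier F" "c \<noteq> \<zero>\<^bsub>F\<^esub>" "x \<in> carrier A" "c \<odot> x \<in> V"
  shows "x \<in> V"
proof -
  have c: "c \<in> Units F" using assms by (simp add: K.field_Units)
  then have "inv\<^bsub>F\<^esub> c \<odot> (c \<odot> x) \<in> V" using subspaceD(4)[OF assms(1) _ assms(5)] by simp
  then show ?thesis using assms c by simp
qed

lemma scalar_hom: "ring_hom_ring F A (\<lambda>c. c \<odot> \<one>)"
proof (intro ring_hom_ringI2 ring_hom_memI)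
  show "ring F" "ring A" by unfold_locales
qed (auto simp: smult_l_distr R.m_comm)

lemma scalars_subfield:
  assumes "\<one> \<noteq> \<zero>"
  shows "subfield (scalars F A) A"
  unfolding scalars_def
  by (rule ring_hom_ring.img_is_subfield(2)[OF scalar_hom K.carrier_is_subfield])
    (use assms in simp)

text \<open>The inductive notion of dimension adds one vector outside the current span at a time;
  independence in terms of coefficient functions says exactly that each new vector is
  outside.\<close>

lemma dimension_lincombs:
  assumes "finite I" "b \<in> I \<rightarrow> carrier A"
    and "\<And>c i. c \<in> I \<rightarrow> carrier F \<Longrightarrow> (\<Oplus>i\<in>I. c i \<odot> b i) = \<zero> \<Longrightarrow> i \<in> I \<Longrightarrow> c i = \<zero>\<^bsub>F\<^esub>"
  shows "dimension (card I) (scalars F A) {\<Oplus>i\<in>I. c i \<odot> b i | c. c \<in> I \<rightarrow> carrier F}"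
  using assms
proof (induction I)
  case empty
  have "{\<Oplus>i\<in>{}. c i \<odot> b i | c. c \<in> {} \<rightarrow> carrier F} = {\<zero>}" by auto
  then show ?case using zero_dim by simp
next
  case (insert i I)
  let ?E = "\<lambda>I. {\<Oplus>i\<in>I. c i \<odot> b i | c. c \<in> I \<rightarrow> carrier F}"
  have bi: "b i \<in> carrier A" "b \<in> I \<rightarrow> carrier A" using insert.prems by auto
  have sum: "(\<Oplus>j\<in>insert i I. c j \<odot> b j) = c i \<odot> b i \<oplus> (\<Oplus>j\<in>I. c j \<odot> b j)"
    if "c \<in> insert i I \<rightarrow> carrier F" for c
    using insert.hyps insert.prems(1) that by (subst finsum_insert) (auto simp: Pi_def)
  have upd: "(\<Oplus>j\<in>I. (c(i := d)) j \<odot> b j) = (\<Oplus>j\<in>I. c j \<odot> b j)" if "c \<in> I \<rightarrow> carrier F" for c d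
    using insert.hyps(2) bi that by (intro finsum_cong') (auto simp: Pi_def)
  have ind: "c j = \<zero>\<^bsub>F\<^esub>" if c: "c \<in> I \<rightarrow> carrier F" "(\<Oplus>i\<in>I. c i \<odot> b i) = \<zero>" "j \<in> I" for c j
  proof -
    have c': "c(i := \<zero>\<^bsub>F\<^esub>) \<in> insert i I \<rightarrow> carrier F" using c(1) by auto
    have "(\<Oplus>j\<in>insert i I. (c(i := \<zero>\<^bsub>F\<^esub>)) j \<odot> b j) = \<zero>"
      unfolding sum[OF c'] upd[OF c(1)] using c(2) bi by simp
    from insert.prems(2)[OF c' this, of j] show ?thesis
      using c(3) insert.hyps(2) by (auto split: if_splits)
  qed
  have "b i \<notin> ?E I"
  proof
    assume "b i \<in> ?E I"
    then obtain c where c: "c \<in> I \<rightarrow> carrier F" "b i = (\<Oplus>j\<in>I. c j \<odot> b j)" by auto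
    \<comment> \<open>A representation of \<open>b i\<close> by the other vectors becomes a
      nontrivial relation once \<open>b i\<close> gets the coefficient -1.\<close>
    have c': "c(i := \<ominus>\<^bsub>F\<^esub> \<one>\<^bsub>F\<^esub>) \<in> insert i I \<rightarrow> carrier F" using c(1) by auto
    have "(\<Oplus>j\<in>insert i I. (c(i := \<ominus>\<^bsub>F\<^esub> \<one>\<^bsub>F\<^esub>)) j \<odot> b j) = \<zero>"
      unfolding sum[OF c'] upd[OF c(1)] c(2)[symmetric] using bi by (simp add: smult_minus_one l_neg)
    from insert.prems(2)[OF c' this, of i] show False by (simp add: R.add.inv_eq_1_iff)
  qed
  moreover have "dimension (card I) (scalars F A) (?E I)" by (rule insert.IH[OF bi(2)], rule ind)
  ultimately have "dimension (Suc (card I)) (scalars F A) (line_extension (scalars F A) (b i) (?E I))"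
    using bi by (intro Suc_dim)
  also have "line_extension (scalars F A) (b i) (?E I) = ?E (insert i I)"
  proof (intro equalityI subsetI)
    fix x assume "x \<in> line_extension (scalars F A) (b i) (?E I)"
    then obtain d c where d: "d \<in> carrier F" and c: "c \<in> I \<rightarrow> carrier F"
      and x: "x = (d \<odot> \<one>) \<otimes> b i \<oplus> (\<Oplus>j\<in>I. c j \<odot> b j)"
      unfolding line_extension_mem_iff scalars_def by blast
    have c': "c(i := d) \<in> insert i I \<rightarrow> carrier F" using c d by auto
    have "x = (\<Oplus>j\<in>insert i I. (c(i := d)) j \<odot> b j)"
      unfolding sum[OF c'] upd[OF c(1)] x using d bi by simp
    then show "x \<in> ?E (insert i I)" using c' by blast
  next
    fix x assume "x \<in> ?E (insert i I)"
    then obtain c where c: "c \<in> insert i I \<rightarrow> carrier F" and x: "x = (\<Oplus>j\<in>insert i I. c j \<odot> b j)"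
      by auto
    have "x = (c i \<odot> \<one>) \<otimes> b i \<oplus> (\<Oplus>j\<in>I. c j \<odot> b j)" using x sum[OF c] c bi by simp
    moreover have "c i \<odot> \<one> \<in> scalars F A" using c by (auto simp: scalars_def)
    moreover have "(\<Oplus>j\<in>I. c j \<odot> b j) \<in> ?E I" using c by auto
    ultimately show "x \<in> line_extension (scalars F A) (b i) (?E I)"
      unfolding line_extension_mem_iff by blast
  qed
  finally show ?case using insert.hyps by simp
qed

lemma dimension_basis:
  assumes "is_basis F A I b"
  shows "dimension (card I) (scalars F A) (carrier A)"
proof -
  note b = basisD[OF assms]
  have "{\<Oplus>i\<in>I. c i \<odot> b i | c. c \<in> I \<rightarrow> carrier F} = carrier A"
    using spanned_lincomb[OF b(1,2)] lincomb_closed[OF b(3)] by blast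
  moreover have "dimension (card I) (scalars F A) {\<Oplus>i\<in>I. c i \<odot> b i | c. c \<in> I \<rightarrow> carrier F}"
    by (rule dimension_lincombs[OF b(1,3)], rule b(4))
  ultimately show ?thesis by simp
qed

end

section \<open>Symbol algebras\<close>

text \<open>Generation by \<open>u\<close> and \<open>v\<close> is deliberately absent: the pairs
  found inside larger algebras satisfy the relations but span a proper subalgebra.\<close>

locale symbol_pair = field_algebra F A
  for F :: "('f, 'r) ring_scheme" and A :: "('f, 'a, 'x) module_scheme" (structure) +
  fixes D :: nat and z b g :: 'f and u v :: 'a
  assumes z: "primitive_root_of_unity F D z"
    and b: "b \<in> carrier F" "b \<noteq> \<zero>\<^bsub>F\<^esub>"
    and g: "g \<in> carrier F" "g \<noteq> \<zero>\<^bsub>F\<^esub>"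
    and u: "u \<in> carrier A" and v: "v \<in> carrier A"
    and vu: "v \<otimes> u = z \<odot> (u \<otimes> v)"
    and uD: "u [^] D = b \<odot> \<one>" and vD: "v [^] D = g \<odot> \<one>"
    and nontriv: "\<one> \<noteq> \<zero>"
begin

lemmas zD = K.primitive_rootD[OF z]

abbreviation mon :: "nat \<Rightarrow> nat \<Rightarrow> 'a" where "mon i j \<equiv> u [^] i \<otimes> v [^] j"

lemma mon_closed [simp, intro]: "mon i j \<in> carrier A"
  using u v by simp

lemma v_upow: "v \<otimes> u [^] (i::nat) = z [^]\<^bsub>F\<^esub> i \<odot> (u [^] i \<otimes> v)"
proof (induction i)
  case (Suc i)
  have "v \<otimes> u [^] Suc i = (v \<otimes> u [^] i) \<otimes> u" using u v by (simp add: m_assoc)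
  also have "\<dots> = z [^]\<^bsub>F\<^esub> i \<odot> (u [^] i \<otimes> (v \<otimes> u))" using Suc u v zD(1) by (simp add: m_assoc)
  also have "\<dots> = z [^]\<^bsub>F\<^esub> Suc i \<odot> (u [^] Suc i \<otimes> v)"
    using u v zD(1) by (simp add: vu m_assoc)
  finally show ?case .
qed (use u v in simp)

lemma vpow_upow: "v [^] (j::nat) \<otimes> u [^] (i::nat) = z [^]\<^bsub>F\<^esub> (i * j) \<odot> mon i j"
proof (induction j)
  case (Suc j)
  have "v [^] Suc j \<otimes> u [^] i = v [^] j \<otimes> (v \<otimes> u [^] i)" using u v by (simp add: m_assoc)
  also have "\<dots> = z [^]\<^bsub>F\<^esub> i \<odot> ((v [^] j \<otimes> u [^] i) \<otimes> v)"
    using u v zD(1) by (simp add: v_upow m_assoc)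
  also have "\<dots> = z [^]\<^bsub>F\<^esub> (i * Suc j) \<odot> mon i (Suc j)"
    using Suc u v zD(1) by (simp add: m_assoc R.nat_pow_mult)
  finally show ?case .
qed (use u v in simp)

lemma mon_mult: "mon i j \<otimes> mon k l = z [^]\<^bsub>F\<^esub> (j * k) \<odot> mon (i + k) (j + l)"
proof -
  have "mon i j \<otimes> mon k l = u [^] i \<otimes> (v [^] j \<otimes> u [^] k) \<otimes> v [^] l"
    using u v by (simp add: m_assoc)
  also have "\<dots> = z [^]\<^bsub>F\<^esub> (j * k) \<odot> (u [^] i \<otimes> u [^] k \<otimes> (v [^] j \<otimes> v [^] l))"
    using u v zD(1) by (simp add: vpow_upow m_assoc mult.commute)
  finally show ?thesis using u v by (simp add: nat_pow_mult)
qed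

lemma upow_mod: "u [^] (i::nat) = b [^]\<^bsub>F\<^esub> (i div D) \<odot> u [^] (i mod D)"
proof -
  have "u [^] i = u [^] (D * (i div D) + i mod D)" by simp
  also have "\<dots> = (u [^] D) [^] (i div D) \<otimes> u [^] (i mod D)"
    using u by (metis nat_pow_mult nat_pow_pow)
  also have "\<dots> = b [^]\<^bsub>F\<^esub> (i div D) \<odot> u [^] (i mod D)"
    using u b by (simp add: uD smult_pow)
  finally show ?thesis .
qed

lemma vpow_mod: "v [^] (i::nat) = g [^]\<^bsub>F\<^esub> (i div D) \<odot> v [^] (i mod D)"
proof -
  have "v [^] i = v [^] (D * (i div D) + i mod D)" by simp
  also have "\<dots> = (v [^] D) [^] (i div D) \<otimes> v [^] (i mod D)"
    using v by (metis nat_pow_mult nat_pow_pow)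
  also have "\<dots> = g [^]\<^bsub>F\<^esub> (i div D) \<odot> v [^] (i mod D)"
    using v g by (simp add: vD smult_pow)
  finally show ?thesis .
qed

lemma mon_mod:
  "mon i j = (b [^]\<^bsub>F\<^esub> (i div D) \<otimes>\<^bsub>F\<^esub> g [^]\<^bsub>F\<^esub> (j div D)) \<odot> mon (i mod D) (j mod D)"
  using u v b g by (subst upow_mod, subst vpow_mod) (simp add: R.m_comm)

text \<open>Monomials are units up to scalars. The complementary exponents complete the powers to
  \<open>u [^] D\<close> and \<open>v [^] D\<close>, and moving powers of \<open>v\<close> past
  powers of \<open>u\<close> only costs a power of \<open>z\<close>.\<close>

lemma mon_inverse:
  assumes "i < D" "j < D"
  shows "\<exists>c\<in>carrier F. c \<noteq> \<zero>\<^bsub>F\<^esub> \<and> mon i j \<otimes> mon (D - i) (D - j) = c \<odot> \<one>"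
proof -
  have "mon i j \<otimes> mon (D - i) (D - j) = (z [^]\<^bsub>F\<^esub> (j * (D - i)) \<otimes>\<^bsub>F\<^esub> (b \<otimes>\<^bsub>F\<^esub> g)) \<odot> \<one>"
    using assms u v b g zD(1) by (simp add: mon_mult uD vD R.m_comm)
  moreover have "z [^]\<^bsub>F\<^esub> (j * (D - i)) \<otimes>\<^bsub>F\<^esub> (b \<otimes>\<^bsub>F\<^esub> g) \<noteq> \<zero>\<^bsub>F\<^esub>"
    using b g zD(1,4) K.pow_nonzero K.integral by (metis R.m_closed R.nat_pow_closed)
  ultimately show ?thesis using b g zD(1) by auto
qed

lemma smult_one_nonzero: "c \<in> carrier F \<Longrightarrow> c \<odot> \<one> = \<zero> \<Longrightarrow> c = \<zero>\<^bsub>F\<^esub>"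
  using smult_cancel_zero nontriv by blast

lemma mon_nonzero: "mon i j \<noteq> \<zero>"
proof
  assume "mon i j = \<zero>"
  then have "mon (i mod D) (j mod D) = \<zero>"
    using mon_mod[of i j] K.pow_nonzero[OF b] K.pow_nonzero[OF g] b g K.integral
    by (metis R.m_closed R.nat_pow_closed mon_closed smult_cancel_zero)
  moreover obtain c where "c \<in> carrier F" "c \<noteq> \<zero>\<^bsub>F\<^esub>"
    "mon (i mod D) (j mod D) \<otimes> mon (D - i mod D) (D - j mod D) = c \<odot> \<one>"
    using mon_inverse[of "i mod D" "j mod D"] zD(2) by auto
  ultimately show False using smult_one_nonzero by (metis l_null mon_closed)
qed

text \<open>Conjugation by \<open>v\<close> for \<open>True\<close> and by the inverse of
  \<open>u\<close> for \<open>False\<close>. The powers with exponent \<open>D - 1\<close> replace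
  inverses, which multiplies the eigenvalues in \<open>conj_val\<close> by \<open>g\<close> and by
  \<open>b\<close>.\<close>

definition conj_op :: "bool \<Rightarrow> 'a \<Rightarrow> 'a"
  where "conj_op k x = (if k then v \<otimes> x \<otimes> v [^] (D - 1) else u [^] (D - 1) \<otimes> x \<otimes> u)"

definition conj_val :: "bool \<Rightarrow> nat \<times> nat \<Rightarrow> 'f"
  where "conj_val k p = (if k then z [^]\<^bsub>F\<^esub> fst p \<otimes>\<^bsub>F\<^esub> g else z [^]\<^bsub>F\<^esub> snd p \<otimes>\<^bsub>F\<^esub> b)"

lemma conj_op_lin: "conj_op k \<in> lin_map F A A"
  using u v by (intro lin_mapI) (auto simp: conj_op_def l_distr r_distr)

lemma conj_val_closed: "conj_val k p \<in> carrier F"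
  using zD(1) b g by (simp add: conj_val_def)

lemma conj_op_mon: "conj_op k (mon i j) = conj_val k (i, j) \<odot> mon i j"
proof (cases k)
  case True
  have "v \<otimes> mon i j \<otimes> v [^] (D - 1) = (v \<otimes> u [^] i) \<otimes> (v [^] j \<otimes> v [^] (D - 1))"
    using u v by (simp add: m_assoc)
  also have "\<dots> = z [^]\<^bsub>F\<^esub> i \<odot> (u [^] i \<otimes> (v \<otimes> (v [^] j \<otimes> v [^] (D - 1))))"
    using u v zD(1) by (simp add: v_upow m_assoc)
  also have "v \<otimes> (v [^] j \<otimes> v [^] (D - 1)) = v [^] (1 + (j + (D - 1)))"
    using v nat_pow_Suc2[OF v] by (simp add: nat_pow_mult)
  also have "1 + (j + (D - 1)) = D + j" using zD(2) by simp
  also have "v [^] (D + j) = g \<odot> v [^] j" using v g by (simp add: nat_pow_mult[symmetric] vD)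
  finally show ?thesis using True u v g zD(1) by (simp add: conj_op_def conj_val_def)
next
  case False
  have "u [^] (D - 1) \<otimes> mon i j \<otimes> u = u [^] (D - 1) \<otimes> u [^] i \<otimes> (v [^] j \<otimes> u [^] (1::nat))"
    using u v by (simp add: m_assoc)
  also have "\<dots> = z [^]\<^bsub>F\<^esub> j \<odot> (u [^] (D - 1) \<otimes> u [^] i \<otimes> u [^] (1::nat) \<otimes> v [^] j)"
    using u v zD(1) by (simp only: vpow_upow) (simp add: m_assoc)
  also have "u [^] (D - 1) \<otimes> u [^] i \<otimes> u [^] (1::nat) = u [^] (D - 1 + i + 1)"
    using u by (simp only: nat_pow_mult)
  also have "D - 1 + i + 1 = D + i" using zD(2) by simp
  also have "u [^] (D + i) = b \<odot> u [^] i" using u b by (simp add: nat_pow_mult[symmetric] uD)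
  finally show ?thesis using False u v b zD(1) by (simp add: conj_op_def conj_val_def)
qed

lemma conj_val_sep:
  assumes "p \<in> {..<D} \<times> {..<D}" "p' \<in> {..<D} \<times> {..<D}" "p \<noteq> p'"
  shows "\<exists>k. conj_val k p \<noteq> conj_val k p'"
proof (rule ccontr)
  assume "\<nexists>k. conj_val k p \<noteq> conj_val k p'"
  then have "conj_val True p = conj_val True p'" "conj_val False p = conj_val False p'" by auto
  then have "z [^]\<^bsub>F\<^esub> fst p = z [^]\<^bsub>F\<^esub> fst p'" "z [^]\<^bsub>F\<^esub> snd p = z [^]\<^bsub>F\<^esub> snd p'"
    using zD(1) b g K.m_rcancel by (simp_all add: conj_val_def)
  then show False
    using K.primitive_root_inj[OF z] assms by (metis lessThan_iff mem_Times_iff mod_less prod_eqI)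
qed

text \<open>The joint eigenvalues of the two conjugations separate all monomials with exponents
  below \<open>D\<close>, so the eigenvector lemma isolates any single term.\<close>

lemma mon_component:
  assumes J: "submodule J F A" "\<And>k x. x \<in> J \<Longrightarrow> conj_op k x \<in> J"
    and c: "c \<in> {..<D} \<times> {..<D} \<rightarrow> carrier F"
    and sum: "(\<Oplus>p\<in>{..<D} \<times> {..<D}. c p \<odot> mon (fst p) (snd p)) \<in> J"
    and p: "p \<in> {..<D} \<times> {..<D}"
  shows "c p \<odot> mon (fst p) (snd p) \<in> J"
proof -
  let ?I = "{..<D} \<times> {..<D}"
  have ins: "insert p (?I - {p}) = ?I" using p by auto
  show ?thesis
  proof (rule eigenvector_component[OF J(1) _ _ conj_op_lin J(2), of "?I - {p}" p _ conj_val])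
    show "conj_op k (c i \<odot> mon (fst i) (snd i)) = conj_val k i \<odot> (c i \<odot> mon (fst i) (snd i))"
      if "i \<in> insert p (?I - {p})" for k i
    proof -
      have "c i \<in> carrier F" using that c unfolding ins by auto
      then show ?thesis
        using lin_mapD(3)[OF conj_op_lin] conj_op_mon[of k "fst i" "snd i"] conj_val_closed[of k i]
        by (simp add: R.m_comm)
    qed
    show "\<exists>k. conj_val k i \<noteq> conj_val k p" if "i \<in> ?I - {p}" for i
      using conj_val_sep[of i p] p that by blast
    show "(\<Oplus>i\<in>insert p (?I - {p}). c i \<odot> mon (fst i) (snd i)) \<in> J" using sum ins by simp
  qed (use c p conj_val_closed in auto)
qed

lemma conj_op_zero: "conj_op k \<zero> = \<zero>"
  using u v by (simp add: conj_op_def)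

text \<open>The zero subspace is stable under both conjugations, hence every term of a vanishing
  combination vanishes, and a monomial itself is never zero.\<close>

lemma mon_independent:
  assumes c: "c \<in> {..<D} \<times> {..<D} \<rightarrow> carrier F"
    and sum: "(\<Oplus>p\<in>{..<D} \<times> {..<D}. c p \<odot> mon (fst p) (snd p)) = \<zero>"
    and p: "p \<in> {..<D} \<times> {..<D}"
  shows "c p = \<zero>\<^bsub>F\<^esub>"
proof -
  have "c p \<odot> mon (fst p) (snd p) \<in> {\<zero>}"
    by (rule mon_component[OF zero_subspace _ c _ p]) (use sum conj_op_zero in auto)
  then show ?thesis using smult_cancel_zero mon_nonzero c p by blast
qed

end

text \<open>Spanning is demanded for monomials with arbitrary exponents, the form that is easiest to
  verify and to use; the reduction modulo \<open>D\<close> happens once, in the basis lemma.\<close>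

locale symbol_algebra = symbol_pair F A D z b g u v
  for F :: "('f, 'r) ring_scheme" and A :: "('f, 'a, 'x) module_scheme" (structure)
    and D :: nat and z b g :: 'f and u v :: 'a +
  assumes span: "spanned F A {u [^] i \<otimes> v [^] j | (i::nat) (j::nat). True}"
begin

lemma mon_basis: "is_basis F A ({..<D} \<times> {..<D}) (\<lambda>p. mon (fst p) (snd p))"
  unfolding is_basis_def
proof (intro conjI ballI impI)
  show "spanned F A ((\<lambda>p. mon (fst p) (snd p)) ` ({..<D} \<times> {..<D}))" (is "spanned F A ?S")
    unfolding spanned_def
  proof (intro conjI allI impI)
    fix V assume V: "submodule V F A" "?S \<subseteq> V"
    have "mon i j \<in> V" for i j
    proof -
      have "mon (i mod D) (j mod D) \<in> V" using V(2) zD(2) by force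
      then show ?thesis
        using subspaceD(4)[OF V(1)] b g by (subst mon_mod) auto
    qed
    then show "carrier A \<subseteq> V" by (intro spannedD(2)[OF span V(1)]) auto
  qed auto
qed (use mon_independent in auto)

text \<open>An ideal is stable under \<open>conj_op\<close>, so a nonzero ideal contains a nonzero
  multiple of a monomial, and a monomial generates the whole algebra because it is a unit up to
  scalars.\<close>

lemma simple: "simple_ring A"
  unfolding simple_ring_def
proof (intro conjI allI impI)
  show "carrier A \<noteq> {\<zero>}" using nontriv one_closed by blast
  fix J assume J: "ideal J A"
  interpret J: ideal J A by fact
  show "J = {\<zero>} \<or> J = carrier A"
  proof (rule ccontr)
    assume "\<not> (J = {\<zero>} \<or> J = carrier A)"
    then obtain x where x: "x \<in> J" "x \<noteq> \<zero>" and J1: "J \<noteq> carrier A" using J.zero_closed by blast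
    let ?I = "{..<D} \<times> {..<D}"
    obtain c where c: "c \<in> ?I \<rightarrow> carrier F" "x = (\<Oplus>p\<in>?I. c p \<odot> mon (fst p) (snd p))"
      using spanned_lincomb[OF basisD(1,2)[OF mon_basis] J.Icarr[OF x(1)]] .
    have "\<exists>p\<in>?I. c p \<noteq> \<zero>\<^bsub>F\<^esub>"
    proof (rule ccontr)
      assume "\<not> ?thesis"
      then have "x = \<zero>" unfolding c(2) by (intro add.finprod_one_eqI) auto
      then show False using x by simp
    qed
    then obtain i j where p: "(i, j) \<in> ?I" "c (i, j) \<noteq> \<zero>\<^bsub>F\<^esub>" by auto
    have "c (i, j) \<odot> mon (fst (i, j)) (snd (i, j)) \<in> J"
    proof (rule mon_component[OF ideal_subspace[OF J] _ c(1) _ p(1)])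
      show "conj_op k y \<in> J" if "y \<in> J" for k y
        using that u v by (auto simp: conj_op_def J.I_l_closed J.I_r_closed)
    qed (use c x in simp)
    then have "c (i, j) \<odot> mon i j \<otimes> mon (D - i) (D - j) \<in> J" by (intro J.I_r_closed) auto
    moreover obtain d where d: "d \<in> carrier F" "d \<noteq> \<zero>\<^bsub>F\<^esub>" "mon i j \<otimes> mon (D - i) (D - j) = d \<odot> \<one>"
      using mon_inverse[of i j] p by auto
    ultimately have cd: "(c (i, j) \<otimes>\<^bsub>F\<^esub> d) \<odot> \<one> \<in> J" using c(1) p(1) by (auto simp: Pi_def)
    have "\<one> \<in> J"
      by (rule subspace_cancel[OF ideal_subspace[OF J] _ _ _ cd])
        (use c(1) p d K.integral[of "c (i, j)" d] in \<open>auto simp: Pi_def\<close>)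
    then show False using J.one_imp_carrier J1 by simp
  qed
qed

text \<open>The centre is stable under both operators, which act on it as the scalars
  \<open>g\<close> and \<open>b\<close>. Hence every monomial that occurs in a central element is
  itself central, and commuting with \<open>v\<close> and \<open>u\<close> forces both exponents to
  be zero.\<close>

lemma center: "centralizer A (carrier A) = scalars F A"
proof (intro equalityI subsetI)
  fix x assume "x \<in> scalars F A"
  then show "x \<in> centralizer A (carrier A)" by (auto simp: scalars_def centralizer_def)
next
  let ?J = "centralizer A (carrier A)" and ?I = "{..<D} \<times> {..<D}"
  fix x assume x: "x \<in> ?J"
  have J: "submodule ?J F A"
    by (rule subspaceI) (auto simp: centralizer_def l_distr r_distr)
  have J': "conj_op k y \<in> ?J" if y: "y \<in> ?J" for k y
  proof -
    have yc: "y \<in> carrier A" "v \<otimes> y = y \<otimes> v" "u [^] (D - 1) \<otimes> y = y \<otimes> u [^] (D - 1)"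
      using y u v by (auto simp: centralizer_def)
    obtain D' where D: "D = Suc D'" using zD(2) by (cases D) auto
    have "v \<otimes> v [^] (D - 1) = g \<odot> \<one>" "u [^] (D - 1) \<otimes> u = b \<odot> \<one>"
      using vD uD v nat_pow_Suc2[OF v] by (simp_all add: D)
    then have "conj_op k y = (if k then g else b) \<odot> y"
      using yc u v b g by (auto simp: conj_op_def m_assoc)
    then show ?thesis using subspaceD(4)[OF J _ y] b g by simp
  qed
  have xc: "x \<in> carrier A" using x by (simp add: centralizer_def)
  obtain c where c: "c \<in> ?I \<rightarrow> carrier F" "x = (\<Oplus>p\<in>?I. c p \<odot> mon (fst p) (snd p))"
    using spanned_lincomb[OF basisD(1,2)[OF mon_basis] xc] .
  have zero: "c p = \<zero>\<^bsub>F\<^esub>" if p: "p \<in> ?I" "p \<noteq> (0, 0)" for p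
  proof (rule ccontr)
    assume nz: "c p \<noteq> \<zero>\<^bsub>F\<^esub>"
    obtain i j where ij: "p = (i, j)" by force
    have "c p \<odot> mon (fst p) (snd p) \<in> ?J"
      by (rule mon_component[OF J J' c(1) _ p(1)]) (use c x in auto)
    from subspace_cancel[OF J _ nz _ this] have m: "mon i j \<in> ?J"
      using c(1) p(1) ij by auto
    have "v \<otimes> mon i j = (v \<otimes> u [^] i) \<otimes> v [^] j" using u v by (simp add: m_assoc)
    also have "\<dots> = z [^]\<^bsub>F\<^esub> i \<odot> mon i (Suc j)"
      using u v zD(1) nat_pow_Suc2[OF v] by (simp add: v_upow m_assoc)
    also have "v \<otimes> mon i j = mon i (Suc j)" using m u v by (simp add: centralizer_def m_assoc)
    finally have "z [^]\<^bsub>F\<^esub> i = \<one>\<^bsub>F\<^esub>"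
      using smult_eq_self[OF _ _ mon_nonzero[of i "Suc j"]] zD(1) u v by simp
    then have i: "i = 0" using p(1) zD(6)[of i] ij by auto
    have "mon (Suc i) j = u \<otimes> mon i j" using u v nat_pow_Suc2[OF u] by (simp add: m_assoc)
    also have "\<dots> = mon i j \<otimes> u" using m u by (simp add: centralizer_def)
    also have "\<dots> = u [^] i \<otimes> (v [^] j \<otimes> u [^] (1::nat))" using u v by (simp add: m_assoc)
    also have "\<dots> = z [^]\<^bsub>F\<^esub> j \<odot> mon (Suc i) j"
      using u v zD(1) by (simp only: vpow_upow) (simp add: m_assoc)
    finally have "z [^]\<^bsub>F\<^esub> j = \<one>\<^bsub>F\<^esub>"
      using smult_eq_self[OF _ _ mon_nonzero[of "Suc i" j]] zD(1) u v by simp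
    then have "j = 0" using p(1) zD(6)[of j] ij by auto
    then show False using i p(2) ij by simp
  qed
  have "x = (\<Oplus>p\<in>?I. if p = (0, 0) then c (0, 0) \<odot> \<one> else \<zero>)"
    unfolding c(2) using zero c(1) zD(2) by (intro finsum_cong') (auto simp: Pi_def)
  also have "\<dots> = c (0, 0) \<odot> \<one>"
    using c(1) zD(2) by (intro finsum_delta) auto
  finally show "x \<in> scalars F A" using c(1) zD(2) by (auto simp: scalars_def)
qed

lemma generated: "subalg_gen F A {u, v} = carrier A"
proof
  have sub: "scalars F A \<union> {u, v} \<subseteq> carrier A" using u v by (auto simp: scalars_def)
  have R: "subring (subalg_gen F A {u, v}) A"
    unfolding subalg_gen_def by (rule generate_ring_is_subring[OF sub])
  have incl: "scalars F A \<union> {u, v} \<subseteq> subalg_gen F A {u, v}"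
    unfolding subalg_gen_def by (auto intro: generate_ring.incl)
  note R' = subringE[OF R]
  show "subalg_gen F A {u, v} \<subseteq> carrier A" by (rule R'(1))
  have V: "submodule (subalg_gen F A {u, v}) F A"
  proof (rule subspaceI)
    fix c x assume c: "c \<in> carrier F" and x: "x \<in> subalg_gen F A {u, v}"
    have "(c \<odot> \<one>) \<otimes> x \<in> subalg_gen F A {u, v}"
      using incl c by (intro R'(6) x) (auto simp: scalars_def)
    then show "c \<odot> x \<in> subalg_gen F A {u, v}" using c x R'(1) by (auto simp: subset_eq)
  qed (use R' in auto)
  have pow: "y [^] (i::nat) \<in> subalg_gen F A {u, v}" if "y \<in> {u, v}" for y i
    using R' incl that by (induction i) auto
  show "carrier A \<subseteq> subalg_gen F A {u, v}"
    by (rule spannedD(2)[OF span V]) (use pow R'(6) in auto)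
qed

lemma degree: "has_degree F A D"
  using dimension_basis[OF mon_basis]
  by (simp add: has_degree_def card_cartesian_product power2_eq_square)

lemma central_simple: "central_simple F A"
proof -
  have "assoc_algebra F A" ..
  then show ?thesis
    using simple center finite_dimensionI[OF dimension_basis[OF mon_basis]] by (simp add: central_simple_def)
qed

end

text \<open>Both algebras multiply monomials with the same structure constants, so matching
  monomials is multiplicative. It is injective because the monomials in \<open>B\<close> are
  independent even if they do not span \<open>B\<close>.\<close>

lemma symbol_mono:
  assumes "symbol_algebra F A D z b g u v" "symbol_pair F B D z b g u' v'"
  obtains f where "f \<in> alg_mono F A B" "f u = u'" "f v = v'"
proof -
  interpret A: symbol_algebra F A D z b g u v by fact
  interpret B: symbol_pair F B D z b g u' v' by fact
  let ?I = "{..<D} \<times> {..<D}"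
  have fa: "field_algebra F A" "field_algebra F B" by unfold_locales
  have t: "(\<lambda>p. B.mon (fst p) (snd p)) \<in> ?I \<rightarrow> carrier B" by auto
  obtain f where f: "f \<in> lin_map F A B" "\<And>p. p \<in> ?I \<Longrightarrow> f (A.mon (fst p) (snd p)) = B.mon (fst p) (snd p)"
    "\<And>c. c \<in> ?I \<rightarrow> carrier F \<Longrightarrow> f (\<Oplus>\<^bsub>A\<^esub>p\<in>?I. c p \<odot>\<^bsub>A\<^esub> A.mon (fst p) (snd p)) =
      (\<Oplus>\<^bsub>B\<^esub>p\<in>?I. c p \<odot>\<^bsub>B\<^esub> B.mon (fst p) (snd p))"
    using basis_extend[OF fa A.mon_basis t] by blast
  have mon: "f (A.mon i j) = B.mon i j" for i j
  proof -
    have "(i mod D, j mod D) \<in> ?I" using A.zD(2) by auto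
    from f(2)[OF this] show ?thesis
      using A.b A.g lin_mapD(3)[OF f(1)] by (subst A.mon_mod, subst B.mon_mod) simp
  qed
  have "f (A.mon 0 0) = B.mon 0 0" "f (A.mon 1 0) = B.mon 1 0" "f (A.mon 0 1) = B.mon 0 1"
    by (rule mon)+
  then have one: "f \<one>\<^bsub>A\<^esub> = \<one>\<^bsub>B\<^esub>" and gens: "f u = u'" "f v = v'"
    using A.u A.v B.u B.v by simp_all
  have "f \<in> alg_hom F A B"
  proof (rule spanned_lin_map_mult[OF fa f(1) A.span _ one])
    fix s t assume "s \<in> {A.mon i j | i j. True}" "t \<in> {A.mon i j | i j. True}"
    then obtain i j k l where "s = A.mon i j" "t = A.mon k l" by blast
    then show "f (s \<otimes>\<^bsub>A\<^esub> t) = f s \<otimes>\<^bsub>B\<^esub> f t"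
      using lin_mapD(3)[OF f(1)] A.zD(1)
      by (simp only: A.mon_mult mon B.mon_mult A.R.nat_pow_closed A.mon_closed)
  qed
  moreover have "inj_on f (carrier A)"
  proof (rule lin_map_inj[OF fa f(1)])
    fix x assume x: "x \<in> carrier A" "f x = \<zero>\<^bsub>B\<^esub>"
    obtain c where c: "c \<in> ?I \<rightarrow> carrier F" "x = (\<Oplus>\<^bsub>A\<^esub>p\<in>?I. c p \<odot>\<^bsub>A\<^esub> A.mon (fst p) (snd p))"
      using A.spanned_lincomb[OF A.basisD(1,2)[OF A.mon_basis] x(1)] .
    have "c p = \<zero>\<^bsub>F\<^esub>" if "p \<in> ?I" for p
      using B.mon_independent[OF c(1) _ that] f(3)[OF c(1)] c(2) x(2) by simp
    then show "x = \<zero>\<^bsub>A\<^esub>" unfolding c(2) by (intro A.add.finprod_one_eqI) auto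
  qed
  ultimately show ?thesis using that gens by (auto simp: alg_mono_def)
qed

section \<open>Matrix units\<close>

lemma (in abelian_monoid) finsum_swap:
  assumes "finite I" "finite J" "\<And>i j. i \<in> I \<Longrightarrow> j \<in> J \<Longrightarrow> t i j \<in> carrier G"
  shows "(\<Oplus>i\<in>I. \<Oplus>j\<in>J. t i j) = (\<Oplus>j\<in>J. \<Oplus>i\<in>I. t i j)"
  using assms(1,3)
proof (induction I)
  case (insert i I)
  have c: "(\<lambda>j. \<Oplus>i\<in>I. t i j) \<in> J \<rightarrow> carrier G" "(\<lambda>j. t i j) \<in> J \<rightarrow> carrier G"
    "(\<lambda>i. \<Oplus>j\<in>J. t i j) \<in> I \<rightarrow> carrier G" "(\<Oplus>j\<in>J. t i j) \<in> carrier G"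
    using insert.prems by (auto intro!: finsum_closed)
  have "(\<Oplus>j\<in>J. \<Oplus>i\<in>insert i I. t i j) = (\<Oplus>j\<in>J. t i j \<oplus> (\<Oplus>i\<in>I. t i j))"
    using insert.hyps insert.prems c by (intro finsum_cong') (auto simp: Pi_def)
  also have "\<dots> = (\<Oplus>j\<in>J. t i j) \<oplus> (\<Oplus>j\<in>J. \<Oplus>i\<in>I. t i j)"
    by (rule finsum_addf[OF c(2,1)])
  finally show ?case using insert c by simp
qed simp

text \<open>Only \<open>A\<close> has to be a ring and a module: operations in \<open>B\<close> are
  pulled back along the bijection. So \<open>B\<close> may be a matrix algebra whose ring laws have
  not been established.\<close>

lemma alg_isomorphic_sym:
  assumes "ring A" "module F A" "alg_isomorphic F A B"
  shows "alg_isomorphic F B A"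
proof -
  interpret ring A by fact
  interpret M: module F A by fact
  obtain f where f: "f \<in> alg_hom F A B" "bij_betw f (carrier A) (carrier B)"
    using assms(3) by (auto simp: alg_isomorphic_def)
  note f' = alg_homD[OF f(1)]
  define h where "h = inv_into (carrier A) f"
  have h: "h (f x) = x" if "x \<in> carrier A" for x
    using f(2) that by (simp add: h_def bij_betw_def)
  have onto: "\<exists>x\<in>carrier A. y = f x" if "y \<in> carrier B" for y
    using f(2) that by (auto simp: bij_betw_def)
  have "h \<in> alg_hom F B A"
  proof (rule alg_homI[OF lin_mapI])
    fix x y assume "x \<in> carrier B" "y \<in> carrier B"
    then obtain x' y' where xy: "x' \<in> carrier A" "y' \<in> carrier A" "x = f x'" "y = f y'"
      using onto by metis
    then show "h x \<in> carrier A" "h (x \<oplus>\<^bsub>B\<^esub> y) = h x \<oplus>\<^bsub>A\<^esub> h y" "h (x \<otimes>\<^bsub>B\<^esub> y) = h x \<otimes>\<^bsub>A\<^esub> h y"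
      using f' h by (simp_all flip: f'(2,4))
    fix c assume "c \<in> carrier F"
    then show "h (c \<odot>\<^bsub>B\<^esub> x) = c \<odot>\<^bsub>A\<^esub> h x" using xy h by (simp flip: f'(3))
  next
    show "h \<one>\<^bsub>B\<^esub> = \<one>\<^bsub>A\<^esub>" using h[OF one_closed] f'(5) by simp
  qed
  moreover have "bij_betw h (carrier B) (carrier A)"
    unfolding h_def by (rule bij_betw_inv_into[OF f(2)])
  ultimately show ?thesis by (auto simp: alg_isomorphic_def)
qed

lemma alg_isomorphic_trans:
  assumes "alg_isomorphic F A B" "alg_isomorphic F B C"
  shows "alg_isomorphic F A C"
  using assms alg_hom_comp bij_betw_trans unfolding alg_isomorphic_def by metis

text \<open>An internal description of \<open>A\<close> as a matrix algebra over the image of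
  \<open>\<Phi>\<close>: matrix units that commute with this image and span \<open>A\<close>
  together with it. Uniqueness of the coefficients is a consequence, since the units recover
  them.\<close>

definition matrix_over ::
  "('f, 'r) ring_scheme \<Rightarrow> ('f, 'c, 'y) module_scheme \<Rightarrow> ('f, 'a, 'x) module_scheme \<Rightarrow> nat \<Rightarrow>
    ('c \<Rightarrow> 'a) \<Rightarrow> (nat \<Rightarrow> nat \<Rightarrow> 'a) \<Rightarrow> bool"
  where "matrix_over F C A k \<Phi> E \<longleftrightarrow> \<Phi> \<in> alg_mono F C A \<and>
    (\<forall>i<k. \<forall>j<k. E i j \<in> carrier A) \<and>
    (\<forall>i<k. \<forall>j<k. \<forall>l<k. \<forall>r<k. E i j \<otimes>\<^bsub>A\<^esub> E l r = (if j = l then E i r else \<zero>\<^bsub>A\<^esub>)) \<and>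
    (\<Oplus>\<^bsub>A\<^esub>i\<in>{..<k}. E i i) = \<one>\<^bsub>A\<^esub> \<and>
    (\<forall>c\<in>carrier C. \<forall>i<k. \<forall>j<k. \<Phi> c \<otimes>\<^bsub>A\<^esub> E i j = E i j \<otimes>\<^bsub>A\<^esub> \<Phi> c) \<and>
    spanned F A {\<Phi> c \<otimes>\<^bsub>A\<^esub> E i j | c i j. c \<in> carrier C \<and> i < k \<and> j < k}"

lemma matrix_overD:
  assumes "matrix_over F C A k \<Phi> E"
  shows "\<Phi> \<in> alg_mono F C A" "\<And>i j. i < k \<Longrightarrow> j < k \<Longrightarrow> E i j \<in> carrier A"
    "\<And>i j l r. i < k \<Longrightarrow> j < k \<Longrightarrow> l < k \<Longrightarrow> r < k \<Longrightarrow>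
      E i j \<otimes>\<^bsub>A\<^esub> E l r = (if j = l then E i r else \<zero>\<^bsub>A\<^esub>)"
    "(\<Oplus>\<^bsub>A\<^esub>i\<in>{..<k}. E i i) = \<one>\<^bsub>A\<^esub>"
    "\<And>c i j. c \<in> carrier C \<Longrightarrow> i < k \<Longrightarrow> j < k \<Longrightarrow> \<Phi> c \<otimes>\<^bsub>A\<^esub> E i j = E i j \<otimes>\<^bsub>A\<^esub> \<Phi> c"
    "spanned F A {\<Phi> c \<otimes>\<^bsub>A\<^esub> E i j | c i j. c \<in> carrier C \<and> i < k \<and> j < k}"
  using assms by (simp_all add: matrix_over_def)

locale matrix_over_algebra = field_algebra F A + C: field_algebra F C
  for F :: "('f, 'r) ring_scheme" and C :: "('f, 'c, 'y) module_scheme"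
    and A :: "('f, 'a, 'x) module_scheme" (structure) +
  fixes k :: nat and \<Phi> :: "'c \<Rightarrow> 'a" and E :: "nat \<Rightarrow> nat \<Rightarrow> 'a"
  assumes matrix_over: "matrix_over F C A k \<Phi> E"
begin

lemmas mo = matrix_overD[OF matrix_over]

lemma E_closed [simp]: "i < k \<Longrightarrow> j < k \<Longrightarrow> E i j \<in> carrier A"
  by (rule mo(2))

lemma E_mult: "\<lbrakk>i < k; j < k; l < k; r < k\<rbrakk> \<Longrightarrow> E i j \<otimes> E l r = (if j = l then E i r else \<zero>)"
  by (rule mo(3))

lemma \<Phi>_hom: "\<Phi> \<in> alg_hom F C A" and \<Phi>_inj: "inj_on \<Phi> (carrier C)"
  using mo(1) by (auto simp: alg_mono_def)

lemmas \<Phi> = alg_homD[OF \<Phi>_hom]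

text \<open>The coefficient of \<open>E i j\<close>. If \<open>x\<close> is the sum of the
  \<open>\<Phi> (c i j) \<otimes> E i j\<close>, then
  \<open>E l i \<otimes> x \<otimes> E j l\<close> is \<open>\<Phi> (c i j) \<otimes> E l l\<close>,
  and summing over \<open>l\<close> leaves \<open>\<Phi> (c i j)\<close>.\<close>

definition co :: "nat \<Rightarrow> nat \<Rightarrow> 'a \<Rightarrow> 'a"
  where "co i j x = (\<Oplus>l\<in>{..<k}. E l i \<otimes> x \<otimes> E j l)"

lemma co_closed [simp]: "i < k \<Longrightarrow> j < k \<Longrightarrow> x \<in> carrier A \<Longrightarrow> co i j x \<in> carrier A"
  unfolding co_def by (intro finsum_closed) auto

lemma co_lin:
  assumes ij: "i < k" "j < k"
  shows "co i j \<in> lin_map F A A"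
proof (rule lin_mapI)
  fix x y assume x: "x \<in> carrier A" and y: "y \<in> carrier A"
  have "(\<Oplus>l\<in>{..<k}. E l i \<otimes> (x \<oplus> y) \<otimes> E j l) =
      (\<Oplus>l\<in>{..<k}. E l i \<otimes> x \<otimes> E j l \<oplus> E l i \<otimes> y \<otimes> E j l)"
    using x y ij by (intro finsum_cong') (auto simp: l_distr r_distr)
  also have "\<dots> = co i j x \<oplus> co i j y"
    unfolding co_def using x y ij by (intro finsum_addf) auto
  finally show "co i j (x \<oplus> y) = co i j x \<oplus> co i j y" unfolding co_def .
  fix c assume c: "c \<in> carrier F"
  have "(\<Oplus>l\<in>{..<k}. E l i \<otimes> (c \<odot> x) \<otimes> E j l) = (\<Oplus>l\<in>{..<k}. c \<odot> (E l i \<otimes> x \<otimes> E j l))"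
    using x c ij by (intro finsum_cong') auto
  also have "\<dots> = c \<odot> co i j x"
    unfolding co_def using x c ij by (intro finsum_smult_ldistr[symmetric]) auto
  finally show "co i j (c \<odot> x) = c \<odot> co i j x" unfolding co_def .
qed (use ij in auto)

text \<open>This is the rule for matrix products. The inner units meet as \<open>E r l\<close> and
  \<open>E l' r\<close>, leaving \<open>E r r\<close> between \<open>x\<close> and \<open>y\<close>,
  and these add up to \<open>\<one>\<close> over \<open>r\<close>.\<close>

lemma co_mult:
  assumes ij: "i < k" "j < k" and x: "x \<in> carrier A" and y: "y \<in> carrier A"
  shows "(\<Oplus>r\<in>{..<k}. co i r x \<otimes> co r j y) = co i j (x \<otimes> y)"
proof -
  have E_co: "E r l \<otimes> co r j y = E r r \<otimes> y \<otimes> E j l" if r: "r < k" and l: "l < k" for r l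
  proof -
    have "E r l \<otimes> co r j y = (\<Oplus>l'\<in>{..<k}. E r l \<otimes> (E l' r \<otimes> y \<otimes> E j l'))"
      unfolding co_def using ij y r l by (intro finsum_rdistr) auto
    also have "\<dots> = (\<Oplus>l'\<in>{..<k}. if l' = l then E r r \<otimes> y \<otimes> E j l else \<zero>)"
    proof (rule finsum_cong', safe)
      fix l' assume l': "l' < k"
      have "E r l \<otimes> (E l' r \<otimes> y \<otimes> E j l') = (E r l \<otimes> E l' r) \<otimes> y \<otimes> E j l'"
        using ij y r l l' by (simp add: m_assoc)
      then show "E r l \<otimes> (E l' r \<otimes> y \<otimes> E j l') = (if l' = l then E r r \<otimes> y \<otimes> E j l else \<zero>)"
        using ij y r l l' by (auto simp: E_mult)
    qed (use ij y r l in auto)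
    also have "\<dots> = E r r \<otimes> y \<otimes> E j l"
      using ij y r l by (intro finsum_delta) auto
    finally show ?thesis .
  qed
  have prod: "co i r x \<otimes> co r j y = (\<Oplus>l\<in>{..<k}. E l i \<otimes> x \<otimes> (E r r \<otimes> y \<otimes> E j l))" if r: "r < k" for r
  proof -
    have "co i r x \<otimes> co r j y = (\<Oplus>l\<in>{..<k}. (E l i \<otimes> x \<otimes> E r l) \<otimes> co r j y)"
      unfolding co_def[of i r] using ij x y r by (intro finsum_ldistr) auto
    also have "\<dots> = (\<Oplus>l\<in>{..<k}. E l i \<otimes> x \<otimes> (E r r \<otimes> y \<otimes> E j l))"
      using ij x y r E_co[OF r] by (intro finsum_cong') (auto simp: m_assoc)
    finally show ?thesis .
  qed
  have "(\<Oplus>r\<in>{..<k}. co i r x \<otimes> co r j y) =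
      (\<Oplus>r\<in>{..<k}. \<Oplus>l\<in>{..<k}. E l i \<otimes> x \<otimes> (E r r \<otimes> y \<otimes> E j l))"
    using prod ij x y by (intro finsum_cong') (auto intro!: finsum_closed)
  also have "\<dots> = (\<Oplus>l\<in>{..<k}. \<Oplus>r\<in>{..<k}. E l i \<otimes> x \<otimes> (E r r \<otimes> y \<otimes> E j l))"
    using ij x y by (intro finsum_swap) auto
  also have "\<dots> = (\<Oplus>l\<in>{..<k}. E l i \<otimes> (x \<otimes> y) \<otimes> E j l)"
  proof (rule finsum_cong', safe)
    fix l assume l: "l < k"
    have "(\<Oplus>r\<in>{..<k}. E l i \<otimes> x \<otimes> (E r r \<otimes> y \<otimes> E j l)) =
        (\<Oplus>r\<in>{..<k}. (E l i \<otimes> x) \<otimes> (E r r \<otimes> (y \<otimes> E j l)))"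
      using ij x y l by (intro finsum_cong') (auto simp: m_assoc)
    also have "\<dots> = (E l i \<otimes> x) \<otimes> ((\<Oplus>r\<in>{..<k}. E r r) \<otimes> (y \<otimes> E j l))"
      using ij x y l by (subst finsum_ldistr) (auto intro!: finsum_rdistr[symmetric])
    finally show "(\<Oplus>r\<in>{..<k}. E l i \<otimes> x \<otimes> (E r r \<otimes> y \<otimes> E j l)) = E l i \<otimes> (x \<otimes> y) \<otimes> E j l"
      using ij x y l mo(4) by (simp add: m_assoc)
  qed (use ij x y in auto)
  finally show ?thesis by (simp add: co_def)
qed

lemma co_unit:
  assumes "i < k" "j < k" "p < k" "r < k" "c \<in> carrier C"
  shows "co i j (\<Phi> c \<otimes> E p r) = (if p = i \<and> r = j then \<Phi> c else \<zero>)"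
proof -
  have "E l i \<otimes> (\<Phi> c \<otimes> E p r) \<otimes> E j l = (if p = i \<and> r = j then \<Phi> c \<otimes> E l l else \<zero>)"
    if l: "l < k" for l
  proof -
    have "E l i \<otimes> (\<Phi> c \<otimes> E p r) \<otimes> E j l = \<Phi> c \<otimes> (E l i \<otimes> E p r \<otimes> E j l)"
      using assms l mo(5)[OF assms(5) l assms(1)] \<Phi>(1)
      by (simp add: m_assoc) (simp add: m_assoc[symmetric])
    then show ?thesis using assms l \<Phi>(1) by (simp add: E_mult)
  qed
  then have "co i j (\<Phi> c \<otimes> E p r) = (\<Oplus>l\<in>{..<k}. if p = i \<and> r = j then \<Phi> c \<otimes> E l l else \<zero>)"
    unfolding co_def using assms \<Phi>(1) by (intro finsum_cong') auto
  also have "\<dots> = (if p = i \<and> r = j then \<Phi> c else \<zero>)"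
    using assms \<Phi>(1) mo(4) by (auto simp: finsum_rdistr[symmetric])
  finally show ?thesis .
qed

lemma \<Phi>_image_subspace: "submodule (\<Phi> ` carrier C) F A"
proof -
  have "field_algebra F C" "field_algebra F A" by unfold_locales
  then show ?thesis
    by (rule lin_map_image_subspace[OF _ _ alg_hom_lin[OF \<Phi>_hom] C.carrier_subspace])
qed

text \<open>The elements whose coefficient lies in the image of \<open>\<Phi>\<close> form a
  subspace, and \<open>co_unit\<close> puts the spanning products into it.\<close>

lemma co_range:
  assumes ij: "i < k" "j < k" and x: "x \<in> carrier A"
  shows "co i j x \<in> \<Phi> ` carrier C"
proof -
  note I = subspaceD[OF \<Phi>_image_subspace] and co = lin_mapD[OF co_lin[OF ij]]
  have "submodule {x \<in> carrier A. co i j x \<in> \<Phi> ` carrier C} F A"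
  proof (rule subspaceI)
    have "co i j (\<zero>\<^bsub>F\<^esub> \<odot> \<zero>) = \<zero>" by (subst co(3)) (use ij in auto)
    then show "\<zero> \<in> {x \<in> carrier A. co i j x \<in> \<Phi> ` carrier C}" using I(2) by simp
  qed (use co I in auto)
  from spannedD(2)[OF mo(6) this] show ?thesis
    using x co_unit[OF ij] I(2) \<Phi>(1) by fastforce
qed

text \<open>Since \<open>co i j x \<otimes> E i j\<close> equals
  \<open>E i i \<otimes> x \<otimes> E j j\<close>, summing over both indices multiplies
  \<open>x\<close> by \<open>\<one>\<close> on either side.\<close>

lemma reconstruct:
  assumes x: "x \<in> carrier A"
  shows "x = (\<Oplus>i\<in>{..<k}. \<Oplus>j\<in>{..<k}. co i j x \<otimes> E i j)"
proof -
  have t: "co i j x \<otimes> E i j = E i i \<otimes> x \<otimes> E j j" if ij: "i < k" "j < k" for i j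
  proof -
    have "co i j x \<otimes> E i j = (\<Oplus>l\<in>{..<k}. (E l i \<otimes> x \<otimes> E j l) \<otimes> E i j)"
      unfolding co_def using x ij by (intro finsum_ldistr) auto
    also have "\<dots> = (\<Oplus>l\<in>{..<k}. if l = i then E i i \<otimes> x \<otimes> E j j else \<zero>)"
      using x ij by (intro finsum_cong') (auto simp: m_assoc E_mult)
    also have "\<dots> = E i i \<otimes> x \<otimes> E j j"
      using x ij by (intro finsum_delta) auto
    finally show ?thesis .
  qed
  have "(\<Oplus>i\<in>{..<k}. \<Oplus>j\<in>{..<k}. co i j x \<otimes> E i j) = (\<Oplus>i\<in>{..<k}. E i i \<otimes> x)"
  proof (rule finsum_cong', safe)
    fix i assume i: "i < k"
    have "(\<Oplus>j\<in>{..<k}. co i j x \<otimes> E i j) = (\<Oplus>j\<in>{..<k}. (E i i \<otimes> x) \<otimes> E j j)"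
      using x i t by (intro finsum_cong') auto
    also have "\<dots> = E i i \<otimes> x"
      using x i mo(4) by (subst finsum_rdistr[symmetric]) auto
    finally show "(\<Oplus>j\<in>{..<k}. co i j x \<otimes> E i j) = E i i \<otimes> x" .
  qed (use x in auto)
  also have "\<dots> = (\<Oplus>i\<in>{..<k}. E i i) \<otimes> x"
    using x by (intro finsum_ldistr[symmetric]) auto
  finally show ?thesis using x mo(4) by simp
qed

theorem isomorphic: "alg_isomorphic F A (mat_alg k C)"
proof -
  let ?I = "{..<k} \<times> {..<k}"
  define f where "f x = (\<lambda>p\<in>?I. inv_into (carrier C) \<Phi> (co (fst p) (snd p) x))" for x
  have fc: "f x (i, j) \<in> carrier C" and \<Phi>f: "\<Phi> (f x (i, j)) = co i j x"
    if "i < k" "j < k" "x \<in> carrier A" for x i j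
    using co_range[OF that] that by (auto simp: f_def intro: inv_into_into f_inv_into_f)
  \<comment> \<open>Matrix entries are compared after applying the injective \<open>\<Phi>\<close>,
    which turns every law for \<open>f\<close> into one for \<open>co\<close>.\<close>
  have f_eq: "f x = P" if "x \<in> carrier A" "P \<in> carrier (mat_alg k C)"
    "\<And>i j. i < k \<Longrightarrow> j < k \<Longrightarrow> \<Phi> (P (i, j)) = co i j x" for x P
  proof (rule extensionalityI[of _ ?I])
    show "f x \<in> extensional ?I" by (simp add: f_def)
    show "P \<in> extensional ?I" using that(2) by (auto simp: mat_alg_def PiE_def)
    fix p assume p: "p \<in> ?I"
    then obtain i j where ij: "p = (i, j)" "i < k" "j < k" by auto
    have "P p \<in> carrier C" using that(2) p by (auto simp: mat_alg_def)
    then show "f x p = P p"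
      using inj_onD[OF \<Phi>_inj, of "f x p" "P p"] fc[OF ij(2,3) that(1)] \<Phi>f[OF ij(2,3) that(1)]
        that(3)[OF ij(2,3)] ij(1) by simp
  qed
  have fM: "f x \<in> carrier (mat_alg k C)" if "x \<in> carrier A" for x
    using fc[OF _ _ that] by (auto simp: mat_alg_def f_def)
  have "f \<in> alg_hom F A (mat_alg k C)"
  proof (rule alg_homI[OF lin_mapI])
    fix x y assume x: "x \<in> carrier A" and y: "y \<in> carrier A"
    note co = lin_mapD[OF co_lin]
    show "f x \<in> carrier (mat_alg k C)" by (rule fM[OF x])
    show "f (x \<oplus> y) = f x \<oplus>\<^bsub>mat_alg k C\<^esub> f y"
    proof (rule f_eq)
      show "f x \<oplus>\<^bsub>mat_alg k C\<^esub> f y \<in> carrier (mat_alg k C)"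
        using fc x y by (auto simp: mat_alg_def)
      show "\<Phi> ((f x \<oplus>\<^bsub>mat_alg k C\<^esub> f y) (i, j)) = co i j (x \<oplus> y)" if "i < k" "j < k" for i j
        using that x y fc \<Phi>f co(2)[OF that x y] \<Phi>(2) by (simp add: mat_alg_def)
    qed (use x y in simp)
    show "f (x \<otimes> y) = f x \<otimes>\<^bsub>mat_alg k C\<^esub> f y"
    proof (rule f_eq)
      show "f x \<otimes>\<^bsub>mat_alg k C\<^esub> f y \<in> carrier (mat_alg k C)"
        using fc x y by (auto simp: mat_alg_def intro!: C.finsum_closed)
      show "\<Phi> ((f x \<otimes>\<^bsub>mat_alg k C\<^esub> f y) (i, j)) = co i j (x \<otimes> y)" if ij: "i < k" "j < k" for i j
      proof -
        have fa: "field_algebra F C" "field_algebra F A" by unfold_locales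
        have "\<Phi> (\<Oplus>\<^bsub>C\<^esub>l\<in>{..<k}. f x (i, l) \<otimes>\<^bsub>C\<^esub> f y (l, j)) =
            (\<Oplus>l\<in>{..<k}. \<Phi> (f x (i, l) \<otimes>\<^bsub>C\<^esub> f y (l, j)))"
          using ij x y fc by (intro lin_map_finsum[OF fa alg_hom_lin[OF \<Phi>_hom]]) auto
        also have "\<dots> = (\<Oplus>l\<in>{..<k}. co i l x \<otimes> co l j y)"
          using ij x y fc \<Phi>f \<Phi>(4) by (intro finsum_cong') auto
        also have "\<dots> = co i j (x \<otimes> y)" by (rule co_mult[OF ij x y])
        finally show ?thesis using ij by (simp add: mat_alg_def)
      qed
    qed (use x y in simp)
    fix c assume c: "c \<in> carrier F"
    show "f (c \<odot> x) = c \<odot>\<^bsub>mat_alg k C\<^esub> f x"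
    proof (rule f_eq)
      show "c \<odot>\<^bsub>mat_alg k C\<^esub> f x \<in> carrier (mat_alg k C)"
        using fc x c by (auto simp: mat_alg_def)
      show "\<Phi> ((c \<odot>\<^bsub>mat_alg k C\<^esub> f x) (i, j)) = co i j (c \<odot> x)" if "i < k" "j < k" for i j
        using that x c fc \<Phi>f co(3)[OF that c x] \<Phi>(3) by (simp add: mat_alg_def)
    qed (use x c in simp)
  next
    show "f \<one> = \<one>\<^bsub>mat_alg k C\<^esub>"
    proof (rule f_eq)
      show "\<one>\<^bsub>mat_alg k C\<^esub> \<in> carrier (mat_alg k C)" by (auto simp: mat_alg_def)
      have fa: "field_algebra F C" "field_algebra F A" by unfold_locales
      have z: "\<Phi> \<zero>\<^bsub>C\<^esub> = \<zero>" by (rule lin_map_zero[OF fa alg_hom_lin[OF \<Phi>_hom]])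
      show "\<Phi> (\<one>\<^bsub>mat_alg k C\<^esub> (i, j)) = co i j \<one>" if ij: "i < k" "j < k" for i j
      proof -
        have "co i j \<one> = (\<Oplus>l\<in>{..<k}. if i = j then E l l else \<zero>)"
          unfolding co_def using ij by (intro finsum_cong') (auto simp: E_mult)
        also have "\<dots> = (if i = j then \<one> else \<zero>)" using mo(4) by auto
        finally show ?thesis using ij z \<Phi>(5) by (simp add: mat_alg_def)
      qed
    qed simp
  qed
  moreover have "bij_betw f (carrier A) (carrier (mat_alg k C))"
  proof (rule bij_betwI')
    fix x y assume x: "x \<in> carrier A" and y: "y \<in> carrier A"
    have "x = y" if "f x = f y"
    proof -
      have "co i j x = co i j y" if "i < k" "j < k" for i j
        using \<Phi>f[OF that x] \<Phi>f[OF that y] \<open>f x = f y\<close> by simp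
      then have "(\<Oplus>i\<in>{..<k}. \<Oplus>j\<in>{..<k}. co i j x \<otimes> E i j) = (\<Oplus>i\<in>{..<k}. \<Oplus>j\<in>{..<k}. co i j y \<otimes> E i j)"
        using y by (intro finsum_cong') (auto intro!: finsum_cong' finsum_closed)
      then show "x = y" using reconstruct[OF x] reconstruct[OF y] by simp
    qed
    then show "f x = f y \<longleftrightarrow> x = y" by blast
  next
    fix P assume P: "P \<in> carrier (mat_alg k C)"
    then have Pc: "P p \<in> carrier C" if "p \<in> ?I" for p using that by (auto simp: mat_alg_def)
    \<comment> \<open>The preimage of a matrix is the sum of its entries times the matrix units;
      \<open>co_unit\<close> reads the entries back.\<close>
    let ?x = "\<Oplus>p\<in>?I. \<Phi> (P p) \<otimes> E (fst p) (snd p)"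
    have Pt: "(\<lambda>p. \<Phi> (P p) \<otimes> E (fst p) (snd p)) \<in> ?I \<rightarrow> carrier A" using Pc \<Phi>(1) by auto
    have fa: "field_algebra F A" ..
    have "f ?x = P"
    proof (rule f_eq[OF finsum_closed[OF Pt] P])
      fix i j assume ij: "i < k" "j < k"
      have "co i j ?x = (\<Oplus>p\<in>?I. co i j (\<Phi> (P p) \<otimes> E (fst p) (snd p)))"
        by (rule lin_map_finsum[OF fa fa co_lin[OF ij] Pt])
      also have "\<dots> = (\<Oplus>p\<in>?I. if p = (i, j) then \<Phi> (P (i, j)) else \<zero>)"
        using ij Pc \<Phi>(1) co_unit[OF ij] by (intro finsum_cong') (auto split: if_splits)
      also have "\<dots> = \<Phi> (P (i, j))"
        using ij Pc \<Phi>(1) by (intro finsum_delta) auto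
      finally show "\<Phi> (P (i, j)) = co i j ?x" by simp
    qed
    then show "\<exists>x\<in>carrier A. P = f x" using finsum_closed[OF Pt] by (intro bexI[of _ ?x]) simp_all
  qed (rule fM)
  ultimately show ?thesis by (auto simp: alg_isomorphic_def)
qed

end

text \<open>Matrices of matrices: an index below \<open>k * l\<close> splits into its block number
  \<open>i div l\<close> and its position \<open>i mod l\<close> in the block. The inner units are
  carried over by \<open>\<Phi>\<close>, whose image commutes with the outer ones.\<close>

lemma matrix_over_trans:
  assumes "matrix_over_algebra F C A k \<Phi> E" "matrix_over_algebra F B C l \<Psi> G"
  shows "matrix_over_algebra F B A (k * l) (\<Phi> \<circ> \<Psi>)
    (\<lambda>i j. E (i div l) (j div l) \<otimes>\<^bsub>A\<^esub> \<Phi> (G (i mod l) (j mod l)))"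
proof -
  interpret X: matrix_over_algebra F C A k \<Phi> E by fact
  interpret Y: matrix_over_algebra F B C l \<Psi> G by fact
  let ?E = "\<lambda>i j. E (i div l) (j div l) \<otimes>\<^bsub>A\<^esub> \<Phi> (G (i mod l) (j mod l))"
  have idx: "i div l < k" "i mod l < l" if "i < k * l" for i
    using that by (auto simp: less_mult_imp_div_less) (metis gr0I less_nat_zero_code mod_less_divisor mult_0_right)
  have idx': "i * l + j < k * l" if "i < k" "j < l" for i j
  proof -
    have "i * l + j < i * l + l" using that by simp
    also have "\<dots> \<le> k * l" using that by (metis Suc_leI add.commute mult_Suc mult_le_mono1)
    finally show ?thesis .
  qed
  have dm: "(i * l + j) div l = i" "(i * l + j) mod l = j" if "j < l" for i j
    using that by auto
  have fa: "field_algebra F B" "field_algebra F C" "field_algebra F A" by unfold_locales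
  have z: "\<Phi> \<zero>\<^bsub>C\<^esub> = \<zero>\<^bsub>A\<^esub>" by (rule lin_map_zero[OF fa(2,3) alg_hom_lin[OF X.\<Phi>_hom]])
  have "matrix_over F B A (k * l) (\<Phi> \<circ> \<Psi>) ?E"
    unfolding matrix_over_def
  proof (intro conjI allI impI ballI)
    show "\<Phi> \<circ> \<Psi> \<in> alg_mono F B A" by (rule alg_mono_comp[OF Y.mo(1) X.mo(1)])
    show cl: "?E i j \<in> carrier A" if "i < k * l" "j < k * l" for i j
      using idx[OF that(1)] idx[OF that(2)] X.\<Phi>(1) by simp
    show "?E i j \<otimes>\<^bsub>A\<^esub> ?E p r = (if j = p then ?E i r else \<zero>\<^bsub>A\<^esub>)"
      if "i < k * l" "j < k * l" "p < k * l" "r < k * l" for i j p r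
    proof -
      note ix = idx[OF that(1)] idx[OF that(2)] idx[OF that(3)] idx[OF that(4)]
      have G: "G (i mod l) (j mod l) \<in> carrier C" "G (p mod l) (r mod l) \<in> carrier C" using ix by auto
      have "?E i j \<otimes>\<^bsub>A\<^esub> ?E p r = E (i div l) (j div l) \<otimes>\<^bsub>A\<^esub>
          (\<Phi> (G (i mod l) (j mod l)) \<otimes>\<^bsub>A\<^esub> E (p div l) (r div l)) \<otimes>\<^bsub>A\<^esub> \<Phi> (G (p mod l) (r mod l))"
        using ix G X.\<Phi>(1) by (simp add: X.m_assoc)
      also have "\<dots> = E (i div l) (j div l) \<otimes>\<^bsub>A\<^esub>
          (E (p div l) (r div l) \<otimes>\<^bsub>A\<^esub> \<Phi> (G (i mod l) (j mod l))) \<otimes>\<^bsub>A\<^esub> \<Phi> (G (p mod l) (r mod l))"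
        using X.mo(5)[OF G(1)] ix by simp
      also have "\<dots> = (E (i div l) (j div l) \<otimes>\<^bsub>A\<^esub> E (p div l) (r div l)) \<otimes>\<^bsub>A\<^esub>
          \<Phi> (G (i mod l) (j mod l) \<otimes>\<^bsub>C\<^esub> G (p mod l) (r mod l))"
        using ix G X.\<Phi>(1,4) by (simp add: X.m_assoc)
      also have "\<dots> = (if j = p then ?E i r else \<zero>\<^bsub>A\<^esub>)"
      proof (cases "j = p")
        case False
        then have "j div l \<noteq> p div l \<or> j mod l \<noteq> p mod l" by (metis div_mult_mod_eq)
        then show ?thesis using False ix G z X.\<Phi>(1) by (auto simp: X.E_mult Y.E_mult)
      qed (use ix in \<open>simp add: X.E_mult Y.E_mult\<close>)
      finally show ?thesis .
    qed
    show "(\<Phi> \<circ> \<Psi>) c \<otimes>\<^bsub>A\<^esub> ?E i j = ?E i j \<otimes>\<^bsub>A\<^esub> (\<Phi> \<circ> \<Psi>) c"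
      if "c \<in> carrier B" "i < k * l" "j < k * l" for c i j
    proof -
      note ix = idx[OF that(2)] idx[OF that(3)]
      have c: "\<Psi> c \<in> carrier C" "\<Phi> (\<Psi> c) \<in> carrier A" using that Y.\<Phi>(1) X.\<Phi>(1) by auto
      have G: "G (i mod l) (j mod l) \<in> carrier C" using ix by auto
      have "\<Phi> (\<Psi> c) \<otimes>\<^bsub>A\<^esub> ?E i j = E (i div l) (j div l) \<otimes>\<^bsub>A\<^esub> (\<Phi> (\<Psi> c) \<otimes>\<^bsub>A\<^esub> \<Phi> (G (i mod l) (j mod l)))"
        using ix c G X.\<Phi>(1) X.mo(5)[OF c(1), of "i div l" "j div l"]
        by (simp add: X.m_assoc[symmetric])
      also have "\<Phi> (\<Psi> c) \<otimes>\<^bsub>A\<^esub> \<Phi> (G (i mod l) (j mod l)) = \<Phi> (G (i mod l) (j mod l)) \<otimes>\<^bsub>A\<^esub> \<Phi> (\<Psi> c)"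
        using Y.mo(5)[OF that(1), of "i mod l" "j mod l"] ix c G by (simp flip: X.\<Phi>(4))
      finally show ?thesis using ix c G X.\<Phi>(1) by (simp add: X.m_assoc)
    qed
    have unit: "E i j \<otimes>\<^bsub>A\<^esub> \<Phi> (G r p) = ?E (i * l + r) (j * l + p)" if "i < k" "j < k" "r < l" "p < l" for i j r p
      using that by (simp add: dm)
    show "(\<Oplus>\<^bsub>A\<^esub>i\<in>{..<k * l}. ?E i i) = \<one>\<^bsub>A\<^esub>"
    proof -
      let ?f = "\<lambda>p. fst p * l + snd p"
      have inj: "inj_on ?f ({..<k} \<times> {..<l})"
      proof (rule inj_onI)
        fix p r assume pr: "p \<in> {..<k} \<times> {..<l}" "r \<in> {..<k} \<times> {..<l}" "?f p = ?f r"
        have "?f p div l = fst p" "?f r div l = fst r" "?f p mod l = snd p" "?f r mod l = snd r"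
          using pr(1,2) by (auto simp: dm)
        then show "p = r" using pr(3) by (simp add: prod_eq_iff)
      qed
      have im: "?f ` ({..<k} \<times> {..<l}) = {..<k * l}"
      proof (intro equalityI subsetI)
        fix i assume "i \<in> {..<k * l}"
        then have "i = ?f (i div l, i mod l)" "(i div l, i mod l) \<in> {..<k} \<times> {..<l}" using idx by auto
        then show "i \<in> ?f ` ({..<k} \<times> {..<l})" by blast
      qed (use idx' in auto)
      have cl': "?E i i \<in> carrier A" if "i < k * l" for i using cl that by blast
      have "(\<Oplus>\<^bsub>A\<^esub>i\<in>{..<k * l}. ?E i i) = (\<Oplus>\<^bsub>A\<^esub>p\<in>{..<k} \<times> {..<l}. ?E (?f p) (?f p))"
        unfolding im[symmetric] using inj cl' im by (intro X.finsum_reindex) auto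
      also have "\<dots> = (\<Oplus>\<^bsub>A\<^esub>p\<in>(\<Union>i\<in>{..<k}. {i} \<times> {..<l}). E (fst p) (fst p) \<otimes>\<^bsub>A\<^esub> \<Phi> (G (snd p) (snd p)))"
      proof (rule X.finsum_cong')
        fix p assume "p \<in> (\<Union>i\<in>{..<k}. {i} \<times> {..<l})"
        then have "fst p < k" "snd p < l" by auto
        from unit[OF this(1,1) this(2,2)]
        show "?E (?f p) (?f p) = E (fst p) (fst p) \<otimes>\<^bsub>A\<^esub> \<Phi> (G (snd p) (snd p))" by simp
      qed (use X.\<Phi>(1) in auto)
      also have "\<dots> = (\<Oplus>\<^bsub>A\<^esub>i\<in>{..<k}. \<Oplus>\<^bsub>A\<^esub>p\<in>{i} \<times> {..<l}. E (fst p) (fst p) \<otimes>\<^bsub>A\<^esub> \<Phi> (G (snd p) (snd p)))"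
        using X.\<Phi>(1) by (intro X.add.finprod_UN_disjoint) (auto simp: pairwise_def disjnt_def)
      also have "\<dots> = (\<Oplus>\<^bsub>A\<^esub>i\<in>{..<k}. E i i)"
      proof (rule X.finsum_cong', safe)
        fix i assume i: "i < k"
        have "(\<Oplus>\<^bsub>A\<^esub>p\<in>{i} \<times> {..<l}. E (fst p) (fst p) \<otimes>\<^bsub>A\<^esub> \<Phi> (G (snd p) (snd p))) =
          (\<Oplus>\<^bsub>A\<^esub>p\<in>Pair i ` {..<l}. E (fst p) (fst p) \<otimes>\<^bsub>A\<^esub> \<Phi> (G (snd p) (snd p)))"
          by (intro arg_cong[where f = "finsum A _"]) auto
        also have "\<dots> = (\<Oplus>\<^bsub>A\<^esub>r\<in>{..<l}. E i i \<otimes>\<^bsub>A\<^esub> \<Phi> (G r r))"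
          using i X.\<Phi>(1) by (subst X.finsum_reindex) (auto simp: inj_on_def)
        also have "\<dots> = E i i \<otimes>\<^bsub>A\<^esub> (\<Oplus>\<^bsub>A\<^esub>r\<in>{..<l}. \<Phi> (G r r))"
          using i X.\<Phi>(1) by (intro X.finsum_rdistr[symmetric]) auto
        also have "(\<Oplus>\<^bsub>A\<^esub>r\<in>{..<l}. \<Phi> (G r r)) = \<Phi> (\<Oplus>\<^bsub>C\<^esub>r\<in>{..<l}. G r r)"
          by (rule lin_map_finsum[OF fa(2,3) alg_hom_lin[OF X.\<Phi>_hom], symmetric]) auto
        finally show "(\<Oplus>\<^bsub>A\<^esub>p\<in>{i} \<times> {..<l}. E (fst p) (fst p) \<otimes>\<^bsub>A\<^esub> \<Phi> (G (snd p) (snd p))) = E i i"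
          using i Y.mo(4) X.\<Phi>(5) by simp
      qed auto
      finally show ?thesis using X.mo(4) by simp
    qed
    show "spanned F A {(\<Phi> \<circ> \<Psi>) c \<otimes>\<^bsub>A\<^esub> ?E i j | c i j. c \<in> carrier B \<and> i < k * l \<and> j < k * l}"
      (is "spanned F A ?S")
      unfolding spanned_def
    proof (intro conjI allI impI)
      show "?S \<subseteq> carrier A"
      proof
        fix x assume "x \<in> ?S"
        then obtain c i j where c: "x = (\<Phi> \<circ> \<Psi>) c \<otimes>\<^bsub>A\<^esub> ?E i j" "c \<in> carrier B" "i < k * l" "j < k * l" by blast
        have "(\<Phi> \<circ> \<Psi>) c \<in> carrier A" using c(2) X.\<Phi>(1) Y.\<Phi>(1) by simp
        then show "x \<in> carrier A" unfolding c(1) using cl[OF c(3,4)] by (rule X.m_closed)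
      qed
      fix V assume V: "submodule V F A" "?S \<subseteq> V"
      show "carrier A \<subseteq> V"
      proof (rule spannedD(2)[OF X.mo(6) V(1)], safe)
        fix c i j assume c: "c \<in> carrier C" and ij: "i < k" "j < k"
        \<comment> \<open>For fixed outer indices the admissible coefficients form a subspace of
          \<open>C\<close>, so it suffices to test the products that span \<open>C\<close> over
          \<open>B\<close>.\<close>
        have lin: "(\<lambda>c. \<Phi> c \<otimes>\<^bsub>A\<^esub> E i j) \<in> lin_map F C A"
          using ij X.\<Phi> by (intro lin_mapI) (auto simp: X.l_distr)
        note lin' = lin_mapD[OF lin]
        have sub: "submodule {c \<in> carrier C. \<Phi> c \<otimes>\<^bsub>A\<^esub> E i j \<in> V} F C"
          using X.subspaceD[OF V(1)] lin' lin_map_zero[OF fa(2,3) lin]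
          by (intro X.C.subspaceI) auto
        have "{\<Psi> c \<otimes>\<^bsub>C\<^esub> G r p | c r p. c \<in> carrier B \<and> r < l \<and> p < l} \<subseteq> {c \<in> carrier C. \<Phi> c \<otimes>\<^bsub>A\<^esub> E i j \<in> V}"
        proof safe
          fix d r p assume d: "d \<in> carrier B" and rp: "r < l" "p < l"
          show "\<Psi> d \<otimes>\<^bsub>C\<^esub> G r p \<in> carrier C" using d rp Y.\<Phi>(1) by simp
          have "\<Phi> (\<Psi> d \<otimes>\<^bsub>C\<^esub> G r p) \<otimes>\<^bsub>A\<^esub> E i j = \<Phi> (\<Psi> d) \<otimes>\<^bsub>A\<^esub> (\<Phi> (G r p) \<otimes>\<^bsub>A\<^esub> E i j)"
            using d rp ij Y.\<Phi>(1) X.\<Phi>(1,4) by (simp add: X.m_assoc)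
          also have "\<Phi> (G r p) \<otimes>\<^bsub>A\<^esub> E i j = E i j \<otimes>\<^bsub>A\<^esub> \<Phi> (G r p)"
            using rp ij by (intro X.mo(5)) auto
          also have "\<dots> = ?E (i * l + r) (j * l + p)" by (rule unit[OF ij rp])
          also have "\<Phi> (\<Psi> d) \<otimes>\<^bsub>A\<^esub> ?E (i * l + r) (j * l + p) \<in> ?S"
          proof (intro CollectI exI conjI)
            show "\<Phi> (\<Psi> d) \<otimes>\<^bsub>A\<^esub> ?E (i * l + r) (j * l + p) = (\<Phi> \<circ> \<Psi>) d \<otimes>\<^bsub>A\<^esub> ?E (i * l + r) (j * l + p)"
              by simp
          qed (use d idx'[OF ij(1) rp(1)] idx'[OF ij(2) rp(2)] in auto)
          finally show "\<Phi> (\<Psi> d \<otimes>\<^bsub>C\<^esub> G r p) \<otimes>\<^bsub>A\<^esub> E i j \<in> V" using V(2) by blast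
        qed
        from spannedD(2)[OF Y.mo(6) sub this] show "\<Phi> c \<otimes>\<^bsub>A\<^esub> E i j \<in> V" using c by blast
      qed
    qed
  qed
  then show ?thesis using fa by (simp add: matrix_over_algebra_def matrix_over_algebra_axioms_def)
qed

lemma matrix_over_self:
  assumes "field_algebra F A"
  shows "matrix_over_algebra F A A 1 id (\<lambda>i j. \<one>\<^bsub>A\<^esub>)"
proof -
  interpret field_algebra F A by fact
  have "matrix_over F A A 1 id (\<lambda>i j. \<one>\<^bsub>A\<^esub>)"
    unfolding matrix_over_def
  proof (intro conjI)
    show "id \<in> alg_mono F A A" unfolding alg_mono_def by (auto intro!: alg_homI lin_mapI)
    show "spanned F A {id c \<otimes>\<^bsub>A\<^esub> \<one>\<^bsub>A\<^esub> | c i j. c \<in> carrier A \<and> i < (1::nat) \<and> j < (1::nat)}"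
      unfolding spanned_def
    proof (intro conjI allI impI subsetI)
      fix V x assume V: "{id c \<otimes>\<^bsub>A\<^esub> \<one>\<^bsub>A\<^esub> | c i j. c \<in> carrier A \<and> i < (1::nat) \<and> j < (1::nat)} \<subseteq> V"
        and x: "x \<in> carrier A"
      then show "x \<in> V" by (intro subsetD[OF V] CollectI exI[of _ x] exI[of _ 0]) simp
    qed auto
  qed (simp_all add: lessThan_Suc)
  then show ?thesis
    using assms by (simp add: matrix_over_algebra_def matrix_over_algebra_axioms_def)
qed

section \<open>Idempotents from roots of unity\<close>

text \<open>Multiplication by \<open>x\<close> shifts the summands by one place; the new last term
  \<open>x [^] n\<close> makes up for the lost first term \<open>\<one>\<close>.\<close>

lemma (in ring) geometric_shift:
  assumes x: "x \<in> carrier R" "x [^] (n::nat) = \<one>"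
  shows "x \<otimes> (\<Oplus>j\<in>{..<n}. x [^] j) = (\<Oplus>j\<in>{..<n}. x [^] j)"
proof -
  have *: "x \<otimes> (\<Oplus>j\<in>{..<n}. x [^] j) \<oplus> \<one> = (\<Oplus>j\<in>{..<n}. x [^] j) \<oplus> x [^] n" for n :: nat
  proof (induction n)
    case (Suc n)
    let ?S = "\<Oplus>j\<in>{..<n}. x [^] j"
    have S: "?S \<in> carrier R" using x(1) by (intro finsum_closed) auto
    have step: "(\<Oplus>j\<in>{..<Suc n}. x [^] j) = x [^] n \<oplus> ?S"
      using x(1) by (simp add: lessThan_Suc)
    have "x \<otimes> (\<Oplus>j\<in>{..<Suc n}. x [^] j) \<oplus> \<one> = x [^] Suc n \<oplus> (x \<otimes> ?S \<oplus> \<one>)"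
      unfolding step using x(1) S nat_pow_Suc2[OF x(1)] by (simp add: r_distr a_assoc)
    also have "\<dots> = x [^] Suc n \<oplus> (?S \<oplus> x [^] n)" by (simp only: Suc)
    finally show ?case unfolding step using x(1) S by (simp add: a_ac)
  qed (use x in simp)
  have S: "(\<Oplus>j\<in>{..<n}. x [^] j) \<in> carrier R" using x(1) by (intro finsum_closed) auto
  show ?thesis using *[of n] x S by simp
qed

context field
begin

lemma geometric_zero:
  assumes "x \<in> carrier R" "x [^] (n::nat) = \<one>" "x \<noteq> \<one>"
  shows "(\<Oplus>j\<in>{..<n}. x [^] j) = \<zero>"
proof (rule ccontr)
  let ?S = "\<Oplus>j\<in>{..<n}. x [^] j"
  assume nz: "?S \<noteq> \<zero>"
  have S: "?S \<in> carrier R" using assms(1) by (intro finsum_closed) auto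
  have "?S \<otimes> x = ?S \<otimes> \<one>" using geometric_shift[OF assms(1,2)] S assms(1) by (simp add: m_comm)
  then show False using mult_cancel_left[OF assms(1) one_closed S nz] assms(3) by simp
qed

text \<open>The independence behind the Vandermonde determinant: if all power sums with weights
  \<open>c\<close> vanish, so do those with weights
  \<open>c j \<otimes> (l j \<ominus> l j1)\<close>, which no longer involve
  \<open>j1\<close>.\<close>

lemma power_sums_zero:
  assumes "finite I" "j0 \<notin> I" "\<And>j. j \<in> insert j0 I \<Longrightarrow> l j \<in> carrier R"
    and "\<And>j. j \<in> insert j0 I \<Longrightarrow> c j \<in> carrier R"
    and "\<And>j. j \<in> I \<Longrightarrow> l j \<noteq> l j0"
    and "\<And>i::nat. (\<Oplus>j\<in>insert j0 I. c j \<otimes> l j [^] i) = \<zero>"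
  shows "c j0 = \<zero>"
  using assms
proof (induction I arbitrary: c)
  case empty
  from empty.prems(5)[of 0] show ?case using empty.prems by simp
next
  case (insert j1 I)
  have lc: "l j \<in> carrier R" "c j \<in> carrier R" if "j = j0 \<or> j = j1 \<or> j \<in> I" for j
    using insert.prems(2,3)[of j] that by auto
  define c' where "c' j = c j \<otimes> (l j \<ominus> l j1)" for j
  have c': "c' j \<in> carrier R" if "j = j0 \<or> j = j1 \<or> j \<in> I" for j
    using lc[OF that] lc[of j1] by (simp add: c'_def)
  have "c' j0 = \<zero>"
  proof (rule insert.IH)
    fix i :: nat
    let ?S = "insert j0 (insert j1 I)"
    have t: "(\<lambda>j. c j \<otimes> l j [^] k) \<in> ?S \<rightarrow> carrier R" for k :: nat using lc by auto
    have "(\<Oplus>j\<in>?S. c j \<otimes> l j [^] Suc i) \<oplus> (\<ominus> l j1) \<otimes> (\<Oplus>j\<in>?S. c j \<otimes> l j [^] i) = \<zero>"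
      unfolding insert.prems(5) using lc by simp
    also have "(\<ominus> l j1) \<otimes> (\<Oplus>j\<in>?S. c j \<otimes> l j [^] i) = (\<Oplus>j\<in>?S. (\<ominus> l j1) \<otimes> (c j \<otimes> l j [^] i))"
      using t insert.hyps lc by (intro finsum_rdistr) auto
    also have "(\<Oplus>j\<in>?S. c j \<otimes> l j [^] Suc i) \<oplus> \<dots> =
        (\<Oplus>j\<in>?S. c j \<otimes> l j [^] Suc i \<oplus> (\<ominus> l j1) \<otimes> (c j \<otimes> l j [^] i))"
      using lc by (intro finsum_addf[symmetric]) auto
    also have "\<dots> = (\<Oplus>j\<in>?S. c' j \<otimes> l j [^] i)"
    proof (rule finsum_cong')
      fix j assume "j \<in> ?S"
      then have j: "j = j0 \<or> j = j1 \<or> j \<in> I" by auto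
      have P: "l j [^] i \<in> carrier R" "l j [^] Suc i = l j [^] i \<otimes> l j" using lc[OF j] by auto
      show "c j \<otimes> l j [^] Suc i \<oplus> (\<ominus> l j1) \<otimes> (c j \<otimes> l j [^] i) = c' j \<otimes> l j [^] i"
        unfolding c'_def P(2) using lc[OF j] lc[of j1] P(1) by algebra
    qed (use c' lc in auto)
    also have "?S = insert j1 (insert j0 I)" by auto
    also have "(\<Oplus>j\<in>insert j1 (insert j0 I). c' j \<otimes> l j [^] i) = (\<Oplus>j\<in>insert j0 I. c' j \<otimes> l j [^] i)"
    proof -
      have "c' j1 = \<zero>" using lc by (simp add: c'_def minus_eq r_neg)
      then show ?thesis
        using insert.hyps insert.prems(1) c' lc by (subst finsum_insert) (auto intro!: finsum_closed)
    qed
    finally show "(\<Oplus>j\<in>insert j0 I. c' j \<otimes> l j [^] i) = \<zero>" .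
  qed (use insert.prems c' in auto)
  moreover have "l j0 \<ominus> l j1 \<noteq> \<zero>" using insert.prems(4)[of j1] lc by auto
  ultimately show ?case using integral[of "c j0" "l j0 \<ominus> l j1"] lc by (simp add: c'_def)
qed

text \<open>A primitive \<open>n\<close>-th root of unity excludes characteristics dividing
  \<open>n\<close>. Otherwise all power sums of the elements \<open>z [^] j\<close> with weights one
  would vanish, as each is a geometric sum in \<open>z [^] i\<close> and hence zero or the element
  \<open>n\<close> itself.\<close>

lemma primitive_root_order_nonzero:
  assumes "primitive_root_of_unity R n z"
  shows "(\<Oplus>j\<in>{..<n}. \<one>) \<noteq> \<zero>"
proof
  note z = primitive_rootD[OF assms]
  assume 0: "(\<Oplus>j\<in>{..<n}. \<one>) = \<zero>"
  have eq: "insert 0 ({..<n} - {0}) = {..<n}" using z(2) by auto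
  have "(\<one>::'a) = \<zero>"
  proof (rule power_sums_zero[of "{..<n} - {0}" 0 "\<lambda>j. z [^] j" "\<lambda>_. \<one>"])
    fix i :: nat
    have "(\<Oplus>j\<in>{..<n}. \<one> \<otimes> (z [^] j) [^] i) = (\<Oplus>j\<in>{..<n}. (z [^] i) [^] j)"
      using z(1) by (intro finsum_cong') (auto simp: nat_pow_pow mult.commute)
    also have "\<dots> = \<zero>"
    proof (cases "z [^] i = \<one>")
      case True
      then show ?thesis using 0 by (simp add: nat_pow_one)
    next
      case False
      then show ?thesis
        using z(1,3) by (intro geometric_zero) (simp_all add: nat_pow_pow mult.commute[of i], simp flip: nat_pow_pow)
    qed
    finally show "(\<Oplus>j\<in>insert 0 ({..<n} - {0}). \<one> \<otimes> (z [^] j) [^] i) = \<zero>" unfolding eq .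
  next
    fix j assume "j \<in> {..<n} - {0}"
    then show "z [^] j \<noteq> z [^] (0::nat)" using z(6)[of j] by auto
  qed (use z(1) in auto)
  then show False by simp
qed

end

section \<open>Projections onto the eigenspaces of a root of a scalar\<close>

context field_algebra
begin

text \<open>The projection onto the eigenspace of \<open>w\<close> for the eigenvalue
  \<open>\<omega>\<close> to the power \<open>i\<close> times \<open>d\<close>. Divided by this
  eigenvalue, \<open>w\<close> has \<open>k\<close>-th power one, and the average of its powers
  projects onto its fixed vectors.\<close>

definition fourier :: "nat \<Rightarrow> 'f \<Rightarrow> 'f \<Rightarrow> 'a \<Rightarrow> nat \<Rightarrow> 'a"
  where "fourier k \<omega> d w i = inv\<^bsub>F\<^esub> (\<Oplus>\<^bsub>F\<^esub>j\<in>{..<k}. \<one>\<^bsub>F\<^esub>) \<odot>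
    (\<Oplus>j\<in>{..<k}. (inv\<^bsub>F\<^esub> (\<omega> [^]\<^bsub>F\<^esub> i \<otimes>\<^bsub>F\<^esub> d) \<odot> w) [^] j)"

text \<open>The eigenvalue equation is the shift of a geometric sum. The projections add up to
  \<open>\<one>\<close> because for \<open>0 < j < k\<close> the coefficient of
  \<open>w [^] j\<close> contains the sum of all powers of a nontrivial root of unity.\<close>

lemma fourier:
  assumes \<omega>: "primitive_root_of_unity F k \<omega>" and d: "d \<in> carrier F" "d \<noteq> \<zero>\<^bsub>F\<^esub>"
    and w: "w \<in> carrier A" "w [^] k = d [^]\<^bsub>F\<^esub> k \<odot> \<one>"
  shows "fourier k \<omega> d w i \<in> carrier A"
    and "w \<otimes> fourier k \<omega> d w i = (\<omega> [^]\<^bsub>F\<^esub> i \<otimes>\<^bsub>F\<^esub> d) \<odot> fourier k \<omega> d w i"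
    and "\<And>x. x \<in> carrier A \<Longrightarrow> x \<otimes> w = w \<otimes> x \<Longrightarrow> x \<otimes> fourier k \<omega> d w i = fourier k \<omega> d w i \<otimes> x"
    and "(\<Oplus>i\<in>{..<k}. fourier k \<omega> d w i) = \<one>"
proof -
  note \<omega>' = K.primitive_rootD[OF \<omega>]
  let ?n = "\<Oplus>\<^bsub>F\<^esub>j\<in>{..<k}. \<one>\<^bsub>F\<^esub>"
  note \<omega>i = K.primitive_rootD[OF K.primitive_root_inverse[OF \<omega>]]
  \<comment> \<open>The inverse of the eigenvalue, written as a product so that its powers split
    into powers of the inverses of \<open>\<omega>\<close> and \<open>d\<close>.\<close>
  define t where "t i = (inv\<^bsub>F\<^esub> \<omega>) [^]\<^bsub>F\<^esub> i \<otimes>\<^bsub>F\<^esub> inv\<^bsub>F\<^esub> d" for i :: nat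
  have n: "?n \<in> carrier F" "inv\<^bsub>F\<^esub> ?n \<in> carrier F" "inv\<^bsub>F\<^esub> ?n \<otimes>\<^bsub>F\<^esub> ?n = \<one>\<^bsub>F\<^esub>"
    using K.primitive_root_order_nonzero[OF \<omega>] by (auto simp: K.field_Units intro!: R.finsum_closed R.Units_inv_closed R.Units_l_inv)
  have du: "d \<in> Units F" "inv\<^bsub>F\<^esub> d \<in> carrier F" "inv\<^bsub>F\<^esub> d \<otimes>\<^bsub>F\<^esub> d = \<one>\<^bsub>F\<^esub>"
    using d by (simp_all add: K.field_Units)
  have \<omega>1: "(inv\<^bsub>F\<^esub> \<omega>) [^]\<^bsub>F\<^esub> i \<otimes>\<^bsub>F\<^esub> \<omega> [^]\<^bsub>F\<^esub> i = \<one>\<^bsub>F\<^esub>" for i :: nat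
    using \<omega>'(1,5) \<omega>i(1) by (simp flip: R.nat_pow_distrib)
  have t: "t i \<in> carrier F" "(\<omega> [^]\<^bsub>F\<^esub> i \<otimes>\<^bsub>F\<^esub> d) \<otimes>\<^bsub>F\<^esub> t i = \<one>\<^bsub>F\<^esub>" "\<omega> [^]\<^bsub>F\<^esub> i \<otimes>\<^bsub>F\<^esub> d \<in> carrier F" for i
  proof -
    show c: "t i \<in> carrier F" "\<omega> [^]\<^bsub>F\<^esub> i \<otimes>\<^bsub>F\<^esub> d \<in> carrier F"
      using \<omega>'(1) \<omega>i(1) du d by (simp_all add: t_def)
    have "(\<omega> [^]\<^bsub>F\<^esub> i \<otimes>\<^bsub>F\<^esub> d) \<otimes>\<^bsub>F\<^esub> t i =
        ((inv\<^bsub>F\<^esub> \<omega>) [^]\<^bsub>F\<^esub> i \<otimes>\<^bsub>F\<^esub> \<omega> [^]\<^bsub>F\<^esub> i) \<otimes>\<^bsub>F\<^esub> (inv\<^bsub>F\<^esub> d \<otimes>\<^bsub>F\<^esub> d)"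
      unfolding t_def using \<omega>'(1) \<omega>i(1) du(2) d(1) by (simp add: R.m_ac)
    then show "(\<omega> [^]\<^bsub>F\<^esub> i \<otimes>\<^bsub>F\<^esub> d) \<otimes>\<^bsub>F\<^esub> t i = \<one>\<^bsub>F\<^esub>" using du by (simp add: \<omega>1)
  qed
  have t_inv: "inv\<^bsub>F\<^esub> (\<omega> [^]\<^bsub>F\<^esub> i \<otimes>\<^bsub>F\<^esub> d) = t i" for i
    using t[of i] by (intro R.comm_inv_char)
  define Z where "Z i = t i \<odot> w" for i
  define S where "S i = (\<Oplus>j\<in>{..<k}. Z i [^] j)" for i
  have Z: "Z i \<in> carrier A" for i using t w by (simp add: Z_def)
  have S: "S i \<in> carrier A" for i unfolding S_def using Z by (intro finsum_closed) auto
  have f: "fourier k \<omega> d w i = inv\<^bsub>F\<^esub> ?n \<odot> S i" for i by (simp add: fourier_def S_def Z_def t_inv)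
  show "fourier k \<omega> d w i \<in> carrier A" using f n S by simp
  have "Z i [^] k = ((t i \<otimes>\<^bsub>F\<^esub> d) [^]\<^bsub>F\<^esub> k) \<odot> \<one>"
    using t d w by (simp add: Z_def smult_pow R.nat_pow_distrib)
  also have "t i \<otimes>\<^bsub>F\<^esub> d = (inv\<^bsub>F\<^esub> \<omega>) [^]\<^bsub>F\<^esub> i"
    unfolding t_def using \<omega>i(1) du d by (simp add: R.m_assoc)
  also have "((inv\<^bsub>F\<^esub> \<omega>) [^]\<^bsub>F\<^esub> i) [^]\<^bsub>F\<^esub> k = \<one>\<^bsub>F\<^esub>"
    using \<omega>i(1,3) by (metis R.nat_pow_one R.nat_pow_pow mult.commute)
  finally have Zk: "Z i [^] k = \<one>" by simp
  have ZS: "Z i \<otimes> S i = S i" unfolding S_def by (rule geometric_shift[OF Z Zk])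
  have "w \<otimes> S i = (\<omega> [^]\<^bsub>F\<^esub> i \<otimes>\<^bsub>F\<^esub> d) \<odot> (Z i \<otimes> S i)"
    unfolding Z_def using t w S by simp
  then show "w \<otimes> fourier k \<omega> d w i = (\<omega> [^]\<^bsub>F\<^esub> i \<otimes>\<^bsub>F\<^esub> d) \<odot> fourier k \<omega> d w i"
    unfolding f ZS using w n S t by (simp add: R.m_comm)
  show "x \<otimes> fourier k \<omega> d w i = fourier k \<omega> d w i \<otimes> x" if x: "x \<in> carrier A" "x \<otimes> w = w \<otimes> x" for x
  proof -
    have "x \<otimes> Z i [^] j = Z i [^] j \<otimes> x" for j :: nat
    proof -
      have "x \<otimes> Z i = Z i \<otimes> x" using x w t by (simp add: Z_def)
      then show ?thesis using x Z by (induction j) (simp_all add: m_assoc[symmetric], simp add: m_assoc)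
    qed
    then have "x \<otimes> S i = S i \<otimes> x"
      unfolding S_def using x Z by (subst finsum_rdistr, auto, subst finsum_ldistr, auto)
    then show ?thesis using f n S x by simp
  qed
  have inner: "(\<Oplus>i\<in>{..<k}. Z i [^] j) = (if j = 0 then ?n \<odot> \<one> else \<zero>)" if j: "j < k" for j
  proof -
    have "(\<Oplus>i\<in>{..<k}. Z i [^] j) = (\<Oplus>i\<in>{..<k}. (t i [^]\<^bsub>F\<^esub> j) \<odot> w [^] j)"
      using t w by (intro finsum_cong') (auto simp: Z_def smult_pow)
    also have "\<dots> = (\<Oplus>\<^bsub>F\<^esub>i\<in>{..<k}. t i [^]\<^bsub>F\<^esub> j) \<odot> w [^] j"
      using t w by (intro finsum_smult_left[symmetric]) auto
    also have "(\<Oplus>\<^bsub>F\<^esub>i\<in>{..<k}. t i [^]\<^bsub>F\<^esub> j) = (\<Oplus>\<^bsub>F\<^esub>i\<in>{..<k}. (inv\<^bsub>F\<^esub> d) [^]\<^bsub>F\<^esub> j \<otimes>\<^bsub>F\<^esub> ((inv\<^bsub>F\<^esub> \<omega>) [^]\<^bsub>F\<^esub> j) [^]\<^bsub>F\<^esub> i)"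
    proof (rule R.finsum_cong')
      fix i assume "i \<in> {..<k}"
      show "t i [^]\<^bsub>F\<^esub> j = (inv\<^bsub>F\<^esub> d) [^]\<^bsub>F\<^esub> j \<otimes>\<^bsub>F\<^esub> ((inv\<^bsub>F\<^esub> \<omega>) [^]\<^bsub>F\<^esub> j) [^]\<^bsub>F\<^esub> i"
        unfolding t_def using \<omega>i(1) du by (simp add: R.nat_pow_distrib R.nat_pow_pow R.m_comm mult.commute)
    qed (use \<omega>'(5) du in auto)
    also have "\<dots> = (inv\<^bsub>F\<^esub> d) [^]\<^bsub>F\<^esub> j \<otimes>\<^bsub>F\<^esub> (\<Oplus>\<^bsub>F\<^esub>i\<in>{..<k}. ((inv\<^bsub>F\<^esub> \<omega>) [^]\<^bsub>F\<^esub> j) [^]\<^bsub>F\<^esub> i)"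
      using \<omega>'(5) du by (intro R.finsum_rdistr[symmetric]) auto
    also have "\<dots> = (if j = 0 then ?n else \<zero>\<^bsub>F\<^esub>)"
    proof (cases "j = 0")
      case False
      have "(\<Oplus>\<^bsub>F\<^esub>i\<in>{..<k}. ((inv\<^bsub>F\<^esub> \<omega>) [^]\<^bsub>F\<^esub> j) [^]\<^bsub>F\<^esub> i) = \<zero>\<^bsub>F\<^esub>"
      proof (rule K.geometric_zero)
        show "((inv\<^bsub>F\<^esub> \<omega>) [^]\<^bsub>F\<^esub> j) [^]\<^bsub>F\<^esub> k = \<one>\<^bsub>F\<^esub>"
          using \<omega>i(1,3) by (metis R.nat_pow_one R.nat_pow_pow mult.commute)
        show "(inv\<^bsub>F\<^esub> \<omega>) [^]\<^bsub>F\<^esub> j \<noteq> \<one>\<^bsub>F\<^esub>" using \<omega>i(6)[of j] False j by simp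
      qed (use \<omega>i in simp)
      then show ?thesis using False du by simp
    qed (use n in \<open>simp add: R.nat_pow_one\<close>)
    finally show ?thesis using w n by (cases "j = 0") auto
  qed
  have "(\<Oplus>i\<in>{..<k}. fourier k \<omega> d w i) = inv\<^bsub>F\<^esub> ?n \<odot> (\<Oplus>i\<in>{..<k}. S i)"
    unfolding f using n S by (intro finsum_smult_ldistr[symmetric]) auto
  also have "(\<Oplus>i\<in>{..<k}. S i) = (\<Oplus>j\<in>{..<k}. \<Oplus>i\<in>{..<k}. Z i [^] j)"
    unfolding S_def using Z by (intro finsum_swap) auto
  also have "\<dots> = (\<Oplus>j\<in>{..<k}. if j = 0 then ?n \<odot> \<one> else \<zero>)"
    using inner n by (intro finsum_cong') auto
  also have "\<dots> = ?n \<odot> \<one>" using n \<omega>'(2) by (intro finsum_delta) auto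
  finally show "(\<Oplus>i\<in>{..<k}. fourier k \<omega> d w i) = \<one>" using n by simp
qed

end

section \<open>Splitting off a matrix factor\<close>

text \<open>Exchanging the generators inverts \<open>z\<close>. The matrix step, which acts on the
  second generator, thereby becomes available for the first one.\<close>

lemma symbol_pair_swap:
  assumes "symbol_pair F A D z b g u v"
  shows "symbol_pair F A D (inv\<^bsub>F\<^esub> z) g b v u"
proof -
  interpret symbol_pair F A D z b g u v by fact
  have "u \<otimes>\<^bsub>A\<^esub> v = inv\<^bsub>F\<^esub> z \<odot>\<^bsub>A\<^esub> (v \<otimes>\<^bsub>A\<^esub> u)"
    using zD(1,5) u v by (simp add: vu)
  then show ?thesis
    using K.primitive_root_inverse[OF z] b g u v uD vD nontriv by unfold_locales auto
qed

lemma symbol_algebra_swap: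
  assumes "symbol_algebra F A D z b g u v"
  shows "symbol_algebra F A D (inv\<^bsub>F\<^esub> z) g b v u"
proof -
  interpret symbol_algebra F A D z b g u v by fact
  interpret S: symbol_pair F A D "inv\<^bsub>F\<^esub> z" g b v u by (rule symbol_pair_swap) unfold_locales
  show ?thesis
  proof
    show "spanned F A {S.mon i j | i j. True}"
      unfolding spanned_def
    proof (intro conjI allI impI)
      fix V assume V: "submodule V F A" "{S.mon i j | i j. True} \<subseteq> V"
      show "carrier A \<subseteq> V"
      proof (rule spannedD(2)[OF span V(1)], safe)
        fix i j
        have "mon i j = (inv\<^bsub>F\<^esub> z) [^]\<^bsub>F\<^esub> (i * j) \<odot>\<^bsub>A\<^esub> S.mon j i"
          using S.vpow_upow[of i j] by (simp add: mult.commute)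
        then show "mon i j \<in> V" using V(2) subspaceD(4)[OF V(1), of "(inv\<^bsub>F\<^esub> z) [^]\<^bsub>F\<^esub> (i * j)" "S.mon j i"] S.zD(1) by auto
      qed
    qed auto
  qed
qed

text \<open>The \<open>k\<close>-th power of \<open>v [^] M\<close> is the scalar \<open>g\<close>,
  so with a root \<open>d\<close> of \<open>g\<close> its eigenvalues are \<open>d\<close> times
  powers of \<open>\<omega>\<close>. Orthogonality and idempotence of \<open>e\<close> follow from
  the eigenvalue equations and the sum, hence the locale serves for idempotents given by different
  formulas.\<close>

locale split_symbol = symbol_algebra F A "M * k" z b g u v
  for F :: "('f, 'r) ring_scheme" and A :: "('f, 'a, 'x) module_scheme" (structure)
    and M k :: nat and z b g :: 'f and u v :: 'a +
  fixes d :: 'f and e :: "nat \<Rightarrow> 'a"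
  assumes d: "d \<in> carrier F" "d [^]\<^bsub>F\<^esub> k = g"
    and e: "\<And>i. i < k \<Longrightarrow> e i \<in> carrier A"
    and e_left: "\<And>i. i < k \<Longrightarrow> v [^] M \<otimes> e i = ((z [^]\<^bsub>F\<^esub> M) [^]\<^bsub>F\<^esub> i \<otimes>\<^bsub>F\<^esub> d) \<odot> e i"
    and e_right: "\<And>i. i < k \<Longrightarrow> e i \<otimes> v [^] M = ((z [^]\<^bsub>F\<^esub> M) [^]\<^bsub>F\<^esub> i \<otimes>\<^bsub>F\<^esub> d) \<odot> e i"
    and e_sum: "(\<Oplus>i\<in>{..<k}. e i) = \<one>"
begin

lemma Mk: "M > 0" "k > 0"
  using zD(2) by auto

abbreviation \<omega> :: 'f where "\<omega> \<equiv> z [^]\<^bsub>F\<^esub> M"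

lemma \<omega>: "primitive_root_of_unity F k \<omega>"
  by (rule K.primitive_root_power[OF z])

lemmas \<omega>D = K.primitive_rootD[OF \<omega>]

lemma d_nonzero: "d \<noteq> \<zero>\<^bsub>F\<^esub>"
  using d g(2) Mk by (auto simp: R.nat_pow_zero)

lemma ev_closed: "\<omega> [^]\<^bsub>F\<^esub> (i::nat) \<otimes>\<^bsub>F\<^esub> d \<in> carrier F"
  using zD(1) d by simp

lemma ev_neq:
  assumes "i mod k \<noteq> j mod k"
  shows "\<omega> [^]\<^bsub>F\<^esub> i \<otimes>\<^bsub>F\<^esub> d \<noteq> \<omega> [^]\<^bsub>F\<^esub> j \<otimes>\<^bsub>F\<^esub> d"
proof
  assume "\<omega> [^]\<^bsub>F\<^esub> i \<otimes>\<^bsub>F\<^esub> d = \<omega> [^]\<^bsub>F\<^esub> j \<otimes>\<^bsub>F\<^esub> d"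
  then have "\<omega> [^]\<^bsub>F\<^esub> i = \<omega> [^]\<^bsub>F\<^esub> j"
    using K.m_rcancel[OF d_nonzero] zD(1) d by simp
  then show False using K.primitive_root_inj[OF \<omega>] assms by blast
qed

text \<open>Left and right multiplication by \<open>v [^] M\<close> give both eigenvalues on \<open>e i \<otimes> x \<otimes> e j\<close>.\<close>

lemma eigen_sandwich:
  assumes i: "i < k" and j: "j < k" and x: "x \<in> carrier A"
    and comm: "v [^] M \<otimes> x = \<omega> [^]\<^bsub>F\<^esub> (p::nat) \<odot> (x \<otimes> v [^] M)"
    and ne: "i \<noteq> (j + p) mod k"
  shows "e i \<otimes> x \<otimes> e j = \<zero>"
proof -
  let ?y = "e i \<otimes> x \<otimes> e j" and ?c = "\<lambda>i::nat. \<omega> [^]\<^bsub>F\<^esub> i \<otimes>\<^bsub>F\<^esub> d"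
  have w: "v [^] M \<in> carrier A" and y: "?y \<in> carrier A" using v e i j x by simp_all
  have "?c i \<odot> ?y = (e i \<otimes> v [^] M) \<otimes> x \<otimes> e j"
    using e_right[OF i] e[OF i] e[OF j] x ev_closed by simp
  also have "\<dots> = e i \<otimes> (v [^] M \<otimes> x) \<otimes> e j"
    using e[OF i] e[OF j] x w by (simp add: m_assoc)
  also have "\<dots> = \<omega> [^]\<^bsub>F\<^esub> p \<odot> (e i \<otimes> x \<otimes> (v [^] M \<otimes> e j))"
    unfolding comm using e[OF i] e[OF j] x w zD(1) by (simp add: m_assoc)
  also have "\<dots> = (\<omega> [^]\<^bsub>F\<^esub> p \<otimes>\<^bsub>F\<^esub> ?c j) \<odot> ?y"
    using e_left[OF j] e[OF i] e[OF j] x zD(1) ev_closed by simp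
  also have "\<omega> [^]\<^bsub>F\<^esub> p \<otimes>\<^bsub>F\<^esub> ?c j = ?c (j + p)"
    using zD(1) d by (simp add: R.nat_pow_mult[symmetric] R.m_ac)
  finally have "(?c i \<ominus>\<^bsub>F\<^esub> ?c (j + p)) \<odot> ?y = \<zero>"
    using y ev_closed by (simp add: smult_diff_distrib minus_eq r_neg)
  moreover have "?c i \<ominus>\<^bsub>F\<^esub> ?c (j + p) \<noteq> \<zero>\<^bsub>F\<^esub>"
    using ev_neq[of i "j + p"] ne i ev_closed by simp
  ultimately show ?thesis using smult_cancel_zero ev_closed y by blast
qed

lemma sum_e_left:
  assumes "x \<in> carrier A" shows "(\<Oplus>i\<in>{..<k}. e i \<otimes> x) = x"
  using assms e e_sum finsum_ldistr[of "{..<k}" x e] by auto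

lemma sum_e_right:
  assumes "x \<in> carrier A" shows "(\<Oplus>i\<in>{..<k}. x \<otimes> e i) = x"
  using assms e e_sum finsum_rdistr[of "{..<k}" x e] by auto

text \<open>An element that commutes with \<open>v [^] M\<close> up to \<open>\<omega>\<close> to
  the power \<open>p\<close> moves eigenspaces by \<open>p\<close> places. Both sides equal
  \<open>e ((j + p) mod k) \<otimes> x \<otimes> e j\<close>, because all other components
  vanish.\<close>

lemma eigen_shift:
  assumes j: "j < k" and x: "x \<in> carrier A"
    and comm: "v [^] M \<otimes> x = \<omega> [^]\<^bsub>F\<^esub> (p::nat) \<odot> (x \<otimes> v [^] M)"
  shows "x \<otimes> e j = e ((j + p) mod k) \<otimes> x"
proof -
  define i where "i = (j + p) mod k"
  have i: "i < k" using Mk by (simp add: i_def)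
  have "x \<otimes> e j = (\<Oplus>l\<in>{..<k}. e l \<otimes> (x \<otimes> e j))"
    using sum_e_left[of "x \<otimes> e j"] x e[OF j] by simp
  also have "\<dots> = (\<Oplus>l\<in>{..<k}. if l = i then e i \<otimes> x \<otimes> e j else \<zero>)"
    using e j x eigen_sandwich[OF _ j x comm] i_def i
    by (intro finsum_cong') (auto simp: m_assoc)
  also have "\<dots> = e i \<otimes> x \<otimes> e j" using e i j x by (intro finsum_delta) auto
  finally have 1: "x \<otimes> e j = e i \<otimes> x \<otimes> e j" .
  have "e i \<otimes> x = (\<Oplus>l\<in>{..<k}. (e i \<otimes> x) \<otimes> e l)"
    using sum_e_right[of "e i \<otimes> x"] x e[OF i] by simp
  also have "\<dots> = (\<Oplus>l\<in>{..<k}. if l = j then e i \<otimes> x \<otimes> e j else \<zero>)"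
  proof (rule finsum_cong', safe)
    fix l assume l: "l < k"
    have lj: "l = j" if "i = (l + p) mod k"
    proof -
      have "(l + p) mod k = (j + p) mod k" using that i_def by simp
      then have "l mod k = j mod k" by (simp add: nat_mod_eq_iff)
      then show ?thesis using l j by simp
    qed
    show "e i \<otimes> x \<otimes> e l = (if l = j then e i \<otimes> x \<otimes> e j else \<zero>)"
    proof (cases "l = j")
      case False
      then show ?thesis using eigen_sandwich[OF i l x comm] lj by metis
    qed simp
  qed (use e[OF i] e[OF j] x in auto)
  also have "\<dots> = e i \<otimes> x \<otimes> e j" using e i j x by (intro finsum_delta) auto
  finally show ?thesis using 1 i_def by simp
qed

text \<open>With \<open>\<one>\<close> in the middle the sandwich gives orthogonality; since the
  \<open>e i\<close> add up to \<open>\<one>\<close>, idempotence follows.\<close>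

lemma e_mult: "i < k \<Longrightarrow> j < k \<Longrightarrow> e i \<otimes> e j = (if i = j then e i else \<zero>)"
proof -
  assume i: "i < k" and j: "j < k"
  have c1: "v [^] M \<otimes> \<one> = \<omega> [^]\<^bsub>F\<^esub> (0::nat) \<odot> (\<one> \<otimes> v [^] M)" using v by simp
  have off: "e i \<otimes> e j = \<zero>" if "i < k" "j < k" "i \<noteq> j" for i j
    using eigen_sandwich[OF that(1,2) one_closed c1] that e by simp
  have "e j \<otimes> e j = e j"
  proof -
    have "e j = (\<Oplus>l\<in>{..<k}. e l \<otimes> e j)" using sum_e_left e j by simp
    also have "\<dots> = (\<Oplus>l\<in>{..<k}. if l = j then e j \<otimes> e j else \<zero>)"
      using off e j by (intro finsum_cong') auto
    also have "\<dots> = e j \<otimes> e j" using e j by (intro finsum_delta) auto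
    finally show ?thesis by simp
  qed
  then show ?thesis using off[OF i j] by auto
qed

lemma u_e: "j < k \<Longrightarrow> u [^] (i::nat) \<otimes> e j = e ((j + i) mod k) \<otimes> u [^] i"
  using u zD(1) by (intro eigen_shift) (auto simp: vpow_upow R.nat_pow_pow mult.commute)

lemma v_e: "j < k \<Longrightarrow> v \<otimes> e j = e j \<otimes> v"
proof -
  assume j: "j < k"
  have "v [^] M \<otimes> v = \<omega> [^]\<^bsub>F\<^esub> (0::nat) \<odot> (v \<otimes> v [^] M)"
    using v nat_pow_comm[OF v, of M 1] by simp
  from eigen_shift[OF j v this] show ?thesis using j by simp
qed

lemma eq_by_e:
  assumes "x \<in> carrier A" "y \<in> carrier A" "\<And>i. i < k \<Longrightarrow> x \<otimes> e i = y \<otimes> e i"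
  shows "x = y"
proof -
  have "(\<Oplus>i\<in>{..<k}. x \<otimes> e i) = (\<Oplus>i\<in>{..<k}. y \<otimes> e i)"
    using assms e by (intro finsum_cong') auto
  then show ?thesis using sum_e_right assms(1,2) by simp
qed

text \<open>The inverse of \<open>u\<close>, available because \<open>u\<close> has a nonzero scalar
  power.\<close>

definition w :: 'a where "w = inv\<^bsub>F\<^esub> b \<odot> u [^] (M * k - 1)"

lemma b_unit: "b \<in> Units F"
  using b by (simp add: K.field_Units)

lemma w: "w \<in> carrier A" "u \<otimes> w = \<one>" "w \<otimes> u = \<one>"
proof -
  obtain n where n: "M * k = Suc n" using zD(2) by (cases "M * k") auto
  have "u \<otimes> u [^] (M * k - 1) = b \<odot> \<one>" "u [^] (M * k - 1) \<otimes> u = b \<odot> \<one>"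
    using uD nat_pow_Suc2[OF u, of n] by (simp_all add: n)
  then show "w \<in> carrier A" "u \<otimes> w = \<one>" "w \<otimes> u = \<one>"
    using u b_unit by (simp_all add: w_def R.Units_closed)
qed

lemma uw_pow: "u [^] (i::nat) \<otimes> w [^] i = \<one>" "w [^] (i::nat) \<otimes> u [^] i = \<one>"
proof -
  show "u [^] (i::nat) \<otimes> w [^] i = \<one>"
  proof (induction i)
    case (Suc i)
    have "u [^] Suc i \<otimes> w [^] Suc i = u [^] i \<otimes> (u \<otimes> w) \<otimes> w [^] i"
      using u w(1) nat_pow_Suc2[OF w(1), of i] by (simp add: m_assoc)
    then show ?case using Suc u w by simp
  qed simp
  show "w [^] (i::nat) \<otimes> u [^] i = \<one>"
  proof (induction i)
    case (Suc i)
    have "w [^] Suc i \<otimes> u [^] Suc i = w [^] i \<otimes> (w \<otimes> u) \<otimes> u [^] i"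
      using u w(1) nat_pow_Suc2[OF u, of i] by (simp add: m_assoc)
    then show ?case using Suc u w by simp
  qed simp
qed

lemma e0: "e 0 \<in> carrier A"
  using e Mk by simp

lemma u_e0: "i < k \<Longrightarrow> u [^] i \<otimes> e 0 = e i \<otimes> u [^] i"
  using u_e[of 0 i] Mk by simp

lemma e0_w: "i < k \<Longrightarrow> e 0 \<otimes> w [^] i = w [^] i \<otimes> e i"
proof -
  assume i: "i < k"
  have "e 0 \<otimes> w [^] i = (w [^] i \<otimes> u [^] i) \<otimes> e 0 \<otimes> w [^] i"
    using e0 w by (simp add: uw_pow)
  also have "\<dots> = w [^] i \<otimes> (u [^] i \<otimes> e 0) \<otimes> w [^] i"
    using e0 w u by (simp add: m_assoc)
  also have "\<dots> = w [^] i \<otimes> e i \<otimes> (u [^] i \<otimes> w [^] i)"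
    unfolding u_e0[OF i] using e[OF i] w u by (simp add: m_assoc)
  finally show ?thesis using e[OF i] w by (simp add: uw_pow)
qed

definition unit :: "nat \<Rightarrow> nat \<Rightarrow> 'a" where "unit i j = u [^] i \<otimes> e 0 \<otimes> w [^] j"

lemma unit_closed: "unit i j \<in> carrier A"
  using u e0 w by (simp add: unit_def)

lemma unit_mult:
  assumes "j < k" "l < k"
  shows "unit i j \<otimes> unit l r = (if j = l then unit i r else \<zero>)"
proof -
  have "unit i j \<otimes> unit l r = u [^] i \<otimes> ((e 0 \<otimes> w [^] j) \<otimes> (u [^] l \<otimes> e 0)) \<otimes> w [^] r"
    unfolding unit_def using u e0 w by (simp add: m_assoc)
  also have "(e 0 \<otimes> w [^] j) \<otimes> (u [^] l \<otimes> e 0) = w [^] j \<otimes> (e j \<otimes> e l) \<otimes> u [^] l"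
    unfolding e0_w[OF assms(1)] u_e0[OF assms(2)] using u w e assms by (simp add: m_assoc)
  also have "\<dots> = (if j = l then e 0 else \<zero>)"
  proof (cases "j = l")
    case True
    have "w [^] j \<otimes> (e j \<otimes> e l) \<otimes> u [^] l = (w [^] j \<otimes> u [^] j) \<otimes> e 0"
      using e_mult[OF assms] u_e0[OF assms(1)] u w e e0 assms True by (simp add: m_assoc)
    then show ?thesis using True e0 by (simp add: uw_pow)
  qed (use e_mult[OF assms] u w in simp)
  finally show ?thesis unfolding unit_def using u w e0 by auto
qed

lemma unit_diag: "i < k \<Longrightarrow> unit i i = e i"
  unfolding unit_def using u w e by (simp add: u_e0 m_assoc uw_pow)

text \<open>Conjugating \<open>v \<otimes> e 0\<close> by \<open>u [^] i\<close> gives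
  \<open>z\<close> to the power \<open>-i\<close> times \<open>v \<otimes> e i\<close>. So
  \<open>y\<close> is the sum of the conjugates of one corner of \<open>v\<close>, which is why it
  commutes with all matrix units.\<close>

definition y :: 'a where "y = (\<Oplus>i\<in>{..<k}. (inv\<^bsub>F\<^esub> z) [^]\<^bsub>F\<^esub> i \<odot> (v \<otimes> e i))"

lemma zi: "inv\<^bsub>F\<^esub> z \<in> carrier F" "inv\<^bsub>F\<^esub> z \<otimes>\<^bsub>F\<^esub> z = \<one>\<^bsub>F\<^esub>"
  using zD(5) by simp_all

lemma zi_pow: "(inv\<^bsub>F\<^esub> z) [^]\<^bsub>F\<^esub> (i::nat) \<otimes>\<^bsub>F\<^esub> z [^]\<^bsub>F\<^esub> i = \<one>\<^bsub>F\<^esub>"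
  using zi zD(1) by (simp flip: R.nat_pow_distrib)

lemma y: "y \<in> carrier A"
  unfolding y_def using zi v e by (intro finsum_closed) auto

lemma y_e:
  assumes j: "j < k"
  shows "y \<otimes> e j = (inv\<^bsub>F\<^esub> z) [^]\<^bsub>F\<^esub> j \<odot> (v \<otimes> e j)"
proof -
  have "y \<otimes> e j = (\<Oplus>i\<in>{..<k}. ((inv\<^bsub>F\<^esub> z) [^]\<^bsub>F\<^esub> i \<odot> (v \<otimes> e i)) \<otimes> e j)"
    unfolding y_def using zi v e j by (intro finsum_ldistr) auto
  also have "\<dots> = (\<Oplus>i\<in>{..<k}. if i = j then (inv\<^bsub>F\<^esub> z) [^]\<^bsub>F\<^esub> j \<odot> (v \<otimes> e j) else \<zero>)"
    using zi v e j by (intro finsum_cong') (auto simp: m_assoc e_mult)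
  also have "\<dots> = (inv\<^bsub>F\<^esub> z) [^]\<^bsub>F\<^esub> j \<odot> (v \<otimes> e j)"
    using zi v e j by (intro finsum_delta) auto
  finally show ?thesis .
qed

lemma e_y:
  assumes j: "j < k"
  shows "e j \<otimes> y = y \<otimes> e j"
proof -
  have "e j \<otimes> y = (\<Oplus>i\<in>{..<k}. e j \<otimes> ((inv\<^bsub>F\<^esub> z) [^]\<^bsub>F\<^esub> i \<odot> (v \<otimes> e i)))"
    unfolding y_def using zi v e j by (intro finsum_rdistr) auto
  also have "\<dots> = (\<Oplus>i\<in>{..<k}. if i = j then (inv\<^bsub>F\<^esub> z) [^]\<^bsub>F\<^esub> j \<odot> (v \<otimes> e j) else \<zero>)"
    using zi v e j by (intro finsum_cong') (auto simp: v_e m_assoc[symmetric] e_mult)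
  also have "\<dots> = (inv\<^bsub>F\<^esub> z) [^]\<^bsub>F\<^esub> j \<odot> (v \<otimes> e j)"
    using zi v e j by (intro finsum_delta) auto
  finally show ?thesis using y_e[OF j] by simp
qed

lemma ypow_e:
  assumes j: "j < k"
  shows "y [^] (i::nat) \<otimes> e j = (inv\<^bsub>F\<^esub> z) [^]\<^bsub>F\<^esub> (j * i) \<odot> (v [^] i \<otimes> e j)"
proof (induction i)
  case (Suc i)
  have "y [^] Suc i \<otimes> e j = y [^] i \<otimes> (y \<otimes> e j)" using y e j by (simp add: m_assoc)
  also have "\<dots> = (inv\<^bsub>F\<^esub> z) [^]\<^bsub>F\<^esub> j \<odot> (y [^] i \<otimes> (e j \<otimes> v))"
    using y_e[OF j] v_e[OF j] y e j v zi by simp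
  also have "\<dots> = (inv\<^bsub>F\<^esub> z) [^]\<^bsub>F\<^esub> j \<odot> ((y [^] i \<otimes> e j) \<otimes> v)"
    using y e j v zi by (simp add: m_assoc)
  also have "\<dots> = ((inv\<^bsub>F\<^esub> z) [^]\<^bsub>F\<^esub> j \<otimes>\<^bsub>F\<^esub> (inv\<^bsub>F\<^esub> z) [^]\<^bsub>F\<^esub> (j * i)) \<odot> (v [^] i \<otimes> (e j \<otimes> v))"
    using Suc y e j v zi by (simp add: m_assoc)
  also have "\<dots> = (inv\<^bsub>F\<^esub> z) [^]\<^bsub>F\<^esub> (j * Suc i) \<odot> (v [^] Suc i \<otimes> e j)"
    using v_e[OF j] y e j v zi by (simp add: m_assoc R.nat_pow_mult)
  finally show ?case .
qed (use e j in simp)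

lemma ypow_unit: "y [^] (i::nat) \<otimes> e j = e j \<otimes> y [^] i" if "j < k"
  using that y e by (induction i) (simp_all add: m_assoc e_y[symmetric], simp add: m_assoc[symmetric])

lemma v_wpow: "w [^] (i::nat) \<otimes> v = z [^]\<^bsub>F\<^esub> i \<odot> (v \<otimes> w [^] i)"
proof -
  have "w [^] i \<otimes> v = w [^] i \<otimes> (v \<otimes> u [^] i) \<otimes> w [^] i"
    using v u w by (simp add: m_assoc uw_pow)
  also have "\<dots> = z [^]\<^bsub>F\<^esub> i \<odot> ((w [^] i \<otimes> u [^] i) \<otimes> v \<otimes> w [^] i)"
    unfolding v_upow using v u w zD(1) by (simp add: m_assoc)
  finally show ?thesis using v w by (simp add: uw_pow)
qed

text \<open>Both sides are brought to
  \<open>u [^] i \<otimes> v \<otimes> e 0 \<otimes> w [^] j\<close>: the scalars in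
  \<open>y\<close> cancel exactly the powers of \<open>z\<close> that arise from moving
  \<open>v\<close> past \<open>u [^] i\<close> or past \<open>w [^] j\<close>.\<close>

lemma unit_y:
  assumes "i < k" "j < k"
  shows "y \<otimes> unit i j = unit i j \<otimes> y"
proof -
  have "y \<otimes> unit i j = (y \<otimes> e i) \<otimes> u [^] i \<otimes> w [^] j"
    unfolding unit_def using u_e0[OF assms(1)] y e0 e u w assms by (simp add: m_assoc[symmetric])
  also have "\<dots> = (inv\<^bsub>F\<^esub> z) [^]\<^bsub>F\<^esub> i \<odot> (v \<otimes> (e i \<otimes> u [^] i) \<otimes> w [^] j)"
    using y_e[OF assms(1)] e u v w zi assms by (simp add: m_assoc)
  also have "\<dots> = (inv\<^bsub>F\<^esub> z) [^]\<^bsub>F\<^esub> i \<odot> ((v \<otimes> u [^] i) \<otimes> e 0 \<otimes> w [^] j)"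
    unfolding u_e0[OF assms(1), symmetric] using e0 u v w zi by (simp add: m_assoc)
  also have "\<dots> = u [^] i \<otimes> v \<otimes> e 0 \<otimes> w [^] j"
    unfolding v_upow using e0 u v w zi zD(1) by (simp add: zi_pow)
  finally have 1: "y \<otimes> unit i j = u [^] i \<otimes> v \<otimes> e 0 \<otimes> w [^] j" .
  have "unit i j \<otimes> y = u [^] i \<otimes> (w [^] j \<otimes> (e j \<otimes> y))"
    unfolding unit_def using e0_w[OF assms(2)] y e0 e u w assms by (simp add: m_assoc)
  also have "\<dots> = (inv\<^bsub>F\<^esub> z) [^]\<^bsub>F\<^esub> j \<odot> (u [^] i \<otimes> ((w [^] j \<otimes> v) \<otimes> e j))"
    unfolding e_y[OF assms(2)] y_e[OF assms(2)] using e u v w zi assms by (simp add: m_assoc)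
  also have "\<dots> = u [^] i \<otimes> (v \<otimes> (w [^] j \<otimes> e j))"
    unfolding v_wpow using e u v w zi zD(1) assms by (simp add: zi_pow m_assoc)
  also have "\<dots> = u [^] i \<otimes> v \<otimes> e 0 \<otimes> w [^] j"
    unfolding e0_w[OF assms(2), symmetric] using e0 u v w by (simp add: m_assoc)
  finally show ?thesis using 1 by simp
qed

lemma uk_e: "j < k \<Longrightarrow> u [^] k \<otimes> e j = e j \<otimes> u [^] k"
  using u_e[of j k] by simp

lemma unit_uk: "u [^] k \<otimes> unit i j = unit i j \<otimes> u [^] k"
proof -
  have uw: "w [^] j \<otimes> u [^] k = u [^] k \<otimes> w [^] j"
  proof -
    have "w [^] j \<otimes> u [^] k = w [^] j \<otimes> u [^] k \<otimes> (u [^] j \<otimes> w [^] j)"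
      using u w by (simp add: uw_pow)
    also have "\<dots> = w [^] j \<otimes> (u [^] k \<otimes> u [^] j) \<otimes> w [^] j" using u w by (simp add: m_assoc)
    also have "u [^] k \<otimes> u [^] j = u [^] j \<otimes> u [^] k" by (rule nat_pow_comm[OF u])
    also have "w [^] j \<otimes> (u [^] j \<otimes> u [^] k) \<otimes> w [^] j = (w [^] j \<otimes> u [^] j) \<otimes> u [^] k \<otimes> w [^] j"
      using u w by (simp add: m_assoc)
    finally show ?thesis using u w by (simp add: uw_pow)
  qed
  have "u [^] k \<otimes> unit i j = (u [^] k \<otimes> u [^] i) \<otimes> e 0 \<otimes> w [^] j"
    unfolding unit_def using u e0 w by (simp add: m_assoc)
  also have "u [^] k \<otimes> u [^] i = u [^] i \<otimes> u [^] k" by (rule nat_pow_comm[OF u])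
  also have "u [^] i \<otimes> u [^] k \<otimes> e 0 \<otimes> w [^] j = u [^] i \<otimes> (u [^] k \<otimes> e 0) \<otimes> w [^] j"
    using u e0 w by (simp add: m_assoc)
  also have "\<dots> = u [^] i \<otimes> e 0 \<otimes> (u [^] k \<otimes> w [^] j)"
    using uk_e[of 0] Mk u e0 w by (simp add: m_assoc)
  finally show ?thesis unfolding unit_def uw[symmetric] using u e0 w by (simp add: m_assoc)
qed

text \<open>On each \<open>e i\<close> the element \<open>y\<close> is a scalar multiple of
  \<open>v\<close>, and \<open>u [^] k\<close> commutes with \<open>e i\<close> because a shift by
  \<open>k\<close> places is trivial. So the relation between \<open>v\<close> and
  \<open>u [^] k\<close> is inherited.\<close>

lemma y_uk: "y \<otimes> u [^] k = z [^]\<^bsub>F\<^esub> k \<odot> (u [^] k \<otimes> y)"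
proof (rule eq_by_e)
  fix i assume i: "i < k"
  have "y \<otimes> u [^] k \<otimes> e i = (y \<otimes> e i) \<otimes> u [^] k"
    using uk_e[OF i] y u e i by (simp add: m_assoc)
  also have "\<dots> = (inv\<^bsub>F\<^esub> z) [^]\<^bsub>F\<^esub> i \<odot> ((v \<otimes> u [^] k) \<otimes> e i)"
    using uk_e[OF i] y_e[OF i] v u e i zi by (simp add: m_assoc)
  also have "\<dots> = z [^]\<^bsub>F\<^esub> k \<odot> (u [^] k \<otimes> ((inv\<^bsub>F\<^esub> z) [^]\<^bsub>F\<^esub> i \<odot> (v \<otimes> e i)))"
    unfolding v_upow using v u e i zi zD(1) by (simp add: m_assoc R.m_comm)
  also have "\<dots> = z [^]\<^bsub>F\<^esub> k \<odot> (u [^] k \<otimes> y) \<otimes> e i"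
    using y_e[OF i] y u e i zD(1) by (simp add: m_assoc)
  finally show "y \<otimes> u [^] k \<otimes> e i = z [^]\<^bsub>F\<^esub> k \<odot> (u [^] k \<otimes> y) \<otimes> e i" .
qed (use y u zD(1) in auto)

text \<open>On \<open>e i\<close> the scalars of \<open>y\<close> contribute \<open>z\<close> to the
  power \<open>- i * M\<close>, which cancels the power of \<open>\<omega>\<close> in the eigenvalue
  of \<open>v [^] M\<close>. All components thus get the same value \<open>d\<close>.\<close>

lemma y_M: "y [^] M = d \<odot> \<one>"
proof (rule eq_by_e)
  fix i assume i: "i < k"
  have "y [^] M \<otimes> e i = ((inv\<^bsub>F\<^esub> z) [^]\<^bsub>F\<^esub> (i * M) \<otimes>\<^bsub>F\<^esub> (z [^]\<^bsub>F\<^esub> (i * M) \<otimes>\<^bsub>F\<^esub> d)) \<odot> e i"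
    using ypow_e[OF i] e_left[OF i] e i zi zD(1) d v by (simp add: R.nat_pow_pow mult.commute)
  also have "\<dots> = d \<odot> \<one> \<otimes> e i"
    using zi_pow[of "i * M"] zi zD(1) d e i by (simp flip: R.m_assoc)
  finally show "y [^] M \<otimes> e i = d \<odot> \<one> \<otimes> e i" .
qed (use y d in auto)

lemma corner_pair: "symbol_pair F A M (z [^]\<^bsub>F\<^esub> k) b d (u [^] k) y"
proof
  show "primitive_root_of_unity F M (z [^]\<^bsub>F\<^esub> k)"
    using z by (intro K.primitive_root_power) (simp add: mult.commute)
  show "(u [^] k) [^] M = b \<odot> \<one>" using u uD by (simp add: nat_pow_pow mult.commute)
qed (use b d d_nonzero u y y_uk y_M nontriv in auto)

text \<open>The image of \<open>\<Phi>\<close> commutes with the units because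
  \<open>u [^] k\<close> and \<open>y\<close> do. For spanning, a monomial is cut by the
  \<open>e i\<close>, and each piece is a scalar times one coefficient times one unit.\<close>

theorem matrix_over_corner:
  assumes "symbol_algebra F C M (z [^]\<^bsub>F\<^esub> k) b d uc vc"
    and \<Phi>: "\<Phi> \<in> alg_mono F C A" "\<Phi> uc = u [^] k" "\<Phi> vc = y"
  shows "matrix_over_algebra F C A k \<Phi> unit"
proof -
  interpret C: symbol_algebra F C M "z [^]\<^bsub>F\<^esub> k" b d uc vc by fact
  note \<Phi>' = alg_homD[OF alg_monoD(1)[OF \<Phi>(1)]]
  have rings: "ring C" "ring A" by unfold_locales
  have pow: "\<Phi> (uc [^]\<^bsub>C\<^esub> (p::nat)) = (u [^] k) [^] p" "\<Phi> (vc [^]\<^bsub>C\<^esub> (p::nat)) = y [^] p" for p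
    using alg_hom_pow[OF alg_monoD(1)[OF \<Phi>(1)] rings] C.u C.v \<Phi>(2,3) by simp_all
  have mon: "\<Phi> (C.mon p r) = (u [^] k) [^] p \<otimes> y [^] r" for p r
    using \<Phi>'(4) C.u C.v pow by simp
  have fa: "field_algebra F C" "field_algebra F A" by unfold_locales
  have comm: "\<Phi> c \<otimes> unit i j = unit i j \<otimes> \<Phi> c" if c: "c \<in> carrier C" and ij: "i < k" "j < k" for c i j
  proof (rule spanned_lin_map_eq[OF fa _ _ C.span _ c])
    show "(\<lambda>c. \<Phi> c \<otimes> unit i j) \<in> lin_map F C A" "(\<lambda>c. unit i j \<otimes> \<Phi> c) \<in> lin_map F C A"
      using \<Phi>' unit_closed by (auto intro!: lin_mapI simp: l_distr r_distr)
    fix s assume "s \<in> {C.mon i j | i j. True}"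
    then obtain p r where s: "s = C.mon p r" by blast
    have P: "x [^] (p::nat) \<otimes> unit i j = unit i j \<otimes> x [^] p"
      if "x \<in> carrier A" "x \<otimes> unit i j = unit i j \<otimes> x" for x p
      using that unit_closed by (induction p) (simp_all add: m_assoc, simp flip: m_assoc)
    have "(u [^] k) [^] p \<otimes> y [^] r \<otimes> unit i j = unit i j \<otimes> ((u [^] k) [^] p \<otimes> y [^] r)"
      using P[of y r] P[of "u [^] k" p] unit_y[OF ij] unit_uk u y unit_closed
      by (simp add: m_assoc) (simp flip: m_assoc)
    then show "\<Phi> s \<otimes> unit i j = unit i j \<otimes> \<Phi> s" unfolding s mon .
  qed
  have "matrix_over F C A k \<Phi> unit"
    unfolding matrix_over_def
  proof (intro conjI allI impI ballI)
    have "(\<Oplus>i\<in>{..<k}. unit i i) = (\<Oplus>i\<in>{..<k}. e i)"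
      using e by (intro finsum_cong') (auto simp: unit_diag)
    then show "(\<Oplus>i\<in>{..<k}. unit i i) = \<one>" using e_sum by simp
    let ?S = "{\<Phi> c \<otimes> unit i j | c i j. c \<in> carrier C \<and> i < k \<and> j < k}"
    show "spanned F A ?S"
      unfolding spanned_def
    proof (intro conjI allI impI)
      show "?S \<subseteq> carrier A" using \<Phi>'(1) unit_closed by auto
      fix V assume V: "submodule V F A" "?S \<subseteq> V"
      show "carrier A \<subseteq> V"
      proof (rule spannedD(2)[OF span V(1)], safe)
        fix a b' :: nat
        have "mon a b' \<otimes> e i \<in> V" if i: "i < k" for i
        proof -
          \<comment> \<open>Moving \<open>u [^] a\<close> into \<open>e i = unit i i\<close>
            produces row exponent \<open>a + i\<close>; whole multiples of \<open>k\<close> go into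
            the coefficient, the remainder is the row index.\<close>
          define p r where "p = (a + i) div k" and "r = (a + i) mod k"
          have r: "r < k" and ai: "a + i = k * p + r" using Mk by (simp_all add: p_def r_def)
          have "v [^] b' \<otimes> e i = z [^]\<^bsub>F\<^esub> (i * b') \<odot> (y [^] b' \<otimes> e i)"
            using ypow_e[OF i, of b'] v e i zi zD(1) zi_pow[of "i * b'"] by (simp add: R.m_comm)
          then have "mon a b' \<otimes> e i = z [^]\<^bsub>F\<^esub> (i * b') \<odot> (u [^] a \<otimes> (e i \<otimes> y [^] b'))"
            using u v e i y zD(1) by (simp add: m_assoc ypow_unit)
          also have "u [^] a \<otimes> (e i \<otimes> y [^] b') = (u [^] a \<otimes> u [^] i) \<otimes> e 0 \<otimes> w [^] i \<otimes> y [^] b'"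
            unfolding unit_diag[OF i, symmetric] unit_def using u w e0 y by (simp add: m_assoc)
          also have "u [^] a \<otimes> u [^] i = (u [^] k) [^] p \<otimes> u [^] r"
            using u by (simp only: nat_pow_mult nat_pow_pow ai)
          also have "(u [^] k) [^] p \<otimes> u [^] r \<otimes> e 0 \<otimes> w [^] i \<otimes> y [^] b' =
              (u [^] k) [^] p \<otimes> (unit r i \<otimes> y [^] b')"
            unfolding unit_def using u w e0 y by (simp add: m_assoc)
          also have "unit r i \<otimes> y [^] b' = y [^] b' \<otimes> unit r i"
            using comm[of "vc [^]\<^bsub>C\<^esub> b'" r i] r i C.v pow by simp
          also have "(u [^] k) [^] p \<otimes> (y [^] b' \<otimes> unit r i) = \<Phi> (C.mon p b') \<otimes> unit r i"
            unfolding mon using u y unit_closed by (simp add: m_assoc)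
          finally have "mon a b' \<otimes> e i = z [^]\<^bsub>F\<^esub> (i * b') \<odot> (\<Phi> (C.mon p b') \<otimes> unit r i)" .
          moreover have "\<Phi> (C.mon p b') \<otimes> unit r i \<in> V" using V(2) r i by blast
          ultimately show ?thesis using subspaceD(4)[OF V(1)] zD(1) by simp
        qed
        then have "(\<Oplus>i\<in>{..<k}. mon a b' \<otimes> e i) \<in> V" by (intro subspace_finsum[OF V(1)]) auto
        then show "mon a b' \<in> V" using sum_e_right[of "mon a b'"] by simp
      qed
    qed
  qed (use \<Phi>(1) unit_closed unit_mult comm in auto)
  then show ?thesis
    using fa by (simp add: matrix_over_algebra_def matrix_over_algebra_axioms_def)
qed

end

text \<open>Every root \<open>d\<close> of \<open>g\<close> provides suitable idempotents:
  \<open>fourier\<close> commutes with \<open>v [^] M\<close>, so the left and the right eigenvalue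
  equation coincide.\<close>

lemma split_symbol_fourier:
  assumes "symbol_algebra F A (M * k) z b g u v" "d \<in> carrier F" "d [^]\<^bsub>F\<^esub> k = g"
  shows "split_symbol F A M k z b g u v d
    (field_algebra.fourier F A k (z [^]\<^bsub>F\<^esub> M) d (v [^]\<^bsub>A\<^esub> M))"
proof -
  interpret symbol_algebra F A "M * k" z b g u v by fact
  have k: "k > 0" using zD(2) by auto
  have \<omega>: "primitive_root_of_unity F k (z [^]\<^bsub>F\<^esub> M)" by (rule K.primitive_root_power[OF z])
  have d0: "d \<noteq> \<zero>\<^bsub>F\<^esub>" using assms(3) g(2) k by (auto simp: R.nat_pow_zero)
  have w: "v [^]\<^bsub>A\<^esub> M \<in> carrier A" "(v [^]\<^bsub>A\<^esub> M) [^]\<^bsub>A\<^esub> k = d [^]\<^bsub>F\<^esub> k \<odot>\<^bsub>A\<^esub> \<one>\<^bsub>A\<^esub>"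
    using v vD assms(3) by (simp_all add: nat_pow_pow)
  note f = fourier[OF \<omega> assms(2) d0 w]
  show ?thesis
    by unfold_locales (use assms(2,3) f f(3)[OF w(1) refl] in auto)
qed

section \<open>Quotient algebras\<close>

lemma field_algebraI:
  assumes "field F" "ring A"
    and "\<And>c x. c \<in> carrier F \<Longrightarrow> x \<in> carrier A \<Longrightarrow> c \<odot>\<^bsub>A\<^esub> x \<in> carrier A"
    and "\<And>c d x. c \<in> carrier F \<Longrightarrow> d \<in> carrier F \<Longrightarrow> x \<in> carrier A \<Longrightarrow>
      (c \<oplus>\<^bsub>F\<^esub> d) \<odot>\<^bsub>A\<^esub> x = c \<odot>\<^bsub>A\<^esub> x \<oplus>\<^bsub>A\<^esub> d \<odot>\<^bsub>A\<^esub> x"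
    and "\<And>c x y. c \<in> carrier F \<Longrightarrow> x \<in> carrier A \<Longrightarrow> y \<in> carrier A \<Longrightarrow>
      c \<odot>\<^bsub>A\<^esub> (x \<oplus>\<^bsub>A\<^esub> y) = c \<odot>\<^bsub>A\<^esub> x \<oplus>\<^bsub>A\<^esub> c \<odot>\<^bsub>A\<^esub> y"
    and "\<And>c d x. c \<in> carrier F \<Longrightarrow> d \<in> carrier F \<Longrightarrow> x \<in> carrier A \<Longrightarrow>
      (c \<otimes>\<^bsub>F\<^esub> d) \<odot>\<^bsub>A\<^esub> x = c \<odot>\<^bsub>A\<^esub> (d \<odot>\<^bsub>A\<^esub> x)"
    and "\<And>x. x \<in> carrier A \<Longrightarrow> \<one>\<^bsub>F\<^esub> \<odot>\<^bsub>A\<^esub> x = x"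
    and "\<And>c x y. c \<in> carrier F \<Longrightarrow> x \<in> carrier A \<Longrightarrow> y \<in> carrier A \<Longrightarrow>
      (c \<odot>\<^bsub>A\<^esub> x) \<otimes>\<^bsub>A\<^esub> y = c \<odot>\<^bsub>A\<^esub> (x \<otimes>\<^bsub>A\<^esub> y)"
    and "\<And>c x y. c \<in> carrier F \<Longrightarrow> x \<in> carrier A \<Longrightarrow> y \<in> carrier A \<Longrightarrow>
      x \<otimes>\<^bsub>A\<^esub> (c \<odot>\<^bsub>A\<^esub> y) = c \<odot>\<^bsub>A\<^esub> (x \<otimes>\<^bsub>A\<^esub> y)"
  shows "field_algebra F A"
proof -
  interpret F: field F by fact
  interpret A: ring A by fact
  have "module F A" by (rule moduleI) (use assms F.is_cring A.is_abelian_group in auto)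
  then show ?thesis
    using assms by (simp add: field_algebra_def assoc_algebra_def assoc_algebra_axioms_def)
qed

lemma alg_quot_simps:
  "carrier (alg_quot A I) = a_rcosets\<^bsub>A\<^esub> I"
  "S \<otimes>\<^bsub>alg_quot A I\<^esub> T = rcoset_mult A I S T"
  "S \<oplus>\<^bsub>alg_quot A I\<^esub> T = S <+>\<^bsub>A\<^esub> T"
  "\<one>\<^bsub>alg_quot A I\<^esub> = I +>\<^bsub>A\<^esub> \<one>\<^bsub>A\<^esub>"
  "\<zero>\<^bsub>alg_quot A I\<^esub> = I"
  "c \<odot>\<^bsub>alg_quot A I\<^esub> S = (\<Union>x\<in>S. I +>\<^bsub>A\<^esub> (c \<odot>\<^bsub>A\<^esub> x))"
  by (simp_all add: alg_quot_def ring.defs FactRing_def)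

locale quotient_algebra = field_algebra F A + ideal I A
  for F :: "('f, 'r) ring_scheme" and A :: "('f, 'a, 'x) module_scheme" (structure) and I
begin

abbreviation Q where "Q \<equiv> alg_quot A I"
abbreviation proj where "proj x \<equiv> I +> x"

lemma I_smult: "c \<in> carrier F \<Longrightarrow> x \<in> I \<Longrightarrow> c \<odot> x \<in> I"
  using subspaceD(4)[OF ideal_subspace[OF is_ideal]] by blast

lemma proj_eq_iff:
  assumes "x \<in> carrier A" "y \<in> carrier A"
  shows "proj x = proj y \<longleftrightarrow> x \<ominus> y \<in> I"
  using quotient_eq_iff_same_a_r_cos[OF is_ideal assms] by simp

text \<open>Scalar multiplication on the quotient is a union over all representatives; each of them
  contributes the same coset, because \<open>I\<close> is stable under scalars.\<close>

lemma proj_smult: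
  assumes c: "c \<in> carrier F" and x: "x \<in> carrier A"
  shows "c \<odot>\<^bsub>Q\<^esub> proj x = proj (c \<odot> x)"
proof -
  have "proj (c \<odot> y) = proj (c \<odot> x)" if y: "y \<in> proj x" for y
  proof -
    have yc: "y \<in> carrier A" using y x a_r_coset_subset_G[OF a_subset x] by auto
    have "proj y = proj x" using a_repr_independence'[OF y x] by simp
    then have "c \<odot> (y \<ominus> x) \<in> I" using proj_eq_iff[OF yc x] I_smult[OF c] by simp
    also have "c \<odot> (y \<ominus> x) = c \<odot> y \<ominus> c \<odot> x"
      using c x yc by (simp add: minus_eq smult_r_distr smult_r_minus)
    finally show ?thesis using proj_eq_iff c x yc by simp
  qed
  moreover have "x \<in> proj x" by (rule a_rcos_self[OF x])
  ultimately show ?thesis unfolding alg_quot_simps by blast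
qed

lemma Q_carrier: "carrier Q = proj ` carrier A"
  by (auto simp: alg_quot_simps A_RCOSETS_def' a_r_coset_def')

lemma proj_mult: "x \<in> carrier A \<Longrightarrow> y \<in> carrier A \<Longrightarrow> proj x \<otimes>\<^bsub>Q\<^esub> proj y = proj (x \<otimes> y)"
  by (simp add: alg_quot_simps rcoset_mult_add)

lemma proj_add: "x \<in> carrier A \<Longrightarrow> y \<in> carrier A \<Longrightarrow> proj x \<oplus>\<^bsub>Q\<^esub> proj y = proj (x \<oplus> y)"
  by (simp add: alg_quot_simps a_rcos_sum)

text \<open>The record extends the quotient ring by a scalar multiplication only, so the ring laws
  carry over one operation at a time.\<close>

lemma Q_ring: "ring Q"
proof -
  interpret QR: ring "A Quot I" by (rule quotient_is_ring)
  have eq: "carrier Q = carrier (A Quot I)" "monoid.mult Q = monoid.mult (A Quot I)" "add Q = add (A Quot I)"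
    "one Q = one (A Quot I)" "ring.zero Q = ring.zero (A Quot I)"
    by (simp_all add: alg_quot_def ring.defs)
  show ?thesis
  proof (intro ringI abelian_groupI monoidI)
    fix x assume "x \<in> carrier Q"
    then have "\<ominus>\<^bsub>A Quot I\<^esub> x \<in> carrier Q" "\<ominus>\<^bsub>A Quot I\<^esub> x \<oplus>\<^bsub>Q\<^esub> x = \<zero>\<^bsub>Q\<^esub>"
      unfolding eq by (auto simp: QR.l_neg)
    then show "\<exists>y\<in>carrier Q. y \<oplus>\<^bsub>Q\<^esub> x = \<zero>\<^bsub>Q\<^esub>" by blast
  qed (unfold eq, simp_all add: QR.a_ac QR.m_assoc QR.l_distr QR.r_distr)
qed

lemma Q_algebra: "field_algebra F Q"
proof (rule field_algebraI)
  show "field F" ..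
qed (auto simp: Q_ring Q_carrier proj_smult proj_mult proj_add smult_l_distr smult_r_distr)

lemma proj_hom: "proj \<in> alg_hom F A Q"
  by (rule alg_homI[OF lin_mapI])
    (auto simp: Q_carrier proj_smult proj_mult proj_add alg_quot_simps(4))

lemma proj_zero_iff: "x \<in> carrier A \<Longrightarrow> proj x = \<zero>\<^bsub>Q\<^esub> \<longleftrightarrow> x \<in> I"
  using a_coset_join1 a_coset_join2 additive_subgroup.a_subgroup[OF is_additive_subgroup] is_additive_subgroup
  unfolding alg_quot_simps(5) by (metis a_rcos_zero is_ideal a_rcos_self)

lemma Q_nontrivial: "\<one> \<notin> I \<Longrightarrow> \<one>\<^bsub>Q\<^esub> \<noteq> \<zero>\<^bsub>Q\<^esub>"
  using proj_zero_iff[OF one_closed] by (simp add: alg_quot_simps(4))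

lemma Q_spanned:
  assumes "spanned F A S"
  shows "spanned F Q (proj ` S)"
  unfolding spanned_def
proof (intro conjI allI impI)
  show "proj ` S \<subseteq> carrier Q" using spannedD(1)[OF assms] by (auto simp: Q_carrier)
  fix V assume V: "submodule V F Q" "proj ` S \<subseteq> V"
  interpret Q: field_algebra F Q by (rule Q_algebra)
  have "submodule {x \<in> carrier A. proj x \<in> V} F A"
    using Q.subspaceD[OF V(1)] proj_zero_iff[of \<zero>] alg_homD[OF proj_hom]
    by (intro subspaceI) auto
  from spannedD(2)[OF assms this] show "carrier Q \<subseteq> V"
    using V(2) spannedD(1)[OF assms] by (auto simp: Q_carrier)
qed

end

section \<open>Skew polynomials\<close>

text \<open>The rearrangement behind associativity of convolution products; it serves the skew
  polynomials and the free algebra alike.\<close>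

lemma (in abelian_monoid) finsum_triangle:
  assumes "\<And>i k. i \<le> k \<Longrightarrow> k \<le> n \<Longrightarrow> t i k \<in> carrier G"
  shows "(\<Oplus>k\<in>{..n::nat}. \<Oplus>i\<in>{..k}. t i k) = (\<Oplus>i\<in>{..n}. \<Oplus>j\<in>{..n-i}. t i (i + j))"
proof -
  \<comment> \<open>The triangle is filled up with zeros to a square, where the two sums can be
    exchanged.\<close>
  define t' where "t' i k = (if i \<le> k then t i k else \<zero>)" for i k
  have t': "t' i k \<in> carrier G" if "k \<le> n" for i k using assms that by (simp add: t'_def)
  have "(\<Oplus>k\<in>{..n}. \<Oplus>i\<in>{..k}. t i k) = (\<Oplus>k\<in>{..n}. \<Oplus>i\<in>{..n}. t' i k)"
  proof (rule finsum_cong'[OF refl])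
    fix k assume k: "k \<in> {..n}"
    show "(\<Oplus>i\<in>{..k}. t i k) = (\<Oplus>i\<in>{..n}. t' i k)"
      by (rule add.finprod_mono_neutral_cong_left) (use k t' in \<open>auto simp: t'_def\<close>)
  qed (use t' in \<open>auto intro!: finsum_closed\<close>)
  also have "\<dots> = (\<Oplus>i\<in>{..n}. \<Oplus>k\<in>{..n}. t' i k)"
    using t' by (intro finsum_swap) auto
  also have "\<dots> = (\<Oplus>i\<in>{..n}. \<Oplus>j\<in>{..n-i}. t i (i + j))"
  proof (rule finsum_cong'[OF refl])
    fix i assume i: "i \<in> {..n}"
    have im: "(+) i ` {..n-i} = {i..n}"
    proof (intro equalityI subsetI)
      fix k assume "k \<in> {i..n}"
      then have "k = i + (k - i)" "k - i \<in> {..n-i}" by auto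
      then show "k \<in> (+) i ` {..n-i}" by blast
    qed (use i in auto)
    have "(\<Oplus>k\<in>{..n}. t' i k) = (\<Oplus>k\<in>{i..n}. t i k)"
      by (rule add.finprod_mono_neutral_cong_right) (use t' in \<open>auto simp: t'_def\<close>)
    also have "\<dots> = (\<Oplus>j\<in>{..n-i}. t i (i + j))"
      unfolding im[symmetric] using assms i by (intro finsum_reindex) auto
    finally show "(\<Oplus>k\<in>{..n}. t' i k) = (\<Oplus>j\<in>{..n-i}. t i (i + j))" .
  qed (use assms in \<open>auto intro!: finsum_closed\<close>)
  finally show ?thesis .
qed

text \<open>The condition \<open>\<tau>N\<close> makes the \<open>N\<close>-th power of the variable
  central, and this keeps the quotient from collapsing.\<close>

locale skew = field_algebra F K + cring K
  for F :: "('f, 'r) ring_scheme" and K :: "('f, 'k, 'x) module_scheme" (structure) +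
  fixes \<tau> :: "'k \<Rightarrow> 'k" and N :: nat and c :: 'f
  assumes \<tau>: "\<tau> \<in> alg_hom F K K"
    and \<tau>N: "\<And>e. e \<in> carrier K \<Longrightarrow> (\<tau> ^^ N) e = e"
    and N: "N > 0" and c: "c \<in> carrier F" and nontriv: "\<one> \<noteq> \<zero>"
begin

lemma \<tau>_pow: "\<tau> ^^ i \<in> alg_hom F K K"
proof (induction i)
  case 0
  show ?case by (auto intro!: alg_homI lin_mapI)
next
  case (Suc i)
  show ?case using alg_hom_comp[OF Suc \<tau>] by (simp add: comp_def)
qed

lemmas \<tau>' = alg_homD[OF \<tau>_pow]

lemma \<tau>_zero [simp]: "(\<tau> ^^ i) \<zero> = \<zero>"
proof -
  have "field_algebra F K" ..
  from lin_map_zero[OF this this alg_hom_lin[OF \<tau>_pow]] show ?thesis .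
qed

lemma \<tau>_closed [simp]: "e \<in> carrier K \<Longrightarrow> (\<tau> ^^ i) e \<in> carrier K"
  by (rule \<tau>'(1))

abbreviation S where "S \<equiv> skew_poly K \<tau>"

lemma S_simps:
  "carrier S = up K"
  "p \<oplus>\<^bsub>S\<^esub> q = (\<lambda>i. p i \<oplus> q i)"
  "p \<otimes>\<^bsub>S\<^esub> q = (\<lambda>n. \<Oplus>i\<in>{..n}. p i \<otimes> (\<tau> ^^ i) (q (n - i)))"
  "\<zero>\<^bsub>S\<^esub> = (\<lambda>i. \<zero>)" "\<one>\<^bsub>S\<^esub> = (\<lambda>i. if i = 0 then \<one> else \<zero>)"
  "d \<odot>\<^bsub>S\<^esub> p = (\<lambda>i. d \<odot> p i)"
  by (simp_all add: skew_poly_def)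

lemma up_coeff: "p \<in> up K \<Longrightarrow> p i \<in> carrier K"
  by (rule mem_upD)

lemma S_mult_closed:
  assumes p: "p \<in> up K" and q: "q \<in> up K"
  shows "(\<lambda>n. \<Oplus>i\<in>{..n}. p i \<otimes> (\<tau> ^^ i) (q (n - i))) \<in> up K"
proof (rule mem_upI)
  fix n show "(\<Oplus>i\<in>{..n}. p i \<otimes> (\<tau> ^^ i) (q (n - i))) \<in> carrier K"
    using up_coeff[OF p] up_coeff[OF q] by (intro finsum_closed) auto
next
  obtain n where n: "bound \<zero> n p" using p by blast
  obtain m where m: "bound \<zero> m q" using q by blast
  have "bound \<zero> (n + m) (\<lambda>n. \<Oplus>i\<in>{..n}. p i \<otimes> (\<tau> ^^ i) (q (n - i)))"
  proof
    fix k assume k: "n + m < k"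
    show "(\<Oplus>i\<in>{..k}. p i \<otimes> (\<tau> ^^ i) (q (k - i))) = \<zero>"
    proof (rule add.finprod_one_eqI)
      fix i
      show "p i \<otimes> (\<tau> ^^ i) (q (k - i)) = \<zero>"
      proof (cases "n < i")
        case True
        then show ?thesis using bound.bound[OF n] up_coeff[OF q] by simp
      next
        case False
        then have "m < k - i" using k by arith
        then show ?thesis using bound.bound[OF m] up_coeff[OF p] by simp
      qed
    qed
  qed
  then show "\<exists>n. bound \<zero> n (\<lambda>n. \<Oplus>i\<in>{..n}. p i \<otimes> (\<tau> ^^ i) (q (n - i)))" by blast
qed

text \<open>Both products collect \<open>p i\<close>, \<open>q (k - i)\<close> twisted by
  \<open>\<tau> ^^ i\<close>, and \<open>r (n - k)\<close> twisted by \<open>\<tau> ^^ k\<close>,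
  over all \<open>i \<le> k \<le> n\<close>.\<close>

lemma S_assoc:
  assumes p: "p \<in> up K" and q: "q \<in> up K" and r: "r \<in> up K"
  shows "(p \<otimes>\<^bsub>S\<^esub> q) \<otimes>\<^bsub>S\<^esub> r = p \<otimes>\<^bsub>S\<^esub> (q \<otimes>\<^bsub>S\<^esub> r)"
proof
  fix n
  note cl = up_coeff[OF p] up_coeff[OF q] up_coeff[OF r]
  have fa: "field_algebra F K" ..
  let ?t = "\<lambda>i k. p i \<otimes> (\<tau> ^^ i) (q (k - i)) \<otimes> (\<tau> ^^ k) (r (n - k))"
  have "((p \<otimes>\<^bsub>S\<^esub> q) \<otimes>\<^bsub>S\<^esub> r) n = (\<Oplus>k\<in>{..n}. \<Oplus>i\<in>{..k}. ?t i k)"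
    unfolding S_simps using cl by (intro finsum_cong' finsum_ldistr) (auto intro!: finsum_closed)
  also have "\<dots> = (\<Oplus>i\<in>{..n}. \<Oplus>j\<in>{..n-i}. ?t i (i + j))"
    using cl by (intro finsum_triangle) auto
  also have "\<dots> = (p \<otimes>\<^bsub>S\<^esub> (q \<otimes>\<^bsub>S\<^esub> r)) n"
    unfolding S_simps
  proof (rule finsum_cong'[OF refl])
    fix i assume i: "i \<in> {..n}"
    have "(\<tau> ^^ i) (\<Oplus>j\<in>{..n-i}. q j \<otimes> (\<tau> ^^ j) (r (n - i - j))) =
        (\<Oplus>j\<in>{..n-i}. (\<tau> ^^ i) (q j \<otimes> (\<tau> ^^ j) (r (n - i - j))))"
      using cl by (intro lin_map_finsum[OF fa fa alg_hom_lin[OF \<tau>_pow]]) auto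
    then have "p i \<otimes> (\<tau> ^^ i) (\<Oplus>j\<in>{..n-i}. q j \<otimes> (\<tau> ^^ j) (r (n - i - j))) =
        (\<Oplus>j\<in>{..n-i}. p i \<otimes> (\<tau> ^^ i) (q j \<otimes> (\<tau> ^^ j) (r (n - i - j))))"
      using cl by (simp add: finsum_rdistr Pi_def)
    also have "\<dots> = (\<Oplus>j\<in>{..n-i}. ?t i (i + j))"
      using cl \<tau>'(4) by (intro finsum_cong') (auto simp: m_assoc funpow_add)
    finally show "(\<Oplus>j\<in>{..n-i}. ?t i (i + j)) =
      p i \<otimes> (\<tau> ^^ i) (\<Oplus>j\<in>{..n-i}. q j \<otimes> (\<tau> ^^ j) (r (n - i - j)))" by simp
  qed (use cl in \<open>auto intro!: finsum_closed\<close>)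
  finally show "((p \<otimes>\<^bsub>S\<^esub> q) \<otimes>\<^bsub>S\<^esub> r) n = (p \<otimes>\<^bsub>S\<^esub> (q \<otimes>\<^bsub>S\<^esub> r)) n" .
qed

lemma S_ring: "ring S"
proof (rule ringI)
  show "abelian_group S"
  proof (rule abelian_groupI)
    fix p assume p: "p \<in> carrier S"
    then have "(\<lambda>i. \<ominus> p i) \<in> carrier S" "(\<lambda>i. \<ominus> p i) \<oplus>\<^bsub>S\<^esub> p = \<zero>\<^bsub>S\<^esub>"
      by (simp_all add: S_simps up_a_inv_closed up_coeff l_neg)
    then show "\<exists>q\<in>carrier S. q \<oplus>\<^bsub>S\<^esub> p = \<zero>\<^bsub>S\<^esub>" by blast
    show "\<zero>\<^bsub>S\<^esub> \<oplus>\<^bsub>S\<^esub> p = p" using p by (simp add: S_simps up_coeff)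
    fix q assume q: "q \<in> carrier S"
    show "p \<oplus>\<^bsub>S\<^esub> q \<in> carrier S" using p q by (simp add: S_simps up_add_closed)
    show "p \<oplus>\<^bsub>S\<^esub> q = q \<oplus>\<^bsub>S\<^esub> p" using p q by (simp add: S_simps up_coeff a_comm)
    fix r assume r: "r \<in> carrier S"
    show "(p \<oplus>\<^bsub>S\<^esub> q) \<oplus>\<^bsub>S\<^esub> r = p \<oplus>\<^bsub>S\<^esub> (q \<oplus>\<^bsub>S\<^esub> r)" using p q r by (simp add: S_simps up_coeff a_assoc)
  next
    have "(\<lambda>i. \<zero>) \<in> up K" by (auto intro!: mem_upI exI)
    then show "\<zero>\<^bsub>S\<^esub> \<in> carrier S" by (simp add: S_simps)
  qed
  show "Group.monoid S"
  proof (rule monoidI)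
    fix p assume "p \<in> carrier S"
    then have cl: "p \<in> up K" "\<And>i. p i \<in> carrier K" by (auto simp: S_simps up_coeff)
    show "\<one>\<^bsub>S\<^esub> \<otimes>\<^bsub>S\<^esub> p = p"
    proof
      fix n
      have "(\<one>\<^bsub>S\<^esub> \<otimes>\<^bsub>S\<^esub> p) n = (\<Oplus>i\<in>{..n}. if i = 0 then p n else \<zero>)"
        unfolding S_simps using cl by (intro finsum_cong') auto
      also have "\<dots> = p n" using cl by (intro finsum_delta) auto
      finally show "(\<one>\<^bsub>S\<^esub> \<otimes>\<^bsub>S\<^esub> p) n = p n" .
    qed
    show "p \<otimes>\<^bsub>S\<^esub> \<one>\<^bsub>S\<^esub> = p"
    proof
      fix n
      have "(p \<otimes>\<^bsub>S\<^esub> \<one>\<^bsub>S\<^esub>) n = (\<Oplus>i\<in>{..n}. if i = n then p n else \<zero>)"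
        unfolding S_simps using cl \<tau>'(5) by (intro finsum_cong') auto
      also have "\<dots> = p n" using cl by (intro finsum_delta) auto
      finally show "(p \<otimes>\<^bsub>S\<^esub> \<one>\<^bsub>S\<^esub>) n = p n" .
    qed
  next
    show "\<one>\<^bsub>S\<^esub> \<in> carrier S" unfolding S_simps by (rule up_one_closed)
  next
    fix p q assume "p \<in> carrier S" "q \<in> carrier S"
    then show "p \<otimes>\<^bsub>S\<^esub> q \<in> carrier S" unfolding S_simps by (rule S_mult_closed)
  next
    fix p q r assume "p \<in> carrier S" "q \<in> carrier S" "r \<in> carrier S"
    then show "(p \<otimes>\<^bsub>S\<^esub> q) \<otimes>\<^bsub>S\<^esub> r = p \<otimes>\<^bsub>S\<^esub> (q \<otimes>\<^bsub>S\<^esub> r)" by (simp add: S_assoc S_simps(1))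
  qed
  fix p q r assume "p \<in> carrier S" "q \<in> carrier S" "r \<in> carrier S"
  then have cl: "p i \<in> carrier K" "q i \<in> carrier K" "r i \<in> carrier K" for i
    by (auto simp: S_simps up_coeff)
  show "(p \<oplus>\<^bsub>S\<^esub> q) \<otimes>\<^bsub>S\<^esub> r = p \<otimes>\<^bsub>S\<^esub> r \<oplus>\<^bsub>S\<^esub> q \<otimes>\<^bsub>S\<^esub> r"
  proof
    fix n show "((p \<oplus>\<^bsub>S\<^esub> q) \<otimes>\<^bsub>S\<^esub> r) n = (p \<otimes>\<^bsub>S\<^esub> r \<oplus>\<^bsub>S\<^esub> q \<otimes>\<^bsub>S\<^esub> r) n"
      unfolding S_simps using cl by (subst finsum_addf[symmetric]) (auto simp: l_distr intro!: finsum_cong')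
  qed
  show "r \<otimes>\<^bsub>S\<^esub> (p \<oplus>\<^bsub>S\<^esub> q) = r \<otimes>\<^bsub>S\<^esub> p \<oplus>\<^bsub>S\<^esub> r \<otimes>\<^bsub>S\<^esub> q"
  proof
    fix n show "(r \<otimes>\<^bsub>S\<^esub> (p \<oplus>\<^bsub>S\<^esub> q)) n = (r \<otimes>\<^bsub>S\<^esub> p \<oplus>\<^bsub>S\<^esub> r \<otimes>\<^bsub>S\<^esub> q) n"
      unfolding S_simps using cl \<tau>'(2) by (subst finsum_addf[symmetric]) (auto simp: r_distr intro!: finsum_cong')
  qed
qed

lemma S_algebra: "field_algebra F S"
proof (rule field_algebraI)
  show "field F" ..
  show "ring S" by (rule S_ring)
  fix d p assume d: "d \<in> carrier F" and "p \<in> carrier S"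
  then have p: "p \<in> up K" "\<And>i. p i \<in> carrier K" by (auto simp: S_simps up_coeff)
  obtain n where n: "bound \<zero> n p" using p(1) by blast
  have "bound \<zero> n (\<lambda>i. d \<odot> p i)" using bound.bound[OF n] d by (intro bound.intro) simp
  then show "d \<odot>\<^bsub>S\<^esub> p \<in> carrier S" unfolding S_simps using p d by (intro mem_upI) auto
  fix q assume "q \<in> carrier S"
  then have q: "\<And>i. q i \<in> carrier K" by (auto simp: S_simps up_coeff)
  show "(d \<odot>\<^bsub>S\<^esub> p) \<otimes>\<^bsub>S\<^esub> q = d \<odot>\<^bsub>S\<^esub> (p \<otimes>\<^bsub>S\<^esub> q)"
  proof
    fix n show "((d \<odot>\<^bsub>S\<^esub> p) \<otimes>\<^bsub>S\<^esub> q) n = (d \<odot>\<^bsub>S\<^esub> (p \<otimes>\<^bsub>S\<^esub> q)) n"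
      unfolding S_simps using p q d by (subst finsum_smult_ldistr) (auto intro!: finsum_cong')
  qed
  show "p \<otimes>\<^bsub>S\<^esub> (d \<odot>\<^bsub>S\<^esub> q) = d \<odot>\<^bsub>S\<^esub> (p \<otimes>\<^bsub>S\<^esub> q)"
  proof
    fix n show "(p \<otimes>\<^bsub>S\<^esub> (d \<odot>\<^bsub>S\<^esub> q)) n = (d \<odot>\<^bsub>S\<^esub> (p \<otimes>\<^bsub>S\<^esub> q)) n"
      unfolding S_simps using p q d \<tau>'(3) by (subst finsum_smult_ldistr) (auto intro!: finsum_cong')
  qed
qed (auto simp: S_simps up_coeff smult_l_distr smult_r_distr)

abbreviation mono where "mono \<equiv> skew_monom K"

lemma mono_closed [simp, intro]:
  assumes "e \<in> carrier K" shows "mono e i \<in> carrier S"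
proof -
  have "bound \<zero> i (mono e i)" by (rule bound.intro) (simp add: skew_monom_def)
  then show ?thesis using assms by (auto simp: S_simps skew_monom_def intro!: mem_upI)
qed

lemma mono_mult:
  assumes e: "e \<in> carrier K" and e': "e' \<in> carrier K"
  shows "mono e i \<otimes>\<^bsub>S\<^esub> mono e' j = mono (e \<otimes> (\<tau> ^^ i) e') (i + j)"
proof
  fix n
  have "(mono e i \<otimes>\<^bsub>S\<^esub> mono e' j) n =
      (\<Oplus>l\<in>{..n}. if l = i then (if n = i + j then e \<otimes> (\<tau> ^^ i) e' else \<zero>) else \<zero>)"
    unfolding S_simps using e e' by (intro finsum_cong') (auto simp: skew_monom_def)
  also have "\<dots> = mono (e \<otimes> (\<tau> ^^ i) e') (i + j) n"
  proof (cases "i \<le> n")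
    case True
    then show ?thesis using e e' by (subst finsum_delta) (auto simp: skew_monom_def)
  next
    case False
    then have "(\<Oplus>l\<in>{..n}. if l = i then (if n = i + j then e \<otimes> (\<tau> ^^ i) e' else \<zero>) else \<zero>) = \<zero>"
      by (intro add.finprod_one_eqI) auto
    then show ?thesis using False by (simp add: skew_monom_def)
  qed
  finally show "(mono e i \<otimes>\<^bsub>S\<^esub> mono e' j) n = mono (e \<otimes> (\<tau> ^^ i) e') (i + j) n" .
qed

lemma mono_one: "mono \<one> 0 = \<one>\<^bsub>S\<^esub>"
  by (auto simp: skew_monom_def S_simps)

lemma mono_add: "e \<in> carrier K \<Longrightarrow> e' \<in> carrier K \<Longrightarrow> mono (e \<oplus> e') i = mono e i \<oplus>\<^bsub>S\<^esub> mono e' i"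
  by (auto simp: skew_monom_def S_simps)

lemma mono_smult: "d \<in> carrier F \<Longrightarrow> e \<in> carrier K \<Longrightarrow> mono (d \<odot> e) i = d \<odot>\<^bsub>S\<^esub> mono e i"
  by (auto simp: skew_monom_def S_simps)

lemma mono_pow:
  assumes "e \<in> carrier K"
  shows "mono e 0 \<otimes>\<^bsub>S\<^esub> mono \<one> 1 [^]\<^bsub>S\<^esub> i = mono e i"
proof -
  interpret S: ring S by (rule S_ring)
  have "mono \<one> 1 [^]\<^bsub>S\<^esub> i = mono \<one> i"
    using \<tau>'(5) by (induction i) (simp_all add: mono_one mono_mult)
  then show ?thesis using assms by (simp add: mono_mult)
qed

lemma S_spanned: "spanned F S {mono e i | e i. e \<in> carrier K}"
  unfolding spanned_def
proof (intro conjI allI impI subsetI)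
  interpret S: field_algebra F S by (rule S_algebra)
  fix V p assume V: "submodule V F S" "{mono e i | e i. e \<in> carrier K} \<subseteq> V" and "p \<in> carrier S"
  have *: "p \<in> V" if "p \<in> up K" "\<And>i. i \<ge> n \<Longrightarrow> p i = \<zero>" for n p
    using that
  proof (induction n arbitrary: p)
    case 0
    then have "p = \<zero>\<^bsub>S\<^esub>" by (auto simp: S_simps)
    then show ?case using S.subspaceD(2)[OF V(1)] by simp
  next
    case (Suc n)
    let ?q = "p(n := \<zero>)"
    have q: "?q \<in> up K"
      using up_coeff[OF Suc.prems(1)] Suc.prems(2) by (auto intro!: mem_upI exI[of _ "Suc n"] bound.intro)
    have "?q \<in> V" by (rule Suc.IH[OF q]) (use Suc.prems(2) in \<open>auto simp: Suc_le_eq\<close>)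
    moreover have "mono (p n) n \<in> V" using V(2) up_coeff[OF Suc.prems(1)] by blast
    moreover have "p = ?q \<oplus>\<^bsub>S\<^esub> mono (p n) n"
      using up_coeff[OF Suc.prems(1)] by (auto simp: S_simps skew_monom_def fun_eq_iff)
    ultimately show ?case using S.subspaceD(3)[OF V(1)] by metis
  qed
  have "p \<in> up K" using \<open>p \<in> carrier S\<close> by (simp add: S_simps)
  moreover obtain n where n: "bound \<zero> n p" using \<open>p \<in> up K\<close> by blast
  ultimately show "p \<in> V" using bound.bound[OF n] by (intro *[of p "Suc n"]) (auto simp: Suc_le_eq)
qed auto

definition G where "G = mono \<one> N \<ominus>\<^bsub>S\<^esub> mono (c \<odot> \<one>) 0"

lemma G_closed: "G \<in> carrier S"
proof -
  interpret S: field_algebra F S by (rule S_algebra)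
  show ?thesis using c by (auto simp: G_def)
qed

text \<open>The constant term of \<open>G\<close> is a scalar, and the \<open>N\<close>-th power of
  the variable commutes with coefficients because \<open>\<tau> ^^ N\<close> is the identity. Hence
  \<open>G\<close> is central.\<close>

lemma mult_G:
  assumes p: "p \<in> carrier S"
  shows "p \<otimes>\<^bsub>S\<^esub> G = p \<otimes>\<^bsub>S\<^esub> mono \<one> N \<ominus>\<^bsub>S\<^esub> c \<odot>\<^bsub>S\<^esub> p"
    and "G \<otimes>\<^bsub>S\<^esub> p = p \<otimes>\<^bsub>S\<^esub> G"
proof -
  interpret S: field_algebra F S by (rule S_algebra)
  have fa: "field_algebra F S" ..
  have m: "mono (c \<odot> \<one>) 0 = c \<odot>\<^bsub>S\<^esub> \<one>\<^bsub>S\<^esub>" using c by (simp add: mono_smult mono_one)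
  show 1: "p \<otimes>\<^bsub>S\<^esub> G = p \<otimes>\<^bsub>S\<^esub> mono \<one> N \<ominus>\<^bsub>S\<^esub> c \<odot>\<^bsub>S\<^esub> p"
    unfolding G_def m using p c by (simp add: S.minus_eq S.r_distr S.r_minus)
  have 2: "G \<otimes>\<^bsub>S\<^esub> p = mono \<one> N \<otimes>\<^bsub>S\<^esub> p \<ominus>\<^bsub>S\<^esub> c \<odot>\<^bsub>S\<^esub> p"
    unfolding G_def m using p c by (simp add: S.minus_eq S.l_distr S.l_minus)
  have "mono \<one> N \<otimes>\<^bsub>S\<^esub> p = p \<otimes>\<^bsub>S\<^esub> mono \<one> N"
  proof (rule spanned_lin_map_eq[OF fa fa _ _ S_spanned _ p])
    show "(\<lambda>p. mono \<one> N \<otimes>\<^bsub>S\<^esub> p) \<in> lin_map F S S" "(\<lambda>p. p \<otimes>\<^bsub>S\<^esub> mono \<one> N) \<in> lin_map F S S"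
      by (auto intro!: lin_mapI simp: S.l_distr S.r_distr)
    fix s assume "s \<in> {mono e i | e i. e \<in> carrier K}"
    then obtain e i where "s = mono e i" "e \<in> carrier K" by blast
    then show "mono \<one> N \<otimes>\<^bsub>S\<^esub> s = s \<otimes>\<^bsub>S\<^esub> mono \<one> N"
      using \<tau>'(5) \<tau>N by (simp add: mono_mult add.commute)
  qed
  then show "G \<otimes>\<^bsub>S\<^esub> p = p \<otimes>\<^bsub>S\<^esub> G" using 1 2 by simp
qed

abbreviation J where "J \<equiv> skew_cyclic_ideal K \<tau> N c"

lemma J_ideal: "ideal J S"
proof -
  interpret S: ring S by (rule S_ring)
  have "skew_monom K \<one> N \<ominus>\<^bsub>S\<^esub> skew_monom K (c \<odot> \<one>) 0 \<in> carrier S" using G_closed by (simp add: G_def)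
  then show ?thesis unfolding skew_cyclic_ideal_def by (intro S.genideal_ideal) simp
qed

lemma G_in_J: "G \<in> J"
proof -
  interpret S: ring S by (rule S_ring)
  have "{G} \<subseteq> Idl\<^bsub>S\<^esub> {G}" using G_closed by (intro S.genideal_self) simp
  then show ?thesis by (simp add: skew_cyclic_ideal_def G_def)
qed

text \<open>As \<open>G\<close> is central, the ideal consists of the left multiples of \<open>G\<close>; the top coefficient
  of such a multiple sits in degree at least \<open>N\<close>.\<close>

lemma one_notin_J: "\<one>\<^bsub>S\<^esub> \<notin> J"
proof
  interpret S: field_algebra F S by (rule S_algebra)
  assume one: "\<one>\<^bsub>S\<^esub> \<in> J"
  let ?L = "(\<lambda>p. p \<otimes>\<^bsub>S\<^esub> G) ` carrier S"
  have fa: "field_algebra F S" ..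
  have lin: "(\<lambda>p. p \<otimes>\<^bsub>S\<^esub> G) \<in> lin_map F S S" using G_closed by (auto intro!: lin_mapI simp: S.l_distr)
  have sub: "submodule ?L F S" by (rule lin_map_image_subspace[OF fa fa lin S.carrier_subspace])
  have "ideal ?L S"
  proof (rule idealI[OF S_ring])
    show "subgroup ?L (add_monoid S)" using sub by (simp add: submodule_def)
    fix y x assume "y \<in> ?L" and x: "x \<in> carrier S"
    then obtain p where p: "p \<in> carrier S" "y = p \<otimes>\<^bsub>S\<^esub> G" by auto
    have "x \<otimes>\<^bsub>S\<^esub> y = (x \<otimes>\<^bsub>S\<^esub> p) \<otimes>\<^bsub>S\<^esub> G" using p x G_closed by (simp add: S.m_assoc)
    then show "x \<otimes>\<^bsub>S\<^esub> y \<in> ?L" using p x by auto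
    have "y \<otimes>\<^bsub>S\<^esub> x = (p \<otimes>\<^bsub>S\<^esub> x) \<otimes>\<^bsub>S\<^esub> G"
      using p x G_closed mult_G(2)[OF x] by (simp add: S.m_assoc)
    then show "y \<otimes>\<^bsub>S\<^esub> x \<in> ?L" using p x by auto
  qed
  moreover have "G \<in> ?L" using G_closed by (intro image_eqI[of _ _ "\<one>\<^bsub>S\<^esub>"]) auto
  ultimately have "J \<subseteq> ?L"
    unfolding skew_cyclic_ideal_def using S.genideal_minimal[of ?L "{G}"] by (simp add: G_def)
  then obtain p where p: "p \<in> carrier S" "\<one>\<^bsub>S\<^esub> = p \<otimes>\<^bsub>S\<^esub> G" using one by auto
  have pc: "p i \<in> carrier K" for i using p(1) by (auto simp: S_simps up_coeff)
  have coeff: "(p \<otimes>\<^bsub>S\<^esub> G) (l + N) = p l \<ominus> c \<odot> p (l + N)" for l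
  proof -
    have "(p \<otimes>\<^bsub>S\<^esub> mono \<one> N) (l + N) = (\<Oplus>i\<in>{..l + N}. if i = l then p l else \<zero>)"
      unfolding S_simps using pc \<tau>'(5) by (intro finsum_cong') (auto simp: skew_monom_def)
    also have "\<dots> = p l" using pc by (intro finsum_delta) auto
    finally have "(p \<otimes>\<^bsub>S\<^esub> mono \<one> N) (l + N) = p l" .
    moreover have "\<ominus>\<^bsub>S\<^esub> q = (\<lambda>i. \<ominus> q i)" if "q \<in> carrier S" for q
      using that by (intro S.minus_equality) (auto simp: S_simps up_coeff l_neg up_a_inv_closed)
    moreover from this[of "c \<odot>\<^bsub>S\<^esub> p"]
    have neg: "\<ominus>\<^bsub>S\<^esub> (c \<odot>\<^bsub>S\<^esub> p) = (\<lambda>i. \<ominus> (c \<odot>\<^bsub>S\<^esub> p) i)" using p(1) c by simp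
    ultimately have "((p \<otimes>\<^bsub>S\<^esub> mono \<one> N) \<oplus>\<^bsub>S\<^esub> (\<ominus>\<^bsub>S\<^esub> (c \<odot>\<^bsub>S\<^esub> p))) (l + N) = p l \<ominus> c \<odot> p (l + N)"
      unfolding S_simps(2) neg S_simps(6) minus_eq by simp
    then show ?thesis unfolding mult_G(1)[OF p(1)] S.minus_eq .
  qed
  have "p l = \<zero>" for l
  proof -
    obtain n where n: "bound \<zero> n p" using p(1) by (auto simp: S_simps)
    \<comment> \<open>Comparing coefficients in degree \<open>l + N > 0\<close> gives the recursion
      \<open>p l = c \<odot> p (l + N)\<close>. It starts above the degree bound \<open>n\<close>
      and descends in steps of \<open>N\<close>.\<close>
    have *: "p l = \<zero>" if "n < l + N * i" for i l
      using that
    proof (induction i arbitrary: l)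
      case 0
      then show ?case using bound.bound[OF n] by simp
    next
      case (Suc i)
      have "p (l + N) = \<zero>" by (rule Suc.IH) (use Suc.prems in \<open>simp add: algebra_simps\<close>)
      moreover have "p l \<ominus> c \<odot> p (l + N) = \<zero>"
        using N unfolding coeff[symmetric] p(2)[symmetric] by (simp add: S_simps(5))
      ultimately show ?case using pc c by (simp add: minus_eq)
    qed
    have "Suc n \<le> N * Suc n" using N by (cases N) auto
    then show "p l = \<zero>" using *[of l "Suc n"] by linarith
  qed
  then have "p = \<zero>\<^bsub>S\<^esub>" by (auto simp: S_simps)
  then have "\<one>\<^bsub>S\<^esub> = \<zero>\<^bsub>S\<^esub>" using p(2) G_closed by simp
  from fun_cong[OF this, of 0] show False using nontriv by (simp add: S_simps)
qed

sublocale Q: quotient_algebra F S J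
  using S_algebra J_ideal by (simp add: quotient_algebra_def)

abbreviation A where "A \<equiv> skew_cyclic K \<tau> N c"
abbreviation \<iota> where "\<iota> \<equiv> skew_const K \<tau> N c"
abbreviation H where "H \<equiv> skew_gen K \<tau> N c"

lemma A_algebra: "field_algebra F A"
  unfolding skew_cyclic_def by (rule Q.Q_algebra)

lemma \<iota>_def': "\<iota> e = Q.proj (mono e 0)"
  by (simp add: skew_const_def)

lemma H_def': "H = Q.proj (mono \<one> 1)"
  by (simp add: skew_gen_def)

lemma proj: "Q.proj \<in> alg_hom F S A"
  unfolding skew_cyclic_def by (rule Q.proj_hom)

lemma \<iota>_hom: "\<iota> \<in> alg_hom F K A"
  using alg_homD[OF proj]
  by (intro alg_homI lin_mapI) (auto simp: \<iota>_def' mono_add mono_smult mono_one mono_mult[of _ _ 0 0, simplified, symmetric])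

lemma H_closed: "H \<in> carrier A"
  unfolding H_def' by (intro alg_homD(1)[OF proj]) auto

lemma H_\<iota>: "e \<in> carrier K \<Longrightarrow> H \<otimes>\<^bsub>A\<^esub> \<iota> e = \<iota> (\<tau> e) \<otimes>\<^bsub>A\<^esub> H"
  using \<tau>'(1)[of e 1] \<tau>'(5)[of 0] unfolding \<iota>_def' H_def'
  by (simp flip: alg_homD(4)[OF proj] add: mono_mult)

lemma proj_mono: "e \<in> carrier K \<Longrightarrow> Q.proj (mono e i) = \<iota> e \<otimes>\<^bsub>A\<^esub> H [^]\<^bsub>A\<^esub> i"
proof -
  assume e: "e \<in> carrier K"
  have rings: "ring S" "ring A"
    using S_ring field_algebra.axioms(1)[OF A_algebra] assoc_algebra.axioms(2) by auto
  interpret S: ring S by (rule S_ring)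
  have "Q.proj (mono e i) = Q.proj (mono e 0 \<otimes>\<^bsub>S\<^esub> mono \<one> 1 [^]\<^bsub>S\<^esub> i)" by (simp only: mono_pow[OF e])
  also have "\<dots> = Q.proj (mono e 0) \<otimes>\<^bsub>A\<^esub> Q.proj (mono \<one> 1) [^]\<^bsub>A\<^esub> i"
    using e by (subst alg_homD(4)[OF proj]) (auto simp: alg_hom_pow[OF proj rings])
  finally show ?thesis unfolding \<iota>_def' H_def' .
qed

lemma H_N: "H [^]\<^bsub>A\<^esub> N = c \<odot>\<^bsub>A\<^esub> \<one>\<^bsub>A\<^esub>"
proof -
  interpret A: field_algebra F A by (rule A_algebra)
  have "Q.proj (mono \<one> N) = Q.proj (mono (c \<odot> \<one>) 0)"
    using G_in_J c by (subst Q.proj_eq_iff) (auto simp: G_def)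
  then have "\<iota> \<one> \<otimes>\<^bsub>A\<^esub> H [^]\<^bsub>A\<^esub> N = \<iota> (c \<odot> \<one>)" using proj_mono[of \<one> N] by (simp add: \<iota>_def')
  then show ?thesis using alg_homD[OF \<iota>_hom] c H_closed by simp
qed

lemma A_nontrivial: "\<one>\<^bsub>A\<^esub> \<noteq> \<zero>\<^bsub>A\<^esub>"
  unfolding skew_cyclic_def by (rule Q.Q_nontrivial[OF one_notin_J])

lemma A_spanned: "spanned F A {\<iota> e \<otimes>\<^bsub>A\<^esub> H [^]\<^bsub>A\<^esub> i | e (i::nat). e \<in> carrier K}"
proof -
  have "spanned F A (Q.proj ` {mono e i | e i. e \<in> carrier K})"
    unfolding skew_cyclic_def by (rule Q.Q_spanned[OF S_spanned])
  also have "Q.proj ` {mono e i | e i. e \<in> carrier K} = {\<iota> e \<otimes>\<^bsub>A\<^esub> H [^]\<^bsub>A\<^esub> i | e (i::nat). e \<in> carrier K}"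
  proof (intro equalityI subsetI)
    fix y assume "y \<in> {\<iota> e \<otimes>\<^bsub>A\<^esub> H [^]\<^bsub>A\<^esub> i | e (i::nat). e \<in> carrier K}"
    then obtain e and i :: nat where e: "e \<in> carrier K" "y = \<iota> e \<otimes>\<^bsub>A\<^esub> H [^]\<^bsub>A\<^esub> i" by blast
    show "y \<in> Q.proj ` {mono e i | e i. e \<in> carrier K}"
      by (rule image_eqI[of _ _ "mono e i"]) (use e proj_mono in auto)
  qed (use proj_mono in force)
  finally show ?thesis .
qed

end

section \<open>The algebra \<open>F[X]/(X^N - \<alpha>)\<close>\<close>

lemma (in ideal) a_r_coset_image:
  assumes "\<And>x y. x \<in> carrier R \<Longrightarrow> y \<in> carrier R \<Longrightarrow> f (x \<oplus> y) = f x \<oplus> f y" "f ` I = I" "x \<in> carrier R"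
  shows "f ` (I +> x) = I +> f x"
proof -
  have "f ` (I +> x) = (\<lambda>h. f (h \<oplus> x)) ` I" by (auto simp: a_r_coset_def')
  also have "\<dots> = (\<lambda>h. f h \<oplus> f x) ` I" using assms(1,3) Icarr by (intro image_cong) auto
  also have "\<dots> = (\<lambda>h. h \<oplus> f x) ` (f ` I)" by (simp add: image_image)
  finally show ?thesis unfolding assms(2) by (auto simp: a_r_coset_def')
qed

lemma UP_carrier: "carrier (UP R) = up R"
  by (simp add: UP_def)

lemma UP_coeff: "p \<in> up R \<Longrightarrow> up_ring.coeff (UP R) p = p"
  by (simp add: UP_def)

locale kummer_poly = field F
  for F :: "('f, 'r) ring_scheme" (structure) +
  fixes N :: nat and \<alpha> :: 'f
  assumes N: "N > 0" and \<alpha>: "\<alpha> \<in> carrier F"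
begin

abbreviation P where "P \<equiv> UP F"

sublocale U: UP_domain F "UP F"
  by unfold_locales

lemma P_algebra: "field_algebra F P"
proof (rule field_algebraI)
  show "field F" ..
  show "ring P" ..
  fix c x y assume "c \<in> carrier F" "x \<in> carrier P" "y \<in> carrier P"
  then show "x \<otimes>\<^bsub>P\<^esub> (c \<odot>\<^bsub>P\<^esub> y) = c \<odot>\<^bsub>P\<^esub> (x \<otimes>\<^bsub>P\<^esub> y)"
    using U.smult_assoc2[of c y x] by (simp add: U.P.m_comm)
qed (simp_all add: U.smult_assoc2 U.smult_l_distr U.smult_r_distr U.smult_assoc1)

lemma P_spanned: "spanned F P (range (up_ring.monom P \<one>))"
  unfolding spanned_def
proof (intro conjI allI impI subsetI)
  interpret P: field_algebra F P by (rule P_algebra)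
  fix V p assume V: "submodule V F P" "range (up_ring.monom P \<one>) \<subseteq> V" and p: "p \<in> carrier P"
  have "up_ring.monom P (up_ring.coeff P p i) i \<in> V" for i
  proof -
    have "up_ring.monom P (up_ring.coeff P p i) i = up_ring.coeff P p i \<odot>\<^bsub>P\<^esub> up_ring.monom P \<one> i"
      using U.monom_mult_smult[of "up_ring.coeff P p i" \<one> i] p by simp
    moreover have "up_ring.monom P \<one> i \<in> V" using V(2) by (rule subsetD) simp
    ultimately show ?thesis using P.subspaceD(4)[OF V(1)] p by simp
  qed
  then have "(\<Oplus>\<^bsub>P\<^esub> i \<in> {..deg F p}. up_ring.monom P (up_ring.coeff P p i) i) \<in> V"
    by (intro P.subspace_finsum[OF V(1)]) auto
  then show "p \<in> V" using U.up_repr[OF p] by simp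
qed auto

definition G where "G = up_ring.monom P \<one> N \<ominus>\<^bsub>P\<^esub> up_ring.monom P \<alpha> 0"

lemma G_closed: "G \<in> carrier P"
  using \<alpha> by (simp add: G_def)

abbreviation I where "I \<equiv> kummer_ideal F N \<alpha>"

lemma I_eq: "I = {p \<otimes>\<^bsub>P\<^esub> G | p. p \<in> carrier P}"
  using U.P.cgenideal_eq_genideal[OF G_closed] by (simp add: kummer_ideal_def G_def cgenideal_def)

lemma I_ideal: "ideal I P"
  using U.P.cgenideal_ideal[OF G_closed] I_eq by (simp add: cgenideal_def)

sublocale Q: quotient_algebra F P I
  using P_algebra I_ideal by (simp add: quotient_algebra_def)

abbreviation K where "K \<equiv> kummer F N \<alpha>"
abbreviation cls where "cls \<equiv> kummer_class F N \<alpha>"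
abbreviation x where "x \<equiv> kummer_gen F N \<alpha>"

lemma K_algebra: "field_algebra F K"
  unfolding kummer_def by (rule Q.Q_algebra)

lemma cls_hom: "cls \<in> alg_hom F P K"
  using Q.proj_hom unfolding kummer_def kummer_class_def .

lemma K_carrier: "carrier K = cls ` carrier P"
  using Q.Q_carrier unfolding kummer_def kummer_class_def .

lemma K_cring: "cring K"
proof -
  interpret K: field_algebra F K by (rule K_algebra)
  show ?thesis
  proof
    fix y z assume "y \<in> carrier K" "z \<in> carrier K"
    then obtain p r where "p \<in> carrier P" "r \<in> carrier P" "y = cls p" "z = cls r"
      by (auto simp: K_carrier)
    then show "y \<otimes>\<^bsub>K\<^esub> z = z \<otimes>\<^bsub>K\<^esub> y"
      using U.P.m_comm[of p r] by (simp flip: alg_homD(4)[OF cls_hom])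
  qed
qed

lemma x_closed: "x \<in> carrier K"
  unfolding kummer_gen_def by (intro alg_homD(1)[OF cls_hom]) simp

lemma cls_monom: "cls (up_ring.monom P \<one> i) = x [^]\<^bsub>K\<^esub> i"
proof -
  interpret K: field_algebra F K by (rule K_algebra)
  have "up_ring.monom P \<one> i = up_ring.monom P \<one> 1 [^]\<^bsub>P\<^esub> i" by (simp add: U.monom_pow)
  moreover have "ring P" "ring K" by unfold_locales
  ultimately show ?thesis
    unfolding kummer_gen_def by (simp add: alg_hom_pow[OF cls_hom])
qed

lemma cls_G: "cls G = \<zero>\<^bsub>K\<^esub>"
proof -
  have "G \<in> I" unfolding I_eq using G_closed by (auto intro!: exI[of _ "\<one>\<^bsub>P\<^esub>"])
  then show ?thesis
    unfolding kummer_def kummer_class_def using Q.proj_zero_iff[OF G_closed] by simp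
qed

lemma cls_G': 
  assumes "f \<in> alg_hom F P B" "field_algebra F B"
  shows "f G = f (up_ring.monom P \<one> 1) [^]\<^bsub>B\<^esub> N \<ominus>\<^bsub>B\<^esub> \<alpha> \<odot>\<^bsub>B\<^esub> \<one>\<^bsub>B\<^esub>"
proof -
  interpret B: field_algebra F B by fact
  have r: "ring P" "ring B" by unfold_locales
  have "up_ring.monom P \<alpha> 0 = \<alpha> \<odot>\<^bsub>P\<^esub> \<one>\<^bsub>P\<^esub>"
    using U.monom_mult_smult[of \<alpha> \<one> 0] \<alpha> by simp
  moreover have "up_ring.monom P \<one> N = up_ring.monom P \<one> 1 [^]\<^bsub>P\<^esub> N" by (simp add: U.monom_pow)
  ultimately show ?thesis
    unfolding G_def
    using alg_homD[OF assms(1)] lin_map_minus[OF P_algebra assms(2) alg_hom_lin[OF assms(1)]] \<alpha>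
    by (simp add: alg_hom_pow[OF assms(1) r])
qed

lemma x_pow_N: "x [^]\<^bsub>K\<^esub> N = \<alpha> \<odot>\<^bsub>K\<^esub> \<one>\<^bsub>K\<^esub>"
proof -
  interpret K: field_algebra F K by (rule K_algebra)
  have "x [^]\<^bsub>K\<^esub> N \<ominus>\<^bsub>K\<^esub> \<alpha> \<odot>\<^bsub>K\<^esub> \<one>\<^bsub>K\<^esub> = \<zero>\<^bsub>K\<^esub>"
    using cls_G'[OF cls_hom K_algebra] cls_G cls_monom[of 1] x_closed by simp
  then show ?thesis using x_closed \<alpha> by simp
qed

lemma K_spanned: "spanned F K (range (\<lambda>i::nat. x [^]\<^bsub>K\<^esub> i))"
proof -
  have "spanned F K (cls ` range (up_ring.monom P \<one>))"
    unfolding kummer_def kummer_class_def by (rule Q.Q_spanned[OF P_spanned])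
  then show ?thesis by (simp add: image_image cls_monom)
qed

text \<open>If \<open>\<one>\<close> were \<open>p\<close> times \<open>G\<close>, the coefficient
  in degree \<open>deg F p + N\<close> would force the leading coefficient of \<open>p\<close> to
  vanish.\<close>

lemma K_nontrivial: "\<one>\<^bsub>K\<^esub> \<noteq> \<zero>\<^bsub>K\<^esub>"
  unfolding kummer_def
proof (rule Q.Q_nontrivial, rule notI)
  assume "\<one>\<^bsub>P\<^esub> \<in> I"
  then obtain p where p: "p \<in> carrier P" "\<one>\<^bsub>P\<^esub> = p \<otimes>\<^bsub>P\<^esub> G" unfolding I_eq by blast
  let ?d = "deg F p"
  have "p \<otimes>\<^bsub>P\<^esub> G = up_ring.monom P \<one> N \<otimes>\<^bsub>P\<^esub> p \<ominus>\<^bsub>P\<^esub> \<alpha> \<odot>\<^bsub>P\<^esub> p"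
    using p \<alpha> U.monom_mult_is_smult[OF \<alpha> p(1)]
    by (simp add: G_def U.P.minus_eq U.P.r_distr U.P.r_minus U.P.m_comm)
  then have "up_ring.coeff P \<one>\<^bsub>P\<^esub> (?d + N) = up_ring.coeff P p ?d \<ominus> \<alpha> \<otimes> up_ring.coeff P p (?d + N)"
    using p \<alpha> U.coeff_monom_mult[of \<one> p N ?d] by simp
  then have "up_ring.coeff P p ?d = \<zero>"
    using N p(1) \<alpha> U.deg_aboveD[of p "?d + N"] by (simp add: minus_eq)
  then have "p = \<zero>\<^bsub>P\<^esub>" using U.lcoeff_nonzero2[OF p(1)] by blast
  then have "\<one>\<^bsub>P\<^esub> = \<zero>\<^bsub>P\<^esub>" using p(2) G_closed by simp
  then show False by simp
qed

section \<open>The substitution that multiplies the variable by a constant\<close>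

definition scale where "scale c p = (\<lambda>i::nat. c [^] i \<otimes> p i)"

lemma P_coeff: "p \<in> carrier P \<Longrightarrow> up_ring.coeff P p = p"
  using UP_coeff by (simp only: UP_carrier)

lemma scale_closed:
  assumes "c \<in> carrier F" "p \<in> carrier P"
  shows "scale c p \<in> carrier P"
proof -
  have p: "p \<in> up F" using assms(2) by (simp only: UP_carrier)
  obtain n where n: "bound \<zero> n p" using p by blast
  have "bound \<zero> n (scale c p)" using bound.bound[OF n] assms(1) by (intro bound.intro) (simp add: scale_def)
  moreover have "scale c p i \<in> carrier F" for i using assms(1) mem_upD[OF p] by (simp add: scale_def)
  ultimately have "scale c p \<in> up F" by blast
  then show ?thesis by (simp only: UP_carrier)
qed

lemma scale_coeff:
  "c \<in> carrier F \<Longrightarrow> p \<in> carrier P \<Longrightarrow> up_ring.coeff P (scale c p) i = c [^] i \<otimes> up_ring.coeff P p i"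
  using P_coeff[OF scale_closed[of c p]] P_coeff[of p] by (simp add: scale_def)

lemma scale_hom:
  assumes c: "c \<in> carrier F"
  shows "scale c \<in> alg_hom F P P"
proof (rule alg_homI[OF lin_mapI])
  fix p r assume p: "p \<in> carrier P" and r: "r \<in> carrier P"
  note cl = scale_closed[OF c]
  show "scale c p \<in> carrier P" by (rule cl[OF p])
  show "scale c (p \<oplus>\<^bsub>P\<^esub> r) = scale c p \<oplus>\<^bsub>P\<^esub> scale c r"
    by (rule U.up_eqI) (use c p r cl in \<open>simp_all add: scale_coeff r_distr\<close>)
  show "scale c (d \<odot>\<^bsub>P\<^esub> p) = d \<odot>\<^bsub>P\<^esub> scale c p" if d: "d \<in> carrier F" for d
    by (rule U.up_eqI) (use c d p cl in \<open>simp_all add: scale_coeff m_lcomm\<close>)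
  show "scale c (p \<otimes>\<^bsub>P\<^esub> r) = scale c p \<otimes>\<^bsub>P\<^esub> scale c r"
  proof (rule U.up_eqI)
    fix n
    have "up_ring.coeff P (scale c p \<otimes>\<^bsub>P\<^esub> scale c r) n =
        (\<Oplus>i\<in>{..n}. c [^] n \<otimes> (up_ring.coeff P p i \<otimes> up_ring.coeff P r (n - i)))"
      using c p r cl
    proof (subst U.coeff_mult, simp_all, intro finsum_cong', simp_all)
      fix i assume i: "i \<le> n"
      have "c [^] n = c [^] i \<otimes> c [^] (n - i)" using i c by (simp add: nat_pow_mult)
      then show "up_ring.coeff P (scale c p) i \<otimes> up_ring.coeff P (scale c r) (n - i) =
          c [^] n \<otimes> (up_ring.coeff P p i \<otimes> up_ring.coeff P r (n - i))"
        using c p r by (simp add: scale_coeff m_ac)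
    qed
    also have "\<dots> = c [^] n \<otimes> (\<Oplus>i\<in>{..n}. up_ring.coeff P p i \<otimes> up_ring.coeff P r (n - i))"
      using c p r by (intro finsum_rdistr[symmetric]) auto
    finally show "up_ring.coeff P (scale c (p \<otimes>\<^bsub>P\<^esub> r)) n = up_ring.coeff P (scale c p \<otimes>\<^bsub>P\<^esub> scale c r) n"
      using c p r by (simp add: scale_coeff)
  qed (use p r cl in simp_all)
next
  show "scale c \<one>\<^bsub>P\<^esub> = \<one>\<^bsub>P\<^esub>"
    by (rule U.up_eqI) (use c scale_closed[OF c] in \<open>simp_all add: scale_coeff\<close>)
qed

lemma scale_monom: "c \<in> carrier F \<Longrightarrow> scale c (up_ring.monom P \<one> i) = c [^] i \<odot>\<^bsub>P\<^esub> up_ring.monom P \<one> i"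
  by (rule U.up_eqI) (use scale_closed in \<open>simp_all add: scale_coeff\<close>)

lemma scale_scale:
  assumes "c \<in> carrier F" "d \<in> carrier F" "c \<otimes> d = \<one>" "p \<in> carrier P"
  shows "scale c (scale d p) = p"
proof (rule U.up_eqI)
  fix n
  have "up_ring.coeff P (scale c (scale d p)) n = (c \<otimes> d) [^] n \<otimes> up_ring.coeff P p n"
    using assms(1,2,4) scale_closed by (simp add: scale_coeff nat_pow_distrib m_assoc)
  then show "up_ring.coeff P (scale c (scale d p)) n = up_ring.coeff P p n" using assms by simp
qed (use assms scale_closed in auto)

lemma scale_I:
  assumes c: "c \<in> carrier F" "c [^] N = \<one>"
  shows "scale c ` I \<subseteq> I"
proof
  fix y assume "y \<in> scale c ` I"
  then obtain p where p: "p \<in> carrier P" "y = scale c (p \<otimes>\<^bsub>P\<^esub> G)" unfolding I_eq by blast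
  note s = alg_homD[OF scale_hom[OF c(1)]]
  have "up_ring.monom P \<alpha> 0 = \<alpha> \<odot>\<^bsub>P\<^esub> up_ring.monom P \<one> 0"
    using U.monom_mult_smult[of \<alpha> \<one> 0] \<alpha> by simp
  then have "scale c G = G"
    unfolding G_def using lin_map_minus[OF P_algebra P_algebra alg_hom_lin[OF scale_hom[OF c(1)]]] \<alpha> c s(3,5)
    by (simp add: scale_monom)
  then have "y = scale c p \<otimes>\<^bsub>P\<^esub> G" using p s(4) G_closed by simp
  then show "y \<in> I" unfolding I_eq using s(1) p(1) by blast
qed

text \<open>\<open>scale_aut\<close> takes images of cosets, so the substitution must map the ideal
  onto itself and not merely into it; the reverse inclusion comes from scaling by the inverse of
  \<open>c\<close>.\<close>

lemma scale_aut_cls: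
  assumes c: "c \<in> carrier F" "c [^] N = \<one>" and p: "p \<in> carrier P"
  shows "scale_aut F c (cls p) = cls (scale c p)"
proof -
  have "scale_aut F c S = scale c ` S" for S by (simp add: scale_aut_def scale_def)
  moreover have "scale c ` I = I"
  proof
    show "scale c ` I \<subseteq> I" by (rule scale_I[OF c])
    have "c \<noteq> \<zero>" using c N by (auto simp: nat_pow_zero)
    then have u: "c \<in> Units F" using c by (simp add: field_Units)
    have d: "inv c \<in> carrier F" "c \<otimes> inv c = \<one>" using u by simp_all
    have "(c \<otimes> inv c) [^] N = \<one>" unfolding d(2) by simp
    then have "inv c [^] N = \<one>" using c d(1) by (simp add: nat_pow_distrib)
    then have "scale (inv c) ` I \<subseteq> I" by (rule scale_I[OF d(1)])
    moreover have "y = scale c (scale (inv c) y)" if "y \<in> I" for y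
      using scale_scale[OF c(1) d] Q.Icarr[OF that] by simp
    ultimately show "I \<subseteq> scale c ` I" by blast
  qed
  ultimately show ?thesis
    unfolding kummer_class_def
    using Q.a_r_coset_image[of "scale c" p] alg_homD(2)[OF scale_hom[OF c(1)]] p by simp
qed

lemma scale_aut_hom:
  assumes c: "c \<in> carrier F" "c [^] N = \<one>"
  shows "scale_aut F c \<in> alg_hom F K K" "scale_aut F c x = c \<odot>\<^bsub>K\<^esub> x"
proof -
  note s = alg_homD[OF scale_hom[OF c(1)]] and k = alg_homD[OF cls_hom] and sc = scale_aut_cls[OF c]
  show "scale_aut F c \<in> alg_hom F K K"
  proof (rule alg_homI[OF lin_mapI])
    fix y z assume "y \<in> carrier K" "z \<in> carrier K"
    then obtain p r where pr: "p \<in> carrier P" "r \<in> carrier P" "y = cls p" "z = cls r"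
      by (auto simp: K_carrier)
    show "scale_aut F c y \<in> carrier K" using pr s k sc by simp
    show "scale_aut F c (y \<oplus>\<^bsub>K\<^esub> z) = scale_aut F c y \<oplus>\<^bsub>K\<^esub> scale_aut F c z"
      using pr s sc by (simp flip: k(2))
    show "scale_aut F c (y \<otimes>\<^bsub>K\<^esub> z) = scale_aut F c y \<otimes>\<^bsub>K\<^esub> scale_aut F c z"
      using pr s sc by (simp flip: k(4))
    fix d assume "d \<in> carrier F"
    then show "scale_aut F c (d \<odot>\<^bsub>K\<^esub> y) = d \<odot>\<^bsub>K\<^esub> scale_aut F c y"
      using pr s sc by (simp flip: k(3))
  next
    show "scale_aut F c \<one>\<^bsub>K\<^esub> = \<one>\<^bsub>K\<^esub>" using sc[of "\<one>\<^bsub>P\<^esub>"] s(5) k(5) by simp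
  qed
  show "scale_aut F c x = c \<odot>\<^bsub>K\<^esub> x"
    unfolding kummer_gen_def using sc[of "up_ring.monom P \<one> 1"] scale_monom[OF c(1), of 1] k(3) c by simp
qed

text \<open>The hypothesis \<open>ann\<close> says that the relation of the smaller quotient
  annihilates \<open>e0\<close>. Representatives of a class differ by multiples of \<open>G\<close>,
  so all have the same product with \<open>e0\<close>, and \<open>the_elem\<close> meets a
  singleton.\<close>

lemma component_embed_cls:
  assumes E: "kummer_poly F M a" and e0: "e0 \<in> carrier (kummer F M a)"
    and ann: "(kummer_gen F M a [^]\<^bsub>kummer F M a\<^esub> N \<ominus>\<^bsub>kummer F M a\<^esub> \<alpha> \<odot>\<^bsub>kummer F M a\<^esub> \<one>\<^bsub>kummer F M a\<^esub>)
      \<otimes>\<^bsub>kummer F M a\<^esub> e0 = \<zero>\<^bsub>kummer F M a\<^esub>"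
    and p: "p \<in> carrier P"
  shows "component_embed F M a e0 (cls p) = kummer_class F M a p \<otimes>\<^bsub>kummer F M a\<^esub> e0"
proof -
  interpret E: kummer_poly F M a by fact
  interpret EK: field_algebra F "kummer F M a" by (rule E.K_algebra)
  note k = alg_homD[OF E.cls_hom]
  have G0: "E.cls G \<otimes>\<^bsub>E.K\<^esub> e0 = \<zero>\<^bsub>E.K\<^esub>"
    using cls_G'[OF E.cls_hom E.K_algebra] ann by (simp add: kummer_gen_def)
  have "E.cls r \<otimes>\<^bsub>E.K\<^esub> e0 = E.cls p \<otimes>\<^bsub>E.K\<^esub> e0" if r: "r \<in> cls p" for r
  proof -
    obtain h where h: "h \<in> I" "r = h \<oplus>\<^bsub>P\<^esub> p" using r by (auto simp: kummer_class_def a_r_coset_def')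
    obtain t where t: "t \<in> carrier P" "h = t \<otimes>\<^bsub>P\<^esub> G" using h(1) unfolding I_eq by blast
    have "E.cls h \<otimes>\<^bsub>E.K\<^esub> e0 = \<zero>\<^bsub>E.K\<^esub>"
      using t k(1,4) G_closed G0 e0 by (simp add: EK.m_assoc)
    then show ?thesis
      using h(2) Q.Icarr[OF h(1)] p k(1,2) e0 by (simp add: EK.l_distr)
  qed
  moreover have "p \<in> cls p" unfolding kummer_class_def by (rule Q.a_rcos_self[OF p])
  ultimately have "(\<lambda>r. E.cls r \<otimes>\<^bsub>E.K\<^esub> e0) ` cls p = {E.cls p \<otimes>\<^bsub>E.K\<^esub> e0}" by blast
  then show ?thesis by (simp add: component_embed_def)
qed

end

section \<open>Kummer algebras and their cyclic algebras\<close>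

text \<open>Kummer quotients up to isomorphism, described by a generator so that their images are
  covered too. The sign in \<open>\<tau>\<close> is chosen such that
  \<open>H y = \<tau>(y) H\<close> turns into the relation \<open>v u = \<zeta> u v\<close> of a
  symbol pair with \<open>u = H\<close> and \<open>v = y\<close>.\<close>

locale kummer_algebra = field_algebra F K + cring K
  for F :: "('f, 'r) ring_scheme" and K :: "('f, 'k, 'x) module_scheme" (structure) +
  fixes N :: nat and \<zeta> \<alpha> :: 'f and y :: 'k and \<tau> :: "'k \<Rightarrow> 'k"
  assumes \<zeta>: "primitive_root_of_unity F N \<zeta>"
    and \<alpha>: "\<alpha> \<in> carrier F" "\<alpha> \<noteq> \<zero>\<^bsub>F\<^esub>"
    and y: "y \<in> carrier K" "y [^] N = \<alpha> \<odot> \<one>"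
    and nontriv: "\<one> \<noteq> \<zero>"
    and span: "spanned F K (range (\<lambda>i::nat. y [^] i))"
    and \<tau>: "\<tau> \<in> alg_hom F K K" "\<tau> y = inv\<^bsub>F\<^esub> \<zeta> \<odot> y"
begin

lemmas \<zeta>D = K.primitive_rootD[OF \<zeta>]

lemma \<zeta>i: "primitive_root_of_unity F N (inv\<^bsub>F\<^esub> \<zeta>)"
  by (rule K.primitive_root_inverse[OF \<zeta>])

lemmas \<zeta>iD = K.primitive_rootD[OF \<zeta>i]

lemma fa: "field_algebra F K" ..
lemma rK: "ring K" ..

lemma \<tau>_pow_hom: "\<tau> ^^ i \<in> alg_hom F K K"
proof (induction i)
  case 0
  show ?case by (auto intro!: alg_homI lin_mapI)
next
  case (Suc i)
  show ?case using alg_hom_comp[OF Suc \<tau>(1)] by (simp add: comp_def)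
qed

lemma \<tau>_pow_y: "(\<tau> ^^ i) y = (inv\<^bsub>F\<^esub> \<zeta>) [^]\<^bsub>F\<^esub> i \<odot> y"
  using y(1) \<zeta>iD(1) \<tau>(2) alg_homD(3)[OF \<tau>(1)]
  by (induction i) (simp_all add: R.m_comm)

lemma \<tau>_pow_ypow: "(\<tau> ^^ i) (y [^] (j::nat)) = (inv\<^bsub>F\<^esub> \<zeta>) [^]\<^bsub>F\<^esub> (i * j) \<odot> y [^] j"
  using y(1) \<zeta>iD(1)
  by (simp add: alg_hom_pow[OF \<tau>_pow_hom rK rK] \<tau>_pow_y smult_pow R.nat_pow_pow)

lemma \<tau>_order: "e \<in> carrier K \<Longrightarrow> (\<tau> ^^ N) e = e"
proof (rule spanned_lin_map_eq[OF fa fa alg_hom_lin[OF \<tau>_pow_hom] _ span])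
  show "(\<lambda>e. e) \<in> lin_map F K K" by (auto intro: lin_mapI)
  fix s assume "s \<in> range (\<lambda>i::nat. y [^] i)"
  then show "(\<tau> ^^ N) s = s"
    using y(1) \<zeta>iD(1,3) by (auto simp: \<tau>_pow_ypow simp flip: R.nat_pow_pow)
qed

lemma ypow_mod: "y [^] (i::nat) = \<alpha> [^]\<^bsub>F\<^esub> (i div N) \<odot> y [^] (i mod N)"
proof -
  have "y [^] i = y [^] (N * (i div N) + i mod N)" by simp
  also have "\<dots> = (y [^] N) [^] (i div N) \<otimes> y [^] (i mod N)"
    using y(1) by (metis nat_pow_mult nat_pow_pow)
  also have "\<dots> = \<alpha> [^]\<^bsub>F\<^esub> (i div N) \<odot> y [^] (i mod N)"
    using y \<alpha> by (simp add: smult_pow)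
  finally show ?thesis .
qed

lemma ypow_unit: "y [^] (i::nat) \<in> Units K"
proof -
  have a: "\<alpha> \<in> Units F" "inv\<^bsub>F\<^esub> \<alpha> \<in> carrier F" using \<alpha> by (auto simp: K.field_Units)
  obtain n where n: "N = Suc n" using \<zeta>D(2) by (cases N) auto
  have "y \<otimes> y [^] n = \<alpha> \<odot> \<one>" using y nat_pow_Suc2[OF y(1), of n] by (simp add: n)
  then have "y \<otimes> (inv\<^bsub>F\<^esub> \<alpha> \<odot> y [^] n) = \<one>" using y(1) a \<alpha> by simp
  then have "y \<in> Units K" using y(1) a unit_factor[of y "inv\<^bsub>F\<^esub> \<alpha> \<odot> y [^] n"] by simp
  then show ?thesis by (rule Units_pow_closed)
qed

text \<open>The powers of \<open>y\<close> below \<open>N\<close> are eigenvectors of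
  \<open>\<tau>\<close> with distinct eigenvalues, so the single operator \<open>\<tau>\<close>
  isolates each term.\<close>

lemma ypow_component:
  assumes J: "submodule J F K" "\<And>x. x \<in> J \<Longrightarrow> \<tau> x \<in> J"
    and c: "c \<in> {..<N} \<rightarrow> carrier F"
    and sum: "(\<Oplus>j\<in>{..<N}. c j \<odot> y [^] j) \<in> J"
    and j: "j < N"
  shows "c j \<odot> y [^] j \<in> J"
proof -
  have ins: "insert j ({..<N} - {j}) = {..<N}" using j by auto
  show ?thesis
  proof (rule eigenvector_component[OF J(1) _ _ alg_hom_lin[OF \<tau>(1)] J(2), of "{..<N} - {j}" j _ "\<lambda>_::unit. \<lambda>j. (inv\<^bsub>F\<^esub> \<zeta>) [^]\<^bsub>F\<^esub> j"])
    show "\<tau> (c i \<odot> y [^] i) = (inv\<^bsub>F\<^esub> \<zeta>) [^]\<^bsub>F\<^esub> i \<odot> (c i \<odot> y [^] i)" if "i \<in> insert j ({..<N} - {j})" for i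
      using that c y(1) \<zeta>iD(1) alg_homD(3)[OF \<tau>(1)] \<tau>_pow_ypow[of 1 i] unfolding ins
      by (auto simp: R.m_comm Pi_def)
    show "\<exists>k::unit. (inv\<^bsub>F\<^esub> \<zeta>) [^]\<^bsub>F\<^esub> i \<noteq> (inv\<^bsub>F\<^esub> \<zeta>) [^]\<^bsub>F\<^esub> j" if "i \<in> {..<N} - {j}" for i
      using K.primitive_root_inj[OF \<zeta>i, of i j] that j by auto
    show "(\<Oplus>i\<in>insert j ({..<N} - {j}). c i \<odot> y [^] i) \<in> J" using sum ins by simp
  qed (use c j y \<zeta>iD(1) in auto)
qed

lemma \<tau>_zero: "\<tau> \<zero> = \<zero>"
  by (rule lin_map_zero[OF fa fa alg_hom_lin[OF \<tau>(1)]])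

lemma ypow_nonzero: "y [^] (i::nat) \<noteq> \<zero>"
  using ypow_unit[of i] nontriv by (metis Units_r_inv_ex l_null)

lemma basis: "is_basis F K {..<N} (\<lambda>j. y [^] j)"
  unfolding is_basis_def
proof (intro conjI ballI impI)
  show "spanned F K ((\<lambda>j. y [^] j) ` {..<N})"
    unfolding spanned_def
  proof (intro conjI allI impI)
    fix V assume V: "submodule V F K" "(\<lambda>j. y [^] j) ` {..<N} \<subseteq> V"
    have "y [^] (j mod N) \<in> V" for j using V(2) \<zeta>D(2) by auto
    then have "y [^] j \<in> V" for j :: nat
      using subspaceD(4)[OF V(1)] \<alpha>(1) by (subst ypow_mod) auto
    then show "carrier K \<subseteq> V" by (intro spannedD(2)[OF span V(1)]) auto
  qed (use y(1) in auto)
  fix c j assume c: "c \<in> {..<N} \<rightarrow> carrier F" "(\<Oplus>j\<in>{..<N}. c j \<odot> y [^] j) = \<zero>" and j: "j \<in> {..<N}"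
  have "c j \<odot> y [^] j \<in> {\<zero>}"
    by (rule ypow_component[OF zero_subspace _ c(1)]) (use c(2) j \<tau>_zero in auto)
  then show "c j = \<zero>\<^bsub>F\<^esub>" using smult_cancel_zero[of "c j" "y [^] j"] ypow_nonzero c(1) j y(1) by auto
qed simp

text \<open>The universal property of the quotient, recovered from the basis so that it holds for
  every algebra of this locale.\<close>

lemma hom_exists:
  assumes "field_algebra F B" "y' \<in> carrier B" "y' [^]\<^bsub>B\<^esub> N = \<alpha> \<odot>\<^bsub>B\<^esub> \<one>\<^bsub>B\<^esub>"
  obtains f where "f \<in> alg_hom F K B" "f y = y'"
proof -
  interpret B: field_algebra F B by fact
  have t: "(\<lambda>j. y' [^]\<^bsub>B\<^esub> j) \<in> {..<N} \<rightarrow> carrier B" using assms(2) by auto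
  obtain f where f: "f \<in> lin_map F K B" "\<And>j. j \<in> {..<N} \<Longrightarrow> f (y [^] j) = y' [^]\<^bsub>B\<^esub> j"
    by (rule basis_extend[OF fa assms(1) basis t]) (rule that)
  have mod': "y' [^]\<^bsub>B\<^esub> (i::nat) = \<alpha> [^]\<^bsub>F\<^esub> (i div N) \<odot>\<^bsub>B\<^esub> y' [^]\<^bsub>B\<^esub> (i mod N)" for i
  proof -
    have "y' [^]\<^bsub>B\<^esub> i = y' [^]\<^bsub>B\<^esub> (N * (i div N) + i mod N)" by simp
    also have "\<dots> = (y' [^]\<^bsub>B\<^esub> N) [^]\<^bsub>B\<^esub> (i div N) \<otimes>\<^bsub>B\<^esub> y' [^]\<^bsub>B\<^esub> (i mod N)"
      using assms(2) by (metis B.nat_pow_mult B.nat_pow_pow)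
    finally show ?thesis using assms(2,3) \<alpha> by (simp add: B.smult_pow)
  qed
  have pow: "f (y [^] (i::nat)) = y' [^]\<^bsub>B\<^esub> i" for i
  proof -
    have "f (y [^] i) = f (\<alpha> [^]\<^bsub>F\<^esub> (i div N) \<odot> y [^] (i mod N))" by (simp only: ypow_mod[of i])
    also have "\<dots> = \<alpha> [^]\<^bsub>F\<^esub> (i div N) \<odot>\<^bsub>B\<^esub> f (y [^] (i mod N))"
      using \<alpha>(1) y(1) by (intro lin_mapD(3)[OF f(1)]) auto
    also have "f (y [^] (i mod N)) = y' [^]\<^bsub>B\<^esub> (i mod N)" using f(2) \<zeta>D(2) by simp
    finally show ?thesis by (simp only: mod'[of i])
  qed
  have "f \<in> alg_hom F K B"
  proof (rule spanned_lin_map_mult[OF fa assms(1) f(1) span])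
    fix s t assume "s \<in> range (\<lambda>i::nat. y [^] i)" "t \<in> range (\<lambda>i::nat. y [^] i)"
    then show "f (s \<otimes> t) = f s \<otimes>\<^bsub>B\<^esub> f t"
      using y(1) assms(2) pow by (auto simp: nat_pow_mult B.nat_pow_mult)
  next
    show "f \<one> = \<one>\<^bsub>B\<^esub>" using pow[of 0] by simp
  qed
  moreover have "f y = y'" using pow[of 1] y(1) assms(2) by simp
  ultimately show ?thesis using that by blast
qed

lemma hom_eq:
  assumes "field_algebra F B" "f \<in> alg_hom F K B" "g \<in> alg_hom F K B" "f y = g y" "x \<in> carrier K"
  shows "f x = g x"
proof (rule spanned_lin_map_eq[OF fa assms(1) alg_hom_lin[OF assms(2)] alg_hom_lin[OF assms(3)] span _ assms(5)])
  have r: "ring B" using assms(1) by (simp add: field_algebra_def assoc_algebra_def)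
  fix s assume "s \<in> range (\<lambda>i::nat. y [^] i)"
  then show "f s = g s"
    using alg_hom_pow[OF assms(2) rK r y(1)] alg_hom_pow[OF assms(3) rK r y(1)] assms(4) by auto
qed

text \<open>The fixed elements form a subspace stable under \<open>\<tau>\<close>, so they contain
  each of their terms; a fixed power \<open>y [^] j\<close> has eigenvalue one, hence
  \<open>j = 0\<close>.\<close>

lemma fixed_scalar:
  assumes x: "x \<in> carrier K" "\<tau> x = x"
  shows "x \<in> scalars F K"
proof -
  obtain c where c: "c \<in> {..<N} \<rightarrow> carrier F" "x = (\<Oplus>j\<in>{..<N}. c j \<odot> y [^] j)"
    using spanned_lincomb[OF basisD(1,2)[OF basis] x(1)] .
  note \<tau>' = alg_homD[OF \<tau>(1)]
  let ?J = "{x \<in> carrier K. \<tau> x = x}"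
  have J: "submodule ?J F K"
    using \<tau>' \<tau>_zero by (intro subspaceI) auto
  have zero: "c j = \<zero>\<^bsub>F\<^esub>" if j: "j < N" "j \<noteq> 0" for j
  proof (rule ccontr)
    assume nz: "c j \<noteq> \<zero>\<^bsub>F\<^esub>"
    have "c j \<odot> y [^] j \<in> ?J"
      by (rule ypow_component[OF J _ c(1) _ j(1)]) (use x c(2) in auto)
    from subspace_cancel[OF J _ nz _ this] have "\<tau> (y [^] j) = y [^] j" using c(1) j(1) y(1) by auto
    then have "(inv\<^bsub>F\<^esub> \<zeta>) [^]\<^bsub>F\<^esub> j \<odot> y [^] j = y [^] j" using \<tau>_pow_ypow[of 1 j] by simp
    then have "(inv\<^bsub>F\<^esub> \<zeta>) [^]\<^bsub>F\<^esub> j = \<one>\<^bsub>F\<^esub>"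
      using smult_eq_self[OF _ _ ypow_nonzero] \<zeta>iD(1) y(1) by simp
    then show False using \<zeta>iD(6)[of j] j by simp
  qed
  have "x = (\<Oplus>j\<in>{..<N}. if j = 0 then c 0 \<odot> \<one> else \<zero>)"
    unfolding c(2) using zero c(1) \<zeta>D(2) y(1) by (intro finsum_cong') (auto simp: Pi_def)
  also have "\<dots> = c 0 \<odot> \<one>" using c(1) \<zeta>D(2) by (intro finsum_delta) auto
  finally show ?thesis using c(1) \<zeta>D(2) by (auto simp: scalars_def)
qed

lemma skew: "c \<in> carrier F \<Longrightarrow> skew F K \<tau> N c"
  using \<tau>(1) \<tau>_order \<zeta>D(2) nontriv by unfold_locales auto

text \<open>The relations hold in the skew quotient, which is known to be nontrivial. Spanning
  passes from coefficients in \<open>K\<close> to monomials because the powers of \<open>y\<close>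
  span \<open>K\<close>.\<close>

lemma symbol_algebra:
  assumes c: "c \<in> carrier F" "c \<noteq> \<zero>\<^bsub>F\<^esub>"
  shows "symbol_algebra F (skew_cyclic K \<tau> N c) N \<zeta> c \<alpha> (skew_gen K \<tau> N c) (skew_const K \<tau> N c y)"
proof -
  interpret S: skew F K \<tau> N c by (rule skew[OF c(1)])
  interpret A: field_algebra F S.A by (rule S.A_algebra)
  note \<iota> = alg_homD[OF S.\<iota>_hom]
  have rA: "ring S.A" ..
  interpret symbol_pair F S.A N \<zeta> c \<alpha> S.H "S.\<iota> y"
  proof
    have "S.H \<otimes>\<^bsub>S.A\<^esub> S.\<iota> y = inv\<^bsub>F\<^esub> \<zeta> \<odot>\<^bsub>S.A\<^esub> (S.\<iota> y \<otimes>\<^bsub>S.A\<^esub> S.H)"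
      using S.H_\<iota>[OF y(1)] \<iota>(1,3) y(1) \<tau>(2) \<zeta>iD(1) S.H_closed by simp
    then show "S.\<iota> y \<otimes>\<^bsub>S.A\<^esub> S.H = \<zeta> \<odot>\<^bsub>S.A\<^esub> (S.H \<otimes>\<^bsub>S.A\<^esub> S.\<iota> y)"
      using \<zeta>D(1,5) \<zeta>iD(1) \<iota>(1) y(1) S.H_closed by simp
    show "S.\<iota> y [^]\<^bsub>S.A\<^esub> N = \<alpha> \<odot>\<^bsub>S.A\<^esub> \<one>\<^bsub>S.A\<^esub>"
      using alg_hom_pow[OF S.\<iota>_hom rK rA y(1), of N] y(2) \<iota>(3,5) \<alpha>(1) by simp
  qed (use \<zeta> \<alpha> c S.H_closed \<iota>(1) y(1) S.H_N S.A_nontrivial in auto)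
  show ?thesis
  proof
    show "spanned F S.A {mon i j | (i::nat) (j::nat). True}"
      unfolding spanned_def
    proof (intro conjI allI impI)
      fix V assume V: "submodule V F S.A" "{mon i j | (i::nat) (j::nat). True} \<subseteq> V"
      show "carrier S.A \<subseteq> V"
      proof (rule spannedD(2)[OF S.A_spanned V(1)], safe)
        fix e and i :: nat assume e: "e \<in> carrier K"
        have Hi: "S.H [^]\<^bsub>S.A\<^esub> i \<in> carrier S.A" using S.H_closed by simp
        have lin: "(\<lambda>e. S.\<iota> e \<otimes>\<^bsub>S.A\<^esub> S.H [^]\<^bsub>S.A\<^esub> i) \<in> lin_map F K S.A"
          using \<iota> Hi by (intro lin_mapI) (auto simp: A.l_distr)
        have "submodule {e \<in> carrier K. S.\<iota> e \<otimes>\<^bsub>S.A\<^esub> S.H [^]\<^bsub>S.A\<^esub> i \<in> V} F K"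
          using A.subspaceD[OF V(1)] lin_mapD[OF lin] lin_map_zero[OF fa A.field_algebra_axioms lin]
          by (intro subspaceI) auto
        moreover have "range (\<lambda>j::nat. y [^] j) \<subseteq> {e \<in> carrier K. S.\<iota> e \<otimes>\<^bsub>S.A\<^esub> S.H [^]\<^bsub>S.A\<^esub> i \<in> V}"
        proof clarify
          fix j :: nat
          have "S.\<iota> (y [^] j) \<otimes>\<^bsub>S.A\<^esub> S.H [^]\<^bsub>S.A\<^esub> i = \<zeta> [^]\<^bsub>F\<^esub> (i * j) \<odot>\<^bsub>S.A\<^esub> mon i j"
            using alg_hom_pow[OF S.\<iota>_hom rK rA y(1), of j] vpow_upow[of j i] by simp
          moreover have "mon i j \<in> V" using V(2) by blast
          ultimately show "y [^] j \<in> carrier K \<and> S.\<iota> (y [^] j) \<otimes>\<^bsub>S.A\<^esub> S.H [^]\<^bsub>S.A\<^esub> i \<in> V"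
            using A.subspaceD(4)[OF V(1)] \<zeta>D(1) y(1) by simp
        qed
        ultimately show "S.\<iota> e \<otimes>\<^bsub>S.A\<^esub> S.H [^]\<^bsub>S.A\<^esub> i \<in> V" using spannedD(2)[OF span] e by blast
      qed
    qed auto
  qed
qed

end

lemma (in kummer_poly) kummer_algebra:
  assumes \<zeta>: "primitive_root_of_unity F N \<zeta>" and "\<alpha> \<noteq> \<zero>"
  shows "kummer_algebra F K N \<zeta> \<alpha> x (scale_aut F (inv \<zeta>))"
proof -
  interpret KA: field_algebra F K by (rule K_algebra)
  interpret KC: cring K by (rule K_cring)
  note z = primitive_rootD[OF primitive_root_inverse[OF \<zeta>]]
  show ?thesis
    by unfold_locales
      (use \<zeta> \<alpha> assms(2) x_closed x_pow_N K_nontrivial K_spanned scale_aut_hom[OF z(1,3)] in auto)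
qed

section \<open>Kummer algebras inside symbol algebras\<close>

lemma (in symbol_pair) v_independent:
  assumes c: "c \<in> {..<D} \<rightarrow> carrier F" and sum: "(\<Oplus>j\<in>{..<D}. c j \<odot> v [^] j) = \<zero>" and j: "j < D"
  shows "c j = \<zero>\<^bsub>F\<^esub>"
proof -
  let ?I = "{..<D} \<times> {..<D}"
  define c' where "c' p = (if fst p = 0 then c (snd p) else \<zero>\<^bsub>F\<^esub>)" for p :: "nat \<times> nat"
  have c': "c' \<in> ?I \<rightarrow> carrier F" using c by (auto simp: c'_def)
  have inj: "inj_on (Pair (0::nat)) {..<D}" by (auto intro: inj_onI)
  have t: "(\<lambda>p. c' p \<odot> mon (fst p) (snd p)) \<in> ?I \<rightarrow> carrier A" using c' by auto
  have "(\<Oplus>p\<in>?I. c' p \<odot> mon (fst p) (snd p)) = (\<Oplus>p\<in>Pair 0 ` {..<D}. c' p \<odot> mon (fst p) (snd p))"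
    using t zD(2) by (intro add.finprod_mono_neutral_cong_right) (auto simp: c'_def)
  also have "\<dots> = (\<Oplus>j\<in>{..<D}. c' (0, j) \<odot> mon (fst (0::nat, j)) (snd (0::nat, j)))"
    by (subst finsum_reindex[OF _ inj]) (use t zD(2) in auto)
  also have "\<dots> = (\<Oplus>j\<in>{..<D}. c j \<odot> v [^] j)"
    using c v by (intro finsum_cong') (auto simp: c'_def)
  finally have "c' (0, j) = \<zero>\<^bsub>F\<^esub>" using mon_independent[OF c', of "(0, j)"] sum j by simp
  then show ?thesis by (simp add: c'_def)
qed

text \<open>The powers of \<open>v\<close> below \<open>N\<close> belong to an independent family of
  monomials, so a combination of powers of \<open>y\<close> that is sent to zero has zero
  coefficients.\<close>

lemma kummer_symbol_mono:
  assumes "kummer_algebra F K N \<zeta> \<alpha> y \<tau>" "symbol_pair F B N \<zeta>' b' g' u v" "f \<in> alg_hom F K B" "f y = v"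
  shows "f \<in> alg_mono F K B"
proof -
  interpret K: kummer_algebra F K N \<zeta> \<alpha> y \<tau> by fact
  interpret B: symbol_pair F B N \<zeta>' b' g' u v by fact
  have "inj_on f (carrier K)"
  proof (rule lin_map_inj[OF K.fa B.field_algebra_axioms alg_hom_lin[OF assms(3)]])
    fix x assume x: "x \<in> carrier K" "f x = \<zero>\<^bsub>B\<^esub>"
    obtain c where c: "c \<in> {..<N} \<rightarrow> carrier F" "x = (\<Oplus>\<^bsub>K\<^esub>j\<in>{..<N}. c j \<odot>\<^bsub>K\<^esub> y [^]\<^bsub>K\<^esub> j)"
      using K.spanned_lincomb[OF K.basisD(1,2)[OF K.basis] x(1)] .
    have rB: "ring B" ..
    have "f x = (\<Oplus>\<^bsub>B\<^esub>j\<in>{..<N}. f (c j \<odot>\<^bsub>K\<^esub> y [^]\<^bsub>K\<^esub> j))"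
      unfolding c(2) using c(1) K.y(1)
      by (intro lin_map_finsum[OF K.fa B.field_algebra_axioms alg_hom_lin[OF assms(3)]]) auto
    also have "\<dots> = (\<Oplus>\<^bsub>B\<^esub>j\<in>{..<N}. c j \<odot>\<^bsub>B\<^esub> v [^]\<^bsub>B\<^esub> j)"
      using c(1) K.y(1) alg_homD(3)[OF assms(3)] alg_hom_pow[OF assms(3) K.rK rB K.y(1)] assms(4) B.v
      by (intro B.finsum_cong') (auto simp: Pi_def)
    finally have "c j = \<zero>\<^bsub>F\<^esub>" if "j < N" for j using B.v_independent[OF c(1) _ that] x(2) by simp
    then show "x = \<zero>\<^bsub>K\<^esub>" unfolding c(2) using K.y(1) by (intro K.add.finprod_one_eqI) auto
  qed
  then show ?thesis using assms(3) by (simp add: alg_mono_def)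
qed

section \<open>The free algebra and the symbol algebra\<close>

lemma free_alg_simps:
  "carrier (free_alg F) = {f. (\<forall>w. f w \<in> carrier F) \<and> finite {w. f w \<noteq> \<zero>\<^bsub>F\<^esub>}}"
  "f \<otimes>\<^bsub>free_alg F\<^esub> g = (\<lambda>w. \<Oplus>\<^bsub>F\<^esub>i\<in>{..length w}. f (take i w) \<otimes>\<^bsub>F\<^esub> g (drop i w))"
  "\<one>\<^bsub>free_alg F\<^esub> = (\<lambda>w. if w = [] then \<one>\<^bsub>F\<^esub> else \<zero>\<^bsub>F\<^esub>)"
  "\<zero>\<^bsub>free_alg F\<^esub> = (\<lambda>w. \<zero>\<^bsub>F\<^esub>)"
  "f \<oplus>\<^bsub>free_alg F\<^esub> g = (\<lambda>w. f w \<oplus>\<^bsub>F\<^esub> g w)"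
  "c \<odot>\<^bsub>free_alg F\<^esub> f = (\<lambda>w. c \<otimes>\<^bsub>F\<^esub> f w)"
  by (simp_all add: free_alg_def)

definition word :: "('f, 'r) ring_scheme \<Rightarrow> 'g list \<Rightarrow> 'g list \<Rightarrow> 'f"
  where "word F w = (\<lambda>v. if v = w then \<one>\<^bsub>F\<^esub> else \<zero>\<^bsub>F\<^esub>)"

lemma letter_word: "letter F g = word F [g]"
  by (simp add: letter_def word_def)

context field
begin

abbreviation FA :: "('a, 'g list \<Rightarrow> 'a) module" where "FA \<equiv> free_alg R"

lemma FA_coeff: "f \<in> carrier FA \<Longrightarrow> f w \<in> carrier R"
  by (simp add: free_alg_simps)

lemma FA_finite: "f \<in> carrier FA \<Longrightarrow> finite {w. f w \<noteq> \<zero>}"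
  by (simp add: free_alg_simps)

lemma FA_I:
  assumes "\<And>w. f w \<in> carrier R" "finite S" "\<And>w. w \<notin> S \<Longrightarrow> f w = \<zero>"
  shows "f \<in> carrier FA"
proof -
  have "{w. f w \<noteq> \<zero>} \<subseteq> S" using assms(3) by blast
  then show ?thesis using assms(1,2) finite_subset by (auto simp: free_alg_simps)
qed

lemma FA_mult_closed:
  assumes f: "f \<in> carrier FA" and g: "g \<in> carrier FA"
  shows "f \<otimes>\<^bsub>FA\<^esub> g \<in> carrier FA"
proof (rule FA_I)
  note c = FA_coeff[OF f] FA_coeff[OF g]
  let ?S = "(\<lambda>(u, v). u @ v) ` ({w. f w \<noteq> \<zero>} \<times> {w. g w \<noteq> \<zero>})"
  show "finite ?S" using FA_finite[OF f] FA_finite[OF g] by blast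
  show "(f \<otimes>\<^bsub>FA\<^esub> g) w \<in> carrier R" for w
    using c by (auto simp: free_alg_simps intro!: finsum_closed)
  fix w assume w: "w \<notin> ?S"
  show "(f \<otimes>\<^bsub>FA\<^esub> g) w = \<zero>"
    unfolding free_alg_simps
  proof (rule add.finprod_one_eqI)
    fix i
    have "f (take i w) = \<zero> \<or> g (drop i w) = \<zero>"
    proof (rule ccontr)
      assume "\<not> ?thesis"
      then have "(\<lambda>(u, v). u @ v) (take i w, drop i w) \<in> ?S" by blast
      then show False using w by simp
    qed
    then show "f (take i w) \<otimes> g (drop i w) = \<zero>" using c by auto
  qed
qed

text \<open>Both sides cut the word at two positions \<open>i \<le> k\<close>, in either
  order.\<close>

lemma FA_assoc:
  fixes f g h :: "'g list \<Rightarrow> 'a"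
  assumes f: "f \<in> carrier FA" and g: "g \<in> carrier FA" and h: "h \<in> carrier FA"
  shows "(f \<otimes>\<^bsub>FA\<^esub> g) \<otimes>\<^bsub>FA\<^esub> h = f \<otimes>\<^bsub>FA\<^esub> (g \<otimes>\<^bsub>FA\<^esub> h)"
proof
  fix w :: "'g list"
  note c = FA_coeff[OF f] FA_coeff[OF g] FA_coeff[OF h]
  let ?n = "length w"
  let ?t = "\<lambda>i k. f (take i w) \<otimes> g (drop i (take k w)) \<otimes> h (drop k w)"
  have "((f \<otimes>\<^bsub>FA\<^esub> g) \<otimes>\<^bsub>FA\<^esub> h) w = (\<Oplus>k\<in>{..?n}. \<Oplus>i\<in>{..k}. ?t i k)"
    unfolding free_alg_simps
  proof (rule finsum_cong'[OF refl])
    fix k assume k: "k \<in> {..?n}"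
    have "(\<Oplus>i\<in>{..length (take k w)}. f (take i (take k w)) \<otimes> g (drop i (take k w))) \<otimes> h (drop k w) =
        (\<Oplus>i\<in>{..length (take k w)}. f (take i (take k w)) \<otimes> g (drop i (take k w)) \<otimes> h (drop k w))"
      using c by (intro finsum_ldistr) auto
    also have "\<dots> = (\<Oplus>i\<in>{..k}. ?t i k)"
      using c k by (intro finsum_cong') (auto simp: min_def)
    finally show "(\<Oplus>i\<in>{..length (take k w)}. f (take i (take k w)) \<otimes> g (drop i (take k w))) \<otimes> h (drop k w) =
        (\<Oplus>i\<in>{..k}. ?t i k)" .
  qed (use c in \<open>auto intro!: finsum_closed\<close>)
  also have "\<dots> = (\<Oplus>i\<in>{..?n}. \<Oplus>j\<in>{..?n-i}. ?t i (i + j))"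
    using c by (intro finsum_triangle) auto
  also have "\<dots> = (f \<otimes>\<^bsub>FA\<^esub> (g \<otimes>\<^bsub>FA\<^esub> h)) w"
    unfolding free_alg_simps
  proof (rule finsum_cong'[OF refl])
    fix i assume i: "i \<in> {..?n}"
    have "f (take i w) \<otimes> (\<Oplus>j\<in>{..length (drop i w)}. g (take j (drop i w)) \<otimes> h (drop j (drop i w))) =
        (\<Oplus>j\<in>{..length (drop i w)}. f (take i w) \<otimes> (g (take j (drop i w)) \<otimes> h (drop j (drop i w))))"
      using c by (intro finsum_rdistr) auto
    also have "\<dots> = (\<Oplus>j\<in>{..?n-i}. ?t i (i + j))"
      using c by (intro finsum_cong') (auto simp: m_assoc drop_take add.commute)
    finally show "(\<Oplus>j\<in>{..?n-i}. ?t i (i + j)) =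
      f (take i w) \<otimes> (\<Oplus>j\<in>{..length (drop i w)}. g (take j (drop i w)) \<otimes> h (drop j (drop i w)))" by simp
  qed (use c in \<open>auto intro!: finsum_closed\<close>)
  finally show "((f \<otimes>\<^bsub>FA\<^esub> g) \<otimes>\<^bsub>FA\<^esub> h) w = (f \<otimes>\<^bsub>FA\<^esub> (g \<otimes>\<^bsub>FA\<^esub> h)) w" .
qed

lemma FA_ring: "ring (FA :: ('a, 'g list \<Rightarrow> 'a) module)"
proof (rule ringI)
  show "abelian_group (FA :: ('a, 'g list \<Rightarrow> 'a) module)"
  proof (rule abelian_groupI)
    fix f :: "'g list \<Rightarrow> 'a" assume f: "f \<in> carrier FA"
    have "(\<lambda>w. \<ominus> f w) \<in> carrier FA"
      by (rule FA_I[OF _ FA_finite[OF f]]) (use FA_coeff[OF f] in auto)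
    moreover have "(\<lambda>w. \<ominus> f w) \<oplus>\<^bsub>FA\<^esub> f = \<zero>\<^bsub>FA\<^esub>"
      using FA_coeff[OF f] by (simp add: free_alg_simps l_neg)
    ultimately show "\<exists>g\<in>carrier FA. g \<oplus>\<^bsub>FA\<^esub> f = \<zero>\<^bsub>FA\<^esub>" by blast
    show "\<zero>\<^bsub>FA\<^esub> \<oplus>\<^bsub>FA\<^esub> f = f" using FA_coeff[OF f] by (simp add: free_alg_simps)
    fix g :: "'g list \<Rightarrow> 'a" assume g: "g \<in> carrier FA"
    have fin: "finite ({w. f w \<noteq> \<zero>} \<union> {w. g w \<noteq> \<zero>})" using FA_finite[OF f] FA_finite[OF g] by simp
    show "f \<oplus>\<^bsub>FA\<^esub> g \<in> carrier FA"
      by (rule FA_I[OF _ fin]) (use FA_coeff[OF f] FA_coeff[OF g] in \<open>auto simp: free_alg_simps\<close>)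
    show "f \<oplus>\<^bsub>FA\<^esub> g = g \<oplus>\<^bsub>FA\<^esub> f"
      using FA_coeff[OF f] FA_coeff[OF g] by (simp add: free_alg_simps a_comm)
    fix h :: "'g list \<Rightarrow> 'a" assume h: "h \<in> carrier FA"
    show "f \<oplus>\<^bsub>FA\<^esub> g \<oplus>\<^bsub>FA\<^esub> h = f \<oplus>\<^bsub>FA\<^esub> (g \<oplus>\<^bsub>FA\<^esub> h)"
      using FA_coeff[OF f] FA_coeff[OF g] FA_coeff[OF h] by (simp add: free_alg_simps a_assoc)
  next
    show "\<zero>\<^bsub>FA\<^esub> \<in> carrier (FA :: ('a, 'g list \<Rightarrow> 'a) module)" by (simp add: free_alg_simps)
  qed
  show "Group.monoid (FA :: ('a, 'g list \<Rightarrow> 'a) module)"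
  proof (rule monoidI)
    show "\<one>\<^bsub>FA\<^esub> \<in> carrier (FA :: ('a, 'g list \<Rightarrow> 'a) module)" by (simp add: free_alg_simps)
    fix f :: "'g list \<Rightarrow> 'a" assume f: "f \<in> carrier FA"
    note c = FA_coeff[OF f]
    show "\<one>\<^bsub>FA\<^esub> \<otimes>\<^bsub>FA\<^esub> f = f"
    proof
      fix w
      have "(\<one>\<^bsub>FA\<^esub> \<otimes>\<^bsub>FA\<^esub> f) w = (\<Oplus>i\<in>{..length w}. if i = 0 then f w else \<zero>)"
        unfolding free_alg_simps using c by (intro finsum_cong') auto
      also have "\<dots> = f w" using c add.finprod_singleton_swap[of 0 "{..length w}" "\<lambda>_. f w"] by simp
      finally show "(\<one>\<^bsub>FA\<^esub> \<otimes>\<^bsub>FA\<^esub> f) w = f w" .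
    qed
    show "f \<otimes>\<^bsub>FA\<^esub> \<one>\<^bsub>FA\<^esub> = f"
    proof
      fix w
      have "(f \<otimes>\<^bsub>FA\<^esub> \<one>\<^bsub>FA\<^esub>) w = (\<Oplus>i\<in>{..length w}. if i = length w then f w else \<zero>)"
        unfolding free_alg_simps using c by (intro finsum_cong') auto
      also have "\<dots> = f w" using c add.finprod_singleton_swap[of "length w" "{..length w}" "\<lambda>_. f w"] by simp
      finally show "(f \<otimes>\<^bsub>FA\<^esub> \<one>\<^bsub>FA\<^esub>) w = f w" .
    qed
  qed (simp_all add: FA_mult_closed FA_assoc)
  fix f g h :: "'g list \<Rightarrow> 'a" assume "f \<in> carrier FA" "g \<in> carrier FA" "h \<in> carrier FA"
  then have c: "f w \<in> carrier R" "g w \<in> carrier R" "h w \<in> carrier R" for w by (simp_all add: FA_coeff)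
  show "(f \<oplus>\<^bsub>FA\<^esub> g) \<otimes>\<^bsub>FA\<^esub> h = f \<otimes>\<^bsub>FA\<^esub> h \<oplus>\<^bsub>FA\<^esub> g \<otimes>\<^bsub>FA\<^esub> h"
  proof
    fix w show "((f \<oplus>\<^bsub>FA\<^esub> g) \<otimes>\<^bsub>FA\<^esub> h) w = (f \<otimes>\<^bsub>FA\<^esub> h \<oplus>\<^bsub>FA\<^esub> g \<otimes>\<^bsub>FA\<^esub> h) w"
      unfolding free_alg_simps using c by (subst finsum_addf[symmetric]) (auto simp: l_distr intro!: finsum_cong')
  qed
  show "h \<otimes>\<^bsub>FA\<^esub> (f \<oplus>\<^bsub>FA\<^esub> g) = h \<otimes>\<^bsub>FA\<^esub> f \<oplus>\<^bsub>FA\<^esub> h \<otimes>\<^bsub>FA\<^esub> g"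
  proof
    fix w show "(h \<otimes>\<^bsub>FA\<^esub> (f \<oplus>\<^bsub>FA\<^esub> g)) w = (h \<otimes>\<^bsub>FA\<^esub> f \<oplus>\<^bsub>FA\<^esub> h \<otimes>\<^bsub>FA\<^esub> g) w"
      unfolding free_alg_simps using c by (subst finsum_addf[symmetric]) (auto simp: r_distr intro!: finsum_cong')
  qed
qed

lemma FA_algebra: "field_algebra R (FA :: ('a, 'g list \<Rightarrow> 'a) module)"
proof (rule field_algebraI)
  show "field R" ..
  show "ring (FA :: ('a, 'g list \<Rightarrow> 'a) module)" by (rule FA_ring)
  fix c and f :: "'g list \<Rightarrow> 'a" assume c: "c \<in> carrier R" and f: "f \<in> carrier FA"
  show "c \<odot>\<^bsub>FA\<^esub> f \<in> carrier FA"
    by (rule FA_I[OF _ FA_finite[OF f]]) (use c FA_coeff[OF f] in \<open>auto simp: free_alg_simps\<close>)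
  fix g :: "'g list \<Rightarrow> 'a" assume g: "g \<in> carrier FA"
  note cl = FA_coeff[OF f] FA_coeff[OF g]
  show "(c \<odot>\<^bsub>FA\<^esub> f) \<otimes>\<^bsub>FA\<^esub> g = c \<odot>\<^bsub>FA\<^esub> (f \<otimes>\<^bsub>FA\<^esub> g)"
  proof
    fix w show "((c \<odot>\<^bsub>FA\<^esub> f) \<otimes>\<^bsub>FA\<^esub> g) w = (c \<odot>\<^bsub>FA\<^esub> (f \<otimes>\<^bsub>FA\<^esub> g)) w"
      unfolding free_alg_simps using c cl by (subst finsum_rdistr) (auto simp: m_assoc intro!: finsum_cong')
  qed
  show "f \<otimes>\<^bsub>FA\<^esub> (c \<odot>\<^bsub>FA\<^esub> g) = c \<odot>\<^bsub>FA\<^esub> (f \<otimes>\<^bsub>FA\<^esub> g)"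
  proof
    fix w show "(f \<otimes>\<^bsub>FA\<^esub> (c \<odot>\<^bsub>FA\<^esub> g)) w = (c \<odot>\<^bsub>FA\<^esub> (f \<otimes>\<^bsub>FA\<^esub> g)) w"
      unfolding free_alg_simps using c cl by (subst finsum_rdistr) (auto simp: m_lcomm intro!: finsum_cong')
  qed
  show "c \<odot>\<^bsub>FA\<^esub> (f \<oplus>\<^bsub>FA\<^esub> g) = c \<odot>\<^bsub>FA\<^esub> f \<oplus>\<^bsub>FA\<^esub> c \<odot>\<^bsub>FA\<^esub> g"
    using c cl by (simp add: free_alg_simps r_distr)
  fix d assume d: "d \<in> carrier R"
  show "(c \<oplus> d) \<odot>\<^bsub>FA\<^esub> f = c \<odot>\<^bsub>FA\<^esub> f \<oplus>\<^bsub>FA\<^esub> d \<odot>\<^bsub>FA\<^esub> f"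
    using c d cl by (simp add: free_alg_simps l_distr)
  show "(c \<otimes> d) \<odot>\<^bsub>FA\<^esub> f = c \<odot>\<^bsub>FA\<^esub> (d \<odot>\<^bsub>FA\<^esub> f)"
    using c d cl by (simp add: free_alg_simps m_assoc)
qed (simp add: free_alg_simps)

lemma word_closed: "word R w \<in> carrier FA"
  by (rule FA_I[of _ "{w}"]) (auto simp: word_def)

lemma word_mult: "word R u \<otimes>\<^bsub>FA\<^esub> word R v = word R (u @ v)"
proof
  fix w
  have "(word R u \<otimes>\<^bsub>FA\<^esub> word R v) w =
      (\<Oplus>i\<in>{..length w}. if i = length u then word R (u @ v) w else \<zero>)"
    unfolding free_alg_simps
  proof (rule finsum_cong'[OF refl])
    fix i assume i: "i \<in> {..length w}"
    have E: "take i w = u \<and> drop i w = v \<longleftrightarrow> i = length u \<and> w = u @ v"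
    proof
      assume uv: "take i w = u \<and> drop i w = v"
      then have "length u = i" using i by auto
      moreover have "w = u @ v" using uv append_take_drop_id[of i w] by simp
      ultimately show "i = length u \<and> w = u @ v" by simp
    qed simp
    have "word R u (take i w) \<otimes> word R v (drop i w) = (if take i w = u \<and> drop i w = v then \<one> else \<zero>)"
      by (simp add: word_def)
    also have "\<dots> = (if i = length u then word R (u @ v) w else \<zero>)"
      unfolding E by (simp add: word_def)
    finally show "word R u (take i w) \<otimes> word R v (drop i w) = (if i = length u then word R (u @ v) w else \<zero>)" .
  qed (auto simp: word_def)
  also have "\<dots> = word R (u @ v) w"
  proof (cases "length u \<le> length w")
    case True
    then show ?thesis
      using add.finprod_singleton_swap[of "length u" "{..length w}" "\<lambda>_. word R (u @ v) w"]
      by (simp add: word_def)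
  next
    case False
    then show ?thesis by (subst add.finprod_one_eqI) (auto simp: word_def)
  qed
  finally show "(word R u \<otimes>\<^bsub>FA\<^esub> word R v) w = word R (u @ v) w" .
qed

lemma word_Nil: "word R [] = \<one>\<^bsub>FA\<^esub>"
  by (auto simp: word_def free_alg_simps)

lemma FA_spanned: "spanned R (FA :: ('a, 'g list \<Rightarrow> 'a) module) (range (word R))"
  unfolding spanned_def
proof (intro conjI allI impI subsetI)
  interpret FA: field_algebra R "FA :: ('a, 'g list \<Rightarrow> 'a) module" by (rule FA_algebra)
  fix V :: "('g list \<Rightarrow> 'a) set" and f :: "'g list \<Rightarrow> 'a"
  assume V: "submodule V R FA" "range (word R) \<subseteq> V" and f: "f \<in> carrier FA"
  have *: "f \<in> V" if "finite S" "f \<in> carrier FA" "\<And>w. w \<notin> S \<Longrightarrow> f w = \<zero>" for S f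
    using that
  proof (induction S arbitrary: f)
    case empty
    then have "f = \<zero>\<^bsub>FA\<^esub>" by (auto simp: free_alg_simps)
    then show ?case using FA.subspaceD(2)[OF V(1)] by simp
  next
    case (insert w S)
    note c = FA_coeff[OF insert.prems(1)]
    have "f(w := \<zero>) \<in> V"
    proof (rule insert.IH)
      show "f(w := \<zero>) \<in> carrier FA"
        by (rule FA_I[OF _ FA_finite[OF insert.prems(1)]]) (use c in auto)
    qed (use insert.prems(2) in auto)
    moreover have "f w \<odot>\<^bsub>FA\<^esub> word R w \<in> V"
      by (rule FA.subspaceD(4)[OF V(1) c]) (use V(2) in blast)
    moreover have "f = f(w := \<zero>) \<oplus>\<^bsub>FA\<^esub> f w \<odot>\<^bsub>FA\<^esub> word R w"
      using c by (auto simp: free_alg_simps word_def)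
    ultimately show ?case using FA.subspaceD(3)[OF V(1)] by metis
  qed
  show "f \<in> V" by (rule *[OF FA_finite[OF f] f]) simp
qed (use word_closed in auto)

lemma FA_universal:
  assumes "field_algebra R B" "\<And>g :: 'g. im g \<in> carrier B"
  obtains f where "f \<in> alg_hom R FA B" "\<And>g. f (letter R g) = im g"
proof -
  interpret B: field_algebra R B by fact
  interpret FA: field_algebra R "FA :: ('a, 'g list \<Rightarrow> 'a) module" by (rule FA_algebra)
  define \<phi> where "\<phi> w = foldr (\<lambda>g r. im g \<otimes>\<^bsub>B\<^esub> r) w \<one>\<^bsub>B\<^esub>" for w
  have \<phi>c: "\<phi> w \<in> carrier B" for w using assms(2) by (induction w) (auto simp: \<phi>_def)
  have \<phi>_append: "\<phi> (u @ v) = \<phi> u \<otimes>\<^bsub>B\<^esub> \<phi> v" for u v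
  proof (induction u)
    case (Cons g u)
    then show ?case using assms(2)[of g] \<phi>c[of u] \<phi>c[of v] by (simp add: \<phi>_def B.m_assoc)
  qed (use \<phi>c[of v] in \<open>simp add: \<phi>_def\<close>)
  define ev where "ev f = (\<Oplus>\<^bsub>B\<^esub>w\<in>{w. f w \<noteq> \<zero>}. f w \<odot>\<^bsub>B\<^esub> \<phi> w)" for f :: "'g list \<Rightarrow> 'a"
  \<comment> \<open>The support changes under addition, so the defining sum is allowed to run over
    any finite set that contains it.\<close>
  have ev: "ev f = (\<Oplus>\<^bsub>B\<^esub>w\<in>S. f w \<odot>\<^bsub>B\<^esub> \<phi> w)"
    if "f \<in> carrier FA" "finite S" "\<And>w. w \<notin> S \<Longrightarrow> f w = \<zero>" for f S
    unfolding ev_def using that FA_coeff[OF that(1)] \<phi>c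
    by (intro B.add.finprod_mono_neutral_cong_left) auto
  have lin: "ev \<in> lin_map R FA B"
  proof (rule lin_mapI)
    fix f g :: "'g list \<Rightarrow> 'a" assume f: "f \<in> carrier FA" and g: "g \<in> carrier FA"
    note c = FA_coeff[OF f] FA_coeff[OF g]
    show "ev f \<in> carrier B" unfolding ev_def using c \<phi>c by (intro B.finsum_closed) auto
    let ?S = "{w. f w \<noteq> \<zero>} \<union> {w. g w \<noteq> \<zero>}"
    have fin: "finite ?S" using FA_finite[OF f] FA_finite[OF g] by simp
    have z: "w \<notin> ?S \<Longrightarrow> f w = \<zero>" "w \<notin> ?S \<Longrightarrow> g w = \<zero>" "w \<notin> ?S \<Longrightarrow> (f \<oplus>\<^bsub>FA\<^esub> g) w = \<zero>" for w
      by (auto simp: free_alg_simps)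
    show "ev (f \<oplus>\<^bsub>FA\<^esub> g) = ev f \<oplus>\<^bsub>B\<^esub> ev g"
    proof -
      have "ev (f \<oplus>\<^bsub>FA\<^esub> g) = (\<Oplus>\<^bsub>B\<^esub>w\<in>?S. (f w \<oplus> g w) \<odot>\<^bsub>B\<^esub> \<phi> w)"
        using ev[OF FA.a_closed[OF f g] fin z(3)] by (simp add: free_alg_simps)
      moreover have "ev f = (\<Oplus>\<^bsub>B\<^esub>w\<in>?S. f w \<odot>\<^bsub>B\<^esub> \<phi> w)" by (rule ev[OF f fin z(1)])
      moreover have "ev g = (\<Oplus>\<^bsub>B\<^esub>w\<in>?S. g w \<odot>\<^bsub>B\<^esub> \<phi> w)" by (rule ev[OF g fin z(2)])
      ultimately show ?thesis using c \<phi>c B.lincomb_add[of \<phi> ?S f g] by (simp add: Pi_def)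
    qed
    fix d assume d: "d \<in> carrier R"
    have z': "w \<notin> {w. f w \<noteq> \<zero>} \<Longrightarrow> (d \<odot>\<^bsub>FA\<^esub> f) w = \<zero>" for w
      using d by (simp add: free_alg_simps)
    show "ev (d \<odot>\<^bsub>FA\<^esub> f) = d \<odot>\<^bsub>B\<^esub> ev f"
    proof -
      have "ev (d \<odot>\<^bsub>FA\<^esub> f) = (\<Oplus>\<^bsub>B\<^esub>w\<in>{w. f w \<noteq> \<zero>}. (d \<otimes> f w) \<odot>\<^bsub>B\<^esub> \<phi> w)"
        using ev[OF FA.smult_closed[OF d f] FA_finite[OF f] z'] by (simp add: free_alg_simps)
      then show ?thesis
        using c d \<phi>c B.lincomb_smult[OF FA_finite[OF f], of \<phi> f d] by (simp add: ev_def[of f] Pi_def)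
    qed
  qed
  have evw: "ev (word R w) = \<phi> w" for w
    using ev[OF word_closed, of "{w}" w] \<phi>c[of w] by (simp add: word_def)
  have "ev \<in> alg_hom R FA B"
  proof (rule spanned_lin_map_mult[OF FA_algebra assms(1) lin FA_spanned])
    fix s t :: "'g list \<Rightarrow> 'a" assume "s \<in> range (word R)" "t \<in> range (word R)"
    then show "ev (s \<otimes>\<^bsub>FA\<^esub> t) = ev s \<otimes>\<^bsub>B\<^esub> ev t" by (auto simp: word_mult evw \<phi>_append)
  next
    show "ev \<one>\<^bsub>FA\<^esub> = \<one>\<^bsub>B\<^esub>" using evw[of "[]"] by (simp add: word_Nil \<phi>_def)
  qed
  moreover have "ev (letter R g) = im g" for g
    using evw[of "[g]"] assms(2) by (simp add: letter_word \<phi>_def)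
  ultimately show ?thesis using that by blast
qed

end

text \<open>A presentation could define the zero algebra. A pair with the required relations in a
  nontrivial \<open>B\<close> gives a homomorphism from the free algebra that kills the relations
  but not \<open>\<one>\<close>, so the quotient does not collapse.\<close>

lemma symbol_alg_symbol_algebra:
  assumes "symbol_pair F B n q s a u v"
  obtains h x where "symbol_algebra F (symbol_alg F n q s a) n q s a h x"
proof -
  interpret B: symbol_pair F B n q s a u v by fact
  interpret A: field_algebra F "free_alg F :: ('a, gen list \<Rightarrow> 'a) module" by (rule B.K.FA_algebra)
  let ?A = "free_alg F :: ('a, gen list \<Rightarrow> 'a) module"
  let ?h = "letter F Gen_h" and ?x = "letter F Gen_x"
  let ?R = "{?x \<otimes>\<^bsub>?A\<^esub> ?h \<ominus>\<^bsub>?A\<^esub> q \<odot>\<^bsub>?A\<^esub> (?h \<otimes>\<^bsub>?A\<^esub> ?x),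
    ?h [^]\<^bsub>?A\<^esub> n \<ominus>\<^bsub>?A\<^esub> s \<odot>\<^bsub>?A\<^esub> \<one>\<^bsub>?A\<^esub>, ?x [^]\<^bsub>?A\<^esub> n \<ominus>\<^bsub>?A\<^esub> a \<odot>\<^bsub>?A\<^esub> \<one>\<^bsub>?A\<^esub>}"
  let ?I = "Idl\<^bsub>?A\<^esub> ?R"
  have l: "letter F g \<in> carrier ?A" for g by (simp add: letter_word B.K.word_closed)
  have R: "?R \<subseteq> carrier ?A" using l B.zD(1) B.b B.g by auto
  interpret Q: quotient_algebra F ?A ?I
    using A.genideal_ideal[OF R] A.field_algebra_axioms by (simp add: quotient_algebra_def)
  have Q: "symbol_alg F n q s a = Q.Q" by (simp add: symbol_alg_def Let_def)
  interpret QA: field_algebra F Q.Q by (rule Q.Q_algebra)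
  have rings: "ring ?A" "ring B" "ring Q.Q" by unfold_locales
  let ?im = "\<lambda>g. case g of Gen_h \<Rightarrow> u | Gen_x \<Rightarrow> v"
  have im: "?im g \<in> carrier B" for g using B.u B.v by (cases g) auto
  obtain f where f: "f \<in> alg_hom F ?A B" "\<And>g. f (letter F g) = ?im g"
    by (rule B.K.FA_universal[where im = ?im, OF B.field_algebra_axioms im]) (rule that)
  note f' = alg_homD[OF f(1)]
  have "ideal (a_kernel ?A B f) ?A"
  proof (rule ring_hom_ring.kernel_is_ideal, rule ring_hom_ringI2[OF rings(1,2)])
    show "f \<in> ring_hom ?A B" using f(1) by (simp add: alg_hom_def)
  qed
  moreover have "?R \<subseteq> a_kernel ?A B f"
  proof -
    have fm: "f (y \<ominus>\<^bsub>?A\<^esub> z) = f y \<ominus>\<^bsub>B\<^esub> f z" if "y \<in> carrier ?A" "z \<in> carrier ?A" for y z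
      by (rule lin_map_minus[OF A.field_algebra_axioms B.field_algebra_axioms alg_hom_lin[OF f(1)] that])
    note simps = f'(3,4,5) f(2) alg_hom_pow[OF f(1) rings(1,2) l] B.minus_eq B.r_neg
    have "f (?x \<otimes>\<^bsub>?A\<^esub> ?h \<ominus>\<^bsub>?A\<^esub> q \<odot>\<^bsub>?A\<^esub> (?h \<otimes>\<^bsub>?A\<^esub> ?x)) = \<zero>\<^bsub>B\<^esub>"
      by (subst fm) (use l B.zD(1) B.u B.v in \<open>simp_all add: simps B.vu\<close>)
    moreover have "f (?h [^]\<^bsub>?A\<^esub> n \<ominus>\<^bsub>?A\<^esub> s \<odot>\<^bsub>?A\<^esub> \<one>\<^bsub>?A\<^esub>) = \<zero>\<^bsub>B\<^esub>"
      by (subst fm) (use l B.b B.u in \<open>simp_all add: simps B.uD\<close>)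
    moreover have "f (?x [^]\<^bsub>?A\<^esub> n \<ominus>\<^bsub>?A\<^esub> a \<odot>\<^bsub>?A\<^esub> \<one>\<^bsub>?A\<^esub>) = \<zero>\<^bsub>B\<^esub>"
      by (subst fm) (use l B.g B.v in \<open>simp_all add: simps B.vD\<close>)
    ultimately have "f r = \<zero>\<^bsub>B\<^esub>" if "r \<in> ?R" for r using that by blast
    then show ?thesis using R by (auto simp: a_kernel_def' subset_eq)
  qed
  ultimately have sub: "?I \<subseteq> a_kernel ?A B f" by (rule A.genideal_minimal)
  have one: "\<one>\<^bsub>?A\<^esub> \<notin> ?I"
  proof
    assume "\<one>\<^bsub>?A\<^esub> \<in> ?I"
    then have "\<one>\<^bsub>?A\<^esub> \<in> a_kernel ?A B f" by (rule subsetD[OF sub])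
    then have "f \<one>\<^bsub>?A\<^esub> = \<zero>\<^bsub>B\<^esub>" unfolding a_kernel_def' by simp
    then show False using f'(5) B.nontriv by simp
  qed
  note p = alg_homD[OF Q.proj_hom]
  have rel: "Q.proj y = Q.proj z" if "y \<ominus>\<^bsub>?A\<^esub> z \<in> ?R" "y \<in> carrier ?A" "z \<in> carrier ?A" for y z
    using Q.proj_eq_iff[OF that(2,3)] A.genideal_self[OF R] that(1) by blast
  let ?u = "Q.proj ?h" and ?v = "Q.proj ?x"
  interpret P: symbol_pair F Q.Q n q s a ?u ?v
  proof
    have "Q.proj (?x \<otimes>\<^bsub>?A\<^esub> ?h) = Q.proj (q \<odot>\<^bsub>?A\<^esub> (?h \<otimes>\<^bsub>?A\<^esub> ?x))"
      by (rule rel) (use l B.zD(1) in auto)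
    then show "?v \<otimes>\<^bsub>Q.Q\<^esub> ?u = q \<odot>\<^bsub>Q.Q\<^esub> (?u \<otimes>\<^bsub>Q.Q\<^esub> ?v)" using p l B.zD(1) by simp
    have "Q.proj (?h [^]\<^bsub>?A\<^esub> n) = Q.proj (s \<odot>\<^bsub>?A\<^esub> \<one>\<^bsub>?A\<^esub>)"
      by (rule rel) (use l B.b in auto)
    then show "?u [^]\<^bsub>Q.Q\<^esub> n = s \<odot>\<^bsub>Q.Q\<^esub> \<one>\<^bsub>Q.Q\<^esub>"
      using p l B.b alg_hom_pow[OF Q.proj_hom rings(1,3) l] by simp
    have "Q.proj (?x [^]\<^bsub>?A\<^esub> n) = Q.proj (a \<odot>\<^bsub>?A\<^esub> \<one>\<^bsub>?A\<^esub>)"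
      by (rule rel) (use l B.g in auto)
    then show "?v [^]\<^bsub>Q.Q\<^esub> n = a \<odot>\<^bsub>Q.Q\<^esub> \<one>\<^bsub>Q.Q\<^esub>"
      using p l B.g alg_hom_pow[OF Q.proj_hom rings(1,3) l] by simp
  qed (use B.z B.b B.g p(1) l Q.Q_nontrivial[OF one] in auto)
  have "symbol_algebra F Q.Q n q s a ?u ?v"
  proof
    show "spanned F Q.Q {P.mon i j | (i::nat) (j::nat). True}"
      unfolding spanned_def
    proof (intro conjI allI impI)
      fix V assume V: "submodule V F Q.Q" "{P.mon i j | (i::nat) (j::nat). True} \<subseteq> V"
      show "carrier Q.Q \<subseteq> V"
      proof (rule spannedD(2)[OF Q.Q_spanned[OF B.K.FA_spanned] V(1)], clarify)
        fix w :: "gen list"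
        \<comment> \<open>Words are brought to normal form from the right: a new letter
          \<open>Gen_h\<close> raises \<open>i\<close>, a new letter \<open>Gen_x\<close> is moved
          past the powers of the first generator at the cost of a power of \<open>q\<close>.\<close>
        have "\<exists>c\<in>carrier F. \<exists>i j. Q.proj (word F w) = c \<odot>\<^bsub>Q.Q\<^esub> P.mon i j"
        proof (induction w)
          case Nil
          have "Q.proj (word F []) = \<one>\<^bsub>F\<^esub> \<odot>\<^bsub>Q.Q\<^esub> P.mon 0 0" using p(5) by (simp add: B.K.word_Nil)
          then show ?case by blast
        next
          case (Cons g w)
          then obtain c i j where c: "c \<in> carrier F" "Q.proj (word F w) = c \<odot>\<^bsub>Q.Q\<^esub> P.mon i j" by blast
          have "Q.proj (word F (g # w)) = Q.proj (letter F g \<otimes>\<^bsub>?A\<^esub> word F w)"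
            using B.K.word_mult[of "[g]" w] by (simp add: letter_word)
          also have "\<dots> = Q.proj (letter F g) \<otimes>\<^bsub>Q.Q\<^esub> Q.proj (word F w)"
            by (rule p(4)[OF l B.K.word_closed])
          also have "\<dots> = c \<odot>\<^bsub>Q.Q\<^esub> (Q.proj (letter F g) \<otimes>\<^bsub>Q.Q\<^esub> P.mon i j)"
            unfolding c(2) by (rule QA.smult_mult_right[OF c(1) p(1)[OF l] P.mon_closed])
          finally have eq: "Q.proj (word F (g # w)) = c \<odot>\<^bsub>Q.Q\<^esub> (Q.proj (letter F g) \<otimes>\<^bsub>Q.Q\<^esub> P.mon i j)" .
          show ?case
          proof (cases g)
            case Gen_h
            have "?u \<otimes>\<^bsub>Q.Q\<^esub> P.mon i j = P.mon (Suc i) j"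
              using P.u P.v QA.nat_pow_Suc2[OF P.u] by (simp add: QA.m_assoc)
            then have "Q.proj (word F (g # w)) = c \<odot>\<^bsub>Q.Q\<^esub> P.mon (Suc i) j"
              using eq Gen_h by (simp only:)
            then show ?thesis using c(1) by blast
          next
            case Gen_x
            have "?v \<otimes>\<^bsub>Q.Q\<^esub> P.mon i j = (?v \<otimes>\<^bsub>Q.Q\<^esub> ?u [^]\<^bsub>Q.Q\<^esub> i) \<otimes>\<^bsub>Q.Q\<^esub> ?v [^]\<^bsub>Q.Q\<^esub> j"
              using P.u P.v by (simp add: QA.m_assoc)
            also have "\<dots> = q [^]\<^bsub>F\<^esub> i \<odot>\<^bsub>Q.Q\<^esub> P.mon i (Suc j)"
              using P.u P.v B.zD(1) QA.nat_pow_Suc2[OF P.v] by (simp add: P.v_upow QA.m_assoc)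
            finally have "Q.proj (word F (g # w)) = (c \<otimes>\<^bsub>F\<^esub> q [^]\<^bsub>F\<^esub> i) \<odot>\<^bsub>Q.Q\<^esub> P.mon i (Suc j)"
              using eq c(1) Gen_x B.zD(1) P.u P.v by simp
            moreover have "c \<otimes>\<^bsub>F\<^esub> q [^]\<^bsub>F\<^esub> i \<in> carrier F" using c(1) B.zD(1) by simp
            ultimately show ?thesis by blast
          qed
        qed
        then obtain c i j where "c \<in> carrier F" "Q.proj (word F w) = c \<odot>\<^bsub>Q.Q\<^esub> P.mon i j" by blast
        moreover have "P.mon i j \<in> V" using V(2) by blast
        ultimately show "Q.proj (word F w) \<in> V" using QA.subspaceD(4)[OF V(1)] by simp
      qed
    qed auto
  qed
  then show ?thesis using that unfolding Q by blast
qed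

section \<open>Kummer algebras that are fields\<close>

text \<open>Zorn's lemma for the ideals that avoid \<open>\<one>\<close>; the union of a nonempty
  chain is an ideal since any two of its elements lie in a common member.\<close>

lemma (in cring) exists_maximalideal:
  assumes "\<one> \<noteq> \<zero>"
  obtains M where "maximalideal M R"
proof -
  define S where "S = {I. ideal I R \<and> \<one> \<notin> I}"
  have "\<exists>M\<in>S. \<forall>I\<in>S. M \<subseteq> I \<longrightarrow> I = M"
  proof (rule subset_Zorn_nonempty)
    show "S \<noteq> {}" using zeroideal assms by (auto simp: S_def)
    fix C assume C: "C \<noteq> {}" "subset.chain S C"
    have CS: "\<And>I. I \<in> C \<Longrightarrow> ideal I R" "\<And>I. I \<in> C \<Longrightarrow> \<one> \<notin> I"
      and ch: "\<And>I J. I \<in> C \<Longrightarrow> J \<in> C \<Longrightarrow> I \<subseteq> J \<or> J \<subseteq> I"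
      using C(2) by (auto simp: subset.chain_def S_def)
    have "ideal (\<Union>C) R"
    proof (intro idealI ring_axioms subgroup.intro)
      show "\<Union>C \<subseteq> carrier (add_monoid R)" using CS(1) ideal.Icarr by fastforce
      fix x y assume "x \<in> \<Union>C" "y \<in> \<Union>C"
      then obtain I where I: "I \<in> C" "x \<in> I" "y \<in> I" using ch by blast
      interpret I: ideal I R by (rule CS(1)[OF I(1)])
      show "x \<otimes>\<^bsub>add_monoid R\<^esub> y \<in> \<Union>C" using I I.a_closed by auto
    next
      obtain I where I: "I \<in> C" using C(1) by blast
      interpret I: ideal I R by (rule CS(1)[OF I])
      show "\<one>\<^bsub>add_monoid R\<^esub> \<in> \<Union>C"
        by (intro UnionI[OF I]) simp
    next
      fix x assume "x \<in> \<Union>C"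
      then obtain I where I: "I \<in> C" "x \<in> I" by blast
      interpret I: ideal I R by (rule CS(1)[OF I(1)])
      have "\<ominus> x \<in> I" using I I.a_inv_closed by simp
      then show "inv\<^bsub>add_monoid R\<^esub> x \<in> \<Union>C" using I(1) by (auto simp: a_inv_def)
      fix r assume r: "r \<in> carrier R"
      show "r \<otimes> x \<in> \<Union>C" "x \<otimes> r \<in> \<Union>C"
        using I(1) I.I_l_closed[OF I(2) r] I.I_r_closed[OF I(2) r] by blast+
    qed
    then show "\<Union>C \<in> S" using CS(2) by (auto simp: S_def)
  qed
  then obtain M where M: "M \<in> S" "\<And>I. I \<in> S \<Longrightarrow> M \<subseteq> I \<Longrightarrow> I = M" by blast
  have "maximalideal M R"
  proof (rule maximalidealI)
    show "ideal M R" "carrier R \<noteq> M" using M(1) one_closed by (auto simp: S_def)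
    fix J assume J: "ideal J R" "M \<subseteq> J" "J \<subseteq> carrier R"
    show "J = M \<or> J = carrier R"
      using M(2)[of J] J ideal.one_imp_carrier[OF J(1)] by (auto simp: S_def)
  qed
  then show ?thesis by (rule that)
qed

context kummer_algebra
begin

lemma \<tau>_pow_add: "(\<tau> ^^ (i + j)) z = (\<tau> ^^ i) ((\<tau> ^^ j) z)"
  by (simp add: funpow_add)

lemma \<tau>_pow_mult_N: "z \<in> carrier K \<Longrightarrow> (\<tau> ^^ (N * k)) z = z"
proof (induction k)
  case (Suc k)
  then show ?case using \<tau>_order by (simp add: \<tau>_pow_add)
qed simp

lemma \<tau>_pow_closed: "z \<in> carrier K \<Longrightarrow> (\<tau> ^^ i) z \<in> carrier K"
  by (rule alg_homD(1)[OF \<tau>_pow_hom])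

text \<open>
  Let \<open>M\<close> be a maximal ideal and \<open>\<tau>\<^sup>t\<close> a generator of its stabilizer. Some \<open>e\<close> fixed by \<open>\<tau>\<^sup>t\<close> lies in
  all conjugates of \<open>M\<close> except \<open>M\<close> itself. For every \<open>b\<close> fixed by \<open>\<tau>\<^sup>t\<close> the trace of \<open>b \<otimes> e\<close> is then a
  scalar congruent to \<open>b \<otimes> e\<close> modulo \<open>M\<close>, so \<open>b\<close> is congruent to a scalar; with \<open>b = y\<^bsup>N/t\<^esup>\<close> this makes
  \<open>\<alpha>\<close> a \<open>t\<close>-th power. Hence \<open>t = 1\<close>, so \<open>M\<close> is stable under \<open>\<tau>\<close> and must vanish.
\<close>

theorem is_field:
  assumes no_power: "\<And>t. t dvd N \<Longrightarrow> t > 1 \<Longrightarrow> \<alpha> \<notin> powers F t"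
  shows "field K"
proof -
  obtain M where M: "maximalideal M K" using exists_maximalideal[OF nontriv] .
  interpret M: maximalideal M K by fact
  have "primeideal M K" by (rule maximalideal_prime[OF M])
  interpret MP: primeideal M K by fact
  have one: "\<one> \<notin> M" using M.one_imp_carrier M.I_notcarr by blast
  have MS: "submodule M F K" by (rule ideal_subspace[OF M.is_ideal])
  note MS' = subspaceD[OF MS]
  have scalar_M: "c = \<zero>\<^bsub>F\<^esub>" if "c \<in> carrier F" "c \<odot> \<one> \<in> M" for c
    using subspace_cancel[OF MS that(1) _ one_closed that(2)] one by blast
  note h = alg_homD[OF \<tau>_pow_hom]
  define St where "St t \<longleftrightarrow> (\<forall>z\<in>M. (\<tau> ^^ t) z \<in> M)" for t
  have StN: "St N" using \<tau>_order M.Icarr by (auto simp: St_def)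
  define t where "t = (LEAST t. t > 0 \<and> St t)"
  have t: "t > 0" "St t" using LeastI[of "\<lambda>t. t > 0 \<and> St t" N] StN \<zeta>D(2) by (auto simp: t_def)
  have t_min: "\<not> St i" if "0 < i" "i < t" for i using not_less_Least[of i "\<lambda>t. t > 0 \<and> St t"] that by (auto simp: t_def)
  have St_add: "St (i + j)" if "St i" "St j" for i j using that by (auto simp: St_def \<tau>_pow_add)
  have St_mult: "St (i * k)" if "St i" for i k
  proof (induction k)
    case (Suc k)
    then show ?case using St_add[OF that Suc] by simp
  qed (simp add: St_def)
  \<comment> \<open>Exponents cannot be subtracted, so \<open>i mod t\<close> is reached by adding
    multiples of \<open>t\<close> to \<open>i\<close> until the total is \<open>i mod t\<close> plus
    a multiple of \<open>N\<close>, where the power of \<open>\<tau>\<close> has returned to the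
    identity.\<close>
  have t_dvd: "t dvd i" if "St i" for i
  proof -
    have "St (i mod t)"
      unfolding St_def
    proof
      fix z assume z: "z \<in> M"
      let ?k = "N * (i div t) - i div t"
      have "i + t * ?k = N * (t * (i div t)) + i mod t"
      proof -
        have "t * ?k = N * (t * (i div t)) - t * (i div t)" by (simp add: diff_mult_distrib2 mult.left_commute)
        moreover have "t * (i div t) \<le> N * (t * (i div t))" using \<zeta>D(2) by simp
        moreover have "i = t * (i div t) + i mod t" by simp
        ultimately show ?thesis by linarith
      qed
      moreover have "St (i + t * ?k)" by (rule St_add[OF that St_mult[OF t(2)]])
      ultimately have "(\<tau> ^^ (N * (t * (i div t)) + i mod t)) z \<in> M" using z by (simp add: St_def)
      then show "(\<tau> ^^ (i mod t)) z \<in> M"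
        using \<tau>_pow_mult_N[OF \<tau>_pow_closed[OF M.Icarr[OF z]]] by (simp add: \<tau>_pow_add)
    qed
    then have "i mod t = 0" using t_min[of "i mod t"] t(1) by (meson mod_less_divisor not_gr_zero)
    then show ?thesis by (simp add: dvd_eq_mod_eq_0)
  qed
  have tN: "t dvd N" by (rule t_dvd[OF StN])
  then obtain k where k: "N = t * k" by blast
  then have kpos: "k > 0" using \<zeta>D(2) by auto
  text \<open>Components under \<open>\<tau>\<^sup>t\<close> of an element outside \<open>M\<close> stay in every \<open>\<tau>\<^sup>t\<close>-stable ideal containing it.\<close>
  define Mi where "Mi i = {z \<in> carrier K. (\<tau> ^^ i) z \<in> M}" for i
  have Mi_sub: "submodule (Mi i) F K" for i
    using alg_homD[OF \<tau>_pow_hom[of i]] MS' lin_map_zero[OF fa fa alg_hom_lin[OF \<tau>_pow_hom[of i]]]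
    by (intro subspaceI) (auto simp: Mi_def)
  have Mi_stable: "(\<tau> ^^ t) z \<in> Mi i" if "z \<in> Mi i" for z i
  proof -
    have "(\<tau> ^^ t) ((\<tau> ^^ i) z) \<in> M" using that t(2) by (auto simp: Mi_def St_def)
    then show ?thesis using that \<tau>_pow_closed \<tau>_pow_add[of t i z] \<tau>_pow_add[of i t z]
      by (simp add: Mi_def add.commute)
  qed
  \<comment> \<open>Avoidance by multiplication: as \<open>N - i\<close> is not in the stabilizer,
    some element lies in \<open>Mi i\<close> but not in \<open>M\<close>, and the product of such
    elements stays outside \<open>M\<close> because \<open>M\<close> is prime.\<close>
  have ex: "\<exists>m\<in>carrier K. m \<notin> M \<and> (\<forall>i\<in>I. m \<in> Mi i)" if "finite I" "\<And>i. i \<in> I \<Longrightarrow> 0 < i \<and> i < t" for I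
    using that
  proof (induction I)
    case empty
    then show ?case using one one_closed by blast
  next
    case (insert i I)
    then obtain m where m: "m \<in> carrier K" "m \<notin> M" "\<forall>i\<in>I. m \<in> Mi i" by auto
    have it: "0 < i" "i < t" using insert.prems by auto
    have "\<not> St (N - i)"
    proof
      assume "St (N - i)"
      then have "t dvd N - (N - i)" using dvd_diff_nat[OF tN t_dvd] by blast
      moreover have "i \<le> N" using it dvd_imp_le[OF tN] \<zeta>D(2) by simp
      ultimately have "t dvd i" by simp
      then show False using it dvd_imp_le by fastforce
    qed
    then obtain z where z: "z \<in> M" "(\<tau> ^^ (N - i)) z \<notin> M" by (auto simp: St_def)
    let ?z = "(\<tau> ^^ (N - i)) z"
    have zc: "?z \<in> carrier K" using \<tau>_pow_closed M.Icarr[OF z(1)] by simp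
    have "i \<le> N" using it tN \<zeta>D(2) dvd_imp_le[OF tN] by simp
    then have "(\<tau> ^^ i) ?z = z" using \<tau>_order[OF M.Icarr[OF z(1)]] by (simp flip: \<tau>_pow_add)
    then have zi: "?z \<in> Mi i" using z(1) zc by (simp add: Mi_def)
    have "m \<otimes> ?z \<notin> M" using MP.I_prime[OF m(1) zc] m(2) z(2) by blast
    moreover have "m \<otimes> ?z \<in> Mi j" if "j \<in> insert i I" for j
    proof (cases "j = i")
      case True
      then show ?thesis using zi m(1) zc h(1,4) M.I_l_closed by (auto simp: Mi_def)
    next
      case False
      then have "m \<in> Mi j" using m(3) that by auto
      then show ?thesis using m(1) zc h(1,4) M.I_r_closed by (auto simp: Mi_def)
    qed
    ultimately show ?case using m(1) zc by (meson m_closed)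
  qed
  obtain m where m: "m \<in> carrier K" "m \<notin> M" "\<And>i. 0 < i \<Longrightarrow> i < t \<Longrightarrow> m \<in> Mi i"
    using ex[of "{0<..<t}"] by auto
  obtain c where c: "c \<in> {..<N} \<rightarrow> carrier F" "m = (\<Oplus>j\<in>{..<N}. c j \<odot> y [^] j)"
    using spanned_lincomb[OF basisD(1,2)[OF basis] m(1)] .
  \<comment> \<open>Collecting exponents by residue modulo \<open>k\<close> gives the components of
    \<open>m\<close> under \<open>\<tau> ^^ t\<close>, whose eigenvalue on \<open>y [^] j\<close>
    depends only on \<open>j mod k\<close>.\<close>
  let ?w = "\<lambda>r. \<Oplus>j\<in>{j. j < N \<and> j mod k = r}. c j \<odot> y [^] j"
  have wc: "?w r \<in> carrier K" for r using c(1) y(1) by (intro finsum_closed) auto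
  have m_sum: "m = (\<Oplus>r\<in>{..<k}. ?w r)"
  proof -
    have "{..<N} = (\<Union>r\<in>{..<k}. {j. j < N \<and> j mod k = r})" using kpos by auto
    then have "m = (\<Oplus>j\<in>(\<Union>r\<in>{..<k}. {j. j < N \<and> j mod k = r}). c j \<odot> y [^] j)" using c(2) by simp
    also have "\<dots> = (\<Oplus>r\<in>{..<k}. ?w r)"
      using c(1) y(1) by (intro add.finprod_UN_disjoint) (auto simp: pairwise_def disjnt_def)
    finally show ?thesis .
  qed
  have eig_pow: "(inv\<^bsub>F\<^esub> \<zeta>) [^]\<^bsub>F\<^esub> (t * j) = (inv\<^bsub>F\<^esub> \<zeta>) [^]\<^bsub>F\<^esub> (t * (j mod k))" for j
  proof -
    have "(t * j) mod N = (t * (j mod k)) mod N" unfolding k by simp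
    then show ?thesis using K.primitive_root_pow_mod[OF \<zeta>i] by metis
  qed
  have w_eig: "(\<tau> ^^ t) (?w r) = (inv\<^bsub>F\<^esub> \<zeta>) [^]\<^bsub>F\<^esub> (t * r) \<odot> ?w r" for r
  proof -
    have "(\<tau> ^^ t) (?w r) = (\<Oplus>j\<in>{j. j < N \<and> j mod k = r}. (\<tau> ^^ t) (c j \<odot> y [^] j))"
      using c(1) y(1) by (intro lin_map_finsum[OF fa fa alg_hom_lin[OF \<tau>_pow_hom]]) auto
    also have "\<dots> = (\<Oplus>j\<in>{j. j < N \<and> j mod k = r}. (inv\<^bsub>F\<^esub> \<zeta>) [^]\<^bsub>F\<^esub> (t * r) \<odot> (c j \<odot> y [^] j))"
    proof (rule finsum_cong'[OF refl])
      fix j assume "j \<in> {j. j < N \<and> j mod k = r}"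
      then have j: "c j \<in> carrier F" "j mod k = r" using c(1) by auto
      show "(\<tau> ^^ t) (c j \<odot> y [^] j) = (inv\<^bsub>F\<^esub> \<zeta>) [^]\<^bsub>F\<^esub> (t * r) \<odot> (c j \<odot> y [^] j)"
        using j(1) y(1) \<zeta>iD(1) eig_pow[of j] unfolding j(2) by (simp add: h(3) \<tau>_pow_ypow R.m_comm)
    qed (use c(1) y(1) \<zeta>iD(1) in auto)
    also have "\<dots> = (inv\<^bsub>F\<^esub> \<zeta>) [^]\<^bsub>F\<^esub> (t * r) \<odot> ?w r"
      using c(1) y(1) \<zeta>iD(1) by (intro finsum_smult_ldistr[symmetric]) auto
    finally show ?thesis .
  qed
  have w_in: "?w r \<in> V" if V: "submodule V F K" "\<And>z. z \<in> V \<Longrightarrow> (\<tau> ^^ t) z \<in> V" "m \<in> V" and r: "r < k" for V r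
  proof (rule eigenvector_component[OF V(1) _ _ alg_hom_lin[OF \<tau>_pow_hom[of t]] V(2), of "{..<k} - {r}" r ?w
        "\<lambda>_::unit. \<lambda>r. (inv\<^bsub>F\<^esub> \<zeta>) [^]\<^bsub>F\<^esub> (t * r)"])
    have ins: "insert r ({..<k} - {r}) = {..<k}" using r by auto
    show "(\<Oplus>i\<in>insert r ({..<k} - {r}). ?w i) \<in> V" unfolding ins using m_sum V(3) by simp
    show "\<exists>u::unit. (inv\<^bsub>F\<^esub> \<zeta>) [^]\<^bsub>F\<^esub> (t * i) \<noteq> (inv\<^bsub>F\<^esub> \<zeta>) [^]\<^bsub>F\<^esub> (t * r)" if "i \<in> {..<k} - {r}" for i
      using K.primitive_root_inj[OF \<zeta>i, of "t * i" "t * r"] that r t(1) k by auto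
  qed (use wc w_eig \<zeta>iD(1) in auto)
  have "\<exists>r<k. ?w r \<notin> M"
  proof (rule ccontr)
    assume "\<not> ?thesis"
    then have "(\<Oplus>r\<in>{..<k}. ?w r) \<in> M" by (intro subspace_finsum[OF MS]) auto
    then show False using m_sum m(2) by simp
  qed
  then obtain r where r: "r < k" "?w r \<notin> M" by blast
  \<comment> \<open>Dividing a component by the unit \<open>y [^] r\<close> removes its eigenvalue,
    so that the result is fixed by \<open>\<tau> ^^ t\<close>; membership in \<open>M\<close> and
    \<open>Mi i\<close> is not affected.\<close>
  define e where "e = inv (y [^] r) \<otimes> ?w r"
  have yu: "y [^] r \<in> Units K" "inv (y [^] r) \<in> carrier K" using ypow_unit by simp_all
  have ec: "e \<in> carrier K" using yu wc by (simp add: e_def)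
  have we: "?w r = y [^] r \<otimes> e"
    unfolding e_def using yu(1) wc[of r] by (simp flip: m_assoc add: Units_closed)
  have eM: "e \<notin> M" using r(2) we M.I_l_closed y(1) by auto
  have eMi: "e \<in> Mi i" if "0 < i" "i < t" for i
  proof -
    have "?w r \<in> Mi i" by (rule w_in[OF Mi_sub Mi_stable m(3)[OF that] r(1)])
    then show ?thesis using h(1,4) M.I_l_closed yu(2) wc[of r] ec by (auto simp: Mi_def e_def)
  qed
  have e_fixed: "(\<tau> ^^ t) e = e"
  proof -
    have "y [^] r \<otimes> ((inv\<^bsub>F\<^esub> \<zeta>) [^]\<^bsub>F\<^esub> (t * r) \<odot> (\<tau> ^^ t) e) = y [^] r \<otimes> ((inv\<^bsub>F\<^esub> \<zeta>) [^]\<^bsub>F\<^esub> (t * r) \<odot> e)"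
      using w_eig[of r] unfolding we using h(1,4) y(1) ec \<zeta>iD(1) by (simp add: \<tau>_pow_ypow)
    then have "(inv\<^bsub>F\<^esub> \<zeta>) [^]\<^bsub>F\<^esub> (t * r) \<odot> (\<tau> ^^ t) e = (inv\<^bsub>F\<^esub> \<zeta>) [^]\<^bsub>F\<^esub> (t * r) \<odot> e"
      using yu(1) ec h(1) \<zeta>iD(1) by simp
    then have "(inv\<^bsub>F\<^esub> \<zeta>) [^]\<^bsub>F\<^esub> (t * r) \<odot> ((\<tau> ^^ t) e \<ominus> e) = \<zero>"
      using ec h(1) \<zeta>iD(1) by (simp add: minus_eq smult_r_distr smult_r_minus r_neg)
    then show ?thesis
      using smult_cancel_zero[of "(inv\<^bsub>F\<^esub> \<zeta>) [^]\<^bsub>F\<^esub> (t * r)" "(\<tau> ^^ t) e \<ominus> e"] ec h(1) \<zeta>iD(1,4) K.pow_nonzero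
      by simp
  qed
  \<comment> \<open>Applying \<open>\<tau>\<close> permutes the \<open>t\<close> summands of the
    trace cyclically, as \<open>b \<otimes> e\<close> is fixed by
    \<open>\<tau> ^^ t\<close>.\<close>
  have trace: "\<exists>d\<in>carrier F. b \<otimes> e \<ominus> d \<odot> \<one> \<in> M" if b: "b \<in> carrier K" "(\<tau> ^^ t) b = b" for b
  proof -
    let ?be = "b \<otimes> e"
    let ?T = "\<Oplus>i\<in>{..<t}. (\<tau> ^^ i) ?be"
    have bec: "?be \<in> carrier K" using b ec by simp
    have Tc: "?T \<in> carrier K" using bec h(1) by (intro finsum_closed) auto
    have be: "(\<tau> ^^ t) ?be = ?be" using b ec h(4) e_fixed by simp
    have t1: "(\<lambda>i. (\<tau> ^^ i) ?be) \<in> UNIV \<rightarrow> carrier K" using bec h(1) by auto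
    have "\<tau> ?T = (\<Oplus>i\<in>{..<t}. (\<tau> ^^ Suc i) ?be)"
      using bec h(1) lin_map_finsum[OF fa fa alg_hom_lin[OF \<tau>(1)], of "\<lambda>i. (\<tau> ^^ i) ?be" "{..<t}"] by simp
    also have "\<dots> = ?T"
    proof -
      obtain t' where t': "t = Suc t'" using t(1) by (cases t) auto
      have "(\<Oplus>i\<in>{..<Suc t'}. (\<tau> ^^ Suc i) ?be) = (\<tau> ^^ t) ?be \<oplus> (\<Oplus>i\<in>{..<t'}. (\<tau> ^^ Suc i) ?be)"
        unfolding lessThan_Suc t' using bec h(1) by (subst finsum_insert) (auto simp del: funpow.simps)
      also have "(\<Oplus>i\<in>{..<t'}. (\<tau> ^^ Suc i) ?be) = (\<Oplus>i\<in>Suc ` {..<t'}. (\<tau> ^^ i) ?be)"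
        using t1 by (subst finsum_reindex) auto
      also have "(\<tau> ^^ t) ?be \<oplus> \<dots> = (\<Oplus>i\<in>insert 0 (Suc ` {..<t'}). (\<tau> ^^ i) ?be)"
        using bec be h(1) t1 by (subst finsum_insert) auto
      also have "insert 0 (Suc ` {..<t'}) = {..<t}" unfolding t' by (simp add: lessThan_Suc_eq_insert_0)
      finally show ?thesis unfolding t' .
    qed
    finally obtain d where d: "d \<in> carrier F" "?T = d \<odot> \<one>" using fixed_scalar[OF Tc] by (auto simp: scalars_def)
    have "?T = ?be \<oplus> (\<Oplus>i\<in>{..<t} - {0}. (\<tau> ^^ i) ?be)"
    proof -
      have "{..<t} = insert 0 ({..<t} - {0})" using t(1) by auto
      then have "?T = (\<Oplus>i\<in>insert 0 ({..<t} - {0}). (\<tau> ^^ i) ?be)" by simp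
      also have "\<dots> = ?be \<oplus> (\<Oplus>i\<in>{..<t} - {0}. (\<tau> ^^ i) ?be)"
        using bec h(1) by (subst finsum_insert) auto
      finally show ?thesis .
    qed
    moreover have "(\<Oplus>i\<in>{..<t} - {0}. (\<tau> ^^ i) ?be) \<in> M"
    proof (rule subspace_finsum[OF MS], rule Pi_I)
      fix i assume "i \<in> {..<t} - {0}"
      then have "e \<in> Mi i" by (intro eMi) auto
      then show "(\<tau> ^^ i) ?be \<in> M" using b ec h(1,4) M.I_l_closed by (simp add: Mi_def)
    qed
    ultimately obtain r where "r \<in> M" "?be \<oplus> r = d \<odot> \<one>" using d(2) by auto
    moreover have "?be \<ominus> (?be \<oplus> r) = \<ominus> r"
      using bec M.Icarr[OF \<open>r \<in> M\<close>] by (simp add: minus_eq minus_add r_neg2 a_assoc[symmetric] r_neg)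
    ultimately have "?be \<ominus> d \<odot> \<one> = \<ominus> r" by simp
    then show ?thesis using \<open>r \<in> M\<close> d(1) M.a_inv_closed by (intro bexI[of _ d]) auto
  qed
  have "t = 1"
  proof (rule ccontr)
    assume "t \<noteq> 1"
    then have t1: "t > 1" using t(1) by simp
    obtain d1 where d1: "d1 \<in> carrier F" "\<one> \<otimes> e \<ominus> d1 \<odot> \<one> \<in> M"
      using trace[of \<one>] h(5) by auto
    \<comment> \<open>This power is fixed by \<open>\<tau> ^^ t\<close> because
      \<open>t * k = N\<close>, and its own \<open>t\<close>-th power is
      \<open>\<alpha>\<close>.\<close>
    let ?b = "y [^] k"
    have b: "?b \<in> carrier K" "(\<tau> ^^ t) ?b = ?b"
      using y(1) \<zeta>iD(1,3) k by (simp_all add: \<tau>_pow_ypow)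
    obtain d2 where d2: "d2 \<in> carrier F" "?b \<otimes> e \<ominus> d2 \<odot> \<one> \<in> M" using trace[OF b] by auto
    have d1nz: "d1 \<noteq> \<zero>\<^bsub>F\<^esub>" using d1 eM ec by (auto simp: minus_eq)
    define d where "d = inv\<^bsub>F\<^esub> d1 \<otimes>\<^bsub>F\<^esub> d2"
    have u: "d1 \<in> Units F" using d1 d1nz by (simp add: K.field_Units)
    have dc: "d \<in> carrier F" using u d2 by (simp add: d_def)
    have d12: "d1 \<otimes>\<^bsub>F\<^esub> d = d2" unfolding d_def using u d1 d2 by (simp flip: R.m_assoc)
    \<comment> \<open>Modulo \<open>M\<close> the element \<open>e\<close> is the nonzero scalar
      \<open>d1\<close> and \<open>?b \<otimes> e\<close> is the scalar \<open>d2\<close>, so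
      \<open>?b\<close> is their quotient \<open>d\<close>.\<close>
    have "d1 \<odot> (?b \<ominus> d \<odot> \<one>) \<in> M"
    proof -
      have "(?b \<otimes> e \<ominus> d2 \<odot> \<one>) \<ominus> ?b \<otimes> (\<one> \<otimes> e \<ominus> d1 \<odot> \<one>) \<in> M"
        using d1(2) d2(2) b(1) M.I_l_closed MS'(5) by simp
      also have "(?b \<otimes> e \<ominus> d2 \<odot> \<one>) \<ominus> ?b \<otimes> (\<one> \<otimes> e \<ominus> d1 \<odot> \<one>) = ?b \<otimes> (d1 \<odot> \<one>) \<ominus> d2 \<odot> \<one>"
      proof -
        have c: "d1 \<odot> \<one> \<in> carrier K" "d2 \<odot> \<one> \<in> carrier K" using d1 d2 by auto
        show ?thesis using b(1) ec c by algebra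
      qed
      also have "\<dots> = d1 \<odot> (?b \<ominus> d \<odot> \<one>)"
        using b(1) d1(1) dc d12 by (simp add: minus_eq smult_r_distr smult_r_minus)
      finally show ?thesis .
    qed
    from subspace_cancel[OF MS d1(1) d1nz _ this] have bd: "?b \<ominus> d \<odot> \<one> \<in> M" using b(1) dc by simp
    have pw: "?b [^] i \<ominus> (d [^]\<^bsub>F\<^esub> i) \<odot> \<one> \<in> M" for i :: nat
    proof (induction i)
      case 0
      show ?case using MS'(2) by (simp add: minus_eq r_neg)
    next
      case (Suc i)
      have c: "?b [^] i \<in> carrier K" "d \<odot> \<one> \<in> carrier K" "d [^]\<^bsub>F\<^esub> i \<odot> \<one> \<in> carrier K" using b(1) dc by auto
      have "?b [^] Suc i \<ominus> (d [^]\<^bsub>F\<^esub> Suc i) \<odot> \<one> = ?b [^] i \<otimes> ?b \<ominus> (d [^]\<^bsub>F\<^esub> i \<odot> \<one>) \<otimes> (d \<odot> \<one>)"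
        using dc by (simp add: R.m_comm)
      also have "\<dots> = ?b [^] i \<otimes> (?b \<ominus> d \<odot> \<one>) \<oplus> (?b [^] i \<ominus> (d [^]\<^bsub>F\<^esub> i) \<odot> \<one>) \<otimes> (d \<odot> \<one>)"
        using b(1) c by algebra
      finally show ?case using Suc bd c b(1) M.I_l_closed M.I_r_closed MS'(3) by simp
    qed
    have "?b [^] t = \<alpha> \<odot> \<one>" using y k by (simp add: nat_pow_pow mult.commute)
    then have "(\<alpha> \<ominus>\<^bsub>F\<^esub> d [^]\<^bsub>F\<^esub> t) \<odot> \<one> \<in> M" using pw[of t] \<alpha>(1) dc by (simp add: smult_diff_distrib)
    then have "\<alpha> = d [^]\<^bsub>F\<^esub> t" using scalar_M[of "\<alpha> \<ominus>\<^bsub>F\<^esub> d [^]\<^bsub>F\<^esub> t"] \<alpha>(1) dc by simp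
    then show False using no_power[OF tN t1] dc by (auto simp: powers_def)
  qed
  \<comment> \<open>With \<open>t = 1\<close> the ideal is stable under \<open>\<tau>\<close>, so it
    contains every term of each of its elements; a nonzero term would put a unit into
    \<open>M\<close>.\<close>
  have "M = {\<zero>}"
  proof (intro equalityI subsetI)
    fix z assume z: "z \<in> M"
    obtain c where c: "c \<in> {..<N} \<rightarrow> carrier F" "z = (\<Oplus>j\<in>{..<N}. c j \<odot> y [^] j)"
      using spanned_lincomb[OF basisD(1,2)[OF basis] M.Icarr[OF z]] .
    have "c j = \<zero>\<^bsub>F\<^esub>" if j: "j < N" for j
    proof (rule ccontr)
      assume nz: "c j \<noteq> \<zero>\<^bsub>F\<^esub>"
      have "c j \<odot> y [^] j \<in> M"
        by (rule ypow_component[OF MS _ c(1) _ j]) (use t(2) \<open>t = 1\<close> z c(2) in \<open>auto simp: St_def\<close>)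
      from subspace_cancel[OF MS _ nz _ this] have "y [^] j \<in> M" using c(1) j y(1) by auto
      then have "inv (y [^] j) \<otimes> y [^] j \<in> M" using ypow_unit[of j] by (intro M.I_l_closed) auto
      then show False using one ypow_unit[of j] by simp
    qed
    then have "z = \<zero>" unfolding c(2) using y(1) by (intro add.finprod_one_eqI) auto
    then show "z \<in> {\<zero>}" by simp
  qed (use MS' in auto)
  then show "field K" using M zeromaximalideal_eq_field by simp
qed

end

section \<open>Subalgebras\<close>

lemma (in field_algebra) subalgebra:
  assumes V: "submodule V F A" and one: "\<one> \<in> V"
    and mult: "\<And>x y. x \<in> V \<Longrightarrow> y \<in> V \<Longrightarrow> x \<otimes> y \<in> V"
  shows "field_algebra F (A\<lparr>carrier := V\<rparr>)"
proof (rule field_algebraI)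
  note V' = subspaceD[OF V]
  show "field F" ..
  have "subring V A"
    using V' one mult submoduleE(3)[OF V] by (intro subringI) auto
  then show "ring (A\<lparr>carrier := V\<rparr>)" by (rule subring_is_ring)
qed (use subspaceD[OF V] in \<open>auto simp: smult_l_distr smult_r_distr subset_eq\<close>)

lemma nat_pow_carrier_update: "x [^]\<^bsub>A\<lparr>carrier := V\<rparr>\<^esub> (n::nat) = x [^]\<^bsub>A\<^esub> n"
  by (simp add: nat_pow_def)

lemma scalars_carrier_update: "scalars F (A\<lparr>carrier := V\<rparr>) = scalars F A"
  by (simp add: scalars_def)

lemma alg_hom_image_subalgebra:
  assumes "field_algebra F K" "field_algebra F A" "f \<in> alg_hom F K A"
  shows "field_algebra F (A\<lparr>carrier := f ` carrier K\<rparr>)"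
proof -
  interpret K: field_algebra F K by fact
  interpret A: field_algebra F A by fact
  note f = alg_homD[OF assms(3)]
  show ?thesis
  proof (rule A.subalgebra)
    show "submodule (f ` carrier K) F A"
      by (rule lin_map_image_subspace[OF assms(1,2) alg_hom_lin[OF assms(3)] K.carrier_subspace])
    show "\<one>\<^bsub>A\<^esub> \<in> f ` carrier K" using f(5) by (metis K.one_closed imageI)
    show "x \<otimes>\<^bsub>A\<^esub> z \<in> f ` carrier K" if "x \<in> f ` carrier K" "z \<in> f ` carrier K" for x z
      using that f(4) by (auto simp flip: f(4))
  qed
qed

text \<open>It suffices that \<open>T\<close> corresponds to \<open>\<tau>\<close> on the image.
  This covers a power of an ambient automorphism as well as \<open>\<tau>\<close> transported
  through \<open>f\<close>.\<close>

lemma kummer_algebra_image: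
  assumes "kummer_algebra F K N \<zeta> \<alpha> y \<tau>" "field_algebra F A" "f \<in> alg_mono F K A"
    and T: "\<And>e. e \<in> carrier K \<Longrightarrow> T (f e) = f (\<tau> e)"
  shows "kummer_algebra F (A\<lparr>carrier := f ` carrier K\<rparr>) N \<zeta> \<alpha> (f y) T"
proof -
  interpret K: kummer_algebra F K N \<zeta> \<alpha> y \<tau> by fact
  interpret A: field_algebra F A by fact
  let ?L = "A\<lparr>carrier := f ` carrier K\<rparr>"
  note fh = alg_monoD(1)[OF assms(3)] and f = alg_homD[OF alg_monoD(1)[OF assms(3)]]
    and inj = alg_monoD(2)[OF assms(3)] and \<tau> = alg_homD[OF K.\<tau>(1)]
  interpret L: field_algebra F ?L by (rule alg_hom_image_subalgebra[OF K.fa assms(2) fh])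
  have rA: "ring A" ..
  have pow: "f (y [^]\<^bsub>K\<^esub> (i::nat)) = f y [^]\<^bsub>?L\<^esub> i" for i
    by (simp add: alg_hom_pow[OF fh K.rK rA K.y(1)] nat_pow_carrier_update)
  have fL: "f \<in> lin_map F K ?L" using f by (intro lin_mapI) auto
  show ?thesis
  proof
    show "x \<otimes>\<^bsub>?L\<^esub> z = z \<otimes>\<^bsub>?L\<^esub> x" if "x \<in> carrier ?L" "z \<in> carrier ?L" for x z
      using that K.m_comm by (auto simp flip: f(4))
    show "f y [^]\<^bsub>?L\<^esub> N = \<alpha> \<odot>\<^bsub>?L\<^esub> \<one>\<^bsub>?L\<^esub>"
      using pow[of N] K.y K.\<alpha> f(3,5) by simp
    have "f \<one>\<^bsub>K\<^esub> \<noteq> f \<zero>\<^bsub>K\<^esub>" using inj_onD[OF inj, of "\<one>\<^bsub>K\<^esub>" "\<zero>\<^bsub>K\<^esub>"] K.nontriv by auto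
    then show "\<one>\<^bsub>?L\<^esub> \<noteq> \<zero>\<^bsub>?L\<^esub>"
      using f(5) lin_map_zero[OF K.fa assms(2) alg_hom_lin[OF fh]] by simp
    show "spanned F ?L (range (\<lambda>i::nat. f y [^]\<^bsub>?L\<^esub> i))"
      unfolding spanned_def
    proof (intro conjI allI impI)
      show "range (\<lambda>i::nat. f y [^]\<^bsub>?L\<^esub> i) \<subseteq> carrier ?L" using K.y(1) by (auto simp flip: pow)
      fix V assume V: "submodule V F ?L" "range (\<lambda>i::nat. f y [^]\<^bsub>?L\<^esub> i) \<subseteq> V"
      have "submodule {e \<in> carrier K. f e \<in> V} F K"
        using L.subspaceD[OF V(1)] lin_mapD[OF fL] lin_map_zero[OF K.fa L.field_algebra_axioms fL]
        by (intro K.subspaceI) auto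
      moreover have "range (\<lambda>i::nat. y [^]\<^bsub>K\<^esub> i) \<subseteq> {e \<in> carrier K. f e \<in> V}"
        using V(2) K.y(1) pow by auto
      ultimately have "carrier K \<subseteq> {e \<in> carrier K. f e \<in> V}" by (rule spannedD(2)[OF K.span])
      then show "carrier ?L \<subseteq> V" by auto
    qed
    show "T \<in> alg_hom F ?L ?L"
    proof (rule alg_homI[OF lin_mapI])
      fix x z assume "x \<in> carrier ?L" "z \<in> carrier ?L"
      then obtain a b where ab: "a \<in> carrier K" "b \<in> carrier K" "x = f a" "z = f b" by auto
      show "T x \<in> carrier ?L" "T (x \<oplus>\<^bsub>?L\<^esub> z) = T x \<oplus>\<^bsub>?L\<^esub> T z" "T (x \<otimes>\<^bsub>?L\<^esub> z) = T x \<otimes>\<^bsub>?L\<^esub> T z"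
        using ab \<tau> T by (auto simp flip: f(2,4))
      show "T (c \<odot>\<^bsub>?L\<^esub> x) = c \<odot>\<^bsub>?L\<^esub> T x" if "c \<in> carrier F" for c
        using ab \<tau> T that by (auto simp flip: f(3))
    next
      show "T \<one>\<^bsub>?L\<^esub> = \<one>\<^bsub>?L\<^esub>" using T[of "\<one>\<^bsub>K\<^esub>"] \<tau>(5) f(5) by simp
    qed
    show "T (f y) = inv\<^bsub>F\<^esub> \<zeta> \<odot>\<^bsub>?L\<^esub> f y" using T[OF K.y(1)] K.\<tau>(2) f(3) K.y(1) K.\<zeta>iD(1) by simp
  qed (use K.\<zeta> K.\<alpha> K.y(1) in auto)
qed

section \<open>The Galois group of a Kummer field\<close>

text \<open>If \<open>x\<close> is none of the powers of \<open>z\<close>, the geometric sums of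
  \<open>x\<close> times \<open>z\<close> to the power \<open>-j\<close> all vanish. Adding them
  over \<open>j\<close> and exchanging the sums leaves only the terms of exponent zero, which add up
  to \<open>n\<close>, and this is not zero in the field.\<close>

lemma (in field) root_of_unity_cases:
  assumes z: "primitive_root_of_unity R n z" and x: "x \<in> carrier R" "x [^] n = \<one>"
  shows "\<exists>j<n. x = z [^] j"
proof (rule ccontr)
  assume neg: "\<not> ?thesis"
  note zD = primitive_rootD[OF z] and zi = primitive_rootD[OF primitive_root_inverse[OF z]]
  let ?w = "\<lambda>j::nat. x \<otimes> (inv z) [^] j"
  have wc: "?w j \<in> carrier R" for j using x zi by simp
  have zz: "(inv z) [^] j \<otimes> z [^] j = \<one>" for j :: nat
    using zD(1,5) zi(1) by (simp flip: nat_pow_distrib)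
  have "(\<Oplus>i\<in>{..<n}. (?w j) [^] i) = \<zero>" if j: "j < n" for j
  proof (rule geometric_zero[OF wc])
    have "((inv z) [^] j) [^] n = \<one>" using zi(1,3) by (metis nat_pow_one nat_pow_pow mult.commute)
    then show "(?w j) [^] n = \<one>" using x zi(1) by (simp add: nat_pow_distrib)
    show "?w j \<noteq> \<one>"
    proof
      assume "?w j = \<one>"
      then have "z [^] j = ?w j \<otimes> z [^] j" using zD(1) by simp
      also have "\<dots> = x \<otimes> ((inv z) [^] j \<otimes> z [^] j)" using x zD(1) zi(1) by (simp add: m_assoc)
      finally show False using neg j zz[of j] x by (metis r_one)
    qed
  qed
  then have "\<zero> = (\<Oplus>j\<in>{..<n}. \<Oplus>i\<in>{..<n}. (?w j) [^] i)"
    by (intro add.finprod_one_eqI[symmetric]) auto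
  also have "\<dots> = (\<Oplus>i\<in>{..<n}. \<Oplus>j\<in>{..<n}. (?w j) [^] i)"
    using wc by (intro finsum_swap) auto
  also have "\<dots> = (\<Oplus>i\<in>{..<n}. if i = 0 then (\<Oplus>j\<in>{..<n}. \<one>) else \<zero>)"
  proof (rule finsum_cong'[OF refl])
    fix i assume i: "i \<in> {..<n}"
    have "(\<Oplus>j\<in>{..<n}. (?w j) [^] i) = (\<Oplus>j\<in>{..<n}. x [^] i \<otimes> ((inv z) [^] i) [^] j)"
      using x zi(1) by (intro finsum_cong') (auto simp: nat_pow_distrib nat_pow_pow mult.commute)
    also have "\<dots> = x [^] i \<otimes> (\<Oplus>j\<in>{..<n}. ((inv z) [^] i) [^] j)"
      using x zi(1) by (intro finsum_rdistr[symmetric]) auto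
    also have "\<dots> = (if i = 0 then (\<Oplus>j\<in>{..<n}. \<one>) else \<zero>)"
    proof (cases "i = 0")
      case False
      have "((inv z) [^] i) [^] n = \<one>" using zi(1,3) by (metis nat_pow_one nat_pow_pow mult.commute)
      moreover have "(inv z) [^] i \<noteq> \<one>" using zi(6)[of i] False i by simp
      ultimately show ?thesis using geometric_zero zi(1) x False by simp
    qed simp
    finally show "(\<Oplus>j\<in>{..<n}. (?w j) [^] i) = (if i = 0 then (\<Oplus>j\<in>{..<n}. \<one>) else \<zero>)" .
  qed auto
  also have "\<dots> = (\<Oplus>j\<in>{..<n}. \<one>)"
    using add.finprod_singleton_swap[of 0 "{..<n}" "\<lambda>_. \<Oplus>j\<in>{..<n}. \<one>"] zD(2) by simp
  finally show False using primitive_root_order_nonzero[OF z] by simp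
qed

locale kummer_field = kummer_algebra +
  assumes field: "field K"
begin

sublocale KF: field K by (rule field)

abbreviation Gal where "Gal \<equiv> galois_group K (scalars F K)"

text \<open>Members of the Galois group are extensional functions, hence the restriction to the
  carrier.\<close>

definition \<rho> where "\<rho> i = restrict (\<tau> ^^ i) (carrier K)"

lemma \<rho>_apply: "z \<in> carrier K \<Longrightarrow> \<rho> i z = (\<tau> ^^ i) z"
  by (simp add: \<rho>_def)

lemma \<rho>_eq: "(\<tau> ^^ i) y = (\<tau> ^^ j) y \<Longrightarrow> \<rho> i = \<rho> j"
  unfolding \<rho>_def by (rule restrict_ext) (rule hom_eq[OF fa \<tau>_pow_hom \<tau>_pow_hom])

lemma \<rho>_mod: "\<rho> i = \<rho> (i mod N)"
  using K.primitive_root_pow_mod[OF \<zeta>i] by (intro \<rho>_eq) (simp add: \<tau>_pow_y)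

lemma scalar_fixed: "(\<tau> ^^ i) (c \<odot> \<one>) = c \<odot> \<one>" if "c \<in> carrier F"
  using that alg_homD(3,5)[OF \<tau>_pow_hom] by simp

lemma \<rho>_in_Gal: "\<rho> i \<in> carrier Gal"
proof -
  note h = alg_homD[OF \<tau>_pow_hom]
  have "\<rho> i \<in> ring_hom K K"
    using h by (intro ring_hom_memI) (auto simp: \<rho>_def)
  moreover have "bij_betw (\<rho> i) (carrier K) (carrier K)"
  \<comment> \<open>The inverse has to be a natural power of \<open>\<tau>\<close>; since
    \<open>\<tau> ^^ N\<close> is the identity, \<open>N * i - i\<close> serves as the exponent
    \<open>-i\<close>.\<close>
  proof (rule bij_betw_byWitness[where f' = "\<tau> ^^ (N * i - i)"])
    have e: "N * i - i + i = N * i" "i + (N * i - i) = N * i" using \<zeta>D(2) by (cases N; simp)+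
    show "\<forall>a\<in>carrier K. (\<tau> ^^ (N * i - i)) (\<rho> i a) = a"
      using \<tau>_pow_mult_N[of _ i] by (simp add: \<rho>_apply e flip: \<tau>_pow_add)
    show "\<forall>a\<in>carrier K. \<rho> i ((\<tau> ^^ (N * i - i)) a) = a"
      using \<tau>_pow_mult_N[of _ i] h(1) by (simp add: \<rho>_apply e flip: \<tau>_pow_add)
  qed (use h(1) in \<open>auto simp: \<rho>_apply\<close>)
  moreover have "\<rho> i \<in> extensional (carrier K)" by (simp add: \<rho>_def)
  moreover have "\<forall>c\<in>scalars F K. \<rho> i c = c"
    using scalar_fixed by (auto simp: scalars_def \<rho>_apply)
  ultimately show ?thesis by (simp add: galois_group_def Bij_def)
qed

lemma \<zeta>_K: "primitive_root_of_unity K N (inv\<^bsub>F\<^esub> \<zeta> \<odot> \<one>)"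
proof -
  have "(inv\<^bsub>F\<^esub> \<zeta> \<odot> \<one>) [^] (k::nat) = (inv\<^bsub>F\<^esub> \<zeta>) [^]\<^bsub>F\<^esub> k \<odot> \<one>" for k
    using \<zeta>iD(1) by (simp add: smult_pow)
  moreover have "(inv\<^bsub>F\<^esub> \<zeta>) [^]\<^bsub>F\<^esub> (k::nat) \<odot> \<one> = \<one> \<Longrightarrow> (inv\<^bsub>F\<^esub> \<zeta>) [^]\<^bsub>F\<^esub> k = \<one>\<^bsub>F\<^esub>" for k
    using smult_eq_self[OF _ one_closed nontriv] \<zeta>iD(1) by simp
  ultimately show ?thesis using \<zeta>iD by (auto simp: primitive_root_of_unity_def)
qed

text \<open>For an automorphism over the scalars, the image of \<open>y\<close> divided by
  \<open>y\<close> is an \<open>N\<close>-th root of unity, hence a power of \<open>\<zeta>\<close>;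
  and the image of \<open>y\<close> determines the automorphism.\<close>

lemma Gal_carrier: "carrier Gal = \<rho> ` {..<N}"
proof (intro equalityI subsetI)
  fix \<sigma> assume "\<sigma> \<in> carrier Gal"
  then have \<sigma>: "\<sigma> \<in> ring_hom K K" "\<sigma> \<in> extensional (carrier K)" "\<And>c. c \<in> scalars F K \<Longrightarrow> \<sigma> c = c"
    by (auto simp: galois_group_def Bij_def)
  have \<sigma>h: "\<sigma> \<in> alg_hom F K K"
  proof -
    have "\<sigma> (c \<odot> z) = c \<odot> \<sigma> z" if c: "c \<in> carrier F" and z: "z \<in> carrier K" for c z
    proof -
      have "\<sigma> ((c \<odot> \<one>) \<otimes> z) = \<sigma> (c \<odot> \<one>) \<otimes> \<sigma> z" using c z by (intro ring_hom_mult[OF \<sigma>(1)]) auto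
      also have "\<sigma> (c \<odot> \<one>) = c \<odot> \<one>" using c by (intro \<sigma>(3)) (auto simp: scalars_def)
      finally show ?thesis using c z ring_hom_closed[OF \<sigma>(1) z] by simp
    qed
    then show ?thesis using \<sigma>(1) by (simp add: alg_hom_def)
  qed
  have yu: "y \<in> Units K" using ypow_unit[of 1] y(1) by simp
  have \<sigma>y: "\<sigma> y \<in> carrier K" "\<sigma> y [^] N = \<alpha> \<odot> \<one>"
    using alg_homD[OF \<sigma>h] y \<alpha>(1) by (simp_all flip: alg_hom_pow[OF \<sigma>h rK rK y(1)])
  have "(inv y \<otimes> \<sigma> y) [^] N = \<one>"
  proof -
    have "(inv y \<otimes> \<sigma> y) [^] N = (inv y) [^] N \<otimes> y [^] N"
      using yu \<sigma>y y by (simp add: nat_pow_distrib)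
    also have "\<dots> = (inv y \<otimes> y) [^] N" using yu y(1) by (simp add: nat_pow_distrib del: Units_l_inv)
    finally show ?thesis using yu by simp
  qed
  then obtain j where j: "j < N" "inv y \<otimes> \<sigma> y = (inv\<^bsub>F\<^esub> \<zeta> \<odot> \<one>) [^] j"
    using KF.root_of_unity_cases[OF \<zeta>_K, of "inv y \<otimes> \<sigma> y"] yu \<sigma>y(1) by auto
  have "y \<otimes> (inv y \<otimes> \<sigma> y) = \<sigma> y" using yu y(1) \<sigma>y(1) by (simp flip: m_assoc)
  then have "\<sigma> y = (\<tau> ^^ j) y"
    unfolding j(2) using y(1) \<zeta>iD(1) by (simp add: smult_pow \<tau>_pow_y)
  then have "\<sigma> z = (\<tau> ^^ j) z" if "z \<in> carrier K" for z
    using hom_eq[OF fa \<sigma>h \<tau>_pow_hom _ that] by simp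
  then have "\<sigma> = \<rho> j" using \<sigma>(2) by (intro extensionalityI[of _ "carrier K"]) (auto simp: \<rho>_def)
  then show "\<sigma> \<in> \<rho> ` {..<N}" using j(1) by simp
qed (use \<rho>_in_Gal in auto)

lemma \<rho>_inj: "inj_on \<rho> {..<N}"
proof (rule inj_onI)
  fix i j assume ij: "i \<in> {..<N}" "j \<in> {..<N}" "\<rho> i = \<rho> j"
  then have "\<rho> i y = \<rho> j y" by simp
  then have eq: "(inv\<^bsub>F\<^esub> \<zeta>) [^]\<^bsub>F\<^esub> i \<odot> y = (inv\<^bsub>F\<^esub> \<zeta>) [^]\<^bsub>F\<^esub> j \<odot> y" using y(1) by (simp add: \<rho>_apply \<tau>_pow_y)
  have "((inv\<^bsub>F\<^esub> \<zeta>) [^]\<^bsub>F\<^esub> i \<ominus>\<^bsub>F\<^esub> (inv\<^bsub>F\<^esub> \<zeta>) [^]\<^bsub>F\<^esub> j) \<odot> y = \<zero>"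
    using eq y(1) \<zeta>iD(1) by (simp add: smult_diff_distrib minus_eq r_neg)
  then have "(inv\<^bsub>F\<^esub> \<zeta>) [^]\<^bsub>F\<^esub> i = (inv\<^bsub>F\<^esub> \<zeta>) [^]\<^bsub>F\<^esub> j"
    using smult_cancel_zero[of "(inv\<^bsub>F\<^esub> \<zeta>) [^]\<^bsub>F\<^esub> i \<ominus>\<^bsub>F\<^esub> (inv\<^bsub>F\<^esub> \<zeta>) [^]\<^bsub>F\<^esub> j" y]
      ypow_nonzero[of 1] y(1) \<zeta>iD(1) by auto
  then show "i = j" using K.primitive_root_inj[OF \<zeta>i] ij by fastforce
qed

lemma norm_eq: "b \<in> carrier K \<Longrightarrow> galois_norm K (scalars F K) b = (\<Otimes>i\<in>{..<N}. (\<tau> ^^ i) b)"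
  unfolding galois_norm_def Gal_carrier using \<rho>_inj \<tau>_pow_closed
  by (subst finprod_reindex) (auto simp: \<rho>_apply intro!: finprod_cong')

lemma Gal_mult: "\<rho> i \<otimes>\<^bsub>Gal\<^esub> \<rho> j = \<rho> (i + j)"
proof -
  have "\<rho> i \<in> Bij (carrier K)" "\<rho> j \<in> Bij (carrier K)"
    using \<rho>_in_Gal by (auto simp: galois_group_def)
  then have "\<rho> i \<otimes>\<^bsub>Gal\<^esub> \<rho> j = compose (carrier K) (\<rho> i) (\<rho> j)"
    by (simp add: galois_group_def BijGroup_def)
  also have "\<dots> = \<rho> (i + j)"
    using \<tau>_pow_closed by (auto simp: compose_def \<rho>_def \<tau>_pow_add)
  finally show ?thesis .
qed

lemma Gal_one: "\<one>\<^bsub>Gal\<^esub> = \<rho> 0"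
  by (simp add: galois_group_def BijGroup_def \<rho>_def id_def)

lemma Gal_group: "group Gal"
proof (rule groupI)
  show "\<one>\<^bsub>Gal\<^esub> \<in> carrier Gal" unfolding Gal_one by (rule \<rho>_in_Gal)
  fix a b assume "a \<in> carrier Gal" "b \<in> carrier Gal"
  then obtain i j where ij: "a = \<rho> i" "b = \<rho> j" "i < N" by (auto simp: Gal_carrier)
  show "a \<otimes>\<^bsub>Gal\<^esub> b \<in> carrier Gal" unfolding ij Gal_mult by (rule \<rho>_in_Gal)
  show "\<one>\<^bsub>Gal\<^esub> \<otimes>\<^bsub>Gal\<^esub> a = a" unfolding ij Gal_one Gal_mult by simp
  have "\<rho> (N - i) \<otimes>\<^bsub>Gal\<^esub> a = \<one>\<^bsub>Gal\<^esub>"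
    unfolding ij(1) Gal_mult Gal_one using ij(3) \<rho>_mod[of N] by simp
  then show "\<exists>c\<in>carrier Gal. c \<otimes>\<^bsub>Gal\<^esub> a = \<one>\<^bsub>Gal\<^esub>" using \<rho>_in_Gal by blast
  fix c assume "c \<in> carrier Gal"
  then obtain l where "c = \<rho> l" by (auto simp: Gal_carrier)
  then show "a \<otimes>\<^bsub>Gal\<^esub> b \<otimes>\<^bsub>Gal\<^esub> c = a \<otimes>\<^bsub>Gal\<^esub> (b \<otimes>\<^bsub>Gal\<^esub> c)" unfolding ij by (simp add: Gal_mult add.assoc)
qed

lemma cyclic: "cyclic_extension K (scalars F K)"
proof -
  have fin: "finite_dimension (scalars F K) (carrier K)"
    by (rule finite_dimensionI[OF dimension_basis[OF basis]])
  have fixed: "{x \<in> carrier K. \<forall>\<sigma>\<in>carrier Gal. \<sigma> x = x} = scalars F K"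
  proof (intro equalityI subsetI)
    fix x assume "x \<in> {x \<in> carrier K. \<forall>\<sigma>\<in>carrier Gal. \<sigma> x = x}"
    then have "x \<in> carrier K" "\<tau> x = x" using \<rho>_in_Gal[of 1] \<rho>_apply[of x 1] by auto
    then show "x \<in> scalars F K" by (rule fixed_scalar)
  next
    fix x assume "x \<in> scalars F K"
    then obtain c where "c \<in> carrier F" "x = c \<odot> \<one>" by (auto simp: scalars_def)
    then show "x \<in> {x \<in> carrier K. \<forall>\<sigma>\<in>carrier Gal. \<sigma> x = x}"
      using scalar_fixed by (auto simp: Gal_carrier \<rho>_apply)
  qed
  have pow: "\<rho> 1 [^]\<^bsub>Gal\<^esub> (i::nat) = \<rho> i" for i
    using Gal_one by (induction i) (simp_all add: nat_pow_def Gal_mult)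
  interpret G: group Gal by (rule Gal_group)
  have "carrier Gal = range (\<lambda>n::int. \<rho> 1 [^]\<^bsub>Gal\<^esub> n)"
  proof (intro equalityI subsetI)
    fix \<sigma> assume "\<sigma> \<in> carrier Gal"
    then obtain i where "\<sigma> = \<rho> i" by (auto simp: Gal_carrier)
    then have "\<sigma> = \<rho> 1 [^]\<^bsub>Gal\<^esub> int i" using pow by (simp add: int_pow_int)
    then show "\<sigma> \<in> range (\<lambda>n::int. \<rho> 1 [^]\<^bsub>Gal\<^esub> n)" by blast
  qed (use \<rho>_in_Gal in auto)
  then have "cyclic_group Gal" unfolding G.cyclic_group using \<rho>_in_Gal[of 1] by blast
  then show ?thesis
    unfolding cyclic_extension_def using field scalars_subfield[OF nontriv] fin fixed by blast
qed

end

section \<open>Reduced cyclic algebras\<close>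

text \<open>Two views of one cyclic algebra: as a symbol algebra, and as generated by a Kummer field
  together with an element \<open>u\<close> that acts on the field as \<open>\<tau>\<close>.\<close>

locale kummer_symbol = K: kummer_field F K N \<zeta> \<alpha> y \<tau> + symbol_algebra F A N \<zeta> b \<alpha> u v
  for F :: "('f, 'r) ring_scheme" and K :: "('f, 'k, 'y) module_scheme"
    and A :: "('f, 'a, 'x) module_scheme" (structure)
    and N \<zeta> \<alpha> y \<tau> b u v +
  fixes \<iota> :: "'k \<Rightarrow> 'a"
  assumes \<iota>: "\<iota> \<in> alg_hom F K A" "\<iota> y = v"
    and u_\<iota>: "\<And>e. e \<in> carrier K \<Longrightarrow> u \<otimes> \<iota> e = \<iota> (\<tau> e) \<otimes> u"
begin

lemmas \<iota>' = alg_homD[OF \<iota>(1)]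

lemma rA: "ring A" ..
lemma faA: "field_algebra F A" ..

lemma \<iota>_mono: "\<iota> \<in> alg_mono F K A"
proof -
  have "kummer_algebra F K N \<zeta> \<alpha> y \<tau>" "symbol_pair F A N \<zeta> b \<alpha> u v" by unfold_locales
  then show ?thesis by (rule kummer_symbol_mono[OF _ _ \<iota>])
qed

lemma \<iota>_pow: "\<iota> (y [^]\<^bsub>K\<^esub> (i::nat)) = v [^] i"
  using alg_hom_pow[OF \<iota>(1) K.rK rA K.y(1)] \<iota>(2) by simp

lemma \<iota>_image: "\<iota> ` carrier K = {\<Oplus>j\<in>{..<N}. c j \<odot> v [^] j | c. c \<in> {..<N} \<rightarrow> carrier F}"
proof -
  have eq: "\<iota> (\<Oplus>\<^bsub>K\<^esub>j\<in>{..<N}. c j \<odot>\<^bsub>K\<^esub> y [^]\<^bsub>K\<^esub> j) = (\<Oplus>j\<in>{..<N}. c j \<odot> v [^] j)"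
    if c: "c \<in> {..<N} \<rightarrow> carrier F" for c
  proof -
    have "\<iota> (\<Oplus>\<^bsub>K\<^esub>j\<in>{..<N}. c j \<odot>\<^bsub>K\<^esub> y [^]\<^bsub>K\<^esub> j) = (\<Oplus>j\<in>{..<N}. \<iota> (c j \<odot>\<^bsub>K\<^esub> y [^]\<^bsub>K\<^esub> j))"
      using c K.y(1) by (intro lin_map_finsum[OF K.fa faA alg_hom_lin[OF \<iota>(1)]]) auto
    also have "\<dots> = (\<Oplus>j\<in>{..<N}. c j \<odot> v [^] j)"
      using c K.y(1) v \<iota>'(3) \<iota>_pow by (intro finsum_cong') (auto simp: Pi_def)
    finally show ?thesis .
  qed
  have yN: "(\<lambda>j. y [^]\<^bsub>K\<^esub> j) \<in> {..<N} \<rightarrow> carrier K" using K.y(1) by auto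
  show ?thesis
  proof (intro equalityI subsetI)
    fix x assume "x \<in> \<iota> ` carrier K"
    then obtain e where e: "e \<in> carrier K" "x = \<iota> e" by auto
    obtain c where "c \<in> {..<N} \<rightarrow> carrier F" "e = (\<Oplus>\<^bsub>K\<^esub>j\<in>{..<N}. c j \<odot>\<^bsub>K\<^esub> y [^]\<^bsub>K\<^esub> j)"
      using K.spanned_lincomb[OF K.basisD(1,2)[OF K.basis] e(1)] .
    then show "x \<in> {\<Oplus>j\<in>{..<N}. c j \<odot> v [^] j | c. c \<in> {..<N} \<rightarrow> carrier F}" using eq e(2) by auto
  next
    fix x assume "x \<in> {\<Oplus>j\<in>{..<N}. c j \<odot> v [^] j | c. c \<in> {..<N} \<rightarrow> carrier F}"
    then obtain c where c: "c \<in> {..<N} \<rightarrow> carrier F" "x = (\<Oplus>j\<in>{..<N}. c j \<odot> v [^] j)" by auto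
    show "x \<in> \<iota> ` carrier K"
      unfolding c(2) eq[OF c(1), symmetric] by (intro imageI K.lincomb_closed[OF yN c(1)])
  qed
qed

lemma dimension_image: "dimension N (scalars F A) (\<iota> ` carrier K)"
proof -
  have "dimension (card {..<N}) (scalars F A) {\<Oplus>j\<in>{..<N}. c j \<odot> v [^] j | c. c \<in> {..<N} \<rightarrow> carrier F}"
    by (rule dimension_lincombs) (use v v_independent in auto)
  then show ?thesis by (simp add: \<iota>_image)
qed

lemma scalars_image: "scalars F A \<subseteq> \<iota> ` carrier K"
proof
  fix x assume "x \<in> scalars F A"
  then obtain c where "c \<in> carrier F" "x = \<iota> (c \<odot>\<^bsub>K\<^esub> \<one>\<^bsub>K\<^esub>)" using \<iota>'(3,5) by (auto simp: scalars_def)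
  then show "x \<in> \<iota> ` carrier K" by auto
qed

lemma subfield_image: "subfield (\<iota> ` carrier K) A"
proof (rule ring_hom_ring.img_is_subfield(2)[of K A \<iota>])
  show "ring_hom_ring K A \<iota>"
    using \<iota>(1) K.rK rA by (intro ring_hom_ringI2) (auto simp: alg_hom_def)
qed (use K.KF.carrier_is_subfield nontriv in auto)

lemma strictly_maximal: "strictly_maximal_subfield F A (\<iota> ` carrier K)"
  unfolding strictly_maximal_subfield_def
  using subfield_image scalars_image degree dimension_image by blast

lemma cyclic_algebra: "cyclic_algebra F A"
proof -
  \<comment> \<open>The image of \<open>\<iota>\<close> is a Kummer field in its own right, with
    \<open>\<tau>\<close> transported through \<open>\<iota>\<close>, so its Galois group is already
    known.\<close>
  let ?L = "A\<lparr>carrier := \<iota> ` carrier K\<rparr>" and ?T = "\<lambda>x. \<iota> (\<tau> (inv_into (carrier K) \<iota> x))"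
  have "kummer_algebra F ?L N \<zeta> \<alpha> (\<iota> y) ?T"
    using alg_monoD(2)[OF \<iota>_mono]
    by (intro kummer_algebra_image[OF K.kummer_algebra_axioms faA \<iota>_mono]) simp
  moreover have "kummer_field_axioms ?L"
    by (rule kummer_field_axioms.intro[OF subfield_iff(2)[OF subfield_image]])
  ultimately have "kummer_field F ?L N \<zeta> \<alpha> (\<iota> y) ?T" by (rule kummer_field.intro)
  from kummer_field.cyclic[OF this] show ?thesis
    unfolding cyclic_algebra_def
    using central_simple strictly_maximal
    by (auto simp: scalars_carrier_update intro!: exI[of _ "\<iota> ` carrier K"])
qed

end

text \<open>The subalgebra generated by \<open>v\<close> is the image of the Kummer field under the
  embedding that sends the class of the variable to \<open>v\<close>. Swapping the generators makes
  this applicable to \<open>u\<close>.\<close>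

lemma (in symbol_pair) kummer_subfield_v:
  assumes "kummer_field F (kummer F D g) D z g (kummer_gen F D g) T"
  shows "kummer_subfield F A D g v"
proof -
  interpret P: kummer_field F "kummer F D g" D z g "kummer_gen F D g" T by fact
  have rA: "ring A" and faA: "field_algebra F A" by unfold_locales
  let ?K = "kummer F D g" and ?x = "kummer_gen F D g"
  obtain f where f: "f \<in> alg_hom F ?K A" "f ?x = v" using P.hom_exists[OF faA v vD] .
  have "kummer_algebra F ?K D z g ?x T" "symbol_pair F A D z b g u v" by unfold_locales
  from kummer_symbol_mono[OF this f] have mono: "f \<in> alg_mono F ?K A" .
  have sub: "scalars F A \<union> {v} \<subseteq> carrier A" using v by (auto simp: scalars_def)
  have hom: "ring_hom_ring ?K A f"
    using f(1) P.rK rA by (intro ring_hom_ringI2) (auto simp: alg_hom_def)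
  have sf: "subfield (f ` carrier ?K) A"
    by (rule ring_hom_ring.img_is_subfield(2)[OF hom P.KF.carrier_is_subfield]) (use nontriv in simp)
  have img: "f ` carrier ?K = subalg_gen F A {v}"
  proof
    have incl: "scalars F A \<union> {v} \<subseteq> subalg_gen F A {v}"
      unfolding subalg_gen_def by (auto intro: generate_ring.incl)
    have R: "subring (subalg_gen F A {v}) A"
      unfolding subalg_gen_def by (rule generate_ring_is_subring[OF sub])
    note R' = subringE[OF R]
    have V: "submodule (subalg_gen F A {v}) F A"
    proof (rule subspaceI)
      fix c x assume c: "c \<in> carrier F" and x: "x \<in> subalg_gen F A {v}"
      have "(c \<odot> \<one>) \<otimes> x \<in> subalg_gen F A {v}"
        using incl c by (intro R'(6) x) (auto simp: scalars_def)
      then show "c \<odot> x \<in> subalg_gen F A {v}" using c x R'(1) by (auto simp: subset_eq)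
    qed (use R' in auto)
    have "v [^] (i::nat) \<in> subalg_gen F A {v}" for i
      using R' incl by (induction i) auto
    then have pow: "f (?x [^]\<^bsub>?K\<^esub> (i::nat)) \<in> subalg_gen F A {v}" for i
      using alg_hom_pow[OF f(1) P.rK rA P.y(1)] f(2) by simp
    have "submodule {e \<in> carrier ?K. f e \<in> subalg_gen F A {v}} F ?K"
      using alg_homD[OF f(1)] subspaceD[OF V] lin_map_zero[OF P.fa faA alg_hom_lin[OF f(1)]]
      by (intro P.subspaceI) auto
    then have "carrier ?K \<subseteq> {e \<in> carrier ?K. f e \<in> subalg_gen F A {v}}"
      by (rule spannedD(2)[OF P.span]) (use pow P.y(1) in auto)
    then show "f ` carrier ?K \<subseteq> subalg_gen F A {v}" by blast
    have "scalars F A \<union> {v} \<subseteq> f ` carrier ?K"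
    proof -
      have "c \<odot> \<one> = f (c \<odot>\<^bsub>?K\<^esub> \<one>\<^bsub>?K\<^esub>)" if "c \<in> carrier F" for c
        using that alg_homD(3,5)[OF f(1)] by simp
      then show ?thesis using f(2) P.y(1) by (auto simp: scalars_def)
    qed
    then show "subalg_gen F A {v} \<subseteq> f ` carrier ?K"
      unfolding subalg_gen_def
      by (rule generate_ring_min_subring1[OF sub subfieldE(1)[OF sf]])
  qed
  show ?thesis unfolding kummer_subfield_def using sf img mono f(2) by auto
qed

section \<open>Splitting and norms\<close>

lemma (in field) self_alg_algebra: "field_algebra R (self_alg R)"
proof (rule field_algebraI)
  show "ring (self_alg R)"
    by (rule ringI) (auto intro!: abelian_groupI monoidI simp: self_alg_def a_ac m_ac l_distr r_distr
        intro: bexI[OF _ a_inv_closed] l_neg)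
qed (auto simp: self_alg_def l_distr r_distr m_assoc m_lcomm field_axioms)

lemma finsum_self_alg: "finsum (self_alg F) f I = finsum F f I"
  by (simp add: finsum_def finprod_def self_alg_def)

text \<open>The field is a symbol algebra of degree one with arbitrary nonzero parameters. Full
  matrix algebras over it thereby become a case of \<open>matrix_over_corner\<close>.\<close>

lemma (in field) self_alg_symbol_algebra:
  assumes g: "b \<in> carrier R" "b \<noteq> \<zero>" "g \<in> carrier R" "g \<noteq> \<zero>"
  shows "symbol_algebra R (self_alg R) 1 \<one> b g b g"
proof -
  interpret S: field_algebra R "self_alg R" by (rule self_alg_algebra)
  have simps: "carrier (self_alg R) = carrier R" "\<one>\<^bsub>self_alg R\<^esub> = \<one>" "\<zero>\<^bsub>self_alg R\<^esub> = \<zero>"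
    "\<And>x y. x \<otimes>\<^bsub>self_alg R\<^esub> y = x \<otimes> y" "\<And>x y. x \<odot>\<^bsub>self_alg R\<^esub> y = x \<otimes> y"
    by (simp_all add: self_alg_def)
  show ?thesis
  proof
    show "spanned R (self_alg R) {b [^]\<^bsub>self_alg R\<^esub> i \<otimes>\<^bsub>self_alg R\<^esub> g [^]\<^bsub>self_alg R\<^esub> j |(i::nat) (j::nat). True}"
      unfolding spanned_def
    proof (intro conjI allI impI)
      show "{b [^]\<^bsub>self_alg R\<^esub> i \<otimes>\<^bsub>self_alg R\<^esub> g [^]\<^bsub>self_alg R\<^esub> j |(i::nat) (j::nat). True} \<subseteq> carrier (self_alg R)"
      proof clarify
        fix i j :: nat
        show "b [^]\<^bsub>self_alg R\<^esub> i \<otimes>\<^bsub>self_alg R\<^esub> g [^]\<^bsub>self_alg R\<^esub> j \<in> carrier (self_alg R)"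
          using g by (intro S.m_closed S.nat_pow_closed) (simp_all add: simps(1))
      qed
      fix V assume V: "submodule V R (self_alg R)"
        "{b [^]\<^bsub>self_alg R\<^esub> i \<otimes>\<^bsub>self_alg R\<^esub> g [^]\<^bsub>self_alg R\<^esub> j |(i::nat) (j::nat). True} \<subseteq> V"
      have "b [^]\<^bsub>self_alg R\<^esub> (0::nat) \<otimes>\<^bsub>self_alg R\<^esub> g [^]\<^bsub>self_alg R\<^esub> (0::nat) \<in> V" using V(2) by blast
      then have "\<one> \<in> V" by (simp only: S.nat_pow_0 simps(2,4) l_one one_closed)
      then have "x \<otimes> \<one> \<in> V" if "x \<in> carrier R" for x
        using S.subspaceD(4)[OF V(1)] that by (metis simps(5))
      then show "carrier (self_alg R) \<subseteq> V" by (auto simp: simps)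
    qed
  qed (use g primitive_root_one in \<open>auto simp: simps m_comm\<close>)
qed

lemma lin_map_vimage_subspace:
  assumes "field_algebra F A" "field_algebra F B" "f \<in> lin_map F A B" "submodule V F B"
  shows "submodule {x \<in> carrier A. f x \<in> V} F A"
proof -
  interpret A: field_algebra F A by fact
  interpret B: field_algebra F B by fact
  show ?thesis
    using B.subspaceD[OF assms(4)] lin_mapD[OF assms(3)] lin_map_zero[OF assms(1,2,3)]
    by (intro A.subspaceI) auto
qed

lemma (in monoid) twisted_commute:
  assumes u: "u \<in> carrier G" and f: "\<And>c. c \<in> D \<Longrightarrow> f c \<in> carrier G"
    and t: "\<And>c. c \<in> D \<Longrightarrow> t c \<in> D" and uf: "\<And>c. c \<in> D \<Longrightarrow> u \<otimes> f c = f (t c) \<otimes> u"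
    and c: "c \<in> D"
  shows "u [^] (i::nat) \<otimes> f c = f ((t ^^ i) c) \<otimes> u [^] i"
  using c
proof (induction i arbitrary: c)
  case (Suc i)
  have D: "(t ^^ j) d \<in> D" if "d \<in> D" for j d using that t by (induction j) auto
  have "u [^] Suc i \<otimes> f c = (u [^] i \<otimes> f (t c)) \<otimes> u"
    using Suc.prems u f t by (simp add: m_assoc uf)
  also have "\<dots> = f ((t ^^ Suc i) c) \<otimes> u [^] Suc i"
    using Suc.IH[OF t[OF Suc.prems]] u f[OF D[OF t[OF Suc.prems]]] by (simp add: m_assoc funpow_swap1)
  finally show ?case .
qed (use u f in simp)

section \<open>Twisted products and the norm criterion\<close>

context kummer_symbol
begin

text \<open>A partial norm: the coefficient that appears when
  \<open>(\<iota> c \<otimes> u) [^] i\<close> is rewritten with \<open>u [^] i\<close> on the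
  right. At \<open>i = N\<close> it is the Galois norm.\<close>

definition tw :: "'k \<Rightarrow> nat \<Rightarrow> 'k" where "tw c i = (\<Otimes>\<^bsub>K\<^esub>l\<in>{..<i}. (\<tau> ^^ l) c)"

lemma tw_closed: "c \<in> carrier K \<Longrightarrow> tw c i \<in> carrier K"
  unfolding tw_def using K.\<tau>_pow_closed by (intro K.finprod_closed) auto

lemma tw_Suc: "c \<in> carrier K \<Longrightarrow> tw c (Suc i) = tw c i \<otimes>\<^bsub>K\<^esub> (\<tau> ^^ i) c"
  unfolding tw_def lessThan_Suc using K.\<tau>_pow_closed
  by (subst K.finprod_insert) (auto intro!: K.m_comm K.finprod_closed)

lemma tw_0: "tw c 0 = \<one>\<^bsub>K\<^esub>"
  by (simp add: tw_def)

lemma tw_mult: "c \<in> carrier K \<Longrightarrow> d \<in> carrier K \<Longrightarrow> tw c i \<otimes>\<^bsub>K\<^esub> tw d i = tw (c \<otimes>\<^bsub>K\<^esub> d) i"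
  unfolding tw_def using K.\<tau>_pow_closed alg_homD(4)[OF K.\<tau>_pow_hom]
  by (subst K.finprod_multf[symmetric]) (auto intro!: K.finprod_cong')

lemma tw_one: "tw \<one>\<^bsub>K\<^esub> i = \<one>\<^bsub>K\<^esub>"
  unfolding tw_def using alg_homD(5)[OF K.\<tau>_pow_hom] by (intro K.finprod_one_eqI) auto

lemma upow_\<iota>: "c \<in> carrier K \<Longrightarrow> u [^] (i::nat) \<otimes> \<iota> c = \<iota> ((\<tau> ^^ i) c) \<otimes> u [^] i"
  by (rule twisted_commute[where D = "carrier K"]) (use u \<iota>'(1) alg_homD(1)[OF K.\<tau>(1)] u_\<iota> in auto)

lemma twisted_pow: "c \<in> carrier K \<Longrightarrow> (\<iota> c \<otimes> u) [^] (i::nat) = \<iota> (tw c i) \<otimes> u [^] i"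
proof (induction i)
  case (Suc i)
  note c = Suc.prems K.\<tau>_pow_closed[OF Suc.prems, of i] tw_closed[OF Suc.prems, of i]
  have "(\<iota> c \<otimes> u) [^] Suc i = \<iota> (tw c i) \<otimes> (u [^] i \<otimes> \<iota> c) \<otimes> u"
    using Suc u \<iota>'(1) c by (simp add: m_assoc)
  also have "\<dots> = \<iota> (tw c i) \<otimes> \<iota> ((\<tau> ^^ i) c) \<otimes> u [^] Suc i"
    unfolding upow_\<iota>[OF c(1)] using u \<iota>'(1) c by (simp add: m_assoc)
  finally show ?case using c \<iota>'(4) by (simp add: tw_Suc)
qed (use \<iota>'(5) in \<open>simp add: tw_0\<close>)

lemma norm_tw: "c \<in> carrier K \<Longrightarrow> galois_norm K (scalars F K) c = tw c N"
  unfolding tw_def by (rule K.norm_eq)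

text \<open>Replacing \<open>u\<close> by \<open>u'\<close> divides \<open>b\<close> by the norm of
  \<open>e\<close>, which leaves the parameter one. After a swap of the generators the matrix step
  applies with \<open>M = 1\<close> and \<open>d\<close> equal to one, so the remaining coefficients
  are the field itself.\<close>

lemma split_if_norm:
  assumes e: "e \<in> Units K" and b_norm: "b \<odot>\<^bsub>K\<^esub> \<one>\<^bsub>K\<^esub> = tw e N"
  shows "alg_isomorphic F A (mat_alg N (self_alg F))"
proof -
  let ?i = "inv\<^bsub>K\<^esub> e" and ?zi = "inv\<^bsub>F\<^esub> \<zeta>"
  define u' where "u' = \<iota> ?i \<otimes> u"
  have ec: "e \<in> carrier K" "?i \<in> carrier K" "?i \<otimes>\<^bsub>K\<^esub> e = \<one>\<^bsub>K\<^esub>" "e \<otimes>\<^bsub>K\<^esub> ?i = \<one>\<^bsub>K\<^esub>" using e by auto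
  have u': "u' \<in> carrier A" using ec u \<iota>'(1) by (simp add: u'_def)
  have u'_pow: "u' [^] (i::nat) = \<iota> (tw ?i i) \<otimes> u [^] i" for i
    unfolding u'_def by (rule twisted_pow[OF ec(2)])
  have inv_tw: "tw ?i i \<otimes>\<^bsub>K\<^esub> tw e i = \<one>\<^bsub>K\<^esub>" "tw e i \<otimes>\<^bsub>K\<^esub> tw ?i i = \<one>\<^bsub>K\<^esub>" for i
    using ec by (simp_all add: tw_mult tw_one)
  have "u' [^] N = \<iota> (tw ?i N) \<otimes> (b \<odot> \<one>)" using u'_pow uD by simp
  also have "b \<odot> \<one> = \<iota> (tw e N)" using b \<iota>'(3,5) by (simp flip: b_norm)
  also have "\<iota> (tw ?i N) \<otimes> \<iota> (tw e N) = \<one>"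
    using inv_tw(1)[of N] ec tw_closed \<iota>'(4,5) by (metis)
  finally have u'N: "u' [^] N = \<one>" .
  have v\<iota>: "v \<otimes> \<iota> c = \<iota> c \<otimes> v" if "c \<in> carrier K" for c
    using that \<iota>'(4) K.y(1) K.m_comm by (metis \<iota>(2))
  have vu': "v \<otimes> u' = \<zeta> \<odot> (u' \<otimes> v)"
  proof -
    have "v \<otimes> u' = \<iota> ?i \<otimes> (v \<otimes> u)"
      unfolding u'_def using v\<iota>[OF ec(2)] v u \<iota>'(1)[OF ec(2)] by (simp flip: m_assoc)
    then show ?thesis
      unfolding vu u'_def using v u \<iota>'(1)[OF ec(2)] zD(1) by (simp add: m_assoc)
  qed
  interpret U: symbol_pair F A N \<zeta> "\<one>\<^bsub>F\<^esub>" \<alpha> u' v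
    by unfold_locales (use z g u' v vu' u'N vD nontriv K.K.one_not_zero in auto)
  have "symbol_algebra F A N \<zeta> \<one>\<^bsub>F\<^esub> \<alpha> u' v"
  proof
    show "spanned F A {U.mon i j | i j. True}"
      unfolding spanned_def
    proof (intro conjI allI impI)
      fix V assume V: "submodule V F A" "{U.mon i j | i j. True} \<subseteq> V"
      have 1: "\<iota> c \<otimes> U.mon i j \<in> V" if c: "c \<in> carrier K" for c i j
      proof -
        have "(\<lambda>c. \<iota> c \<otimes> U.mon i j) \<in> lin_map F K A"
          using \<iota>' u' v by (intro lin_mapI) (auto simp: l_distr)
        then have "submodule {c \<in> carrier K. \<iota> c \<otimes> U.mon i j \<in> V} F K"
          by (rule lin_map_vimage_subspace[OF K.fa faA _ V(1)])
        moreover have "range (\<lambda>l::nat. y [^]\<^bsub>K\<^esub> l) \<subseteq> {c \<in> carrier K. \<iota> c \<otimes> U.mon i j \<in> V}"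
        proof clarify
          fix l :: nat
          have "\<iota> (y [^]\<^bsub>K\<^esub> l) \<otimes> U.mon i j = (v [^] l \<otimes> u' [^] i) \<otimes> v [^] j"
            using \<iota>_pow u' v by (simp add: m_assoc)
          also have "\<dots> = \<zeta> [^]\<^bsub>F\<^esub> (i * l) \<odot> U.mon i (l + j)"
            using U.vpow_upow[of l i] u' v zD(1) by (simp add: m_assoc nat_pow_mult)
          finally have "\<iota> (y [^]\<^bsub>K\<^esub> l) \<otimes> U.mon i j = \<zeta> [^]\<^bsub>F\<^esub> (i * l) \<odot> U.mon i (l + j)" .
          moreover have "U.mon i (l + j) \<in> V" using V(2) by blast
          ultimately show "y [^]\<^bsub>K\<^esub> l \<in> carrier K \<and> \<iota> (y [^]\<^bsub>K\<^esub> l) \<otimes> U.mon i j \<in> V"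
            using subspaceD(4)[OF V(1)] zD(1) K.y(1) by simp
        qed
        ultimately have "carrier K \<subseteq> {c \<in> carrier K. \<iota> c \<otimes> U.mon i j \<in> V}" by (rule spannedD(2)[OF K.span])
        then show ?thesis using c by auto
      qed
      show "carrier A \<subseteq> V"
      proof (rule spannedD(2)[OF span V(1)], safe)
        fix i j :: nat
        note t = tw_closed[OF ec(1), of i] tw_closed[OF ec(2), of i]
        \<comment> \<open>Multiplying by \<open>tw e i\<close> undoes the rescaling of
          \<open>u [^] i\<close>, so the old monomials are combinations of the new ones.\<close>
        have "\<iota> (tw e i) \<otimes> U.mon i j = (\<iota> (tw e i) \<otimes> \<iota> (tw ?i i)) \<otimes> mon i j"
          unfolding u'_pow using t \<iota>'(1) u v by (simp add: m_assoc)
        also have "\<iota> (tw e i) \<otimes> \<iota> (tw ?i i) = \<one>"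
          using inv_tw(2)[of i] t \<iota>'(4,5) by metis
        finally show "mon i j \<in> V" using 1[OF t(1), of i j] by simp
      qed
    qed (use u' v in auto)
  qed
  from symbol_algebra_swap[OF this]
  have S: "symbol_algebra F A (1 * N) ?zi \<alpha> \<one>\<^bsub>F\<^esub> v u'" by simp
  interpret S: split_symbol F A 1 N ?zi \<alpha> "\<one>\<^bsub>F\<^esub>" v u' "\<one>\<^bsub>F\<^esub>"
    "fourier N (?zi [^]\<^bsub>F\<^esub> (1::nat)) \<one>\<^bsub>F\<^esub> (u' [^] (1::nat))"
    by (rule split_symbol_fourier[OF S]) auto
  have zN: "?zi [^]\<^bsub>F\<^esub> N = \<one>\<^bsub>F\<^esub>" by (rule K.\<zeta>iD(3))
  have C: "symbol_algebra F (self_alg F) 1 (?zi [^]\<^bsub>F\<^esub> N) \<alpha> \<one>\<^bsub>F\<^esub> \<alpha> \<one>\<^bsub>F\<^esub>"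
    unfolding zN using K.K.self_alg_symbol_algebra g K.K.one_not_zero by auto
  obtain f where f: "f \<in> alg_mono F (self_alg F) A" "f \<alpha> = v [^] N" "f \<one>\<^bsub>F\<^esub> = S.y"
    using symbol_mono[OF C S.corner_pair] .
  interpret M: matrix_over_algebra F "self_alg F" A N f S.unit
    by (rule S.matrix_over_corner[OF C f])
  show ?thesis by (rule M.isomorphic)
qed

text \<open>The left ideal of \<open>\<epsilon>\<close> is the first column of the matrices. The
  field acts on it without torsion and has the same dimension \<open>N\<close>, so the column is its
  orbit of \<open>\<epsilon>\<close>. This produces \<open>e\<close>, and applying \<open>u\<close>
  to \<open>\<epsilon>\<close> \<open>N\<close> times compares \<open>b\<close> with the norm of
  \<open>e\<close>.\<close>

lemma norm_if_split:
  assumes "alg_isomorphic F A (mat_alg N (self_alg F))"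
  shows "\<exists>e\<in>Units K. b \<odot>\<^bsub>K\<^esub> \<one>\<^bsub>K\<^esub> = tw e N"
proof -
  obtain f where f: "f \<in> alg_hom F A (mat_alg N (self_alg F))"
    and bij: "bij_betw f (carrier A) (carrier (mat_alg N (self_alg F)))"
    using assms by (auto simp: alg_isomorphic_def)
  note f' = alg_homD[OF f]
  let ?S = "self_alg F"
  interpret S: field_algebra F ?S by (rule K.K.self_alg_algebra)
  have faS: "field_algebra F ?S" by (rule K.K.self_alg_algebra)
  define \<chi> where "\<chi> p r x = f x (p, r)" for p r x
  have fc: "f x \<in> {..<N} \<times> {..<N} \<rightarrow>\<^sub>E carrier F" if "x \<in> carrier A" for x
    using f'(1)[OF that] by (simp add: mat_alg_def self_alg_def)
  have \<chi>_closed: "\<chi> p r x \<in> carrier F" if "p < N" "r < N" "x \<in> carrier A" for p r x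
    using fc[OF that(3)] that(1,2) by (auto simp: \<chi>_def)
  have \<chi>_lin: "\<chi> p r \<in> lin_map F A ?S" if "p < N" "r < N" for p r
    using that f'(2,3) \<chi>_closed by (intro lin_mapI) (auto simp: \<chi>_def mat_alg_def self_alg_def)
  have \<chi>_mult: "\<chi> p r (x \<otimes> x') = (\<Oplus>\<^bsub>F\<^esub>l\<in>{..<N}. \<chi> p l x \<otimes>\<^bsub>F\<^esub> \<chi> l r x')"
    if "p < N" "r < N" "x \<in> carrier A" "x' \<in> carrier A" for p r x x'
    using that f'(4) by (simp add: \<chi>_def mat_alg_def finsum_self_alg) (simp add: self_alg_def)
  have \<chi>_eq: "x = x'" if "x \<in> carrier A" "x' \<in> carrier A"
    "\<And>p r. p < N \<Longrightarrow> r < N \<Longrightarrow> \<chi> p r x = \<chi> p r x'" for x x'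
  proof -
    have "f x = f x'"
      using fc[OF that(1)] fc[OF that(2)] that(3) by (intro PiE_ext) (auto simp: \<chi>_def)
    then show ?thesis using bij_betw_imp_inj_on[OF bij] that(1,2) by (auto dest: inj_onD)
  qed
  \<comment> \<open>The preimages of the matrix units in the first column; \<open>B 0\<close> will
    be the idempotent \<open>\<epsilon>\<close>.\<close>
  define B where "B i = inv_into (carrier A) f
    (\<lambda>p\<in>{..<N} \<times> {..<N}. if p = (i, 0) then \<one>\<^bsub>F\<^esub> else \<zero>\<^bsub>F\<^esub>)" for i :: nat
  have "(\<lambda>p\<in>{..<N} \<times> {..<N}. if p = (i, 0) then \<one>\<^bsub>F\<^esub> else \<zero>\<^bsub>F\<^esub>) \<in> f ` carrier A" for i
    unfolding bij_betw_imp_surj_on[OF bij] by (simp add: mat_alg_def self_alg_def)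
  then have B: "B i \<in> carrier A" and
    fB: "f (B i) = (\<lambda>p\<in>{..<N} \<times> {..<N}. if p = (i, 0) then \<one>\<^bsub>F\<^esub> else \<zero>\<^bsub>F\<^esub>)" for i
    unfolding B_def by (blast intro: inv_into_into, blast intro: f_inv_into_f)
  have \<chi>B: "\<chi> p r (B i) = (if p = i \<and> r = 0 then \<one>\<^bsub>F\<^esub> else \<zero>\<^bsub>F\<^esub>)" if "p < N" "r < N" for p r i
    using that by (simp add: \<chi>_def fB)
  have BN: "B \<in> {..<N} \<rightarrow> carrier A" using B by auto
  have \<chi>_sum: "\<chi> p r (\<Oplus>i\<in>{..<N}. c i \<odot> B i) = (if r = 0 then c p else \<zero>\<^bsub>F\<^esub>)"
    if c: "c \<in> {..<N} \<rightarrow> carrier F" and pr: "p < N" "r < N" for c p r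
  proof -
    have "\<chi> p r (\<Oplus>i\<in>{..<N}. c i \<odot> B i) = (\<Oplus>\<^bsub>F\<^esub>i\<in>{..<N}. \<chi> p r (c i \<odot> B i))"
      using c B lin_map_finsum[OF faA faS \<chi>_lin[OF pr], where I = "{..<N}" and w = "\<lambda>i. c i \<odot> B i"]
      by (auto simp: finsum_self_alg)
    also have "\<dots> = (\<Oplus>\<^bsub>F\<^esub>i\<in>{..<N}. if i = p then (if r = 0 then c p else \<zero>\<^bsub>F\<^esub>) else \<zero>\<^bsub>F\<^esub>)"
    proof (rule K.R.finsum_cong'[OF refl])
      fix i assume i: "i \<in> {..<N}"
      have ci: "c i \<in> carrier F" using c i by auto
      have "\<chi> p r (c i \<odot> B i) = c i \<otimes>\<^bsub>F\<^esub> \<chi> p r (B i)"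
        using lin_mapD(3)[OF \<chi>_lin[OF pr] ci B] by (simp add: self_alg_def)
      then show "\<chi> p r (c i \<odot> B i) = (if i = p then (if r = 0 then c p else \<zero>\<^bsub>F\<^esub>) else \<zero>\<^bsub>F\<^esub>)"
        using \<chi>B[OF pr, of i] ci by auto
    qed (use c pr in auto)
    also have "\<dots> = (if r = 0 then c p else \<zero>\<^bsub>F\<^esub>)"
      using c pr K.R.add.finprod_singleton_swap[of p "{..<N}" "\<lambda>_. if r = 0 then c p else \<zero>\<^bsub>F\<^esub>"]
      by (auto simp: Pi_def cong: if_cong)
    finally show ?thesis .
  qed
  define \<epsilon> where "\<epsilon> = B 0"
  have N0: "0 < N" by (rule zD(2))
  have \<epsilon>: "\<epsilon> \<in> carrier A" by (simp add: \<epsilon>_def B)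
  have col: "x \<otimes> \<epsilon> = (\<Oplus>i\<in>{..<N}. \<chi> i 0 x \<odot> B i)" if x: "x \<in> carrier A" for x
  proof (rule \<chi>_eq)
    have c: "(\<lambda>i. \<chi> i 0 x) \<in> {..<N} \<rightarrow> carrier F" using \<chi>_closed N0 x by auto
    show "(\<Oplus>i\<in>{..<N}. \<chi> i 0 x \<odot> B i) \<in> carrier A" by (rule lincomb_closed[OF BN c])
    fix p r assume pr: "p < N" "r < N"
    have "\<chi> p r (x \<otimes> \<epsilon>) = (\<Oplus>\<^bsub>F\<^esub>l\<in>{..<N}. \<chi> p l x \<otimes>\<^bsub>F\<^esub> \<chi> l r \<epsilon>)" by (rule \<chi>_mult[OF pr x \<epsilon>])
    also have "\<dots> = (\<Oplus>\<^bsub>F\<^esub>l\<in>{..<N}. if l = 0 then (if r = 0 then \<chi> p 0 x else \<zero>\<^bsub>F\<^esub>) else \<zero>\<^bsub>F\<^esub>)"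
      using \<chi>_closed x pr \<chi>B by (intro K.R.finsum_cong') (auto simp: \<epsilon>_def)
    also have "\<dots> = (if r = 0 then \<chi> p 0 x else \<zero>\<^bsub>F\<^esub>)"
      using \<chi>_closed x pr N0 K.R.add.finprod_singleton_swap[of 0 "{..<N}" "\<lambda>_. if r = 0 then \<chi> p 0 x else \<zero>\<^bsub>F\<^esub>"] by auto
    finally show "\<chi> p r (x \<otimes> \<epsilon>) = \<chi> p r (\<Oplus>i\<in>{..<N}. \<chi> i 0 x \<odot> B i)"
      using \<chi>_sum[OF c pr] by simp
  qed (use x \<epsilon> in simp)
  define W where "W = {\<Oplus>i\<in>{..<N}. c i \<odot> B i | c. c \<in> {..<N} \<rightarrow> carrier F}"
  define W' where "W' = {\<Oplus>j\<in>{..<N}. c j \<odot> (v [^] j \<otimes> \<epsilon>) | c. c \<in> {..<N} \<rightarrow> carrier F}"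
  have "dimension (card {..<N}) (scalars F A) W"
    unfolding W_def
  proof (rule dimension_lincombs[OF _ BN])
    fix c i assume c: "c \<in> {..<N} \<rightarrow> carrier F" "(\<Oplus>i\<in>{..<N}. c i \<odot> B i) = \<zero>" "i \<in> {..<N}"
    have "\<chi> i 0 \<zero> = \<zero>\<^bsub>F\<^esub>" using lin_map_zero[OF faA faS \<chi>_lin[of i 0]] c(3) N0 by (simp add: self_alg_def)
    then show "c i = \<zero>\<^bsub>F\<^esub>" using \<chi>_sum[OF c(1), of i 0] c(2,3) N0 by simp
  qed simp
  then have dimW: "dimension N (scalars F A) W" by simp
  have \<epsilon>0: "\<epsilon> \<noteq> \<zero>"
  proof
    assume "\<epsilon> = \<zero>"
    then have "\<chi> 0 0 \<epsilon> = \<zero>\<^bsub>F\<^esub>" using lin_map_zero[OF faA faS \<chi>_lin[of 0 0]] N0 by (simp add: self_alg_def)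
    then show False using \<chi>B[OF N0 N0, of 0] K.K.one_not_zero by (simp add: \<epsilon>_def)
  qed
  \<comment> \<open>A nonzero coefficient is invertible, as \<open>K\<close> is a field, and would
    force \<open>\<epsilon>\<close> to be zero.\<close>
  have cancel: "c = \<zero>\<^bsub>K\<^esub>" if c: "c \<in> carrier K" "\<iota> c \<otimes> \<epsilon> = \<zero>" for c
  proof (rule ccontr)
    assume "c \<noteq> \<zero>\<^bsub>K\<^esub>"
    then have "c \<in> Units K" using c(1) by (simp add: K.KF.field_Units)
    then have "inv\<^bsub>K\<^esub> c \<otimes>\<^bsub>K\<^esub> c = \<one>\<^bsub>K\<^esub>" "inv\<^bsub>K\<^esub> c \<in> carrier K" by auto
    then have "\<iota> (inv\<^bsub>K\<^esub> c) \<otimes> (\<iota> c \<otimes> \<epsilon>) = \<epsilon>"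
      using c(1) \<iota>'(1,4,5) \<epsilon> by (metis l_one m_assoc)
    then show False using c(2) \<epsilon>0 \<iota>'(1) \<open>inv\<^bsub>K\<^esub> c \<in> carrier K\<close> by simp
  qed
  have sum_v: "(\<Oplus>j\<in>{..<N}. c j \<odot> (v [^] j \<otimes> \<epsilon>)) = \<iota> (\<Oplus>\<^bsub>K\<^esub>j\<in>{..<N}. c j \<odot>\<^bsub>K\<^esub> y [^]\<^bsub>K\<^esub> j) \<otimes> \<epsilon>"
    if c: "c \<in> {..<N} \<rightarrow> carrier F" for c
  proof -
    have l: "(\<lambda>e. \<iota> e \<otimes> \<epsilon>) \<in> lin_map F K A" using \<iota>' \<epsilon> by (intro lin_mapI) (auto simp: l_distr)
    have "\<iota> (\<Oplus>\<^bsub>K\<^esub>j\<in>{..<N}. c j \<odot>\<^bsub>K\<^esub> y [^]\<^bsub>K\<^esub> j) \<otimes> \<epsilon> = (\<Oplus>j\<in>{..<N}. \<iota> (c j \<odot>\<^bsub>K\<^esub> y [^]\<^bsub>K\<^esub> j) \<otimes> \<epsilon>)"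
      using c K.y(1) by (intro lin_map_finsum[OF K.fa faA l]) auto
    also have "\<dots> = (\<Oplus>j\<in>{..<N}. c j \<odot> (v [^] j \<otimes> \<epsilon>))"
      using c K.y(1) v \<epsilon> \<iota>'(3) \<iota>_pow by (intro finsum_cong') (auto simp: Pi_def)
    finally show ?thesis ..
  qed
  have yN: "(\<lambda>j. y [^]\<^bsub>K\<^esub> j) \<in> {..<N} \<rightarrow> carrier K" using K.y(1) by auto
  have "dimension (card {..<N}) (scalars F A) W'"
    unfolding W'_def
  proof (rule dimension_lincombs)
    fix c i assume c: "c \<in> {..<N} \<rightarrow> carrier F" "(\<Oplus>j\<in>{..<N}. c j \<odot> (v [^] j \<otimes> \<epsilon>)) = \<zero>" "i \<in> {..<N}"
    have "(\<Oplus>\<^bsub>K\<^esub>j\<in>{..<N}. c j \<odot>\<^bsub>K\<^esub> y [^]\<^bsub>K\<^esub> j) = \<zero>\<^bsub>K\<^esub>"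
      using c(2) sum_v[OF c(1)] by (intro cancel K.lincomb_closed[OF yN c(1)]) simp
    then show "c i = \<zero>\<^bsub>F\<^esub>" using K.basis c(1,3) by (auto simp: is_basis_def)
  qed (use v \<epsilon> in auto)
  then have dimW': "dimension N (scalars F A) W'" by simp
  have W'W: "W' \<subseteq> W"
  proof
    fix x assume "x \<in> W'"
    then obtain c where c: "c \<in> {..<N} \<rightarrow> carrier F" "x = \<iota> (\<Oplus>\<^bsub>K\<^esub>j\<in>{..<N}. c j \<odot>\<^bsub>K\<^esub> y [^]\<^bsub>K\<^esub> j) \<otimes> \<epsilon>"
      using sum_v by (auto simp: W'_def)
    have "\<iota> (\<Oplus>\<^bsub>K\<^esub>j\<in>{..<N}. c j \<odot>\<^bsub>K\<^esub> y [^]\<^bsub>K\<^esub> j) \<in> carrier A" by (intro \<iota>'(1) K.lincomb_closed[OF yN c(1)])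
    from col[OF this] c(2) \<chi>_closed[OF _ N0 this] show "x \<in> W" by (auto simp: W_def)
  qed
  have sf: "subfield (scalars F A) A" by (rule scalars_subfield[OF nontriv])
  \<comment> \<open>A base of \<open>W'\<close> is an independent list of length \<open>N\<close> in
    the space \<open>W\<close> of dimension \<open>N\<close>, so it spans \<open>W\<close>.\<close>
  have "W' = W"
  proof -
    obtain Vs where Vs: "independent (scalars F A) Vs" "length Vs = N" "Span (scalars F A) Vs = W'"
      "set Vs \<subseteq> carrier A"
      using exists_base[OF sf dimW'] by blast
    have "set Vs \<subseteq> W" using Span_base_incl[OF sf Vs(4)] Vs(3) W'W by simp
    then show ?thesis using independent_length_eq_dimension[OF sf dimW Vs(1)] Vs(2,3) by simp
  qed
  moreover have "u \<otimes> \<epsilon> \<in> W" using col[OF u] \<chi>_closed[OF _ N0 u] by (auto simp: W_def)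
  ultimately obtain c where c: "c \<in> {..<N} \<rightarrow> carrier F" "u \<otimes> \<epsilon> = \<iota> (\<Oplus>\<^bsub>K\<^esub>j\<in>{..<N}. c j \<odot>\<^bsub>K\<^esub> y [^]\<^bsub>K\<^esub> j) \<otimes> \<epsilon>"
    using sum_v by (auto simp: W'_def)
  define e where "e = (\<Oplus>\<^bsub>K\<^esub>j\<in>{..<N}. c j \<odot>\<^bsub>K\<^esub> y [^]\<^bsub>K\<^esub> j)"
  have e: "e \<in> carrier K" unfolding e_def by (rule K.lincomb_closed[OF yN c(1)])
  \<comment> \<open>The innermost \<open>u\<close> is replaced by \<open>e\<close>, which is then
    moved to the left past \<open>u [^] i\<close> and becomes twisted by \<open>\<tau> ^^ i\<close>;
    this builds up the partial norm.\<close>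
  have u\<epsilon>: "u [^] (i::nat) \<otimes> \<epsilon> = \<iota> (tw e i) \<otimes> \<epsilon>" for i
  proof (induction i)
    case (Suc i)
    have "u [^] Suc i \<otimes> \<epsilon> = (u [^] i \<otimes> \<iota> e) \<otimes> \<epsilon>"
      using u \<epsilon> e \<iota>'(1) c(2) by (simp add: m_assoc e_def)
    also have "\<dots> = \<iota> ((\<tau> ^^ i) e) \<otimes> (u [^] i \<otimes> \<epsilon>)"
      unfolding upow_\<iota>[OF e] using u \<epsilon> e \<iota>'(1) K.\<tau>_pow_closed[OF e] by (simp add: m_assoc)
    also have "\<dots> = \<iota> ((\<tau> ^^ i) e \<otimes>\<^bsub>K\<^esub> tw e i) \<otimes> \<epsilon>"
      unfolding Suc using \<epsilon> \<iota>'(1,4) K.\<tau>_pow_closed[OF e] tw_closed[OF e] by (simp add: m_assoc)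
    finally show ?case using K.m_comm K.\<tau>_pow_closed[OF e] tw_closed[OF e] by (simp add: tw_Suc[OF e])
  qed (use \<epsilon> \<iota>'(5) in \<open>simp add: tw_0\<close>)
  have bK: "b \<odot>\<^bsub>K\<^esub> \<one>\<^bsub>K\<^esub> \<in> carrier K" using b by simp
  have "\<iota> (tw e N \<ominus>\<^bsub>K\<^esub> b \<odot>\<^bsub>K\<^esub> \<one>\<^bsub>K\<^esub>) \<otimes> \<epsilon> = (\<iota> (tw e N) \<ominus> \<iota> (b \<odot>\<^bsub>K\<^esub> \<one>\<^bsub>K\<^esub>)) \<otimes> \<epsilon>"
    using lin_map_minus[OF K.fa faA alg_hom_lin[OF \<iota>(1)] tw_closed[OF e] bK] by simp
  also have "\<dots> = \<iota> (tw e N) \<otimes> \<epsilon> \<ominus> b \<odot> \<epsilon>"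
    using \<iota>'(1)[OF tw_closed[OF e]] \<iota>'(3,5) b \<epsilon> by (simp add: minus_eq l_distr l_minus)
  also have "\<dots> = \<zero>"
    unfolding u\<epsilon>[symmetric] uD using b \<epsilon> by (simp add: minus_eq r_neg)
  finally have "tw e N \<ominus>\<^bsub>K\<^esub> b \<odot>\<^bsub>K\<^esub> \<one>\<^bsub>K\<^esub> = \<zero>\<^bsub>K\<^esub>"
    by (intro cancel) (use tw_closed[OF e] bK in auto)
  then have norm: "tw e N = b \<odot>\<^bsub>K\<^esub> \<one>\<^bsub>K\<^esub>" using tw_closed[OF e] bK by simp
  have "e \<noteq> \<zero>\<^bsub>K\<^esub>"
  proof
    assume "e = \<zero>\<^bsub>K\<^esub>"
    then have "tw e N = \<zero>\<^bsub>K\<^esub>"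
      using e N0 tw_closed[OF e] tw_Suc[OF e, of "N - 1"] lin_map_zero[OF K.fa K.fa alg_hom_lin[OF K.\<tau>_pow_hom]] by simp
    then have "b \<odot>\<^bsub>K\<^esub> \<one>\<^bsub>K\<^esub> = \<zero>\<^bsub>K\<^esub>" using norm by simp
    then show False using b K.smult_cancel_zero[OF _ _ K.one_closed] K.nontriv by blast
  qed
  then have "e \<in> Units K" using e by (simp add: K.KF.field_Units)
  then show ?thesis using norm[symmetric] by (intro bexI)
qed

theorem split_iff_norm:
  "alg_isomorphic F A (mat_alg N (self_alg F)) \<longleftrightarrow>
    (\<exists>e\<in>Units K. b \<odot>\<^bsub>K\<^esub> \<one>\<^bsub>K\<^esub> = galois_norm K (scalars F K) e)"
  using norm_if_split split_if_norm norm_tw K.Units_closed by (metis)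

end

section \<open>Direct sum decompositions\<close>

context field_algebra
begin

lemma finsum_diff:
  assumes "finite I" "v \<in> I \<rightarrow> carrier A" "w \<in> I \<rightarrow> carrier A"
  shows "(\<Oplus>i\<in>I. v i \<ominus> w i) = (\<Oplus>i\<in>I. v i) \<ominus> (\<Oplus>i\<in>I. w i)"
proof -
  have "(\<Oplus>i\<in>I. v i \<ominus> w i) = (\<Oplus>i\<in>I. v i \<oplus> (\<ominus>\<^bsub>F\<^esub> \<one>\<^bsub>F\<^esub>) \<odot> w i)"
    using assms by (intro finsum_cong') (auto simp: minus_eq smult_minus_one Pi_def)
  also have "\<dots> = (\<Oplus>i\<in>I. v i) \<oplus> (\<Oplus>i\<in>I. (\<ominus>\<^bsub>F\<^esub> \<one>\<^bsub>F\<^esub>) \<odot> w i)"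
    using assms by (intro finsum_addf) auto
  also have "(\<Oplus>i\<in>I. (\<ominus>\<^bsub>F\<^esub> \<one>\<^bsub>F\<^esub>) \<odot> w i) = (\<ominus>\<^bsub>F\<^esub> \<one>\<^bsub>F\<^esub>) \<odot> (\<Oplus>i\<in>I. w i)"
    using assms by (intro finsum_smult_ldistr[symmetric]) auto
  finally show ?thesis using assms by (simp add: minus_eq smult_minus_one)
qed

lemma sums_subspace:
  assumes V: "\<And>i. i < (k::nat) \<Longrightarrow> submodule (V i) F A"
  shows "submodule {\<Oplus>i\<in>{..<k}. v i | v. v \<in> (\<Pi>\<^sub>E i\<in>{..<k}. V i)} F A" 
    and "\<And>i. i < k \<Longrightarrow> V i \<subseteq> {\<Oplus>i\<in>{..<k}. v i | v. v \<in> (\<Pi>\<^sub>E i\<in>{..<k}. V i)}"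
proof -
  let ?S = "{\<Oplus>i\<in>{..<k}. v i | v. v \<in> (\<Pi>\<^sub>E i\<in>{..<k}. V i)}"
  note V' = subspaceD[OF V]
  have cl: "v \<in> {..<k} \<rightarrow> carrier A" if "v \<in> (\<Pi>\<^sub>E i\<in>{..<k}. V i)" for v
    using that V'(1) by (auto simp: PiE_def Pi_def)
  have I: "(\<Oplus>i\<in>{..<k}. v i) \<in> ?S" if "\<And>i. i < k \<Longrightarrow> v i \<in> V i" for v
  proof -
    have "(\<Oplus>i\<in>{..<k}. v i) = (\<Oplus>i\<in>{..<k}. restrict v {..<k} i)"
      using that V'(1) by (intro finsum_cong') (auto simp: subset_eq)
    moreover have "restrict v {..<k} \<in> (\<Pi>\<^sub>E i\<in>{..<k}. V i)" using that by auto
    ultimately show ?thesis by blast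
  qed
  show "submodule ?S F A"
  proof (rule subspaceI)
    show "?S \<subseteq> carrier A" using cl by auto
    have "(\<Oplus>i\<in>{..<k}. \<zero>) \<in> ?S" using V'(2) by (intro I) auto
    then show "\<zero> \<in> ?S" by simp
  next
    fix x y assume "x \<in> ?S" "y \<in> ?S"
    then obtain v w where vw: "v \<in> (\<Pi>\<^sub>E i\<in>{..<k}. V i)" "w \<in> (\<Pi>\<^sub>E i\<in>{..<k}. V i)"
      "x = (\<Oplus>i\<in>{..<k}. v i)" "y = (\<Oplus>i\<in>{..<k}. w i)" by blast
    have "(\<Oplus>i\<in>{..<k}. v i \<oplus> w i) \<in> ?S"
      using V'(3) PiE_mem[OF vw(1)] PiE_mem[OF vw(2)] by (intro I) simp
    then show "x \<oplus> y \<in> ?S" using vw cl by (simp add: finsum_addf)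
  next
    fix c x assume c: "c \<in> carrier F" and "x \<in> ?S"
    then obtain v where v: "v \<in> (\<Pi>\<^sub>E i\<in>{..<k}. V i)" "x = (\<Oplus>i\<in>{..<k}. v i)" by blast
    have "(\<Oplus>i\<in>{..<k}. c \<odot> v i) \<in> ?S" using V'(4) PiE_mem[OF v(1)] c by (intro I) simp
    then show "c \<odot> x \<in> ?S" using v cl c by (simp add: finsum_smult_ldistr)
  qed
  show "V i \<subseteq> ?S" if i: "i < k" for i
  proof
    fix x assume x: "x \<in> V i"
    then have "(\<Oplus>j\<in>{..<k}. if j = i then x else \<zero>) \<in> ?S" using V'(2) by (intro I) auto
    moreover have "(\<Oplus>j\<in>{..<k}. if j = i then x else \<zero>) = x"
      using i x V'(1)[OF i] by (intro finsum_delta) auto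
    ultimately show "x \<in> ?S" by simp
  qed
qed

text \<open>Spanning is tested on subspaces that contain all summands, and uniqueness on vanishing
  sums of arbitrary functions, so applications need not handle the extensional functions of the
  definition.\<close>

lemma internal_direct_sumI:
  assumes V: "\<And>i. i < k \<Longrightarrow> submodule (V i) F A" "\<And>i. i < k \<Longrightarrow> V i \<subseteq> W"
    and W: "submodule W F A" "\<And>U. submodule U F A \<Longrightarrow> (\<And>i. i < k \<Longrightarrow> V i \<subseteq> U) \<Longrightarrow> W \<subseteq> U"
    and indep: "\<And>d i. (\<And>i. i < k \<Longrightarrow> d i \<in> V i) \<Longrightarrow> (\<Oplus>i\<in>{..<k}. d i) = \<zero> \<Longrightarrow> i < k \<Longrightarrow> d i = \<zero>"
  shows "internal_direct_sum F A k V W"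
proof -
  let ?f = "\<lambda>v. \<Oplus>i\<in>{..<k}. v i"
  note V' = subspaceD[OF V(1)]
  have cl: "v \<in> {..<k} \<rightarrow> carrier A" if "v \<in> (\<Pi>\<^sub>E i\<in>{..<k}. V i)" for v
    using that V'(1) by (auto simp: PiE_def Pi_def)
  have "inj_on ?f (\<Pi>\<^sub>E i\<in>{..<k}. V i)"
  proof (rule inj_onI)
    fix v w assume vw: "v \<in> (\<Pi>\<^sub>E i\<in>{..<k}. V i)" "w \<in> (\<Pi>\<^sub>E i\<in>{..<k}. V i)" "?f v = ?f w"
    have "?f (\<lambda>i. v i \<ominus> w i) = ?f v \<ominus> ?f w" using vw cl by (intro finsum_diff) auto
    then have "?f (\<lambda>i. v i \<ominus> w i) = \<zero>" using vw(3) cl[OF vw(2)] by (simp add: minus_eq r_neg)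
    note sum0 = this
    have "v i \<ominus> w i = \<zero>" if "i < k" for i
    proof (rule indep[of "\<lambda>i. v i \<ominus> w i", OF _ _ that])
      show "v j \<ominus> w j \<in> V j" if "j < k" for j
        using V'(5)[OF that] PiE_mem[OF vw(1)] PiE_mem[OF vw(2)] that by simp
    qed (rule sum0)
    then have "v i = w i" if "i < k" for i using that cl[OF vw(1)] cl[OF vw(2)] by (simp add: Pi_def)
    then show "v = w" using vw by (intro PiE_ext[OF vw(1,2)]) auto
  qed
  moreover have "?f ` (\<Pi>\<^sub>E i\<in>{..<k}. V i) = W"
  proof
    show "?f ` (\<Pi>\<^sub>E i\<in>{..<k}. V i) \<subseteq> W"
      using V(2) by (auto intro!: subspace_finsum[OF W(1)])
    have "W \<subseteq> {?f v | v. v \<in> (\<Pi>\<^sub>E i\<in>{..<k}. V i)}" by (intro W(2) sums_subspace[OF V(1)])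
    then show "W \<subseteq> ?f ` (\<Pi>\<^sub>E i\<in>{..<k}. V i)" by blast
  qed
  ultimately show ?thesis using V(1) by (simp add: internal_direct_sum_def bij_betw_def)
qed

text \<open>The subspace has its own unit \<open>e\<close>, in general different from
  \<open>\<one>\<close>; the factors of the product in claim 4 have this form.\<close>

lemma corner_algebra:
  assumes V: "submodule V F A" "\<And>x y. x \<in> V \<Longrightarrow> y \<in> V \<Longrightarrow> x \<otimes> y \<in> V"
    and e: "e \<in> V" "\<And>x. x \<in> V \<Longrightarrow> e \<otimes> x = x" "\<And>x. x \<in> V \<Longrightarrow> x \<otimes> e = x"
  shows "field_algebra F (A\<lparr>carrier := V, one := e\<rparr>)"
proof (rule field_algebraI)
  note V' = subspaceD[OF V(1)]
  have c: "x \<in> V \<Longrightarrow> x \<in> carrier A" for x using V'(1) by auto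
  show "field F" ..
  show "ring (A\<lparr>carrier := V, one := e\<rparr>)"
  proof (rule ringI)
    have "\<exists>y\<in>V. y \<oplus> x = \<zero>" if "x \<in> V" for x
      using submoduleE(3)[OF V(1) that] c[OF that] by (intro bexI[of _ "\<ominus> x"]) (auto simp: l_neg)
    then show "abelian_group (A\<lparr>carrier := V, one := e\<rparr>)"
      using V' by (intro abelian_groupI) (auto simp: a_ac c)
    show "monoid (A\<lparr>carrier := V, one := e\<rparr>)" using V e by (intro monoidI) (auto simp: m_assoc c)
  qed (auto simp: l_distr r_distr c)
qed (use subspaceD[OF V(1)] in \<open>auto simp: smult_l_distr smult_r_distr subset_eq\<close>)

lemma finsum_subalgebra:
  assumes "field_algebra F (A\<lparr>carrier := V\<rparr>)" "V \<subseteq> carrier A" "f \<in> I \<rightarrow> V"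
  shows "finsum (A\<lparr>carrier := V\<rparr>) f I = finsum A f I"
proof -
  have "(\<lambda>x. x) \<in> lin_map F (A\<lparr>carrier := V\<rparr>) A" using assms(2) by (intro lin_mapI) auto
  from lin_map_finsum[OF assms(1) field_algebra_axioms this] assms(3) show ?thesis by simp
qed

end

text \<open>The summands are eigenspaces of conjugation by \<open>v\<close>, which fixes the image
  of \<open>K\<close> and multiplies \<open>u [^] i\<close> by a power of \<open>\<zeta>\<close>;
  distinct eigenvalues make the sum direct. With \<open>f\<close> the identity this is the
  decomposition in claim 1, with an embedding the one in claim 3.\<close>

lemma (in kummer_symbol) image_decomposition:
  assumes B: "field_algebra F B" and f: "f \<in> alg_mono F A B"
  shows "internal_direct_sum F B N (\<lambda>i. {f (\<iota> c \<otimes> u [^] i) | c. c \<in> carrier K}) (f ` carrier A)"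
proof -
  interpret B: field_algebra F B by fact
  note fh = alg_monoD(1)[OF f] and f' = alg_homD[OF alg_monoD(1)[OF f]]
  let ?w = "\<lambda>i c. \<iota> c \<otimes> u [^] (i::nat)"
  have w: "?w i c \<in> carrier A" if "c \<in> carrier K" for i c using that \<iota>'(1) u by simp
  have w_lin: "?w i \<in> lin_map F K A" for i
    using \<iota>' u by (intro lin_mapI) (auto simp: l_distr)
  have fw_lin: "(\<lambda>c. f (?w i c)) \<in> lin_map F K B" for i
    using lin_mapD[OF w_lin] f' by (intro lin_mapI) auto
  have im: "{f (?w i c) | c. c \<in> carrier K} = (\<lambda>c. f (?w i c)) ` carrier K" for i by auto
  have w_ypow: "?w i (y [^]\<^bsub>K\<^esub> j) = \<zeta> [^]\<^bsub>F\<^esub> (i * j) \<odot> mon i j" for i j :: nat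
    using vpow_upow[of j i] \<iota>_pow by simp
  have conj: "conj_op True (?w i c) = conj_val True (i, 0) \<odot> ?w i c" if c: "c \<in> carrier K" for i c
  proof (rule spanned_lin_map_eq[OF K.fa faA _ _ K.span _ c])
    show "(\<lambda>c. conj_op True (?w i c)) \<in> lin_map F K A"
      using lin_mapD[OF w_lin] lin_mapD[OF conj_op_lin] by (intro lin_mapI) auto
    show "(\<lambda>c. conj_val True (i, 0) \<odot> ?w i c) \<in> lin_map F K A"
      using lin_mapD[OF w_lin] conj_val_closed
      by (intro lin_mapI) (auto simp: smult_r_distr K.R.m_comm)
    fix s assume "s \<in> range (\<lambda>j::nat. y [^]\<^bsub>K\<^esub> j)"
    then obtain j :: nat where s: "s = y [^]\<^bsub>K\<^esub> j" by blast
    show "conj_op True (?w i s) = conj_val True (i, 0) \<odot> ?w i s"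
    proof -
      have "conj_val True (i, j) = conj_val True (i, 0)" by (simp add: conj_val_def)
      then show ?thesis
        unfolding s w_ypow using lin_mapD(3)[OF conj_op_lin] conj_op_mon[of True i j] conj_val_closed zD(1)
          K.R.m_comm[of "\<zeta> [^]\<^bsub>F\<^esub> (i * j)" "conj_val True (i, 0)"]
        by simp
    qed
  qed
  show ?thesis
  proof (rule B.internal_direct_sumI)
    show "submodule {f (?w i c) | c. c \<in> carrier K} F B" for i
      unfolding im by (rule lin_map_image_subspace[OF K.fa B fw_lin K.carrier_subspace])
    show "{f (?w i c) | c. c \<in> carrier K} \<subseteq> f ` carrier A" for i using w by auto
    show "submodule (f ` carrier A) F B"
      by (rule lin_map_image_subspace[OF faA B alg_hom_lin[OF fh] carrier_subspace])
  next
    fix U assume U: "submodule U F B" "\<And>i. i < N \<Longrightarrow> {f (?w i c) | c. c \<in> carrier K} \<subseteq> U"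
    have "carrier A \<subseteq> {x \<in> carrier A. f x \<in> U}"
    proof (rule spannedD(2)[OF span lin_map_vimage_subspace[OF faA B alg_hom_lin[OF fh] U(1)]], safe)
      fix i j :: nat
      have "f (?w (i mod N) (y [^]\<^bsub>K\<^esub> j)) \<in> U" using K.y(1) by (intro subsetD[OF U(2)[OF mod_less_divisor[OF zD(2)]]]) blast
      then have "\<zeta> [^]\<^bsub>F\<^esub> (i mod N * j) \<odot>\<^bsub>B\<^esub> f (mon (i mod N) j) \<in> U" unfolding w_ypow using f'(3) zD(1) by simp
      then have *: "f (mon (i mod N) j) \<in> U"
        by (rule B.subspace_cancel[OF U(1), rotated 3]) (use zD K.K.pow_nonzero f'(1) in auto)
      \<comment> \<open>Higher powers of \<open>u\<close> fold back to exponents below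
        \<open>N\<close>, with a scalar power of \<open>b\<close>.\<close>
      have "mon i j = b [^]\<^bsub>F\<^esub> (i div N) \<odot> mon (i mod N) j"
        using upow_mod[of i] u v b by (metis K.R.nat_pow_closed nat_pow_closed smult_mult_left)
      then show "f (mon i j) \<in> U" using * f'(3) b B.subspaceD(4)[OF U(1)] by simp
    qed (use u v in auto)
    then show "f ` carrier A \<subseteq> U" by auto
  next
    fix d i assume d: "\<And>i. i < N \<Longrightarrow> d i \<in> {f (?w i c) | c. c \<in> carrier K}"
      and sum: "(\<Oplus>\<^bsub>B\<^esub>i\<in>{..<N}. d i) = \<zero>\<^bsub>B\<^esub>" and i: "i < N"
    obtain c where c: "\<And>i. i < N \<Longrightarrow> c i \<in> carrier K \<and> d i = f (?w i (c i))"
      using d by simp metis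
    have "f (\<Oplus>i\<in>{..<N}. ?w i (c i)) = (\<Oplus>\<^bsub>B\<^esub>i\<in>{..<N}. f (?w i (c i)))"
      using c w by (intro lin_map_finsum[OF faA B alg_hom_lin[OF fh]]) auto
    also have "\<dots> = (\<Oplus>\<^bsub>B\<^esub>i\<in>{..<N}. d i)" using c w f'(1) by (intro B.finsum_cong') auto
    also have "\<dots> = f \<zero>" using sum lin_map_zero[OF faA B alg_hom_lin[OF fh]] by simp
    finally have 0: "(\<Oplus>i\<in>{..<N}. ?w i (c i)) = \<zero>"
      using c w by (intro inj_onD[OF alg_monoD(2)[OF f]]) (auto intro!: finsum_closed)
    have ins: "insert i ({..<N} - {i}) = {..<N}" using i by auto
    have "?w i (c i) \<in> {\<zero>}"
    proof (rule eigenvector_component[OF zero_subspace, of "{..<N} - {i}" i "\<lambda>_::unit. conj_op True"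
          "\<lambda>i. ?w i (c i)" "\<lambda>_ i. conj_val True (i, 0)"])
      show "(\<Oplus>i\<in>insert i ({..<N} - {i}). ?w i (c i)) \<in> {\<zero>}" using 0 ins by simp
      show "\<exists>_::unit. conj_val True (i', 0) \<noteq> conj_val True (i, 0)" if i': "i' \<in> {..<N} - {i}" for i'
      proof -
        have "\<zeta> [^]\<^bsub>F\<^esub> i' \<noteq> \<zeta> [^]\<^bsub>F\<^esub> i"
        proof
          assume "\<zeta> [^]\<^bsub>F\<^esub> i' = \<zeta> [^]\<^bsub>F\<^esub> i"
          from K.K.primitive_root_inj[OF z this] show False using i i' by simp
        qed
        then have "conj_val True (i', 0) \<noteq> conj_val True (i, 0)"
          using zD(1) g K.K.m_rcancel by (simp add: conj_val_def)
        then show ?thesis by simp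
      qed
    qed (use c w conj conj_op_lin conj_op_zero conj_val_closed i in auto)
    then show "d i = \<zero>\<^bsub>B\<^esub>" using c[OF i] lin_map_zero[OF faA B alg_hom_lin[OF fh]] by simp
  qed
qed

section \<open>The centralizer of the coefficients of a matrix algebra\<close>

text \<open>The matrix units lie in the centralizer. The coefficients of a centralizing element
  commute with the whole image of \<open>C\<close>, so they come from its centre and are
  scalars.\<close>

lemma (in matrix_over_algebra) centralizer_isomorphic:
  assumes C: "centralizer C (carrier C) = scalars F C" and nt: "\<one> \<noteq> \<zero>"
  shows "alg_isomorphic F (A\<lparr>carrier := centralizer A (\<Phi> ` carrier C)\<rparr>) (mat_alg k (self_alg F))"
proof -
  let ?Z = "centralizer A (\<Phi> ` carrier C)"
  let ?ZA = "A\<lparr>carrier := ?Z\<rparr>"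
  have Zc: "x \<in> carrier A" and Zcomm: "c \<in> carrier C \<Longrightarrow> x \<otimes> \<Phi> c = \<Phi> c \<otimes> x" if "x \<in> ?Z" for x c
    using that by (auto simp: centralizer_def)
  have ZI: "x \<in> ?Z" if "x \<in> carrier A" "\<And>c. c \<in> carrier C \<Longrightarrow> x \<otimes> \<Phi> c = \<Phi> c \<otimes> x" for x
    using that by (auto simp: centralizer_def)
  have Z: "submodule ?Z F A"
    by (rule subspaceI) (use \<Phi>(1) Zc Zcomm in \<open>auto intro!: ZI simp: l_distr r_distr\<close>)
  have Zmult: "x \<otimes> y \<in> ?Z" if "x \<in> ?Z" "y \<in> ?Z" for x y
  proof (rule ZI)
    fix c assume c: "c \<in> carrier C"
    show "x \<otimes> y \<otimes> \<Phi> c = \<Phi> c \<otimes> (x \<otimes> y)"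
      using Zc that Zcomm[OF that(1) c] Zcomm[OF that(2) c] \<Phi>(1)[OF c]
      by (simp add: m_assoc) (simp flip: m_assoc)
  qed (use Zc that in auto)
  have EZ: "E i j \<in> ?Z" if "i < k" "j < k" for i j using mo(5)[OF _ that] that by (intro ZI) auto
  interpret Z: field_algebra F ?ZA
    by (rule subalgebra[OF Z ZI Zmult]) (use \<Phi>(1) in auto)
  have sub: "?Z \<subseteq> carrier A" using Zc by auto
  have sums: "finsum ?ZA f I = finsum A f I" if "f \<in> I \<rightarrow> ?Z" for f and I :: "'i set"
    by (rule finsum_subalgebra[OF Z.field_algebra_axioms sub that])
  have co_Z: "\<exists>s\<in>carrier F. co i j x = s \<odot> \<one>" if ij: "i < k" "j < k" and x: "x \<in> ?Z" for i j x
  proof -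
    obtain c where c: "c \<in> carrier C" "co i j x = \<Phi> c" using co_range[OF ij Zc[OF x]] by auto
    have "co i j x \<in> ?Z"
      unfolding co_def using ij x EZ Zmult by (intro subspace_finsum[OF Z]) auto
    then have "\<Phi> (c \<otimes>\<^bsub>C\<^esub> c') = \<Phi> (c' \<otimes>\<^bsub>C\<^esub> c)" if "c' \<in> carrier C" for c'
      using Zcomm[OF _ that] c \<Phi>(4) that by simp
    then have "c \<otimes>\<^bsub>C\<^esub> c' = c' \<otimes>\<^bsub>C\<^esub> c" if "c' \<in> carrier C" for c'
      using that c(1) by (intro inj_onD[OF \<Phi>_inj]) auto
    then have "c \<in> scalars F C" using c(1) by (simp add: C[symmetric] centralizer_def)
    then show ?thesis using c(2) \<Phi>(3,5) by (auto simp: scalars_def)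
  qed
  have mono: "(\<lambda>c. c \<odot> \<one>) \<in> alg_mono F (self_alg F) ?ZA"
  proof -
    have "(\<lambda>c. c \<odot> \<one>) \<in> alg_hom F (self_alg F) ?ZA"
      using \<Phi>(1) by (intro alg_homI lin_mapI) (auto simp: self_alg_def smult_l_distr R.m_comm intro!: ZI)
    moreover have "inj_on (\<lambda>c. c \<odot> \<one>) (carrier (self_alg F))"
    proof (rule inj_onI)
      fix c d assume "c \<in> carrier (self_alg F)" "d \<in> carrier (self_alg F)" "c \<odot> \<one> = d \<odot> \<one>"
      then have cd: "c \<in> carrier F" "d \<in> carrier F" "(c \<ominus>\<^bsub>F\<^esub> d) \<odot> \<one> = \<zero>"
        by (auto simp: self_alg_def smult_diff_distrib minus_eq r_neg)
      then have "c \<ominus>\<^bsub>F\<^esub> d = \<zero>\<^bsub>F\<^esub>" using smult_cancel_zero[of "c \<ominus>\<^bsub>F\<^esub> d" \<one>] nt by auto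
      then show "c = d" using cd by simp
    qed
    ultimately show ?thesis by (simp add: alg_mono_def)
  qed
  have "matrix_over F (self_alg F) ?ZA k (\<lambda>c. c \<odot> \<one>) E"
    unfolding matrix_over_def
  proof (intro conjI allI impI ballI)
    show "(\<Oplus>\<^bsub>?ZA\<^esub>i\<in>{..<k}. E i i) = \<one>\<^bsub>?ZA\<^esub>" using EZ mo(4) by (subst sums) auto
    let ?S = "{c \<odot> \<one> \<otimes>\<^bsub>?ZA\<^esub> E i j | c i j. c \<in> carrier (self_alg F) \<and> i < k \<and> j < k}"
    show "spanned F ?ZA ?S"
      unfolding spanned_def
    proof (intro conjI allI impI)
      show "?S \<subseteq> carrier ?ZA" using EZ subspaceD(4)[OF Z] by (auto simp: self_alg_def)
      fix V assume V: "submodule V F ?ZA" "?S \<subseteq> V"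
      show "carrier ?ZA \<subseteq> V"
      proof
        fix x assume "x \<in> carrier ?ZA"
        then have x: "x \<in> ?Z" by simp
        have t: "co i j x \<otimes> E i j \<in> V" if ij: "i < k" "j < k" for i j
        proof -
          obtain s where s: "s \<in> carrier F" "co i j x = s \<odot> \<one>" using co_Z[OF ij x] by auto
          moreover have "s \<in> carrier (self_alg F)" using s(1) by (simp add: self_alg_def)
          then have "s \<odot> \<one> \<otimes>\<^bsub>?ZA\<^esub> E i j \<in> ?S" using ij by blast
          ultimately show ?thesis using V(2) by auto
        qed
        have VZ: "V \<subseteq> ?Z" using Z.subspaceD(1)[OF V(1)] by simp
        have t': "(\<Oplus>j\<in>{..<k}. co i j x \<otimes> E i j) \<in> V" if i: "i < k" for i
        proof -
          have "(\<Oplus>\<^bsub>?ZA\<^esub>j\<in>{..<k}. co i j x \<otimes> E i j) \<in> V" using t i by (intro Z.subspace_finsum[OF V(1)]) auto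
          then show ?thesis using t i VZ by (subst (asm) sums) auto
        qed
        have "(\<Oplus>\<^bsub>?ZA\<^esub>i\<in>{..<k}. \<Oplus>j\<in>{..<k}. co i j x \<otimes> E i j) \<in> V"
          using t' by (intro Z.subspace_finsum[OF V(1)]) auto
        then have "(\<Oplus>i\<in>{..<k}. \<Oplus>j\<in>{..<k}. co i j x \<otimes> E i j) \<in> V"
          using t' VZ by (subst (asm) sums) auto
        then show "x \<in> V" using reconstruct[OF Zc[OF x]] by simp
      qed
    qed
  qed (use mono EZ E_mult in \<open>auto simp: self_alg_def\<close>)
  then have "matrix_over_algebra F (self_alg F) ?ZA k (\<lambda>c. c \<odot> \<one>) E"
    using K.self_alg_algebra Z.field_algebra_axioms
    by (simp add: matrix_over_algebra_def matrix_over_algebra_axioms_def)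
  then show ?thesis by (rule matrix_over_algebra.isomorphic)
qed

section \<open>The decomposition along the powers of the first generator\<close>

lemma add_mod_inj: "(r + i) mod k = (r + i') mod k \<Longrightarrow> i < k \<Longrightarrow> i' < k \<Longrightarrow> i = i'" for i i' k r :: nat
proof -
  assume *: "(r + i) mod k = (r + i') mod k" "i < k" "i' < k"
  let ?r = "r mod k"
  have "(?r + i) mod k = (?r + i') mod k" "?r < k" using * by (simp_all add: mod_add_left_eq)
  then show "i = i'" using *(2,3) by (cases "?r + i < k"; cases "?r + i' < k") (auto simp: mod_if[of "?r + i" k] mod_if[of "?r + i'" k])
qed

locale corner_symbol = split_symbol F A M k z b g u v d e + C: symbol_algebra F C M "z [^]\<^bsub>F\<^esub> k" b d uc vc
  for F :: "('f, 'r) ring_scheme" and A :: "('f, 'a, 'x) module_scheme" (structure)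
    and M k z b g u v d e and C :: "('f, 'c, 'y) module_scheme" and uc vc +
  fixes \<Phi> :: "'c \<Rightarrow> 'a"
  assumes \<Phi>: "\<Phi> \<in> alg_mono F C A" "\<Phi> uc = u [^] k" "\<Phi> vc = y"
begin

lemma faA: "field_algebra F A" ..

sublocale M: matrix_over_algebra F C A k \<Phi> unit
  by (rule matrix_over_corner[OF _ \<Phi>]) unfold_locales

abbreviation S where "S \<equiv> \<Phi> ` carrier C"

abbreviation comp :: "nat \<Rightarrow> ('f, 'a, 'x) module_scheme"
  where "comp j \<equiv> A\<lparr>carrier := {s \<otimes> e j | s. s \<in> S}, one := e j\<rparr>"

lemma S_closed: "s \<in> S \<Longrightarrow> s \<in> carrier A"
  using M.\<Phi>(1) by auto

lemma S_mult: "s \<in> S \<Longrightarrow> t \<in> S \<Longrightarrow> s \<otimes> t \<in> S"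
  using M.\<Phi>(4) by (auto simp flip: M.\<Phi>(4))

lemma S_one: "\<one> \<in> S"
  using M.\<Phi>(5) C.one_closed by (metis imageI)

lemma S_e: "s \<in> S \<Longrightarrow> j < k \<Longrightarrow> s \<otimes> e j = e j \<otimes> s"
  using M.mo(5)[of _ j j] unit_diag by auto

lemma comp_mult:
  assumes "s \<in> S" "t \<in> S" "j < k" "l < k"
  shows "(s \<otimes> e j) \<otimes> (t \<otimes> e l) = (if j = l then (s \<otimes> t) \<otimes> e j else \<zero>)"
proof -
  note c = S_closed[OF assms(1)] S_closed[OF assms(2)] e[OF assms(3)] e[OF assms(4)]
  have "(s \<otimes> e j) \<otimes> (t \<otimes> e l) = s \<otimes> (e j \<otimes> t) \<otimes> e l" using c by (simp add: m_assoc)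
  also have "\<dots> = (s \<otimes> t) \<otimes> (e j \<otimes> e l)"
    unfolding S_e[OF assms(2,3), symmetric] using c by (simp add: m_assoc)
  finally show ?thesis using c e_mult[OF assms(3,4)] by simp
qed

lemma comp_subspace:
  assumes j: "j < k"
  shows "submodule {s \<otimes> e j | s. s \<in> S} F A"
proof -
  have "(\<lambda>s. s \<otimes> e j) \<in> lin_map F A A" using e[OF j] by (intro lin_mapI) (auto simp: l_distr)
  from lin_map_image_subspace[OF faA faA this M.\<Phi>_image_subspace] show ?thesis
    by (simp add: image_def Bex_def conj_commute) 
qed

lemma comp_algebra:
  assumes j: "j < k"
  shows "field_algebra F (comp j)"
proof (rule corner_algebra[OF comp_subspace[OF j]])
  show "x \<otimes> y' \<in> {s \<otimes> e j | s. s \<in> S}" if "x \<in> {s \<otimes> e j | s. s \<in> S}" "y' \<in> {s \<otimes> e j | s. s \<in> S}" for x y'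
    using that comp_mult[OF _ _ j j] S_mult by fastforce
  show "e j \<in> {s \<otimes> e j | s. s \<in> S}" using S_one e[OF j] by (intro CollectI exI[of _ \<one>]) simp
  show "e j \<otimes> x = x" "x \<otimes> e j = x" if "x \<in> {s \<otimes> e j | s. s \<in> S}" for x
    using that comp_mult[OF S_one _ j j] comp_mult[OF _ S_one j j] S_closed e[OF j] by auto
qed

definition sm :: "(nat \<Rightarrow> 'a) \<Rightarrow> 'a" where "sm f = (\<Oplus>j\<in>{..<k}. f j)"

lemma prod_carrier: "carrier (prod_alg k comp) = (\<Pi>\<^sub>E j\<in>{..<k}. {s \<otimes> e j | s. s \<in> S})"
  by (simp add: prod_alg_def)

lemma prod_elem:
  assumes "f \<in> carrier (prod_alg k comp)"
  obtains s where "\<And>j. j < k \<Longrightarrow> s j \<in> S" "\<And>j. j < k \<Longrightarrow> f j = s j \<otimes> e j"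
proof -
  have "\<forall>j\<in>{..<k}. \<exists>s. s \<in> S \<and> f j = s \<otimes> e j"
    using PiE_mem[OF assms[unfolded prod_carrier]] by blast
  from bchoice[OF this] obtain s where "\<forall>j\<in>{..<k}. s j \<in> S \<and> f j = s j \<otimes> e j" by blast
  then show ?thesis using that by blast
qed

lemma prod_closed: "f \<in> carrier (prod_alg k comp) \<Longrightarrow> j < k \<Longrightarrow> f j \<in> carrier A"
  using S_closed e by (elim prod_elem) auto

text \<open>The \<open>e j\<close> cut a sum back into its components. This makes \<open>sm\<close>
  injective and reduces its laws to the components.\<close>

lemma sm_e:
  assumes f: "f \<in> carrier (prod_alg k comp)" and l: "l < k"
  shows "sm f \<otimes> e l = f l" "e l \<otimes> sm f = f l"
proof -
  obtain s where s: "\<And>j. j < k \<Longrightarrow> s j \<in> S" "\<And>j. j < k \<Longrightarrow> f j = s j \<otimes> e j"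
    using prod_elem[OF f] by blast
  have wl: "f l \<in> carrier A" by (rule prod_closed[OF f l])
  have "sm f \<otimes> e l = (\<Oplus>j\<in>{..<k}. f j \<otimes> e l)"
    unfolding sm_def using prod_closed[OF f] e[OF l] by (intro finsum_ldistr) auto
  also have "\<dots> = (\<Oplus>j\<in>{..<k}. if j = l then f l else \<zero>)"
    using s S_closed e e_mult l by (intro finsum_cong') (auto simp: m_assoc)
  finally show "sm f \<otimes> e l = f l" using finsum_delta[of "{..<k}" l "f l"] l wl by simp
  have "e l \<otimes> sm f = (\<Oplus>j\<in>{..<k}. e l \<otimes> f j)"
    unfolding sm_def using prod_closed[OF f] e[OF l] by (intro finsum_rdistr) auto
  also have "\<dots> = (\<Oplus>j\<in>{..<k}. if j = l then f l else \<zero>)"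
    using comp_mult[OF S_one _ l] s S_closed e e_mult l prod_closed[OF f] by (intro finsum_cong') auto
  finally show "e l \<otimes> sm f = f l" using finsum_delta[of "{..<k}" l "f l"] l wl by simp
qed

lemma sm_closed: "f \<in> carrier (prod_alg k comp) \<Longrightarrow> sm f \<in> carrier A"
  unfolding sm_def using prod_closed by (intro finsum_closed) auto

lemma sm_eqI:
  assumes "f \<in> carrier (prod_alg k comp)" "x \<in> carrier A" "\<And>l. l < k \<Longrightarrow> f l = x \<otimes> e l"
  shows "sm f = x"
proof (rule eq_by_e)
  fix l assume "l < k"
  then show "sm f \<otimes> e l = x \<otimes> e l" using sm_e(1)[OF assms(1)] assms(3) by metis
qed (use assms sm_closed in auto)

lemma sm_mono: "sm \<in> alg_mono F (prod_alg k comp) A"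
proof -
  have mult: "f \<otimes>\<^bsub>prod_alg k comp\<^esub> f' \<in> carrier (prod_alg k comp)"
    and add: "f \<oplus>\<^bsub>prod_alg k comp\<^esub> f' \<in> carrier (prod_alg k comp)"
    if "f \<in> carrier (prod_alg k comp)" "f' \<in> carrier (prod_alg k comp)" for f f'
    using that ring.ring_simprules(5)[of "comp _"] ring.ring_simprules(1)[of "comp _"]
      comp_algebra[unfolded field_algebra_def assoc_algebra_def]
    by (auto simp: prod_alg_def PiE_def Pi_def)
  have smul: "c \<odot>\<^bsub>prod_alg k comp\<^esub> f \<in> carrier (prod_alg k comp)"
    if "c \<in> carrier F" "f \<in> carrier (prod_alg k comp)" for c f
    using that subspaceD(4)[OF comp_subspace] by (auto simp: prod_alg_def PiE_def Pi_def)
  have one: "\<one>\<^bsub>prod_alg k comp\<^esub> \<in> carrier (prod_alg k comp)"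
    using ring.ring_simprules(6)[of "comp _"] comp_algebra[unfolded field_algebra_def assoc_algebra_def]
    by (auto simp: prod_alg_def PiE_def Pi_def)
  have "sm \<in> alg_hom F (prod_alg k comp) A"
  proof (rule alg_homI[OF lin_mapI])
    fix f f' assume f: "f \<in> carrier (prod_alg k comp)" and f': "f' \<in> carrier (prod_alg k comp)"
    show "sm f \<in> carrier A" by (rule sm_closed[OF f])
    show "sm (f \<oplus>\<^bsub>prod_alg k comp\<^esub> f') = sm f \<oplus> sm f'"
      by (rule sm_eqI[OF add[OF f f']]) (use f f' sm_closed sm_e e in \<open>auto simp: l_distr prod_alg_def\<close>)
    show "sm (f \<otimes>\<^bsub>prod_alg k comp\<^esub> f') = sm f \<otimes> sm f'"
    proof (rule sm_eqI[OF mult[OF f f']])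
      fix l assume l: "l < k"
      have "sm f \<otimes> sm f' \<otimes> e l = sm f \<otimes> (e l \<otimes> e l \<otimes> sm f')"
        using sm_e[OF f' l] e_mult[OF l l] sm_closed[OF f] sm_closed[OF f'] e[OF l] by (simp add: m_assoc)
      also have "\<dots> = (sm f \<otimes> e l) \<otimes> (e l \<otimes> sm f')"
        using sm_closed[OF f] sm_closed[OF f'] e[OF l] by (simp add: m_assoc)
      finally show "(f \<otimes>\<^bsub>prod_alg k comp\<^esub> f') l = sm f \<otimes> sm f' \<otimes> e l"
        using sm_e[OF f l] sm_e[OF f' l] l by (simp add: prod_alg_def)
    qed (use f f' sm_closed in auto)
    fix c assume c: "c \<in> carrier F"
    show "sm (c \<odot>\<^bsub>prod_alg k comp\<^esub> f) = c \<odot> sm f"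
      by (rule sm_eqI[OF smul[OF c f]]) (use f c sm_closed sm_e e in \<open>auto simp: prod_alg_def\<close>)
  next
    show "sm \<one>\<^bsub>prod_alg k comp\<^esub> = \<one>" by (rule sm_eqI[OF one]) (use e in \<open>auto simp: prod_alg_def\<close>)
  qed
  moreover have "inj_on sm (carrier (prod_alg k comp))"
  proof (rule inj_onI)
    fix f f' assume f: "f \<in> carrier (prod_alg k comp)" and f': "f' \<in> carrier (prod_alg k comp)" and eq: "sm f = sm f'"
    have "f l = f' l" if "l < k" for l using sm_e(1)[OF f that] sm_e(1)[OF f' that] eq by simp
    then show "f = f'" using f f' unfolding prod_carrier by (intro PiE_ext[OF f[unfolded prod_carrier] f'[unfolded prod_carrier]]) auto
  qed
  ultimately show ?thesis by (simp add: alg_mono_def)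
qed

text \<open>The summand for \<open>i\<close> is a cyclic diagonal in the block pattern of the
  idempotents: between \<open>e j\<close> on the left and \<open>e r\<close> on the right it
  survives only for \<open>j = (r + i) mod k\<close>. So the blocks separate the summands.\<close>

lemma power_decomposition:
  "internal_direct_sum F A k (\<lambda>i. {sm f \<otimes> u [^] i | f. f \<in> carrier (prod_alg k comp)}) (carrier A)"
proof (rule internal_direct_sumI)
  let ?P = "{\<Oplus>j\<in>{..<k}. f j | f. f \<in> (\<Pi>\<^sub>E j\<in>{..<k}. {s \<otimes> e j | s. s \<in> S})}"
  let ?V = "\<lambda>i. {sm f \<otimes> u [^] (i::nat) | f. f \<in> carrier (prod_alg k comp)}"
  have P: "submodule ?P F A" by (rule sums_subspace[OF comp_subspace])
  have V_eq: "?V i = (\<lambda>x. x \<otimes> u [^] i) ` ?P" for i by (auto simp: prod_carrier sm_def)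
  show "submodule (?V i) F A" for i
  proof -
    have "(\<lambda>x. x \<otimes> u [^] i) \<in> lin_map F A A" using u by (intro lin_mapI) (auto simp: l_distr)
    from lin_map_image_subspace[OF faA faA this P] show ?thesis unfolding V_eq .
  qed
  show "?V i \<subseteq> carrier A" for i using sm_closed u by auto
  show "submodule (carrier A) F A" by (rule carrier_subspace)
next
  fix U assume U: "submodule U F A"
    "\<And>i. i < k \<Longrightarrow> {sm f \<otimes> u [^] i | f. f \<in> carrier (prod_alg k comp)} \<subseteq> U"
  show "carrier A \<subseteq> U"
  proof (rule spannedD(2)[OF span U(1)], safe)
    fix a b' :: nat
    \<comment> \<open>The exponent of \<open>u\<close> splits into a multiple of \<open>k\<close>,
      absorbed into the coefficients, and the index \<open>i\<close> of the summand.\<close>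
    define p i where "p = a div k" and "i = a mod k"
    have i: "i < k" and a: "a = k * p + i" using Mk by (simp_all add: p_def i_def)
    define c where "c = vc [^]\<^bsub>C\<^esub> b' \<otimes>\<^bsub>C\<^esub> uc [^]\<^bsub>C\<^esub> p"
    have c: "c \<in> carrier C" using C.u C.v by (simp add: c_def)
    have rings: "ring C" "ring A" by unfold_locales
    have \<Phi>c: "\<Phi> c = y [^] b' \<otimes> (u [^] k) [^] p"
      unfolding c_def using C.u C.v M.\<Phi>(4) alg_hom_pow[OF M.\<Phi>_hom rings] \<Phi>(2,3) by simp
    \<comment> \<open>The element \<open>v [^] b'\<close> need not lie in the image of
      \<open>\<Phi>\<close>, but on \<open>e j\<close> it agrees with a scalar multiple of
      \<open>y [^] b'\<close>; the scalar depends on \<open>j\<close>, which is why the product over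
      all \<open>j\<close> is required.\<close>
    define f where "f = (\<lambda>j\<in>{..<k}. (z [^]\<^bsub>F\<^esub> (j * b') \<odot> \<Phi> c) \<otimes> e j)"
    have wS: "f \<in> carrier (prod_alg k comp)"
      unfolding f_def prod_carrier using c subspaceD(4)[OF M.\<Phi>_image_subspace] zD(1) by auto
    have ukp: "(u [^] k) [^] p \<in> carrier A" using u by simp
    have "sm f = v [^] b' \<otimes> (u [^] k) [^] p"
    proof (rule sm_eqI[OF wS])
      fix l assume l: "l < k"
      have ukp_e: "(u [^] k) [^] p \<otimes> e l = e l \<otimes> (u [^] k) [^] p"
        using u_e[OF l, of "k * p"] l u by (simp add: nat_pow_pow)
      have "v [^] b' \<otimes> e l = z [^]\<^bsub>F\<^esub> (l * b') \<odot> (y [^] b' \<otimes> e l)"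
        using ypow_e[OF l, of b'] v e[OF l] zi zD(1) zi_pow[of "l * b'"] by (simp add: R.m_comm)
      then have "v [^] b' \<otimes> (u [^] k) [^] p \<otimes> e l = z [^]\<^bsub>F\<^esub> (l * b') \<odot> (y [^] b' \<otimes> (e l \<otimes> (u [^] k) [^] p))"
        using ukp_e v e[OF l] ukp y zD(1) by (simp add: m_assoc[of "v [^] b'"]) (simp add: m_assoc flip: m_assoc[of "v [^] b'"])
      also have "\<dots> = f l"
        unfolding ukp_e[symmetric] f_def \<Phi>c using l e[OF l] ukp y zD(1) by (simp add: m_assoc)
      finally show "f l = v [^] b' \<otimes> (u [^] k) [^] p \<otimes> e l" by simp
    qed (use v u in simp)
    moreover have "sm f \<otimes> u [^] i \<in> U" using U(2)[OF i] wS by blast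
    moreover have "(u [^] k) [^] p \<otimes> u [^] i = u [^] a" using u by (simp add: nat_pow_pow nat_pow_mult a)
    ultimately have "v [^] b' \<otimes> u [^] a \<in> U" using v u by (simp add: m_assoc)
    then have "z [^]\<^bsub>F\<^esub> (a * b') \<odot> mon a b' \<in> U" by (simp add: vpow_upow)
    then show "mon a b' \<in> U"
      by (rule subspace_cancel[OF U(1), rotated 3]) (use zD K.pow_nonzero in auto)
  qed
next
  fix d i
  assume d: "\<And>i. i < k \<Longrightarrow> d i \<in> {sm f \<otimes> u [^] i | f. f \<in> carrier (prod_alg k comp)}"
    and sum: "(\<Oplus>i\<in>{..<k}. d i) = \<zero>" and i: "i < k"
  have dc: "d i \<in> carrier A" if "i < k" for i using d[OF that] sm_closed u by auto
  have sandwich: "e j \<otimes> d i \<otimes> e r = (if j = (r + i) mod k then e j \<otimes> d i else \<zero>)"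
    if j: "j < k" and i: "i < k" and r: "r < k" for i j r
  proof -
    obtain f where f: "f \<in> carrier (prod_alg k comp)" "d i = sm f \<otimes> u [^] i" using d[OF i] by blast
    let ?l = "(r + i) mod k"
    have l: "?l < k" using Mk by simp
    note cl = sm_closed[OF f(1)] e[OF j] e[OF l] e[OF r] u
    have comm: "e j \<otimes> sm f = sm f \<otimes> e j" using sm_e[OF f(1) j] by simp
    have "e j \<otimes> d i \<otimes> e r = (e j \<otimes> sm f) \<otimes> (u [^] i \<otimes> e r)" using f cl by (simp add: m_assoc)
    also have "\<dots> = (sm f \<otimes> (e j \<otimes> e ?l)) \<otimes> u [^] i"
      unfolding u_e[OF r] comm using cl by (simp add: m_assoc)
    also have "\<dots> = (if j = ?l then (sm f \<otimes> e j) \<otimes> u [^] i else \<zero>)"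
      using cl e_mult[OF j l] by simp
    finally show ?thesis unfolding comm[symmetric] using cl f(2) by (simp add: m_assoc)
  qed
  have "e j \<otimes> d i = \<zero>" if j: "j < k" for j
  proof -
    \<comment> \<open>The column in which the diagonal with index \<open>i\<close> meets row
      \<open>j\<close>.\<close>
    define r where "r = (j + (k - i)) mod k"
    have r: "r < k" using Mk by (simp add: r_def)
    have "(r + i) mod k = (j + (k - i) + i) mod k" unfolding r_def by (rule mod_add_left_eq)
    also have "j + (k - i) + i = j + k" using i by simp
    finally have ri: "(r + i) mod k = j" using j by simp
    have "\<zero> = e j \<otimes> (\<Oplus>i'\<in>{..<k}. d i') \<otimes> e r" using sum e[OF j] e[OF r] by simp
    also have "\<dots> = (\<Oplus>i'\<in>{..<k}. e j \<otimes> d i' \<otimes> e r)"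
    proof -
      have "e j \<otimes> (\<Oplus>i'\<in>{..<k}. d i') = (\<Oplus>i'\<in>{..<k}. e j \<otimes> d i')"
        using dc e[OF j] by (intro finsum_rdistr) auto
      moreover have "(\<Oplus>i'\<in>{..<k}. e j \<otimes> d i') \<otimes> e r = (\<Oplus>i'\<in>{..<k}. e j \<otimes> d i' \<otimes> e r)"
        using dc e[OF j] e[OF r] by (intro finsum_ldistr) auto
      ultimately show ?thesis by simp
    qed
    also have "\<dots> = (\<Oplus>i'\<in>{..<k}. if i' = i then e j \<otimes> d i else \<zero>)"
    proof (rule finsum_cong'[OF refl])
      fix i' assume "i' \<in> {..<k}"
      then have i': "i' < k" by simp
      have "j = (r + i') mod k \<longleftrightarrow> i' = i" using add_mod_inj[OF _ i' i, of r] ri by metis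
      then show "e j \<otimes> d i' \<otimes> e r = (if i' = i then e j \<otimes> d i else \<zero>)" using sandwich[OF j i' r] by simp
    qed (use dc[OF i] e[OF j] in auto)
    also have "\<dots> = e j \<otimes> d i" using dc[OF i] e[OF j] i by (intro finsum_delta) auto
    finally show ?thesis by simp
  qed
  then have "(\<Oplus>j\<in>{..<k}. e j \<otimes> d i) = \<zero>" by (intro add.finprod_one_eqI) auto
  then show "d i = \<zero>" using sum_e_left[OF dc[OF i]] by simp
qed

end

section \<open>Largest powers and roots\<close>

context field
begin

lemma max_powerD:
  assumes n: "n > 0" and s: "s \<in> carrier R"
  shows "max_power R n s \<ge> 1" "max_power R n s dvd n"
    and "\<And>k. k \<ge> 1 \<Longrightarrow> k dvd n \<Longrightarrow> s \<in> powers R k \<Longrightarrow> k \<le> max_power R n s"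
proof -
  let ?S = "{k. k \<ge> 1 \<and> k dvd n \<and> s \<in> powers R k}"
  have "?S \<subseteq> {..n}" using n by (auto dest: dvd_imp_le)
  then have fin: "finite ?S" using finite_subset by blast
  have "s [^] (1::nat) = s" using s by simp
  then have "s \<in> powers R 1" using s unfolding powers_def by (intro CollectI exI[of _ s]) simp
  then have "?S \<noteq> {}" by (auto intro!: exI[of _ 1])
  then have "Max ?S \<in> ?S" using fin by (rule Max_in[rotated])
  then show "max_power R n s \<ge> 1" "max_power R n s dvd n" by (auto simp: max_power_def)
  show "k \<le> max_power R n s" if "k \<ge> 1" "k dvd n" "s \<in> powers R k" for k
    unfolding max_power_def using that fin by (intro Max_ge) auto
qed

text \<open>A \<open>t\<close>-th root of \<open>c\<close> would make \<open>s\<close> a power whose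
  exponent is \<open>t\<close> times the maximal one, and this product still divides
  \<open>n\<close>.\<close>

lemma root_not_power:
  assumes n: "n > 0" and s: "s \<in> carrier R" and c: "c [^] max_power R n s = s"
    and t: "t dvd n div max_power R n s" "t > 1"
  shows "c \<notin> powers R t"
proof
  let ?m = "max_power R n s"
  note m = max_powerD[OF n s]
  assume "c \<in> powers R t"
  then obtain r where r: "r \<in> carrier R" "c = r [^] t" by (auto simp: powers_def)
  then have "s = r [^] (t * ?m)" using c by (simp add: nat_pow_pow)
  then have "s \<in> powers R (t * ?m)" using r(1) by (auto simp: powers_def)
  moreover have "t * ?m dvd n" using t(1) m(1,2) by (metis dvd_div_mult_self dvd_mult_cancel1 mult.commute mult_dvd_mono dvd_refl)
  ultimately have "t * ?m \<le> ?m" using m(1) t(2) by (intro m(3)) auto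
  then show False using m(1) t(2) by simp
qed

lemma kummer_fieldI:
  assumes \<zeta>: "primitive_root_of_unity R N \<zeta>" and \<alpha>: "\<alpha> \<in> carrier R" "\<alpha> \<noteq> \<zero>"
    and "\<And>t. t dvd N \<Longrightarrow> t > 1 \<Longrightarrow> \<alpha> \<notin> powers R t"
  shows "kummer_field R (kummer R N \<alpha>) N \<zeta> \<alpha> (kummer_gen R N \<alpha>) (scale_aut R (inv \<zeta>))"
proof -
  interpret P: kummer_poly R N \<alpha> by unfold_locales (use primitive_rootD[OF \<zeta>] \<alpha> in auto)
  note KA = P.kummer_algebra[OF \<zeta> \<alpha>(2)]
  show ?thesis
    by (rule kummer_field.intro[OF KA kummer_field_axioms.intro[OF kummer_algebra.is_field[OF KA assms(4)]]])
qed

end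

lemma (in kummer_algebra) skew_const_hom:
  assumes "c \<in> carrier F"
  shows "skew_const K \<tau> N c \<in> alg_hom F K (skew_cyclic K \<tau> N c)"
    and "\<And>e. e \<in> carrier K \<Longrightarrow> skew_gen K \<tau> N c \<otimes>\<^bsub>skew_cyclic K \<tau> N c\<^esub> skew_const K \<tau> N c e =
      skew_const K \<tau> N c (\<tau> e) \<otimes>\<^bsub>skew_cyclic K \<tau> N c\<^esub> skew_gen K \<tau> N c"
proof -
  interpret S: skew F K \<tau> N c by (rule skew[OF assms])
  show "S.\<iota> \<in> alg_hom F K S.A" by (rule S.\<iota>_hom)
  show "S.H \<otimes>\<^bsub>S.A\<^esub> S.\<iota> e = S.\<iota> (\<tau> e) \<otimes>\<^bsub>S.A\<^esub> S.H" if "e \<in> carrier K" for e by (rule S.H_\<iota>[OF that])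
qed

lemma (in kummer_field) skew_kummer_symbol:
  assumes c: "c \<in> carrier F" "c \<noteq> \<zero>\<^bsub>F\<^esub>"
  shows "kummer_symbol F K (skew_cyclic K \<tau> N c) N \<zeta> \<alpha> y \<tau> c (skew_gen K \<tau> N c)
    (skew_const K \<tau> N c y) (skew_const K \<tau> N c)"
  using kummer_field_axioms symbol_algebra[OF c] skew_const_hom[OF c(1)]
  by (simp add: kummer_symbol_def kummer_symbol_axioms_def)

text \<open>The product is Lagrange interpolation, \<open>fourier\<close> a geometric sum. They
  agree because the product acts on the projection with index \<open>l\<close> as one for
  \<open>l = i\<close> and as zero otherwise, and the projections add up to
  \<open>\<one>\<close>.\<close>

lemma (in field_algebra) split_idem_fourier:
  assumes "cring A" and \<omega>: "primitive_root_of_unity F k \<omega>" and d: "d \<in> carrier F" "d \<noteq> \<zero>\<^bsub>F\<^esub>"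
    and x: "x \<in> carrier A" "(x [^] (N::nat)) [^] k = d [^]\<^bsub>F\<^esub> k \<odot> \<one>" and i: "i < k"
  shows "split_idem F A x N k \<omega> d i = fourier k \<omega> d (x [^] N) i"
proof -
  interpret C: cring A by fact
  note \<omega>D = K.primitive_rootD[OF \<omega>]
  let ?c = "\<lambda>j::nat. \<omega> [^]\<^bsub>F\<^esub> j \<otimes>\<^bsub>F\<^esub> d"
  define f where "f = fourier k \<omega> d (x [^] N)"
  have w: "x [^] N \<in> carrier A" using x by simp
  note f' = fourier[OF \<omega> d w x(2), folded f_def]
  define fac where "fac j = inv\<^bsub>F\<^esub> (?c i \<ominus>\<^bsub>F\<^esub> ?c j) \<odot> (x [^] N \<ominus> ?c j \<odot> \<one>)" for j
  have c: "?c j \<in> carrier F" for j using \<omega>D(1) d by simp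
  have du: "?c i \<ominus>\<^bsub>F\<^esub> ?c j \<in> Units F" if "j \<in> {..<k} - {i}" for j
  proof -
    have "?c i \<noteq> ?c j"
    proof
      assume "?c i = ?c j"
      then have "\<omega> [^]\<^bsub>F\<^esub> i = \<omega> [^]\<^bsub>F\<^esub> j" using K.m_rcancel[OF d(2)] \<omega>D(1) d(1) by simp
      from K.primitive_root_inj[OF \<omega> this] show False using that i by (metis DiffD1 DiffD2 lessThan_iff mod_less singletonI)
    qed
    then show ?thesis using c by (simp add: K.field_Units)
  qed
  have fac: "fac j \<in> carrier A" if "j \<in> {..<k} - {i}" for j
    unfolding fac_def using R.Units_inv_closed[OF du[OF that]] w c by simp
  have eig: "(x [^] N \<ominus> ?c j \<odot> \<one>) \<otimes> f l = (?c l \<ominus>\<^bsub>F\<^esub> ?c j) \<odot> f l" for j l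
  proof -
    have "(x [^] N \<ominus> ?c j \<odot> \<one>) \<otimes> f l = x [^] N \<otimes> f l \<ominus> ?c j \<odot> f l"
      using w c f'(1) by (simp add: minus_eq l_distr l_minus)
    then show ?thesis unfolding f'(2) using c f'(1) by (simp add: smult_diff_distrib)
  qed
  have fac_i: "fac j \<otimes> f i = f i" if j: "j \<in> {..<k} - {i}" for j
    unfolding fac_def using eig[of j i] du[OF j] w c f'(1) by (simp add: R.Units_inv_closed)
  have fac_l: "fac l \<otimes> f l = \<zero>" if l: "l \<in> {..<k} - {i}" for l
    unfolding fac_def using eig[of l l] du[OF l] w c f'(1)
    by (simp add: R.Units_inv_closed R.minus_eq R.r_neg)
  have prod_i: "(\<Otimes>j\<in>J. fac j) \<otimes> f i = f i" if "finite J" "J \<subseteq> {..<k} - {i}" for J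
    using that
  proof (induction J)
    case (insert j J)
    have "fac ` insert j J \<subseteq> carrier A" using insert.prems fac by blast
    then have "(\<Otimes>j\<in>insert j J. fac j) \<otimes> f i = fac j \<otimes> ((\<Otimes>j\<in>J. fac j) \<otimes> f i)"
      using insert.hyps f'(1) by (subst C.finprod_insert) (auto simp: m_assoc image_subset_iff Pi_def)
    then show ?case using insert fac_i by simp
  qed (use f'(1) in simp)
  let ?e = "split_idem F A x N k \<omega> d i"
  have e: "?e = (\<Otimes>j\<in>{..<k} - {i}. fac j)" by (simp add: split_idem_def fac_def)
  have ec: "?e \<in> carrier A" unfolding e using fac by (intro C.finprod_closed) auto
  have "?e \<otimes> f l = (if l = i then f i else \<zero>)" if l: "l < k" for l
  proof (cases "l = i")
    case True
    then show ?thesis unfolding e by (simp add: prod_i)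
  next
    case False
    then have lJ: "l \<in> {..<k} - {i}" using l by simp
    let ?J = "{..<k} - {i} - {l}"
    have "{..<k} - {i} = insert l ?J" using lJ by auto
    then have "?e = (\<Otimes>j\<in>insert l ?J. fac j)" unfolding e by simp
    also have "\<dots> = fac l \<otimes> (\<Otimes>j\<in>?J. fac j)" using fac lJ by (intro C.finprod_insert) auto
    also have "\<dots> = (\<Otimes>j\<in>?J. fac j) \<otimes> fac l"
      using fac lJ by (intro C.m_comm C.finprod_closed) auto
    finally have "?e \<otimes> f l = (\<Otimes>j\<in>?J. fac j) \<otimes> (fac l \<otimes> f l)"
      using fac lJ f'(1) by (simp add: m_assoc C.finprod_closed)
    then show ?thesis unfolding fac_l[OF lJ] using False fac by (simp add: C.finprod_closed)
  qed
  then have "(\<Oplus>l\<in>{..<k}. ?e \<otimes> f l) = (\<Oplus>l\<in>{..<k}. if l = i then f i else \<zero>)"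
    using f'(1) by (intro finsum_cong') auto
  also have "\<dots> = f i" using i f'(1) by (intro finsum_delta) auto
  also have "(\<Oplus>l\<in>{..<k}. ?e \<otimes> f l) = ?e \<otimes> (\<Oplus>l\<in>{..<k}. f l)"
    using ec f'(1) by (intro finsum_rdistr[symmetric]) auto
  finally show ?thesis using f'(4) ec by (simp add: f_def)
qed

text \<open>The field generated by \<open>v\<close> is treated directly and the one generated by
  \<open>u\<close> through the swapped pair; hence the inverse of \<open>\<zeta>\<close> in the last
  hypothesis.\<close>

lemma symbol_algebra_reduced:
  assumes "symbol_algebra F A N \<zeta> b \<alpha> u v" "cyclic_algebra F A"
    and "kummer_field F (kummer F N \<alpha>) N \<zeta> \<alpha> (kummer_gen F N \<alpha>) T"
    and "kummer_field F (kummer F N b) N (inv\<^bsub>F\<^esub> \<zeta>) b (kummer_gen F N b) T'"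
  shows "reduced_cyclic F A N \<zeta> b \<alpha> u v"
proof -
  interpret symbol_algebra F A N \<zeta> b \<alpha> u v by fact
  interpret S: symbol_pair F A N "inv\<^bsub>F\<^esub> \<zeta>" \<alpha> b v u by (rule symbol_pair_swap[OF symbol_pair_axioms])
  show ?thesis
    unfolding reduced_cyclic_def
    using assms(2) z b g u v generated vu uD vD kummer_subfield_v[OF assms(3)] S.kummer_subfield_v[OF assms(4)]
    by blast
qed

section \<open>Comparing symbol algebras\<close>

lemma symbol_hom_image_subset:
  assumes "symbol_algebra F B1 D z b g u1 v1" "symbol_algebra F B2 D z b g u2 v2" "field_algebra F A"
    and "f1 \<in> alg_hom F B1 A" "f2 \<in> alg_hom F B2 A" "f1 u1 = f2 u2" "f1 v1 = f2 v2"
  shows "f1 ` carrier B1 \<subseteq> f2 ` carrier B2"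
proof -
  interpret B1: symbol_algebra F B1 D z b g u1 v1 by fact
  interpret B2: symbol_algebra F B2 D z b g u2 v2 by fact
  interpret A: field_algebra F A by fact
  have fa: "field_algebra F B1" "field_algebra F B2" and r: "ring B1" "ring B2" "ring A" by unfold_locales
  have mon: "f1 (B1.mon i j) = f2 (B2.mon i j)" for i j
    using alg_homD(4)[OF assms(4)] alg_homD(4)[OF assms(5)] alg_hom_pow[OF assms(4) r(1,3)]
      alg_hom_pow[OF assms(5) r(2,3)] assms(6,7) B1.u B1.v B2.u B2.v by simp
  have "submodule (f2 ` carrier B2) F A"
    by (rule lin_map_image_subspace[OF fa(2) assms(3) alg_hom_lin[OF assms(5)] B2.carrier_subspace])
  from lin_map_vimage_subspace[OF fa(1) assms(3) alg_hom_lin[OF assms(4)] this]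
  have "carrier B1 \<subseteq> {x \<in> carrier B1. f1 x \<in> f2 ` carrier B2}"
    by (rule spannedD(2)[OF B1.span]) (use mon in auto)
  then show ?thesis by auto
qed

text \<open>The generator whose power is \<open>s\<close> comes first, but the matrix step extracts
  the root from the second parameter. So the generators are swapped in both algebras and
  \<open>q\<close> is replaced by its inverse.\<close>

lemma symbol_matrix_over:
  assumes E: "symbol_algebra F E (M * m) q s a h x" and A: "symbol_algebra F A M (q [^]\<^bsub>F\<^esub> m) \<sigma> a u v"
    and \<sigma>: "\<sigma> [^]\<^bsub>F\<^esub> m = s"
  obtains \<Phi> U where "matrix_over_algebra F A E m \<Phi> U"
proof -
  interpret E: symbol_algebra F E "M * m" q s a h x by fact
  interpret A: symbol_algebra F A M "q [^]\<^bsub>F\<^esub> m" \<sigma> a u v by fact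
  let ?qi = "inv\<^bsub>F\<^esub> q"
  interpret S: split_symbol F E M m ?qi a s x h \<sigma> "E.fourier m (?qi [^]\<^bsub>F\<^esub> M) \<sigma> (h [^]\<^bsub>E\<^esub> M)"
    by (rule split_symbol_fourier[OF symbol_algebra_swap[OF E] A.b(1) \<sigma>])
  have "inv\<^bsub>F\<^esub> (q [^]\<^bsub>F\<^esub> m) = ?qi [^]\<^bsub>F\<^esub> m" 
  proof (rule E.R.comm_inv_char)
    have "q [^]\<^bsub>F\<^esub> m \<otimes>\<^bsub>F\<^esub> ?qi [^]\<^bsub>F\<^esub> m = (q \<otimes>\<^bsub>F\<^esub> ?qi) [^]\<^bsub>F\<^esub> m"
      using E.zD(1,5) by (intro E.R.nat_pow_distrib[symmetric]) auto
    then show "q [^]\<^bsub>F\<^esub> m \<otimes>\<^bsub>F\<^esub> ?qi [^]\<^bsub>F\<^esub> m = \<one>\<^bsub>F\<^esub>" using E.zD(5) by simp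
  qed (use E.zD(1,5) in auto)
  then have C: "symbol_algebra F A M (?qi [^]\<^bsub>F\<^esub> m) a \<sigma> v u" using symbol_algebra_swap[OF A] by simp
  obtain f where f: "f \<in> alg_mono F A E" "f v = x [^]\<^bsub>E\<^esub> m" "f u = S.y"
    using symbol_mono[OF C S.corner_pair] .
  from S.matrix_over_corner[OF C f] show ?thesis by (rule that)
qed

section \<open>The splitting of a Kummer symbol\<close>

text \<open>\<open>T\<close> is the Kummer algebra that contains the idempotents, \<open>K\<close>
  the field that becomes its component, \<open>C\<close> the cyclic algebra over \<open>K\<close>.
  The locale lets the comparison of \<open>T\<close> with \<open>K\<close> be computed inside
  \<open>A\<close>, where \<open>\<tau>\<close> is conjugation by \<open>u\<close>.\<close>

locale kummer_tower = split_symbol F A N k z b g u "\<iota> x" d "\<lambda>i. \<iota> (e i)"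
  for F :: "('f, 'r) ring_scheme" and A :: "('f, 'a, 'x) module_scheme" (structure)
    and N k z b g u d and \<iota> :: "'t \<Rightarrow> 'a" and x e +
  fixes T :: "('f, 't, 'y) module_scheme" and \<tau> and K :: "('f, 'k, 'y') module_scheme" and \<tau>' x'
    and C :: "('f, 'c, 'y'') module_scheme" and H \<iota>2
  assumes T: "kummer_algebra F T (N * k) z g x \<tau>"
    and e_T: "\<And>i. i < k \<Longrightarrow> e i \<in> carrier T"
    and \<iota>: "\<iota> \<in> alg_hom F T A" and u_\<iota>: "\<And>c. c \<in> carrier T \<Longrightarrow> u \<otimes> \<iota> c = \<iota> (\<tau> c) \<otimes> u"
    and K: "kummer_field F K N (z [^]\<^bsub>F\<^esub> k) d x' \<tau>'"
    and C: "kummer_symbol F K C N (z [^]\<^bsub>F\<^esub> k) d x' \<tau>' b H (\<iota>2 x') \<iota>2"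
begin

lemma fA: "field_algebra F A" ..
lemma ringA: "ring A" ..

lemmas \<iota>' = alg_homD[OF \<iota>]
lemmas fT = kummer_algebra.fa[OF T] and ringT = kummer_algebra.rK[OF T]
lemmas xT = kummer_algebra.y(1)[OF T]

lemma KA: "kummer_algebra F K N (z [^]\<^bsub>F\<^esub> k) d x' \<tau>'"
  by (rule kummer_field.axioms(1)[OF K])

lemmas fK = kummer_algebra.fa[OF KA] and ringK = kummer_algebra.rK[OF KA]
lemmas x'K = kummer_algebra.y(1)[OF KA]

lemma \<iota>_mono: "\<iota> \<in> alg_mono F T A"
  by (rule kummer_symbol_mono[OF T symbol_pair_axioms \<iota> refl])

lemma upow_\<iota>: "c \<in> carrier T \<Longrightarrow> u [^] (i::nat) \<otimes> \<iota> c = \<iota> ((\<tau> ^^ i) c) \<otimes> u [^] i"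
  by (rule twisted_commute[where D = "carrier T"])
    (use u \<iota>'(1) alg_homD(1)[OF kummer_algebra.\<tau>(1)[OF T]] u_\<iota> in auto)

lemma cancel_upow:
  assumes "s \<in> carrier A" "t \<in> carrier A" "s \<otimes> u [^] (i::nat) = t \<otimes> u [^] i"
  shows "s = t"
proof -
  have "s \<otimes> u [^] i \<otimes> w [^] i = t \<otimes> u [^] i \<otimes> w [^] i" using assms(3) by simp
  then show ?thesis using assms(1,2) u w(1) by (simp add: m_assoc uw_pow)
qed

text \<open>Conjugation by \<open>u [^] i\<close> realises \<open>\<tau> ^^ i\<close> inside
  \<open>A\<close>; it carries \<open>e 0\<close> to \<open>e i\<close> and multiplies
  \<open>x\<close> by the inverse of \<open>z\<close> to the power \<open>i\<close>.\<close>

lemma \<iota>_shift: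
  assumes i: "i < k"
  shows "\<iota> ((\<tau> ^^ i) (x [^]\<^bsub>T\<^esub> (j::nat) \<otimes>\<^bsub>T\<^esub> e 0)) = (inv\<^bsub>F\<^esub> z) [^]\<^bsub>F\<^esub> (i * j) \<odot> (\<iota> x [^] j \<otimes> \<iota> (e i))"
proof (rule cancel_upow)
  interpret T: kummer_algebra F T "N * k" z g x \<tau> by (rule T)
  have eT: "e 0 \<in> carrier T" using e_T Mk by simp
  have c: "x [^]\<^bsub>T\<^esub> j \<otimes>\<^bsub>T\<^esub> e 0 \<in> carrier T" using eT xT by simp
  show "\<iota> ((\<tau> ^^ i) (x [^]\<^bsub>T\<^esub> j \<otimes>\<^bsub>T\<^esub> e 0)) \<in> carrier A"
    by (intro \<iota>'(1) T.\<tau>_pow_closed c)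
  show "(inv\<^bsub>F\<^esub> z) [^]\<^bsub>F\<^esub> (i * j) \<odot> (\<iota> x [^] j \<otimes> \<iota> (e i)) \<in> carrier A"
    using zi v e[OF i] by simp
  have "\<iota> ((\<tau> ^^ i) (x [^]\<^bsub>T\<^esub> j \<otimes>\<^bsub>T\<^esub> e 0)) \<otimes> u [^] i = u [^] i \<otimes> (\<iota> x [^] j \<otimes> \<iota> (e 0))"
    using upow_\<iota>[OF c, of i] \<iota>'(4) eT xT alg_hom_pow[OF \<iota> ringT ringA xT] by simp
  also have "\<dots> = mon i j \<otimes> \<iota> (e 0)" using u v e0 by (simp add: m_assoc)
  also have "mon i j = (inv\<^bsub>F\<^esub> z) [^]\<^bsub>F\<^esub> (i * j) \<odot> (\<iota> x [^] j \<otimes> u [^] i)"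
    using vpow_upow[of j i] zi zi_pow[of "i * j"] zD(1) u v by simp
  also have "(inv\<^bsub>F\<^esub> z) [^]\<^bsub>F\<^esub> (i * j) \<odot> (\<iota> x [^] j \<otimes> u [^] i) \<otimes> \<iota> (e 0) =
      (inv\<^bsub>F\<^esub> z) [^]\<^bsub>F\<^esub> (i * j) \<odot> (\<iota> x [^] j \<otimes> (u [^] i \<otimes> \<iota> (e 0)))"
    using zi u v e0 by (simp add: m_assoc)
  also have "\<dots> = (inv\<^bsub>F\<^esub> z) [^]\<^bsub>F\<^esub> (i * j) \<odot> (\<iota> x [^] j \<otimes> \<iota> (e i)) \<otimes> u [^] i"
    unfolding u_e0[OF i] using zi u v e[OF i] by (simp add: m_assoc)
  finally show "\<iota> ((\<tau> ^^ i) (x [^]\<^bsub>T\<^esub> j \<otimes>\<^bsub>T\<^esub> e 0)) \<otimes> u [^] i =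
    (inv\<^bsub>F\<^esub> z) [^]\<^bsub>F\<^esub> (i * j) \<odot> (\<iota> x [^] j \<otimes> \<iota> (e i)) \<otimes> u [^] i" .
qed

text \<open>A trace is a priori only additive. On the components of powers of \<open>x\<close> it is
  multiplicative all the same, since the scalars from the shift are exactly those in the powers of
  \<open>y\<close>.\<close>

lemma \<iota>_trace:
  "\<iota> (\<Oplus>\<^bsub>T\<^esub>i\<in>{..<k}. (\<tau> ^^ i) (x [^]\<^bsub>T\<^esub> (j::nat) \<otimes>\<^bsub>T\<^esub> e 0)) = y [^] j"
proof -
  interpret T: kummer_algebra F T "N * k" z g x \<tau> by (rule T)
  have eT: "e 0 \<in> carrier T" using e_T Mk by simp
  have c: "x [^]\<^bsub>T\<^esub> j \<otimes>\<^bsub>T\<^esub> e 0 \<in> carrier T" using eT xT by simp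
  have "\<iota> (\<Oplus>\<^bsub>T\<^esub>i\<in>{..<k}. (\<tau> ^^ i) (x [^]\<^bsub>T\<^esub> j \<otimes>\<^bsub>T\<^esub> e 0)) =
      (\<Oplus>i\<in>{..<k}. \<iota> ((\<tau> ^^ i) (x [^]\<^bsub>T\<^esub> j \<otimes>\<^bsub>T\<^esub> e 0)))"
    using T.\<tau>_pow_closed[OF c] by (intro lin_map_finsum[OF fT fA alg_hom_lin[OF \<iota>]]) auto
  also have "\<dots> = (\<Oplus>i\<in>{..<k}. y [^] j \<otimes> \<iota> (e i))"
    using y e ypow_e \<iota>_shift by (intro finsum_cong') auto
  also have "\<dots> = y [^] j" using y by (intro sum_e_right) simp
  finally show ?thesis .
qed

end

text \<open>As a sum of conjugates of a component embedding, \<open>\<phi>\<close> is visibly linear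
  but not visibly multiplicative. It is identified with the homomorphism that sends the generator to
  \<open>y0\<close> by comparing both on powers of the variable.\<close>

lemma component_embed_trace:
  fixes F :: "('f, 'r) ring_scheme"
  assumes "kummer_tower F A N k z b g u d \<iota> (kummer_gen F (N * k) g) e (kummer F (N * k) g) \<tau>
    (kummer F N d) \<tau>' (kummer_gen F N d) C H \<iota>2"
    and \<phi>: "\<phi> = (\<lambda>S. \<Oplus>\<^bsub>kummer F (N * k) g\<^esub>i\<in>{..<k}. (\<tau> ^^ i) (component_embed F (N * k) g (e 0) S))"
  shows "\<phi> \<in> alg_hom F (kummer F N d) (kummer F (N * k) g)"
    and "\<iota> (\<phi> (kummer_gen F N d)) = split_symbol.y F A k z (\<iota> (kummer_gen F (N * k) g)) (\<lambda>i. \<iota> (e i))"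
proof -
  interpret kummer_tower F A N k z b g u d \<iota> "kummer_gen F (N * k) g" e "kummer F (N * k) g" \<tau>
    "kummer F N d" \<tau>' "kummer_gen F N d" C H \<iota>2 by fact
  let ?T = "kummer F (N * k) g" and ?K = "kummer F N d" and ?x = "kummer_gen F (N * k) g" and ?x' = "kummer_gen F N d"
  interpret T: kummer_algebra F ?T "N * k" z g ?x \<tau> by (rule T)
  interpret K: kummer_algebra F ?K N "z [^]\<^bsub>F\<^esub> k" d ?x' \<tau>' by (rule KA)
  interpret PT: kummer_poly F "N * k" g using g(1) zD(2) by unfold_locales auto
  interpret PK: kummer_poly F N d using d(1) Mk by unfold_locales auto
  note inj = alg_monoD(2)[OF \<iota>_mono]
  have eT: "e 0 \<in> carrier ?T" using e_T Mk by simp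
  \<comment> \<open>On the component of \<open>e 0\<close> the element \<open>?x\<close> has
    \<open>N\<close>-th power \<open>d\<close>. This is checked in \<open>A\<close>, where the
    eigenvalue equation is available, and pulled back along the injective
    \<open>\<iota>\<close>.\<close>
  have ann: "(?x [^]\<^bsub>?T\<^esub> N \<ominus>\<^bsub>?T\<^esub> d \<odot>\<^bsub>?T\<^esub> \<one>\<^bsub>?T\<^esub>) \<otimes>\<^bsub>?T\<^esub> e 0 = \<zero>\<^bsub>?T\<^esub>"
  proof -
    have "\<iota> (?x [^]\<^bsub>?T\<^esub> N \<otimes>\<^bsub>?T\<^esub> e 0) = \<iota> (d \<odot>\<^bsub>?T\<^esub> e 0)"
      using e_left[of 0] Mk \<iota>'(3,4) eT xT d(1) alg_hom_pow[OF \<iota> ringT ringA xT] by simp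
    then have "?x [^]\<^bsub>?T\<^esub> N \<otimes>\<^bsub>?T\<^esub> e 0 = d \<odot>\<^bsub>?T\<^esub> e 0"
      by (rule inj_onD[OF inj]) (use eT xT d(1) in auto)
    then show ?thesis using eT xT d(1) by (simp add: T.minus_eq T.l_distr T.l_minus T.r_neg)
  qed
  have emb: "component_embed F (N * k) g (e 0) (PK.cls p) = PT.cls p \<otimes>\<^bsub>?T\<^esub> e 0" if "p \<in> carrier PK.P" for p
    by (rule PK.component_embed_cls[OF PT.kummer_poly_axioms eT ann that])
  define y0 where "y0 = (\<Oplus>\<^bsub>?T\<^esub>i\<in>{..<k}. (\<tau> ^^ i) (?x [^]\<^bsub>?T\<^esub> (1::nat) \<otimes>\<^bsub>?T\<^esub> e 0))"
  have pow_closed: "(\<Oplus>\<^bsub>?T\<^esub>i\<in>{..<k}. (\<tau> ^^ i) (?x [^]\<^bsub>?T\<^esub> (j::nat) \<otimes>\<^bsub>?T\<^esub> e 0)) \<in> carrier ?T" for j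
    using T.\<tau>_pow_closed eT xT by (intro T.finsum_closed) auto
  have y0: "y0 \<in> carrier ?T" "\<iota> y0 = y"
    unfolding y0_def using pow_closed[of 1] \<iota>_trace[of 1] y by simp_all
  have y0_pow: "(\<Oplus>\<^bsub>?T\<^esub>i\<in>{..<k}. (\<tau> ^^ i) (?x [^]\<^bsub>?T\<^esub> (j::nat) \<otimes>\<^bsub>?T\<^esub> e 0)) = y0 [^]\<^bsub>?T\<^esub> j" for j
  proof (rule inj_onD[OF inj])
    show "\<iota> (\<Oplus>\<^bsub>?T\<^esub>i\<in>{..<k}. (\<tau> ^^ i) (?x [^]\<^bsub>?T\<^esub> j \<otimes>\<^bsub>?T\<^esub> e 0)) = \<iota> (y0 [^]\<^bsub>?T\<^esub> j)"
      unfolding \<iota>_trace alg_hom_pow[OF \<iota> ringT ringA y0(1)] y0(2) by (rule refl)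
  qed (use y0 pow_closed in auto)
  have "y0 [^]\<^bsub>?T\<^esub> N = d \<odot>\<^bsub>?T\<^esub> \<one>\<^bsub>?T\<^esub>"
    by (rule inj_onD[OF inj]) (use y0 y_M \<iota>'(3,5) d(1) alg_hom_pow[OF \<iota> ringT ringA y0(1)] in auto)
  then obtain f where f: "f \<in> alg_hom F ?K ?T" "f ?x' = y0"
    using K.hom_exists[OF fT y0(1)] by blast
  have eq: "\<phi> (PK.cls p) = f (PK.cls p)" if p: "p \<in> carrier PK.P" for p
  proof -
    let ?tr = "\<lambda>p. \<Oplus>\<^bsub>?T\<^esub>i\<in>{..<k}. (\<tau> ^^ i) (PT.cls p \<otimes>\<^bsub>?T\<^esub> e 0)"
    note cT = alg_homD[OF PT.cls_hom] and \<tau>i = alg_homD[OF T.\<tau>_pow_hom]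
    have "?tr p = f (PK.cls p)"
    proof (rule spanned_lin_map_eq[OF PK.P_algebra fT _ _ PK.P_spanned _ p])
      show "?tr \<in> lin_map F PK.P ?T"
      proof (rule lin_mapI)
        fix p r assume p: "p \<in> carrier PK.P" and r: "r \<in> carrier PK.P"
        show "?tr p \<in> carrier ?T" using cT p eT \<tau>i(1) by (intro T.finsum_closed) auto
        have "?tr (p \<oplus>\<^bsub>PK.P\<^esub> r) = (\<Oplus>\<^bsub>?T\<^esub>i\<in>{..<k}. (\<tau> ^^ i) (PT.cls p \<otimes>\<^bsub>?T\<^esub> e 0) \<oplus>\<^bsub>?T\<^esub> (\<tau> ^^ i) (PT.cls r \<otimes>\<^bsub>?T\<^esub> e 0))"
          using cT p r eT \<tau>i(1,2) by (intro T.finsum_cong') (auto simp: T.l_distr)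
        then show "?tr (p \<oplus>\<^bsub>PK.P\<^esub> r) = ?tr p \<oplus>\<^bsub>?T\<^esub> ?tr r"
          using cT p r eT \<tau>i(1) by (subst T.finsum_addf[symmetric]) auto
        fix c assume c: "c \<in> carrier F"
        have "?tr (c \<odot>\<^bsub>PK.P\<^esub> p) = (\<Oplus>\<^bsub>?T\<^esub>i\<in>{..<k}. c \<odot>\<^bsub>?T\<^esub> (\<tau> ^^ i) (PT.cls p \<otimes>\<^bsub>?T\<^esub> e 0))"
          using cT p c eT \<tau>i(1,3) by (intro T.finsum_cong') auto
        then show "?tr (c \<odot>\<^bsub>PK.P\<^esub> p) = c \<odot>\<^bsub>?T\<^esub> ?tr p"
          using cT p c eT \<tau>i(1) by (subst T.finsum_smult_ldistr) auto
      qed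
      show "(\<lambda>p. f (PK.cls p)) \<in> lin_map F PK.P ?T"
        using alg_hom_lin[OF alg_hom_comp[OF PK.cls_hom f(1)]] by (simp add: comp_def)
      fix s assume "s \<in> range (up_ring.monom PK.P \<one>\<^bsub>F\<^esub>)"
      then obtain j where s: "s = up_ring.monom PK.P \<one>\<^bsub>F\<^esub> j" by blast
      show "?tr s = f (PK.cls s)"
        unfolding s PT.cls_monom PK.cls_monom y0_pow using alg_hom_pow[OF f(1) ringK ringT x'K] f(2) by simp
    qed
    then show ?thesis by (simp add: \<phi> emb[OF p])
  qed
  have \<phi>f: "\<phi> c = f c" if "c \<in> carrier ?K" for c using that eq unfolding PK.K_carrier by blast
  note f' = alg_homD[OF f(1)]
  show "\<phi> \<in> alg_hom F ?K ?T"
    by (rule alg_homI[OF lin_mapI]) (use \<phi>f f' in auto)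
  show "\<iota> (\<phi> ?x') = y" using \<phi>f[OF x'K] f(2) y0(2) by simp
qed

locale kummer_tower_hom = kummer_tower F A N k z b g u d \<iota> x e T \<tau> K \<tau>' x' C H \<iota>2
  for F :: "('f, 'r) ring_scheme" and A :: "('f, 'a, 'x) module_scheme" (structure)
    and N k z b g u d and \<iota> :: "'t \<Rightarrow> 'a" and x e
    and T :: "('f, 't, 'y) module_scheme" and \<tau> and K :: "('f, 'k, 'y') module_scheme" and \<tau>' x'
    and C :: "('f, 'c, 'y'') module_scheme" and H \<iota>2 +
  fixes \<phi> :: "'k \<Rightarrow> 't" and \<Phi> :: "'c \<Rightarrow> 'a"
  assumes \<phi>: "\<phi> \<in> alg_hom F K T" "\<iota> (\<phi> x') = y"
    and \<Phi>: "\<Phi> \<in> alg_mono F C A" "\<Phi> H = u [^] k" "\<Phi> (\<iota>2 x') = y"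
begin

lemma CS: "symbol_algebra F C N (z [^]\<^bsub>F\<^esub> k) b d H (\<iota>2 x')"
  by (rule kummer_symbol.axioms(2)[OF C])

sublocale Co: corner_symbol F A N k z b g u "\<iota> x" d "\<lambda>i. \<iota> (e i)" C H "\<iota>2 x'" \<Phi>
  by (intro corner_symbol.intro corner_symbol_axioms.intro split_symbol_axioms CS \<Phi>)

lemmas \<phi>' = alg_homD[OF \<phi>(1)]

lemma \<phi>_mono: "\<phi> \<in> alg_mono F K T"
proof -
  have "\<iota> \<circ> \<phi> \<in> alg_mono F K A"
    by (rule kummer_symbol_mono[OF KA corner_pair alg_hom_comp[OF \<phi>(1) \<iota>]]) (simp add: \<phi>(2))
  then have "inj_on \<phi> (carrier K)" by (rule inj_on_imageI2[OF alg_monoD(2)])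
  then show ?thesis using \<phi>(1) by (simp add: alg_mono_def)
qed

lemma \<Phi>_\<iota>2:
  assumes c: "c \<in> carrier K"
  shows "\<Phi> (\<iota>2 c) = \<iota> (\<phi> c)"
proof -
  have "(\<Phi> \<circ> \<iota>2) c = (\<iota> \<circ> \<phi>) c"
    by (rule kummer_algebra.hom_eq[OF KA fA alg_hom_comp[OF kummer_symbol.\<iota>(1)[OF C] alg_monoD(1)[OF \<Phi>(1)]]
        alg_hom_comp[OF \<phi>(1) \<iota>] _ c]) (simp add: \<phi>(2) \<Phi>(3))
  then show ?thesis by simp
qed

text \<open>Both sides are homomorphisms, so the generator decides. In \<open>A\<close> the map
  \<open>\<tau> ^^ k\<close> is conjugation by \<open>u [^] k\<close>, and the relation between
  \<open>y\<close> and \<open>u [^] k\<close> yields the same scalar as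
  \<open>\<tau>'\<close>.\<close>

lemma \<tau>_pow_\<phi>:
  assumes c: "c \<in> carrier K"
  shows "(\<tau> ^^ k) (\<phi> c) = \<phi> (\<tau>' c)"
proof -
  interpret T: kummer_algebra F T "N * k" z g x \<tau> by (rule T)
  interpret K: kummer_algebra F K N "z [^]\<^bsub>F\<^esub> k" d x' \<tau>' by (rule KA)
  interpret P: symbol_pair F A N "z [^]\<^bsub>F\<^esub> k" b d "u [^] k" y by (rule corner_pair)
  let ?i = "inv\<^bsub>F\<^esub> (z [^]\<^bsub>F\<^esub> k)"
  have i: "?i \<in> carrier F" "?i \<otimes>\<^bsub>F\<^esub> z [^]\<^bsub>F\<^esub> k = \<one>\<^bsub>F\<^esub>" using P.zD(5) by auto
  have \<phi>x: "\<phi> x' \<in> carrier T" by (rule \<phi>'(1)[OF x'K])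
  have "\<iota> ((\<tau> ^^ k) (\<phi> x')) \<otimes> u [^] k = u [^] k \<otimes> y" using upow_\<iota>[OF \<phi>x] \<phi>(2) by simp
  also have "\<dots> = ?i \<odot> (y \<otimes> u [^] k)" unfolding y_uk using i u y zD(1) by simp
  also have "\<dots> = \<iota> (?i \<odot>\<^bsub>T\<^esub> \<phi> x') \<otimes> u [^] k" using \<iota>'(3)[OF i(1) \<phi>x] \<phi>(2) i u y by simp
  finally have "\<iota> ((\<tau> ^^ k) (\<phi> x')) = \<iota> (?i \<odot>\<^bsub>T\<^esub> \<phi> x')"
    by (rule cancel_upow[rotated 2]) (use T.\<tau>_pow_closed[OF \<phi>x] \<iota>'(1) \<phi>x i in auto)
  then have "(\<tau> ^^ k) (\<phi> x') = ?i \<odot>\<^bsub>T\<^esub> \<phi> x'"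
    by (rule inj_onD[OF alg_monoD(2)[OF \<iota>_mono]]) (use T.\<tau>_pow_closed[OF \<phi>x] \<phi>x i in auto)
  also have "\<dots> = \<phi> (\<tau>' x')" using K.\<tau>(2) \<phi>'(3) i(1) x'K by simp
  finally have "((\<tau> ^^ k) \<circ> \<phi>) x' = (\<phi> \<circ> \<tau>') x'" by simp
  then have "((\<tau> ^^ k) \<circ> \<phi>) c = (\<phi> \<circ> \<tau>') c"
    by (rule K.hom_eq[OF fT alg_hom_comp[OF \<phi>(1) T.\<tau>_pow_hom] alg_hom_comp[OF K.\<tau>(1) \<phi>(1)] _ c])
  then show ?thesis by simp
qed

abbreviation T'' where "T'' \<equiv> T\<lparr>carrier := \<phi> ` carrier K\<rparr>"

lemma T''_kummer: "kummer_algebra F T'' N (z [^]\<^bsub>F\<^esub> k) d (\<phi> x') (\<tau> ^^ k)"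
  by (rule kummer_algebra_image[OF KA fT \<phi>_mono \<tau>_pow_\<phi>])

text \<open>The skew algebra over the image of \<open>\<phi>\<close> is a symbol algebra with the
  same parameters as \<open>C\<close>, so both have as image the subalgebra generated by
  \<open>u [^] k\<close> and \<open>y\<close>.\<close>

lemma image_skew:
  obtains \<Psi> where "\<Psi> \<in> alg_mono F (skew_cyclic T'' (\<tau> ^^ k) N b) A"
    "\<And>c. c \<in> carrier T'' \<Longrightarrow> \<Psi> (skew_const T'' (\<tau> ^^ k) N b c) = \<iota> c"
    "\<Psi> (skew_gen T'' (\<tau> ^^ k) N b) = u [^] k"
    "\<Psi> ` carrier (skew_cyclic T'' (\<tau> ^^ k) N b) = \<Phi> ` carrier C"
proof -
  interpret I: kummer_algebra F T'' N "z [^]\<^bsub>F\<^esub> k" d "\<phi> x'" "\<tau> ^^ k" by (rule T''_kummer)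
  let ?X = "skew_cyclic T'' (\<tau> ^^ k) N b" and ?\<iota> = "skew_const T'' (\<tau> ^^ k) N b"
  note X = I.symbol_algebra[OF b] and \<iota>X = I.skew_const_hom(1)[OF b(1)]
  obtain f where f: "f \<in> alg_mono F ?X A" "f (skew_gen T'' (\<tau> ^^ k) N b) = u [^] k" "f (?\<iota> (\<phi> x')) = y"
    using symbol_mono[OF X corner_pair] .
  have "(f \<circ> ?\<iota>) c = \<iota> c" if c: "c \<in> carrier T''" for c
  proof (rule I.hom_eq[OF fA alg_hom_comp[OF \<iota>X alg_monoD(1)[OF f(1)]] _ _ c])
    show "\<iota> \<in> alg_hom F T'' A"
      using \<phi>'(1) \<iota>' by (intro alg_homI lin_mapI) auto
    show "(f \<circ> ?\<iota>) (\<phi> x') = \<iota> (\<phi> x')" using f(3) \<phi>(2) by simp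
  qed
  moreover have "f ` carrier ?X = \<Phi> ` carrier C"
    using symbol_hom_image_subset[OF X CS fA alg_monoD(1)[OF f(1)] alg_monoD(1)[OF \<Phi>(1)]]
      symbol_hom_image_subset[OF CS X fA alg_monoD(1)[OF \<Phi>(1)] alg_monoD(1)[OF f(1)]] f(2,3) \<Phi>(2,3) by auto
  ultimately show ?thesis using that f by simp
qed

lemma image_direct_sum:
  "internal_direct_sum F A N (\<lambda>i. {\<iota> c \<otimes> u [^] (i * k) | c. c \<in> carrier T''}) (\<Phi> ` carrier C)"
proof -
  interpret C: kummer_symbol F K C N "z [^]\<^bsub>F\<^esub> k" d x' \<tau>' b H "\<iota>2 x'" \<iota>2 by (rule C)
  note \<Phi>' = alg_homD[OF alg_monoD(1)[OF \<Phi>(1)]]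
  have pow: "\<Phi> (H [^]\<^bsub>C\<^esub> (i::nat)) = u [^] (i * k)" for i
    using alg_hom_pow[OF alg_monoD(1)[OF \<Phi>(1)] C.rA ringA Co.C.u] \<Phi>(2) u by (simp add: nat_pow_pow mult.commute)
  have "\<Phi> (\<iota>2 c \<otimes>\<^bsub>C\<^esub> H [^]\<^bsub>C\<^esub> i) = \<iota> (\<phi> c) \<otimes> u [^] (i * k)" if "c \<in> carrier K" for c and i :: nat
    using that \<Phi>'(4) C.\<iota>'(1) Co.C.u pow \<Phi>_\<iota>2 by simp
  then have "{\<Phi> (\<iota>2 c \<otimes>\<^bsub>C\<^esub> H [^]\<^bsub>C\<^esub> i) | c. c \<in> carrier K} = {\<iota> c \<otimes> u [^] (i * k) | c. c \<in> carrier T''}" for i :: nat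
    by (simp add: Setcompr_eq_image image_image cong: image_cong_simp)
  with C.image_decomposition[OF fA \<Phi>(1)] show ?thesis by simp
qed

lemma centralizer_image:
  "alg_isomorphic F (A\<lparr>carrier := centralizer A (\<Phi> ` carrier C)\<rparr>) (mat_alg k (self_alg F))"
  by (rule Co.M.centralizer_isomorphic[OF symbol_algebra.center[OF CS] nontriv])

end

section \<open>The reduced cyclic algebra of a symbol algebra\<close>

theorem corollary2p14:
  fixes F :: "('f, 'r) ring_scheme" and n m m' N :: nat and q s a \<sigma> \<alpha> \<omega> :: 'f
    and E :: "('f, (gen list \<Rightarrow> 'f) set) module"
    and Et Et' Et'' :: "('f, (nat \<Rightarrow> 'f) set) module"
    and E' E2 :: "('f, (nat \<Rightarrow> (nat \<Rightarrow> 'f) set) set) module"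
    and x x' :: "(nat \<Rightarrow> 'f) set" and \<tau> \<tau>' :: "(nat \<Rightarrow> 'f) set \<Rightarrow> (nat \<Rightarrow> 'f) set"
    and h H :: "(nat \<Rightarrow> (nat \<Rightarrow> 'f) set) set"
    and \<iota>' \<iota>2 :: "(nat \<Rightarrow> 'f) set \<Rightarrow> (nat \<Rightarrow> (nat \<Rightarrow> 'f) set) set"
    and e :: "nat \<Rightarrow> (nat \<Rightarrow> 'f) set" and \<phi>0 :: "(nat \<Rightarrow> 'f) set \<Rightarrow> (nat \<Rightarrow> 'f) set"
  assumes F: "field F"
    and n: "n \<ge> 2"
    and q: "primitive_root_of_unity F n q"
    and s: "s \<in> carrier F" "s \<noteq> \<zero>\<^bsub>F\<^esub>"
    and a: "a \<in> carrier F" "a \<noteq> \<zero>\<^bsub>F\<^esub>"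
    and m: "m = max_power F n s"
    and m': "m' = max_power F (n div m) a"
    and \<sigma>: "\<sigma> \<in> carrier F" "\<sigma> [^]\<^bsub>F\<^esub> m = s"
    and \<alpha>: "\<alpha> \<in> carrier F" "\<alpha> [^]\<^bsub>F\<^esub> m' = a"
    and N: "N = n div (m * m')"
    and E: "E = symbol_alg F n q s a"
    and Et: "Et = kummer F (n div m) a"
    and x: "x = kummer_gen F (n div m) a"
    and \<tau>: "\<tau> = scale_aut F (inv\<^bsub>F\<^esub> (q [^]\<^bsub>F\<^esub> m))"
    and E': "E' = skew_cyclic Et \<tau> (n div m) \<sigma>"
    and h: "h = skew_gen Et \<tau> (n div m) \<sigma>"
    and \<iota>': "\<iota>' = skew_const Et \<tau> (n div m) \<sigma>"
    and Et': "Et' = kummer F N \<alpha>"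
    and x': "x' = kummer_gen F N \<alpha>"
    and \<tau>': "\<tau>' = scale_aut F (inv\<^bsub>F\<^esub> (q [^]\<^bsub>F\<^esub> (m * m')))"
    and E2: "E2 = skew_cyclic Et' \<tau>' N \<sigma>"
    and H: "H = skew_gen Et' \<tau>' N \<sigma>"
    and \<iota>2: "\<iota>2 = skew_const Et' \<tau>' N \<sigma>"
    and \<omega>: "\<omega> = q [^]\<^bsub>F\<^esub> (n div m')"
    and e: "e = split_idem F Et x N m' \<omega> \<alpha>"
    and \<phi>0: "\<phi>0 = (\<lambda>S. \<Oplus>\<^bsub>Et\<^esub>i\<in>{..<m'}. (\<tau> ^^ i) (component_embed F (n div m) a (e 0) S))"
    and Et'': "Et'' = Et\<lparr>carrier := \<phi>0 ` carrier Et'\<rparr>"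
  shows
    \<comment> \<open>1\<close>
    "(reduced_cyclic F E2 N (q [^]\<^bsub>F\<^esub> (m * m')) \<sigma> \<alpha> H (\<iota>2 x') \<and>
      has_degree F E2 N \<and>
      \<sigma> \<in> Units F \<and>
      centralizer E2 (carrier E2) = scalars F E2 \<and>
      field Et' \<and> \<iota>2 \<in> alg_mono F Et' E2 \<and>
      strictly_maximal_subfield F E2 (\<iota>2 ` carrier Et') \<and>
      ring.dimension Et' N (scalars F Et') (carrier Et') \<and>
      internal_direct_sum F E2 N
        (\<lambda>k. {\<iota>2 b \<otimes>\<^bsub>E2\<^esub> H [^]\<^bsub>E2\<^esub> k | b. b \<in> carrier Et'}) (carrier E2))
     \<and>
    \<comment> \<open>2\<close>
     (alg_isomorphic F E2 (mat_alg N (self_alg F)) \<longleftrightarrow>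
      (\<exists>b \<in> Units Et'. \<sigma> \<odot>\<^bsub>Et'\<^esub> \<one>\<^bsub>Et'\<^esub> = galois_norm Et' (scalars F Et') b))
     \<and>
    \<comment> \<open>3 and 4\<close>
     (\<phi>0 \<in> alg_mono F Et' Et \<and> \<iota>' \<in> alg_mono F Et E' \<and>
      (\<exists>\<Phi> \<in> alg_mono F E2 E'.
        (\<forall>b \<in> carrier Et'. \<Phi> (\<iota>2 b) = \<iota>' (\<phi>0 b)) \<and>
        \<Phi> H = h [^]\<^bsub>E'\<^esub> m' \<and>
        (\<exists>\<Psi> \<in> alg_mono F (skew_cyclic Et'' (\<tau> ^^ m') N \<sigma>) E'.
          (\<forall>b \<in> carrier Et''. \<Psi> (skew_const Et'' (\<tau> ^^ m') N \<sigma> b) = \<iota>' b) \<and>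
          \<Psi> (skew_gen Et'' (\<tau> ^^ m') N \<sigma>) = h [^]\<^bsub>E'\<^esub> m' \<and>
          \<Psi> ` carrier (skew_cyclic Et'' (\<tau> ^^ m') N \<sigma>) = \<Phi> ` carrier E2) \<and>
        internal_direct_sum F E' N
          (\<lambda>k. {\<iota>' b \<otimes>\<^bsub>E'\<^esub> h [^]\<^bsub>E'\<^esub> (k * m') | b. b \<in> carrier Et''}) (\<Phi> ` carrier E2) \<and>
        alg_isomorphic F E' (mat_alg m' E2) \<and>
        alg_isomorphic F (E'\<lparr>carrier := centralizer E' (\<Phi> ` carrier E2)\<rparr>)
          (mat_alg m' (self_alg F)) \<and>
        (let B = (\<lambda>j. E'\<lparr>carrier := {z \<otimes>\<^bsub>E'\<^esub> \<iota>' (e j) | z. z \<in> \<Phi> ` carrier E2},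
                        one := \<iota>' (e j)\<rparr>);
             \<pi> = (\<lambda>v. \<Oplus>\<^bsub>E'\<^esub>j\<in>{..<m'}. v j)
         in (\<forall>j<m'. assoc_algebra F (B j)) \<and>
            \<pi> \<in> alg_mono F (prod_alg m' B) E' \<and>
            internal_direct_sum F E' m'
              (\<lambda>i. {\<pi> v \<otimes>\<^bsub>E'\<^esub> h [^]\<^bsub>E'\<^esub> i | v. v \<in> carrier (prod_alg m' B)}) (carrier E'))))
     \<and>
    \<comment> \<open>5\<close>
     (alg_isomorphic F E (mat_alg (m * m') E2) \<and> alg_equivalent F E E2)"
proof -
  interpret K: field F by (rule F)
  define \<zeta> where "\<zeta> = q [^]\<^bsub>F\<^esub> m"
  have n0: "n > 0" using n by simp
  note mD = K.max_powerD[OF n0 s(1), folded m]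
  have nm: "n = m * (n div m)" using mD(2) by simp
  then have M0: "n div m > 0" using n0 by (metis gr0I mult_0_right)
  note m'D = K.max_powerD[OF M0 a(1), folded m']
  have N_eq: "N = n div m div m'" using N by (simp add: div_mult2_eq)
  have M: "n div m = N * m'" using m'D(2) N_eq by simp
  have n_eq: "n = N * m' * m" using nm M by simp
  have \<sigma>0: "\<sigma> \<noteq> \<zero>\<^bsub>F\<^esub>" using \<sigma>(2) s(2) mD(1) by (auto simp: K.nat_pow_zero)
  have \<alpha>0: "\<alpha> \<noteq> \<zero>\<^bsub>F\<^esub>" using \<alpha>(2) a(2) m'D(1) by (auto simp: K.nat_pow_zero)
  have qF: "q \<in> carrier F" using q by (simp add: primitive_root_of_unity_def)
  have \<zeta>: "primitive_root_of_unity F (N * m') \<zeta>"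
    unfolding \<zeta>_def using q n_eq by (intro K.primitive_root_power) (simp add: mult.commute)
  have \<zeta>': "primitive_root_of_unity F N (\<zeta> [^]\<^bsub>F\<^esub> m')"
    using \<zeta> by (intro K.primitive_root_power) (simp add: mult.commute)
  have \<zeta>_pow: "q [^]\<^bsub>F\<^esub> (m * m') = \<zeta> [^]\<^bsub>F\<^esub> m'" using qF by (simp add: \<zeta>_def K.nat_pow_pow)
  have \<omega>_eq: "\<omega> = \<zeta> [^]\<^bsub>F\<^esub> N"
  proof -
    have "n div m' = m * N" using n_eq m'D(1) by (simp add: mult.commute mult.left_commute)
    then show ?thesis using qF by (simp add: \<omega> \<zeta>_def K.nat_pow_pow)
  qed
  \<comment> \<open>Maximality of \<open>m\<close> excludes powers for all divisors of
    \<open>n div m\<close>, in particular for those of \<open>N\<close>. For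
    \<open>\<alpha>\<close>, maximality of \<open>m'\<close> speaks about the divisors of
    \<open>n div m div m'\<close>, which is \<open>N\<close> itself.\<close>
  have \<sigma>_root: "\<sigma> \<notin> powers F t" if "t dvd N" "t > 1" for t
    by (rule K.root_not_power[OF n0 s(1)]) (use \<sigma>(2) that M m in auto)
  have \<alpha>_root: "\<alpha> \<notin> powers F t" if "t dvd N" "t > 1" for t
    by (rule K.root_not_power[OF M0 a(1)]) (use \<alpha>(2) that N_eq m' in auto)
  interpret PT: kummer_poly F "N * m'" a using a(1) M0 M by unfold_locales auto
  have T: "kummer_algebra F Et (N * m') \<zeta> a x \<tau>"
    unfolding Et x \<tau> M \<zeta>_def[symmetric] by (rule PT.kummer_algebra[OF \<zeta> a(2)])
  interpret T: kummer_algebra F Et "N * m'" \<zeta> a x \<tau> by (rule T)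
  have K: "kummer_field F Et' N (\<zeta> [^]\<^bsub>F\<^esub> m') \<alpha> x' \<tau>'"
    unfolding Et' x' \<tau>' \<zeta>_pow by (rule K.kummer_fieldI[OF \<zeta>' \<alpha>(1) \<alpha>0 \<alpha>_root])
  \<comment> \<open>This makes the subalgebra generated by \<open>H\<close> a field too; the root of
    unity is inverted because there the generators are swapped.\<close>
  note K\<sigma> = K.kummer_fieldI[OF K.primitive_root_inverse[OF \<zeta>'] \<sigma>(1) \<sigma>0 \<sigma>_root]
  have C: "kummer_symbol F Et' E2 N (\<zeta> [^]\<^bsub>F\<^esub> m') \<alpha> x' \<tau>' \<sigma> H (\<iota>2 x') \<iota>2"
    unfolding E2 H \<iota>2 by (rule kummer_field.skew_kummer_symbol[OF K \<sigma>(1) \<sigma>0])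
  note CS = kummer_symbol.axioms(2)[OF C]
  have A: "symbol_algebra F E' (N * m') \<zeta> \<sigma> a h (\<iota>' x)"
    unfolding E' h \<iota>' M by (rule T.symbol_algebra[OF \<sigma>(1) \<sigma>0])
  note \<iota>_hom = T.skew_const_hom[OF \<sigma>(1), folded M, folded E' h \<iota>']
  interpret A: symbol_algebra F E' "N * m'" \<zeta> \<sigma> a h "\<iota>' x" by (rule A)
  have rings: "ring Et" "ring E'" by unfold_locales
  note \<iota>h = alg_homD[OF \<iota>_hom(1)]
  have \<omega>: "primitive_root_of_unity F m' \<omega>" unfolding \<omega>_eq by (rule K.primitive_root_power[OF \<zeta>])
  have xN: "x [^]\<^bsub>Et\<^esub> N \<in> carrier Et" "(x [^]\<^bsub>Et\<^esub> N) [^]\<^bsub>Et\<^esub> m' = \<alpha> [^]\<^bsub>F\<^esub> m' \<odot>\<^bsub>Et\<^esub> \<one>\<^bsub>Et\<^esub>"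
    using T.y \<alpha>(2) by (simp_all add: T.nat_pow_pow)
  \<comment> \<open>The idempotents are given as products; as geometric sums they come with their
    eigenvalue equation and their sum, which is what the matrix step asks for.\<close>
  have e_fourier: "e i = T.fourier m' \<omega> \<alpha> (x [^]\<^bsub>Et\<^esub> N) i" if "i < m'" for i
    unfolding e using T.is_cring xN that by (intro T.split_idem_fourier \<omega> \<alpha> \<alpha>0 T.y(1))
  note four = T.fourier[OF \<omega> \<alpha>(1) \<alpha>0 xN]
  have e_T: "e i \<in> carrier Et" if "i < m'" for i using e_fourier[OF that] four(1) by simp
  have e_eig: "x [^]\<^bsub>Et\<^esub> N \<otimes>\<^bsub>Et\<^esub> e i = (\<omega> [^]\<^bsub>F\<^esub> i \<otimes>\<^bsub>F\<^esub> \<alpha>) \<odot>\<^bsub>Et\<^esub> e i" if "i < m'" for i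
    using e_fourier[OF that] four(2) by simp
  have e_sum: "(\<Oplus>\<^bsub>Et\<^esub>i\<in>{..<m'}. e i) = \<one>\<^bsub>Et\<^esub>"
    using four(1,4) e_fourier by (simp cong: T.finsum_cong)
  have ipow: "\<iota>' x [^]\<^bsub>E'\<^esub> N = \<iota>' (x [^]\<^bsub>Et\<^esub> N)"
    using alg_hom_pow[OF \<iota>_hom(1) rings T.y(1)] by simp
  have ie: "\<iota>' (x [^]\<^bsub>Et\<^esub> N \<otimes>\<^bsub>Et\<^esub> e i) = (\<omega> [^]\<^bsub>F\<^esub> i \<otimes>\<^bsub>F\<^esub> \<alpha>) \<odot>\<^bsub>E'\<^esub> \<iota>' (e i)" if "i < m'" for i
    unfolding e_eig[OF that] using \<omega> \<alpha>(1) e_T[OF that] \<iota>h(3) K.primitive_rootD(1)[OF \<omega>] by simp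
  have Sp: "split_symbol F E' N m' \<zeta> \<sigma> a h (\<iota>' x) \<alpha> (\<lambda>i. \<iota>' (e i))"
  proof (intro split_symbol.intro[OF A] split_symbol_axioms.intro)
    fix i assume i: "i < m'"
    show "\<iota>' (e i) \<in> carrier E'" using \<iota>h(1) e_T[OF i] .
    show "\<iota>' x [^]\<^bsub>E'\<^esub> N \<otimes>\<^bsub>E'\<^esub> \<iota>' (e i) = ((\<zeta> [^]\<^bsub>F\<^esub> N) [^]\<^bsub>F\<^esub> i \<otimes>\<^bsub>F\<^esub> \<alpha>) \<odot>\<^bsub>E'\<^esub> \<iota>' (e i)"
      using ie[OF i] \<iota>h(4) xN(1) e_T[OF i] by (simp add: ipow \<omega>_eq)
    have "x [^]\<^bsub>Et\<^esub> N \<otimes>\<^bsub>Et\<^esub> e i = e i \<otimes>\<^bsub>Et\<^esub> x [^]\<^bsub>Et\<^esub> N" using T.m_comm xN(1) e_T[OF i] .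
    then show "\<iota>' (e i) \<otimes>\<^bsub>E'\<^esub> \<iota>' x [^]\<^bsub>E'\<^esub> N = ((\<zeta> [^]\<^bsub>F\<^esub> N) [^]\<^bsub>F\<^esub> i \<otimes>\<^bsub>F\<^esub> \<alpha>) \<odot>\<^bsub>E'\<^esub> \<iota>' (e i)"
      using ie[OF i] \<iota>h(4) xN(1) e_T[OF i] by (simp add: ipow \<omega>_eq)
  next
    have "\<iota>' (\<Oplus>\<^bsub>Et\<^esub>i\<in>{..<m'}. e i) = (\<Oplus>\<^bsub>E'\<^esub>i\<in>{..<m'}. \<iota>' (e i))"
      using e_T by (intro lin_map_finsum[OF T.fa A.field_algebra_axioms alg_hom_lin[OF \<iota>_hom(1)]]) auto
    then show "(\<Oplus>\<^bsub>E'\<^esub>i\<in>{..<m'}. \<iota>' (e i)) = \<one>\<^bsub>E'\<^esub>" using e_sum \<iota>h(5) by simp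
  qed (use \<alpha> in auto)
  have tower: "kummer_tower F E' N m' \<zeta> \<sigma> a h \<alpha> \<iota>' x e Et \<tau> Et' \<tau>' x' E2 H \<iota>2"
    unfolding kummer_tower_def kummer_tower_axioms_def using Sp T e_T \<iota>_hom K C by blast
  have \<phi>0_eq: "\<phi>0 = (\<lambda>S. \<Oplus>\<^bsub>kummer F (N * m') a\<^esub>i\<in>{..<m'}. (\<tau> ^^ i) (component_embed F (N * m') a (e 0) S))"
    unfolding \<phi>0 Et M ..
  note \<phi>0_hom = component_embed_trace[OF tower[unfolded Et x Et' x' M] \<phi>0_eq, folded M, folded Et x Et' x']
  obtain \<Phi> where \<Phi>: "\<Phi> \<in> alg_mono F E2 E'" "\<Phi> H = h [^]\<^bsub>E'\<^esub> m'"
    "\<Phi> (\<iota>2 x') = split_symbol.y F E' m' \<zeta> (\<iota>' x) (\<lambda>i. \<iota>' (e i))"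
    using symbol_mono[OF CS split_symbol.corner_pair[OF Sp]] .
  interpret W: kummer_tower_hom F E' N m' \<zeta> \<sigma> a h \<alpha> \<iota>' x e Et \<tau> Et' \<tau>' x' E2 H \<iota>2 \<phi>0 \<Phi>
    by (intro kummer_tower_hom.intro[OF tower] kummer_tower_hom_axioms.intro \<phi>0_hom \<Phi>)
  have reduced: "reduced_cyclic F E2 N (q [^]\<^bsub>F\<^esub> (m * m')) \<sigma> \<alpha> H (\<iota>2 x')"
    unfolding \<zeta>_pow
    by (rule symbol_algebra_reduced[OF CS kummer_symbol.cyclic_algebra[OF C] K[unfolded Et' x'] K\<sigma>])
  have sum2: "internal_direct_sum F E2 N
      (\<lambda>k. {\<iota>2 b \<otimes>\<^bsub>E2\<^esub> H [^]\<^bsub>E2\<^esub> k | b. b \<in> carrier Et'}) (carrier E2)"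
  proof -
    have "(\<lambda>x. x) \<in> alg_mono F E2 E2" by (auto simp: alg_mono_def alg_hom_def ring_hom_def)
    from kummer_symbol.image_decomposition[OF C kummer_symbol.faA[OF C] this] show ?thesis by simp
  qed
  have dim: "ring.dimension Et' N (scalars F Et') (carrier Et')"
    using field_algebra.dimension_basis[OF W.fK kummer_algebra.basis[OF W.KA]] by simp
  have claim1: "reduced_cyclic F E2 N (q [^]\<^bsub>F\<^esub> (m * m')) \<sigma> \<alpha> H (\<iota>2 x') \<and>
      has_degree F E2 N \<and> \<sigma> \<in> Units F \<and> centralizer E2 (carrier E2) = scalars F E2 \<and>
      field Et' \<and> \<iota>2 \<in> alg_mono F Et' E2 \<and> strictly_maximal_subfield F E2 (\<iota>2 ` carrier Et') \<and>
      ring.dimension Et' N (scalars F Et') (carrier Et') \<and>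
      internal_direct_sum F E2 N
        (\<lambda>k. {\<iota>2 b \<otimes>\<^bsub>E2\<^esub> H [^]\<^bsub>E2\<^esub> k | b. b \<in> carrier Et'}) (carrier E2)"
    using reduced symbol_algebra.degree[OF CS] \<sigma>(1) \<sigma>0 K.field_Units symbol_algebra.center[OF CS]
      kummer_field.field[OF K] kummer_symbol.\<iota>_mono[OF C] kummer_symbol.strictly_maximal[OF C] dim sum2
    by blast
  have claim2: "alg_isomorphic F E2 (mat_alg N (self_alg F)) \<longleftrightarrow>
      (\<exists>b \<in> Units Et'. \<sigma> \<odot>\<^bsub>Et'\<^esub> \<one>\<^bsub>Et'\<^esub> = galois_norm Et' (scalars F Et') b)"
    by (rule kummer_symbol.split_iff_norm[OF C])
  have ex_\<Psi>: "\<exists>\<Psi> \<in> alg_mono F (skew_cyclic Et'' (\<tau> ^^ m') N \<sigma>) E'.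
      (\<forall>b \<in> carrier Et''. \<Psi> (skew_const Et'' (\<tau> ^^ m') N \<sigma> b) = \<iota>' b) \<and>
      \<Psi> (skew_gen Et'' (\<tau> ^^ m') N \<sigma>) = h [^]\<^bsub>E'\<^esub> m' \<and>
      \<Psi> ` carrier (skew_cyclic Et'' (\<tau> ^^ m') N \<sigma>) = \<Phi> ` carrier E2"
    unfolding Et'' using W.image_skew by metis
  define B where "B = (\<lambda>j. E'\<lparr>carrier := {z \<otimes>\<^bsub>E'\<^esub> \<iota>' (e j) | z. z \<in> \<Phi> ` carrier E2}, one := \<iota>' (e j)\<rparr>)"
  define \<pi> where "\<pi> = (\<lambda>v. \<Oplus>\<^bsub>E'\<^esub>j\<in>{..<m'}. v j)"
  have \<pi>: "\<pi> = W.Co.sm" by (simp add: \<pi>_def W.Co.sm_def fun_eq_iff)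
  have Bj: "\<forall>j<m'. assoc_algebra F (B j)"
    using W.Co.comp_algebra by (simp add: B_def field_algebra_def)
  have \<pi>_mono: "\<pi> \<in> alg_mono F (prod_alg m' B) E'" unfolding \<pi> B_def by (rule W.Co.sm_mono)
  have \<pi>_sum: "internal_direct_sum F E' m'
      (\<lambda>i. {\<pi> v \<otimes>\<^bsub>E'\<^esub> h [^]\<^bsub>E'\<^esub> i | v. v \<in> carrier (prod_alg m' B)}) (carrier E')"
    unfolding \<pi> B_def by (rule W.Co.power_decomposition)
  have sum3: "internal_direct_sum F E' N
      (\<lambda>k. {\<iota>' b \<otimes>\<^bsub>E'\<^esub> h [^]\<^bsub>E'\<^esub> (k * m') | b. b \<in> carrier Et''}) (\<Phi> ` carrier E2)"
    unfolding Et'' by (rule W.image_direct_sum)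
  \<comment> \<open>Some nontrivial algebra with the relations of \<open>E\<close> is needed to see
    that \<open>E\<close> does not vanish; the skew quotient over \<open>F[X]/(X^n - a)\<close> is
    one.\<close>
  interpret PA: kummer_poly F n a using a(1) n0 by unfold_locales auto
  note KA = PA.kummer_algebra[OF q a(2)]
  note Q = symbol_algebra.axioms(1)[OF kummer_algebra.symbol_algebra[OF KA s]]
  obtain h0 x0 where E0: "symbol_algebra F E n q s a h0 x0"
    unfolding E using symbol_alg_symbol_algebra[OF Q] .
  then have E1: "symbol_algebra F E (N * m' * m) q s a h0 x0" using n_eq by simp
  \<comment> \<open>The matrix step of size \<open>m\<close>; composed with the one of size
    \<open>m'\<close> it gives matrices of size \<open>m * m'\<close> over
    \<open>E2\<close>.\<close>
  obtain \<Theta> U where \<Theta>: "matrix_over_algebra F E' E m \<Theta> U"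
    using symbol_matrix_over[OF E1 A[unfolded \<zeta>_def] \<sigma>(2)] .
  have iso5: "alg_isomorphic F E (mat_alg (m * m') E2)"
    by (rule matrix_over_algebra.isomorphic[OF matrix_over_trans[OF \<Theta> W.Co.M.matrix_over_algebra_axioms]])
  have "field_algebra F E" using E0 by (simp add: symbol_algebra_def symbol_pair_def)
  then have "ring E" "module F E" by (simp_all add: field_algebra_def assoc_algebra_def)
  \<comment> \<open>Equivalence compares matrix algebras on both sides, so \<open>E\<close> is
    replaced by matrices of size one over itself.\<close>
  moreover have "alg_isomorphic F E (mat_alg 1 E)"
    by (rule matrix_over_algebra.isomorphic[OF matrix_over_self]) fact
  ultimately have "alg_isomorphic F (mat_alg 1 E) E" by (rule alg_isomorphic_sym)
  then have "alg_isomorphic F (mat_alg 1 E) (mat_alg (m * m') E2)"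
    using iso5 by (rule alg_isomorphic_trans)
  moreover have "m * m' \<ge> 1" using mD(1) m'D(1) by simp
  ultimately have claim5: "alg_isomorphic F E (mat_alg (m * m') E2) \<and> alg_equivalent F E E2"
    unfolding alg_equivalent_def
    using iso5 symbol_algebra.central_simple[OF E0] symbol_algebra.central_simple[OF CS] by blast
  have \<Phi>_ext: "\<forall>b \<in> carrier Et'. \<Phi> (\<iota>2 b) = \<iota>' (\<phi>0 b)" using W.\<Phi>_\<iota>2 by blast
  show ?thesis
    unfolding Let_def
    by (intro conjI[OF claim1] conjI[OF claim2] conjI[OF _ claim5] bexI[OF _ \<Phi>(1)] conjI)
      (fact W.\<phi>_mono W.\<iota>_mono \<Phi>(2) \<Phi>_ext ex_\<Psi> sum3 W.Co.M.isomorphic W.centralizer_image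
        Bj[unfolded B_def] \<pi>_mono[unfolded B_def \<pi>_def] \<pi>_sum[unfolded B_def \<pi>_def])+
qed

end
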